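(* If $\mathfrak g_0$ is not semisimple, then $$|\mathcal W_{ab}^{\sigma}| =\frac{|W_f|}{|W_\sigma|}\left(1+\frac{\ell_\sigma}{\ell_f}\right).$$
   Context: Setting. $\mathfrak g$ is a finite-dimensional complex simple Lie algebra of type $X_N$, $\sigma$ is an automorphism of $\mathfrak g$ of order $2$, and $\mathfrak g=\mathfrak g_0\oplus\mathfrak g_1$ is the corresponding $\mathbb Z_2$-gradation ($(+1)$- and $(-1)$-eigenspaces). Let $k\in\{1,2\}$ be the least positive integer such that $\sigma^k$ is inner, and let $\widehat{\mathfrak g}$ be the affine Kac-Moody algebra of type $X_N^{(k)}$ (nodes labelled $0,\dots,n$ as in Kac's book "Infinite dimensional Lie algebras", namely: if $k=1$, nodes $1,\dots,n$ form the finite Dynkin diagram of type $X_N$, their order being immaterial here, and $0$ is the additional node of the extended diagram, with label $a_0=1$; for $A_{2n}^{(2)}$ the diagram is the chain $0,1,\dots,n$ with labels $(a_0,\dots,a_n)=(2,\dots,2,1)$, $\alpha_0$ being the shortest and $\alpha_n$ the longest simple root; for $A_{2n-1}^{(2)}$, $n\ge3$, nodes $0$ and $1$ are both joined to node $2$, which starts the chain $2,\dots,n$, with labels $(1,1,2,\dots,2,1)$ and $\alpha_n$ the only long simple root; for $D_{n+1}^{(2)}$, $n\ge2$, the diagram is the chain $0,1,\dots,n$ with all labels $1$ and $\alpha_0,\alpha_n$ the short simple roots; for $E_6^{(2)}$ the diagram is the chain $0,1,2,3,4$ with labels $(1,2,3,2,1)$ and $\alpha_3,\alpha_4$ the long simple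 roots), with root system $\widehat\Delta$ (real and imaginary roots), simple roots $\widehat\Pi=\{\alpha_0,\dots,\alpha_n\}$, positive roots $\widehat\Delta^+$, Weyl group $\widehat W$, and labels $a_0,\dots,a_n$ of the affine Dynkin diagram. By Kac's classification, up to conjugation by an automorphism of $\mathfrak g$, $\sigma$ is the automorphism of type $(s_0,\dots,s_n;k)$ (the automorphism characterized by $E_i\mapsto(-1)^{s_i}E_i$, where $E_0,\dots,E_n\in\mathfrak g$ are the images at $t=1$ of the Chevalley generators $e_0,\dots,e_n$ of $\widehat{\mathfrak g}$ in its standard (twisted) loop realization), where the $s_i$ are coprime non-negative integers with $k\sum_{i=0}^n a_is_i=2$; we assume $\sigma$ is this automorphism. The algebra $\mathfrak g_0$ is not semisimple if and only if $k=1$ and there are two indices $p\ne q$ with $a_p=a_q=s_p=s_q=1$ and $s_i=0$ for $i\neq p,q$. For $\alpha=\sum_{i=0}^n m_i\alpha_i\in\widehat\Delta$ put $ht_\sigma(\alpha)=\sum_{i=0}^n s_im_i$. Let $\widehat\Delta_0=\{\alpha\in\widehat\Delta: ht_\sigma(\alpha)=0\}$ (a finite root system, the root system of $\mathfrak g_0$) and let $W_\sigma$ be its Weyl group, generated by the simple reflections $s_{\alpha_i}$ with $s_i=0$. Let $\Delta_f$ be the finite root system generated by $\Pi_f=\{\alpha_1,\dots,\alpha_n\}$ and $W_f$ its Weyl group. $\ell_f$ and $\ell_\sigma$ are the connection indices of $\Delta_f$ and $\widehat\Delta_0$ respectively, i.e. the index of the coroot lattice in the coweight lattice (equivalently, of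 the root lattice in the weight lattice) of the root system; it is $1$ for an empty root system. For $w\in\widehat W$ let $N(w)=\{\beta\in\widehat\Delta^+: w^{-1}(\beta)\in-\widehat\Delta^+\}$. $\mathcal W_{ab}^\sigma$ is the set of $\sigma$-minuscule elements, i.e. of $w\in\widehat W$ such that $N(w)\subset\{\alpha\in\widehat\Delta: ht_\sigma(\alpha)=1\}$. *)

theory Defs
  imports Complex_Main
begin

section \<open>Complex Lie algebras\<close>

text \<open>A Lie algebra is a whole type \<open>'g\<close> with scalar multiplication \<open>scale\<close> and bracket \<open>br\<close>;
  subalgebras and ideals are subsets of \<open>'g\<close>.\<close>

locale complex_lie_algebra = vector_space scale
  for scale :: "complex \<Rightarrow> 'g::ab_group_add \<Rightarrow> 'g" +
  fixes br :: "'g \<Rightarrow> 'g \<Rightarrow> 'g"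
  assumes br_add_left: "br (x + y) z = br x z + br y z"
    and br_add_right: "br x (y + z) = br x y + br x z"
    and br_scale_left: "br (scale c x) y = scale c (br x y)"
    and br_scale_right: "br x (scale c y) = scale c (br x y)"
    and br_self: "br x x = 0"
    and jacobi: "br x (br y z) + br y (br z x) + br z (br x y) = 0"

definition lie_finite_dim :: "(complex \<Rightarrow> 'g::ab_group_add \<Rightarrow> 'g) \<Rightarrow> bool" where
  "lie_finite_dim scale \<longleftrightarrow> (\<exists>B. finite B \<and> module.span scale B = UNIV)"

definition lie_subalgebra ::
  "(complex \<Rightarrow> 'g::ab_group_add \<Rightarrow> 'g) \<Rightarrow> ('g \<Rightarrow> 'g \<Rightarrow> 'g) \<Rightarrow> 'g set \<Rightarrow> bool" where
  "lie_subalgebra scale br L \<longleftrightarrow>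
     module.subspace scale L \<and> (\<forall>x\<in>L. \<forall>y\<in>L. br x y \<in> L)"

definition lie_generated ::
  "(complex \<Rightarrow> 'g::ab_group_add \<Rightarrow> 'g) \<Rightarrow> ('g \<Rightarrow> 'g \<Rightarrow> 'g) \<Rightarrow> 'g set \<Rightarrow> 'g set" where
  "lie_generated scale br S = \<Inter>{L. lie_subalgebra scale br L \<and> S \<subseteq> L}"

definition lie_ideal ::
  "(complex \<Rightarrow> 'g::ab_group_add \<Rightarrow> 'g) \<Rightarrow> ('g \<Rightarrow> 'g \<Rightarrow> 'g) \<Rightarrow> 'g set \<Rightarrow> 'g set \<Rightarrow> bool" where
  "lie_ideal scale br L I \<longleftrightarrow>
     module.subspace scale I \<and> I \<subseteq> L \<and> (\<forall>x\<in>L. \<forall>y\<in>I. br x y \<in> I)"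

definition lie_derived ::
  "(complex \<Rightarrow> 'g::ab_group_add \<Rightarrow> 'g) \<Rightarrow> ('g \<Rightarrow> 'g \<Rightarrow> 'g) \<Rightarrow> 'g set \<Rightarrow> 'g set" where
  "lie_derived scale br I = module.span scale {br x y | x y. x \<in> I \<and> y \<in> I}"

definition lie_solvable ::
  "(complex \<Rightarrow> 'g::ab_group_add \<Rightarrow> 'g) \<Rightarrow> ('g \<Rightarrow> 'g \<Rightarrow> 'g) \<Rightarrow> 'g set \<Rightarrow> bool" where
  "lie_solvable scale br I \<longleftrightarrow> (\<exists>m. (lie_derived scale br ^^ m) I = {0})"

definition lie_semisimple ::
  "(complex \<Rightarrow> 'g::ab_group_add \<Rightarrow> 'g) \<Rightarrow> ('g \<Rightarrow> 'g \<Rightarrow> 'g) \<Rightarrow> 'g set \<Rightarrow> bool" where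
  "lie_semisimple scale br L \<longleftrightarrow>
     (\<forall>I. lie_ideal scale br L I \<and> lie_solvable scale br I \<longrightarrow> I = {0})"

definition lie_simple ::
  "(complex \<Rightarrow> 'g::ab_group_add \<Rightarrow> 'g) \<Rightarrow> ('g \<Rightarrow> 'g \<Rightarrow> 'g) \<Rightarrow> bool" where
  "lie_simple scale br \<longleftrightarrow>
     (\<exists>x y. br x y \<noteq> 0) \<and> (\<forall>I. lie_ideal scale br UNIV I \<longrightarrow> I = {0} \<or> I = UNIV)"

definition lie_automorphism ::
  "(complex \<Rightarrow> 'g::ab_group_add \<Rightarrow> 'g) \<Rightarrow> ('g \<Rightarrow> 'g \<Rightarrow> 'g) \<Rightarrow> ('g \<Rightarrow> 'g) \<Rightarrow> bool" where
  "lie_automorphism scale br f \<longleftrightarrow>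
     Vector_Spaces.linear scale scale f \<and> bij f \<and> (\<forall>x y. f (br x y) = br (f x) (f y))"


section \<open>Weyl groups and roots of a Cartan matrix\<close>

text \<open>Throughout, \<open>C i j\<close> is the value of the simple coroot \<open>\<alpha>\<^sub>i\<^sup>\<or>\<close> on the simple root \<open>\<alpha>\<^sub>j\<close>, the
  nodes being \<open>0, \<dots>, n\<close>. An element of the root lattice is the function of its coordinates
  in the basis of simple roots, and an element of the coroot lattice is the function of its
  coordinates in the basis of simple coroots. Both reflect by the same formula, with \<open>C\<close>
  replaced by its transpose for coroots.\<close>

definition simple_root :: "nat \<Rightarrow> nat \<Rightarrow> int" where
  "simple_root i = (\<lambda>j. if j = i then 1 else 0)"

definition simple_refl ::
  "(nat \<Rightarrow> nat \<Rightarrow> int) \<Rightarrow> nat \<Rightarrow> nat \<Rightarrow> (nat \<Rightarrow> int) \<Rightarrow> (nat \<Rightarrow> int)" where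
  "simple_refl C n i v = v(i := v i - (\<Sum>j\<le>n. C i j * v j))"

text \<open>The subgroup generated by the reflections in the simple roots with index in \<open>S\<close>
  (the generators are involutions). It acts faithfully on the root lattice, also in the
  affine case.\<close>

inductive_set weyl_group ::
  "(nat \<Rightarrow> nat \<Rightarrow> int) \<Rightarrow> nat \<Rightarrow> nat set \<Rightarrow> ((nat \<Rightarrow> int) \<Rightarrow> (nat \<Rightarrow> int)) set"
  for C :: "nat \<Rightarrow> nat \<Rightarrow> int" and n :: nat and S :: "nat set" where
  weyl_id: "id \<in> weyl_group C n S"
| weyl_step: "w \<in> weyl_group C n S \<Longrightarrow> i \<in> S \<Longrightarrow> simple_refl C n i \<circ> w \<in> weyl_group C n S"

definition real_roots :: "(nat \<Rightarrow> nat \<Rightarrow> int) \<Rightarrow> nat \<Rightarrow> nat set \<Rightarrow> (nat \<Rightarrow> int) set" where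
  "real_roots C n S = {w (simple_root i) | w i. w \<in> weyl_group C n S \<and> i \<in> S}"

text \<open>The pairs \<open>(\<beta>, \<beta>\<^sup>\<or>)\<close> of a real root \<open>\<beta> = w \<alpha>\<^sub>i\<close> and its coroot \<open>\<beta>\<^sup>\<or> = w \<alpha>\<^sub>i\<^sup>\<or>\<close>; the simple coroot
  \<open>\<alpha>\<^sub>i\<^sup>\<or>\<close> has the same coordinates as \<open>simple_root i\<close>.\<close>

inductive_set root_coroot ::
  "(nat \<Rightarrow> nat \<Rightarrow> int) \<Rightarrow> nat \<Rightarrow> nat set \<Rightarrow> ((nat \<Rightarrow> int) \<times> (nat \<Rightarrow> int)) set"
  for C :: "nat \<Rightarrow> nat \<Rightarrow> int" and n :: nat and S :: "nat set" where
  rc_simple: "i \<in> S \<Longrightarrow> (simple_root i, simple_root i) \<in> root_coroot C n S"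
| rc_refl: "(\<beta>, \<gamma>) \<in> root_coroot C n S \<Longrightarrow> i \<in> S \<Longrightarrow>
    (simple_refl C n i \<beta>, simple_refl (\<lambda>p q. C q p) n i \<gamma>) \<in> root_coroot C n S"

definition highest_root :: 
  "(nat \<Rightarrow> nat \<Rightarrow> int) \<Rightarrow> nat \<Rightarrow> nat set \<Rightarrow> (nat \<Rightarrow> int) \<Rightarrow> bool" where
  "highest_root C n S \<theta> \<longleftrightarrow>
     \<theta> \<in> real_roots C n S \<and> (\<forall>\<beta>\<in>real_roots C n S. \<forall>i. \<beta> i \<le> \<theta> i)"


section \<open>Connection index\<close>

text \<open>\<open>combinations K G\<close> consists of the linear combinations of \<open>G\<close> with coefficients in \<open>K\<close>:
  the lattice generated by \<open>G\<close> for \<open>K = \<int>\<close> and the real span of \<open>G\<close> for \<open>K = UNIV\<close>.\<close>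

definition combinations :: "real set \<Rightarrow> (nat \<Rightarrow> int) set \<Rightarrow> (nat \<Rightarrow> real) set" where
  "combinations K G =
     {(\<lambda>i. \<Sum>\<gamma>\<in>F. c \<gamma> * real_of_int (\<gamma> i)) | F c. finite F \<and> F \<subseteq> G \<and> (\<forall>\<gamma>\<in>F. c \<gamma> \<in> K)}"

definition coroots_of ::
  "(nat \<Rightarrow> nat \<Rightarrow> int) \<Rightarrow> nat \<Rightarrow> (nat \<Rightarrow> int) set \<Rightarrow> (nat \<Rightarrow> int) set" where
  "coroots_of C n \<Phi> = {\<gamma>. \<exists>\<beta>\<in>\<Phi>. (\<beta>, \<gamma>) \<in> root_coroot C n {0..n}}"

definition coroot_lattice ::
  "(nat \<Rightarrow> nat \<Rightarrow> int) \<Rightarrow> nat \<Rightarrow> (nat \<Rightarrow> int) set \<Rightarrow> (nat \<Rightarrow> real) set" where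
  "coroot_lattice C n \<Phi> = combinations \<int> (coroots_of C n \<Phi>)"

definition coweight_lattice ::
  "(nat \<Rightarrow> nat \<Rightarrow> int) \<Rightarrow> nat \<Rightarrow> (nat \<Rightarrow> int) set \<Rightarrow> (nat \<Rightarrow> real) set" where
  "coweight_lattice C n \<Phi> =
     {x \<in> combinations UNIV (coroots_of C n \<Phi>).
        \<forall>\<beta>\<in>\<Phi>. (\<Sum>i\<le>n. \<Sum>j\<le>n. x i * real_of_int (C i j) * real_of_int (\<beta> j)) \<in> \<int>}"

definition connection_index ::
  "(nat \<Rightarrow> nat \<Rightarrow> int) \<Rightarrow> nat \<Rightarrow> (nat \<Rightarrow> int) set \<Rightarrow> nat" where
  "connection_index C n \<Phi> =
     card (coweight_lattice C n \<Phi> //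
       {(x, y). x \<in> coweight_lattice C n \<Phi> \<and> y \<in> coweight_lattice C n \<Phi> \<and>
                (\<lambda>i. x i - y i) \<in> coroot_lattice C n \<Phi>})"


section \<open>Affine diagrams\<close>

text \<open>The Cartan matrix of a Dynkin diagram with the given edges and squared lengths of the simple
  roots: for adjacent \<open>i \<noteq> j\<close> the entry is \<open>- max 1 (\<bar>\<alpha>\<^sub>j\<bar>\<^sup>2 / \<bar>\<alpha>\<^sub>i\<bar>\<^sup>2)\<close>, and the larger length is
  always an integer multiple of the smaller one. This covers every diagram below with the
  exception of \<open>A\<^sub>1\<^sup>(\<^sup>1\<^sup>)\<close>, which arises by extension.\<close>

definition diagram_cartan :: "(nat \<times> nat) set \<Rightarrow> (nat \<Rightarrow> nat) \<Rightarrow> nat \<Rightarrow> nat \<Rightarrow> int" where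
  "diagram_cartan edges len i j =
     (if i = j then 2
      else if (i, j) \<in> edges \<or> (j, i) \<in> edges then - int (max 1 (len j div len i))
      else 0)"

definition chain :: "nat \<Rightarrow> nat \<Rightarrow> (nat \<times> nat) set" where
  "chain a b = {(i, Suc i) | i. a \<le> i \<and> i < b}"

datatype family = A_fam | B_fam | C_fam | D_fam | E_fam | F_fam | G_fam

fun finite_type :: "family \<Rightarrow> nat \<Rightarrow> bool" where
  "finite_type A_fam n \<longleftrightarrow> n \<ge> 1"
| "finite_type B_fam n \<longleftrightarrow> n \<ge> 3"
| "finite_type C_fam n \<longleftrightarrow> n \<ge> 2"
| "finite_type D_fam n \<longleftrightarrow> n \<ge> 4"
| "finite_type E_fam n \<longleftrightarrow> n \<in> {6, 7, 8}"
| "finite_type F_fam n \<longleftrightarrow> n = 4"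
| "finite_type G_fam n \<longleftrightarrow> n = 2"

text \<open>The finite diagrams, with nodes \<open>1, \<dots>, n\<close> in the order of Bourbaki.\<close>

fun finite_cartan :: "family \<Rightarrow> nat \<Rightarrow> nat \<Rightarrow> nat \<Rightarrow> int" where
  "finite_cartan A_fam n = diagram_cartan (chain 1 n) (\<lambda>i. 1)"
| "finite_cartan B_fam n = diagram_cartan (chain 1 n) (\<lambda>i. if i = n then 1 else 2)"
| "finite_cartan C_fam n = diagram_cartan (chain 1 n) (\<lambda>i. if i = n then 2 else 1)"
| "finite_cartan D_fam n = diagram_cartan (insert (n - 2, n) (chain 1 (n - 1))) (\<lambda>i. 1)"
| "finite_cartan E_fam n = diagram_cartan ({(1, 3), (3, 4), (2, 4)} \<union> chain 4 n) (\<lambda>i. 1)"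
| "finite_cartan F_fam n = diagram_cartan (chain 1 n) (\<lambda>i. if i \<le> 2 then 2 else 1)"
| "finite_cartan G_fam n = diagram_cartan (chain 1 n) (\<lambda>i. if i = 1 then 1 else 3)"

text \<open>\<open>C\<close> is the extended Cartan matrix: \<open>\<alpha>\<^sub>0\<close> restricts to \<open>-\<theta>\<close> and \<open>\<alpha>\<^sub>0\<^sup>\<or>\<close> to \<open>-\<theta>\<^sup>\<or>\<close>, where \<open>\<theta>\<close> is the
  highest root. The roots of the subsystem on \<open>1, \<dots>, n\<close> have zero coordinate at the node \<open>0\<close>,
  hence \<open>\<theta>\<close> and \<open>\<theta>\<^sup>\<or>\<close> only depend on the finite part of \<open>C\<close>.\<close>

definition untwisted_affine :: "family \<Rightarrow> nat \<Rightarrow> (nat \<Rightarrow> nat \<Rightarrow> int) \<Rightarrow> bool" where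
  "untwisted_affine X n C \<longleftrightarrow>
     finite_type X n \<and>
     (\<forall>i\<in>{1..n}. \<forall>j\<in>{1..n}. C i j = finite_cartan X n i j) \<and>
     (\<exists>\<theta> \<theta>'. highest_root C n {1..n} \<theta> \<and> (\<theta>, \<theta>') \<in> root_coroot C n {1..n} \<and>
        C 0 0 = 2 \<and>
        (\<forall>j\<in>{1..n}. C 0 j = - (\<Sum>i=1..n. \<theta>' i * C i j)) \<and>
        (\<forall>i\<in>{1..n}. C i 0 = - (\<Sum>j=1..n. C i j * \<theta> j)))"

text \<open>The diagrams \<open>X\<^sub>N\<^sup>(\<^sup>2\<^sup>)\<close> with nodes \<open>0, \<dots>, n\<close>. For \<open>A\<^sub>2\<^sub>n\<^sup>(\<^sup>2\<^sup>)\<close> the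
  root \<open>\<alpha>\<^sub>0\<close> is the shortest and \<open>\<alpha>\<^sub>n\<close> the longest one, also if \<open>n = 1\<close>.\<close>

definition twisted_affine :: "family \<Rightarrow> nat \<Rightarrow> nat \<Rightarrow> (nat \<Rightarrow> nat \<Rightarrow> int) \<Rightarrow> bool" where
  "twisted_affine X N n C \<longleftrightarrow>
     (X = A_fam \<and> n \<ge> 1 \<and> N = 2 * n \<and>
        (\<forall>i\<le>n. \<forall>j\<le>n. C i j =
           diagram_cartan (chain 0 n) (\<lambda>i. if i = 0 then 1 else if i = n then 4 else 2) i j)) \<or>
     (X = A_fam \<and> n \<ge> 3 \<and> N = 2 * n - 1 \<and>
        (\<forall>i\<le>n. \<forall>j\<le>n. C i j =
           diagram_cartan (insert (0, 2) (chain 1 n)) (\<lambda>i. if i = n then 2 else 1) i j)) \<or>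
     (X = D_fam \<and> n \<ge> 2 \<and> N = n + 1 \<and>
        (\<forall>i\<le>n. \<forall>j\<le>n. C i j =
           diagram_cartan (chain 0 n) (\<lambda>i. if i = 0 \<or> i = n then 1 else 2) i j)) \<or>
     (X = E_fam \<and> n = 4 \<and> N = 6 \<and>
        (\<forall>i\<le>n. \<forall>j\<le>n. C i j =
           diagram_cartan (chain 0 4) (\<lambda>i. if i \<le> 2 then 1 else 2) i j))"

definition affine_cartan ::
  "family \<Rightarrow> nat \<Rightarrow> nat \<Rightarrow> nat \<Rightarrow> (nat \<Rightarrow> nat \<Rightarrow> int) \<Rightarrow> bool" where
  "affine_cartan X N k n C \<longleftrightarrow>
     (k = 1 \<and> N = n \<and> untwisted_affine X n C) \<or> (k = 2 \<and> twisted_affine X N n C)"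

text \<open>The numerical labels of an affine diagram: the coprime positive integers with \<open>C a = 0\<close>.\<close>

definition affine_labels :: "(nat \<Rightarrow> nat \<Rightarrow> int) \<Rightarrow> nat \<Rightarrow> (nat \<Rightarrow> nat) \<Rightarrow> bool" where
  "affine_labels C n a \<longleftrightarrow>
     (\<forall>i\<le>n. a i > 0) \<and> Gcd (a ` {0..n}) = 1 \<and> (\<forall>i\<le>n. (\<Sum>j\<le>n. C i j * int (a j)) = 0)"

definition affine_roots ::
  "(nat \<Rightarrow> nat \<Rightarrow> int) \<Rightarrow> nat \<Rightarrow> (nat \<Rightarrow> nat) \<Rightarrow> (nat \<Rightarrow> int) set" where
  "affine_roots C n a =
     real_roots C n {0..n} \<union> {(\<lambda>i. if i \<le> n then m * int (a i) else 0) | m. m \<noteq> 0}"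

definition positive_roots ::
  "(nat \<Rightarrow> nat \<Rightarrow> int) \<Rightarrow> nat \<Rightarrow> (nat \<Rightarrow> nat) \<Rightarrow> (nat \<Rightarrow> int) set" where
  "positive_roots C n a = {\<beta> \<in> affine_roots C n a. \<forall>i. \<beta> i \<ge> 0}"


section \<open>Loop realization and automorphisms of finite order\<close>

text \<open>The relations satisfied by the Chevalley generators of the derived algebra of the Kac--Moody
  algebra of \<open>C\<close>, including the Serre relations.\<close>

definition chevalley_relations ::
  "(complex \<Rightarrow> 'g::ab_group_add \<Rightarrow> 'g) \<Rightarrow> ('g \<Rightarrow> 'g \<Rightarrow> 'g) \<Rightarrow>
   (nat \<Rightarrow> nat \<Rightarrow> int) \<Rightarrow> nat \<Rightarrow> (nat \<Rightarrow> 'g) \<Rightarrow> (nat \<Rightarrow> 'g) \<Rightarrow> bool" where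
  "chevalley_relations scale br C n E F \<longleftrightarrow>
     (\<forall>i\<le>n. \<forall>j\<le>n.
        (i \<noteq> j \<longrightarrow> br (E i) (F j) = 0) \<and>
        br (br (E i) (F i)) (br (E j) (F j)) = 0 \<and>
        br (br (E i) (F i)) (E j) = scale (of_int (C i j)) (E j) \<and>
        br (br (E i) (F i)) (F j) = scale (- of_int (C i j)) (F j) \<and>
        (i \<noteq> j \<longrightarrow> (br (E i) ^^ nat (1 - C i j)) (E j) = 0 \<and>
                  (br (F i) ^^ nat (1 - C i j)) (F j) = 0))"

text \<open>The node whose Chevalley generators involve the loop variable \<open>t\<close>.\<close>

definition loop_node :: "family \<Rightarrow> nat \<Rightarrow> nat \<Rightarrow> nat \<Rightarrow> nat" where
  "loop_node X N k n = (if k = 2 \<and> X = A_fam \<and> N = 2 * n then n else 0)"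

text \<open>The (twisted) loop realization uses an automorphism \<open>\<mu>\<close> of \<open>\<gg>\<close> with \<open>\<mu>\<^sup>k = 1\<close> (induced by a
  diagram automorphism of order \<open>k\<close>). With \<open>\<epsilon>\<close> the loop node, the \<open>E i\<close>, \<open>F i\<close> with \<open>i \<noteq> \<epsilon>\<close> generate
  the fixed point algebra of \<open>\<mu>\<close>, while \<open>E \<epsilon>\<close> and \<open>F \<epsilon>\<close> lie in the eigenspace of \<open>exp (2\<pi>i/k)\<close>
  and of its inverse, which is \<open>(-1)\<^sup>k\<^sup>-\<^sup>1\<close> for \<open>k = 1, 2\<close>. Then \<open>e\<^sub>i = E i\<close>, \<open>f\<^sub>i = F i\<close> for \<open>i \<noteq> \<epsilon>\<close> and
  \<open>e\<^sub>\<epsilon> = t E \<epsilon>\<close>, \<open>f\<^sub>\<epsilon> = t\<^sup>-\<^sup>1 F \<epsilon>\<close> are the images in the loop algebra of \<open>(\<gg>, \<mu>)\<close> of the Chevalley generators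
  of the affine algebra, and \<open>E\<close>, \<open>F\<close> are their values at \<open>t = 1\<close>.\<close>

definition loop_generators ::
  "(complex \<Rightarrow> 'g::ab_group_add \<Rightarrow> 'g) \<Rightarrow> ('g \<Rightarrow> 'g \<Rightarrow> 'g) \<Rightarrow> family \<Rightarrow> nat \<Rightarrow> nat \<Rightarrow> nat \<Rightarrow>
   (nat \<Rightarrow> nat \<Rightarrow> int) \<Rightarrow> (nat \<Rightarrow> 'g) \<Rightarrow> (nat \<Rightarrow> 'g) \<Rightarrow> bool" where
  "loop_generators scale br X N k n C E F \<longleftrightarrow>
     chevalley_relations scale br C n E F \<and>
     lie_generated scale br (E ` {0..n} \<union> F ` {0..n}) = UNIV \<and>
     (\<exists>\<mu>. lie_automorphism scale br \<mu> \<and>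
        {x. \<mu> x = x} =
          lie_generated scale br
            (E ` ({0..n} - {loop_node X N k n}) \<union> F ` ({0..n} - {loop_node X N k n})) \<and>
        \<mu> (E (loop_node X N k n)) = scale ((-1) ^ (k - 1)) (E (loop_node X N k n)) \<and>
        \<mu> (F (loop_node X N k n)) = scale ((-1) ^ (k - 1)) (F (loop_node X N k n)))"

text \<open>The automorphism of order two of type \<open>(s\<^sub>0, \<dots>, s\<^sub>n; k)\<close>. It is determined by its values on
  \<open>E 0, \<dots>, E n\<close>, which already generate \<open>\<gg>\<close>; the values on the \<open>F i\<close> are the resulting ones.\<close>

definition involution_of_type ::
  "(complex \<Rightarrow> 'g::ab_group_add \<Rightarrow> 'g) \<Rightarrow> ('g \<Rightarrow> 'g \<Rightarrow> 'g) \<Rightarrow> nat \<Rightarrow>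
   (nat \<Rightarrow> 'g) \<Rightarrow> (nat \<Rightarrow> 'g) \<Rightarrow> (nat \<Rightarrow> nat) \<Rightarrow> ('g \<Rightarrow> 'g) \<Rightarrow> bool" where
  "involution_of_type scale br n E F s \<sigma> \<longleftrightarrow>
     lie_automorphism scale br \<sigma> \<and> \<sigma> \<circ> \<sigma> = id \<and> \<sigma> \<noteq> id \<and>
     (\<forall>i\<le>n. \<sigma> (E i) = scale ((-1) ^ s i) (E i) \<and> \<sigma> (F i) = scale ((-1) ^ s i) (F i))"


section \<open>Minuscule elements\<close>

definition sigma_height :: "nat \<Rightarrow> (nat \<Rightarrow> nat) \<Rightarrow> (nat \<Rightarrow> int) \<Rightarrow> int" where
  "sigma_height n s \<beta> = (\<Sum>i\<le>n. int (s i) * \<beta> i)"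

definition height_zero_roots ::
  "(nat \<Rightarrow> nat \<Rightarrow> int) \<Rightarrow> nat \<Rightarrow> (nat \<Rightarrow> nat) \<Rightarrow> (nat \<Rightarrow> nat) \<Rightarrow> (nat \<Rightarrow> int) set" where
  "height_zero_roots C n a s = {\<beta> \<in> affine_roots C n a. sigma_height n s \<beta> = 0}"

definition inversion_set ::
  "(nat \<Rightarrow> nat \<Rightarrow> int) \<Rightarrow> nat \<Rightarrow> (nat \<Rightarrow> nat) \<Rightarrow> ((nat \<Rightarrow> int) \<Rightarrow> (nat \<Rightarrow> int)) \<Rightarrow> (nat \<Rightarrow> int) set"
  where
  "inversion_set C n a w =
     {\<beta> \<in> positive_roots C n a. (\<lambda>i. - inv w \<beta> i) \<in> positive_roots C n a}"

definition sigma_minuscule ::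
  "(nat \<Rightarrow> nat \<Rightarrow> int) \<Rightarrow> nat \<Rightarrow> (nat \<Rightarrow> nat) \<Rightarrow> (nat \<Rightarrow> nat) \<Rightarrow>
   ((nat \<Rightarrow> int) \<Rightarrow> (nat \<Rightarrow> int)) set" where
  "sigma_minuscule C n a s =
     {w \<in> weyl_group C n {0..n}.
        inversion_set C n a w \<subseteq> {\<beta> \<in> affine_roots C n a. sigma_height n s \<beta> = 1}}"

end

theory Submission
  imports Defs "HOL-Library.Function_Algebras"
begin

text \<open>Since the labels \<open>a i\<close> are positive and the \<open>s i\<close> coprime, \<open>s\<close> is supported either on a single node \<open>p\<close>
  or, for \<open>k = 1\<close>, on two nodes \<open>p\<close> and \<open>q\<close> with label \<open>1\<close>.

  In the first case the fixed point algebra is semisimple. A nonzero abelian ideal contains a joint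
  eigenvector \<open>x\<close> of the Cartan subalgebra spanned by the \<open>H i = [E i, F i]\<close>. If its weight is not zero,
  then \<open>x\<close> lies in the radical of the Killing form. If the weight is zero, then \<open>x\<close> lies in the Cartan
  subalgebra and commutes with all \<open>E i\<close> and \<open>F i\<close> for \<open>i \<noteq> p\<close>; the linear relation between the weights of the
  \<open>E i\<close> given by the labels extends this to \<open>i = p\<close>, and \<open>x\<close> is central. Both contradict simplicity.

  In the second case \<open>w\<close> is minuscule if and only if \<open>w\<inverse>\<close> is positive on \<open>\<alpha>\<^sub>p + \<delta>\<close>, on \<open>\<alpha>\<^sub>q + \<delta>\<close>, and on
  \<open>\<beta>\<close> and \<open>\<delta> - \<beta>\<close> for all positive \<open>\<beta>\<close> of height zero. The \<open>w\<close> with \<open>w\<inverse> \<alpha>\<^sub>p > 0\<close> contribute \<open>|W\<^sub>f| / |W\<^sub>\<sigma>|\<close>. For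
  the others the condition on \<open>\<alpha>\<^sub>q + \<delta>\<close> is automatic, and their alcoves fill a fundamental domain of the
  group generated by \<open>W\<^sub>\<sigma>\<close>, the coroot lattice of height zero and the translation by \<open>\<omega>\<^sub>q - \<omega>\<^sub>p\<close>. In the
  affine Weyl group extended by the whole coweight lattice such a domain consists of
  \<open>\<ell>\<^sub>\<sigma> |W\<^sub>f| / |W\<^sub>\<sigma>|\<close> elements, and the \<open>\<ell>\<^sub>f\<close> cosets of the affine Weyl group contribute equally.\<close>

section \<open>Lattice vectors and linear maps\<close>

text \<open>The second half of the count is a double count of the set \<open>Sh\<close> of extended
  affine elements, given by a translation part in the coweight lattice \<open>P\<close> and a linear
  part in \<open>Wp\<close>. Modulo translations from \<open>L\<close> and linear parts from
  \<open>Ws\<close> it yields |Ws| |Sh| = |P/L| |Wp|; modulo the coroot lattice \<open>Q\<close> it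
  yields |Sh| = |S2| |P/Q|. Here \<open>L\<close> is the coroot lattice of height zero together with
  the multiples of omega_q - omega_p. These multiples are the kernel of the restriction of coweights
  to the simple roots of height zero, a restriction that is onto because p has label 1. Hence P/L is
  the coweight lattice of the height zero system modulo its coroot lattice, although that system has
  smaller rank than the finite one. The obstacle is that the translation by omega_q - omega_p need
  not lie in the affine Weyl group. Alcoves are therefore encoded as sign patterns on the real
  roots, read off from linear maps that preserve these roots and fix delta. Existence of
  representatives comes from minimising a quadratic distance, uniqueness modulo \<open>L\<close>
  from an invariant functional that vanishes on no real root.\<close>

definition smult_vec :: "int \<Rightarrow> (nat \<Rightarrow> int) \<Rightarrow> nat \<Rightarrow> int" (infixr "\<cdot>" 75) where
  "c \<cdot> v = (\<lambda>i. c * v i)"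

lemma smult_vec_apply [simp]: "(c \<cdot> v) i = c * v i"
  by (simp add: smult_vec_def)

definition lin :: "((nat \<Rightarrow> int) \<Rightarrow> nat \<Rightarrow> int) \<Rightarrow> bool" where
  "lin g \<longleftrightarrow> (\<forall>u v. g (u + v) = g u + g v) \<and> (\<forall>c v. g (c \<cdot> v) = c \<cdot> g v)"

definition flin :: "((nat \<Rightarrow> int) \<Rightarrow> int) \<Rightarrow> bool" where
  "flin f \<longleftrightarrow> (\<forall>u v. f (u + v) = f u + f v) \<and> (\<forall>c v. f (c \<cdot> v) = c * f v)"

lemma smult_0 [simp]: "0 \<cdot> v = 0" and smult_1 [simp]: "1 \<cdot> v = v" and smult_zero [simp]: "c \<cdot> 0 = 0"
  by (auto simp: fun_eq_iff)

lemma linD: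
  assumes "lin g"
  shows "g (u + v) = g u + g v" "g (c \<cdot> v) = c \<cdot> g v" "g (u - v) = g u - g v" "g (- v) = - g v" "g 0 = 0"
proof -
  show a: "g (u + v) = g u + g v" and m: "g (c \<cdot> v) = c \<cdot> g v" for u v c
    using assms by (auto simp: lin_def)
  show z: "g 0 = 0" using m[of 0 0] by simp
  have "- v = (-1) \<cdot> v" for v by (auto simp: fun_eq_iff)
  then show n: "g (- v) = - g v" for v using m[of "-1" v] by metis
  show "g (u - v) = g u - g v" using a[of u "- v"] n[of v] by simp
qed

lemma flinD:
  assumes "flin f"
  shows "f (u + v) = f u + f v" "f (c \<cdot> v) = c * f v" "f (u - v) = f u - f v" "f (- v) = - f v" "f 0 = 0"
proof -
  show a: "f (u + v) = f u + f v" and m: "f (c \<cdot> v) = c * f v" for u v c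
    using assms by (auto simp: flin_def)
  show z: "f 0 = 0" using m[of 0 0] by simp
  have "- v = (-1) \<cdot> v" for v by (auto simp: fun_eq_iff)
  then show n: "f (- v) = - f v" for v using m[of "-1" v] by (metis mult_minus1)
  show "f (u - v) = f u - f v" using a[of u "- v"] n[of v] by simp
qed

lemma lin_id [simp]: "lin id" by (simp add: lin_def)

lemma lin_comp: "lin g \<Longrightarrow> lin h \<Longrightarrow> lin (g \<circ> h)" by (simp add: lin_def)

lemma flin_comp: "flin f \<Longrightarrow> lin h \<Longrightarrow> flin (f \<circ> h)" by (simp add: lin_def flin_def)

lemma lin_sum: "lin g \<Longrightarrow> g (\<Sum>i\<in>A. c i \<cdot> u i) = (\<Sum>i\<in>A. c i \<cdot> g (u i))"
  by (induct A rule: infinite_finite_induct) (auto simp: linD)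

lemma flin_sum: "flin f \<Longrightarrow> f (\<Sum>i\<in>A. c i \<cdot> u i) = (\<Sum>i\<in>A. c i * f (u i))"
  by (induct A rule: infinite_finite_induct) (auto simp: flinD)

lemma flin_Sum: "(\<And>i. i \<in> A \<Longrightarrow> flin (f i)) \<Longrightarrow> flin (\<lambda>v. \<Sum>i\<in>A. f i v)"
  by (auto simp: flin_def sum.distrib sum_distrib_left)

lemma flin_add: "flin f \<Longrightarrow> flin g \<Longrightarrow> flin (\<lambda>v. f v + g v)"
  by (auto simp: flin_def algebra_simps)

lemma flin_cmult: "flin f \<Longrightarrow> flin (\<lambda>v. c * f v)"
  by (auto simp: flin_def algebra_simps)

lemma flin_diff: "flin f \<Longrightarrow> flin g \<Longrightarrow> flin (\<lambda>v. f v - g v)"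
  by (auto simp: flin_def algebra_simps)

lemma sum_vec_apply: "(\<Sum>i\<in>A. u i) k = (\<Sum>i\<in>A. (u i :: nat \<Rightarrow> int) k)"
  by (induct A rule: infinite_finite_induct) auto

lemma simple_root_apply: "simple_root i k = (if k = i then 1 else 0)"
  by (simp add: simple_root_def)

lemma expand_vec:
  "v = (\<lambda>i. if i \<le> n then 0 else v i) + (\<Sum>i\<le>n. v i \<cdot> simple_root i)" for v :: "nat \<Rightarrow> int"
proof
  fix k
  have "(\<Sum>i\<le>n. v i \<cdot> simple_root i) k = (\<Sum>i\<le>n. if k = i then v i else 0)"
    unfolding sum_vec_apply by (intro sum.cong) (auto simp: simple_root_apply)
  also have "\<dots> = (if k \<le> n then v k else 0)" by simp
  finally show "v k = ((\<lambda>i. if i \<le> n then 0 else v i) + (\<Sum>i\<le>n. v i \<cdot> simple_root i)) k"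
    by simp
qed

text \<open>Vectors also have coordinates beyond \<open>n\<close>, which \<open>simple_refl C n\<close> leaves alone. Linear maps are
  only determined by their values on the simple roots if they do the same.\<close>

definition supported :: "nat \<Rightarrow> ((nat \<Rightarrow> int) \<Rightarrow> nat \<Rightarrow> int) \<Rightarrow> bool" where
  "supported n g \<longleftrightarrow> (\<forall>v. (\<forall>i\<le>n. v i = 0) \<longrightarrow> g v = v) \<and> (\<forall>v k. k > n \<longrightarrow> g v k = v k)"

lemma supported_comp: "supported n g \<Longrightarrow> supported n h \<Longrightarrow> supported n (g \<circ> h)"
  by (simp add: supported_def)

lemma lin_eqI:
  assumes "lin g" "lin h" "supported n g" "supported n h"
    and "\<And>i. i \<le> n \<Longrightarrow> g (simple_root i) = h (simple_root i)"
  shows "g = h"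
proof
  fix v
  let ?r = "\<lambda>i. if i \<le> n then 0 else v i :: int"
  have "g ?r = ?r" "h ?r = ?r" using assms(3,4) by (auto simp: supported_def)
  then show "g v = h v"
    by (subst (1 2) expand_vec[of v n]) (simp add: linD assms lin_sum)
qed

definition fsupported :: "nat \<Rightarrow> ((nat \<Rightarrow> int) \<Rightarrow> int) \<Rightarrow> bool" where
  "fsupported n f \<longleftrightarrow> (\<forall>v. (\<forall>i\<le>n. v i = 0) \<longrightarrow> f v = 0)"

lemma flin_expand:
  assumes "flin f" "fsupported n f"
  shows "f v = (\<Sum>i\<le>n. v i * f (simple_root i))"
proof -
  have "f (\<lambda>i. if i \<le> n then 0 else v i) = 0" using assms(2) by (auto simp: fsupported_def)
  then show ?thesis
    by (subst expand_vec[of v n]) (simp add: flinD flin_sum assms)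
qed

lemma flin_eqI:
  assumes "flin f" "flin g" "fsupported n f" "fsupported n g"
    and "\<And>i. i \<le> n \<Longrightarrow> f (simple_root i) = g (simple_root i)"
  shows "f = g"
  by (rule ext) (subst (1 2) flin_expand[of _ n], auto simp: assms)


section \<open>Affine Cartan matrices\<close>

text \<open>The value of the simple coroot with index i on v. \<open>simple_refl\<close> computes
  with the same sum, but as a functional it can be added, composed with Weyl group elements and
  evaluated on simple roots.\<close>

definition pairing :: "(nat \<Rightarrow> nat \<Rightarrow> int) \<Rightarrow> nat \<Rightarrow> nat \<Rightarrow> (nat \<Rightarrow> int) \<Rightarrow> int" where
  "pairing C n i v = (\<Sum>j\<le>n. C i j * v j)"

lemma flin_pairing: "flin (pairing C n i)"
  by (auto simp: flin_def pairing_def algebra_simps sum.distrib sum_distrib_left)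

lemma fsupported_pairing: "fsupported n (pairing C n i)"
  by (simp add: fsupported_def pairing_def)

lemma pairing_simple_root [simp]: "j \<le> n \<Longrightarrow> pairing C n i (simple_root j) = C i j"
proof -
  assume "j \<le> n"
  have "(\<Sum>k\<le>n. C i k * simple_root j k) = (\<Sum>k\<le>n. if k = j then C i k else 0)"
    by (intro sum.cong) (auto simp: simple_root_apply)
  then show ?thesis using \<open>j \<le> n\<close> by (simp add: pairing_def)
qed

lemma simple_refl_alt: "simple_refl C n i v = v - pairing C n i v \<cdot> simple_root i"
  by (auto simp: simple_refl_def pairing_def fun_eq_iff simple_root_apply)

lemma lin_simple_refl: "lin (simple_refl C n i)"
  using flin_pairing[of C n i] by (auto simp: lin_def simple_refl_alt flinD fun_eq_iff algebra_simps)

lemma supported_simple_refl: "i \<le> n \<Longrightarrow> supported n (simple_refl C n i)"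
  by (auto simp: supported_def simple_refl_alt pairing_def simple_root_apply)

lemma simple_refl_other: "k \<noteq> i \<Longrightarrow> simple_refl C n i v k = v k"
  by (simp add: simple_refl_def)

lemma weyl_group_comp:
  "w \<in> weyl_group C n J \<Longrightarrow> u \<in> weyl_group C n J \<Longrightarrow> w \<circ> u \<in> weyl_group C n J"
  by (induct rule: weyl_group.induct) (auto simp: comp_assoc intro: weyl_step)

lemma weyl_group_refl: "i \<in> J \<Longrightarrow> simple_refl C n i \<in> weyl_group C n J"
  using weyl_step[OF weyl_id, of i J C n] by simp

lemma weyl_group_mono: "w \<in> weyl_group C n J \<Longrightarrow> J \<subseteq> J' \<Longrightarrow> w \<in> weyl_group C n J'"
  by (induct rule: weyl_group.induct) (auto intro: weyl_id weyl_step)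

lemma weyl_group_lin: "w \<in> weyl_group C n J \<Longrightarrow> lin w"
  by (induct rule: weyl_group.induct) (simp_all only: lin_id lin_comp lin_simple_refl)

lemma weyl_group_supported: "w \<in> weyl_group C n J \<Longrightarrow> J \<subseteq> {0..n} \<Longrightarrow> supported n w"
  by (induct rule: weyl_group.induct) (auto intro!: supported_comp supported_simple_refl simp: supported_def[of _ id])

text \<open>A simple reflection changes only the coordinate at its own node. So the group of a
  proper subdiagram preserves the coordinates at the omitted nodes, which later separates linear
  parts from translations.\<close>

lemma weyl_group_coord: "w \<in> weyl_group C n J \<Longrightarrow> k \<notin> J \<Longrightarrow> w v k = v k"
  by (induct arbitrary: v rule: weyl_group.induct) (auto simp: simple_refl_def)

text \<open>A symmetrizable indecomposable Cartan matrix for which the labels are a positive null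
  vector, hence one of affine type. The numbers \<open>d i\<close> are proportional to the squared
  lengths of the simple roots, and \<open>conn\<close> says that no proper nonempty set of nodes is
  closed under adjacency.\<close>

locale affine_matrix =
  fixes C :: "nat \<Rightarrow> nat \<Rightarrow> int" and n :: nat and a :: "nat \<Rightarrow> nat" and d :: "nat \<Rightarrow> int"
  assumes diag: "i \<le> n \<Longrightarrow> C i i = 2"
    and offdiag: "i \<le> n \<Longrightarrow> j \<le> n \<Longrightarrow> i \<noteq> j \<Longrightarrow> C i j \<le> 0"
    and d_pos: "i \<le> n \<Longrightarrow> d i > 0"
    and symm: "i \<le> n \<Longrightarrow> j \<le> n \<Longrightarrow> d i * C i j = d j * C j i"
    and conn: "S \<subseteq> {..n} \<Longrightarrow> S \<noteq> {} \<Longrightarrow> (\<And>i j. i \<in> S \<Longrightarrow> j \<le> n \<Longrightarrow> C i j \<noteq> 0 \<Longrightarrow> j \<in> S) \<Longrightarrow> S = {..n}"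
    and a_pos: "i \<le> n \<Longrightarrow> a i > 0"
    and null: "i \<le> n \<Longrightarrow> (\<Sum>j\<le>n. C i j * int (a j)) = 0"
begin

abbreviation W where "W \<equiv> weyl_group C n {0..n}"
abbreviation RR where "RR \<equiv> real_roots C n {0..n}"
abbreviation refl where "refl \<equiv> simple_refl C n"
abbreviation pr where "pr \<equiv> pairing C n"
abbreviation al where "al \<equiv> simple_root"

definition delta :: "nat \<Rightarrow> int" where "delta = (\<lambda>i. if i \<le> n then int (a i) else 0)"

lemma pr_delta: "i \<le> n \<Longrightarrow> pr i delta = 0"
  using null[of i] by (simp add: pairing_def delta_def)

lemma C_zero_sym: "i \<le> n \<Longrightarrow> j \<le> n \<Longrightarrow> C i j = 0 \<longleftrightarrow> C j i = 0"
  using symm[of i j] d_pos[of i] d_pos[of j] by auto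

section \<open>The invariant form: semidefinite, with radical spanned by delta\<close>

lemma sum_nonpos_zeroD:
  fixes f :: "nat \<Rightarrow> real"
  assumes "(\<Sum>i\<le>m. f i) = 0" "\<And>i. i \<le> m \<Longrightarrow> f i \<le> 0" "i \<le> m"
  shows "f i = 0"
  using sum_nonneg_eq_0_iff[of "{..m}" "\<lambda>i. - f i"] assms by (auto simp: sum_negf)

text \<open>After the substitution x_i = a_i y_i the coefficient matrix has zero row and column
  sums, because the labels are a null vector. In the expansion of the squares (y_i - y_j)^2 only the
  mixed terms then survive.\<close>

lemma psd_real:
  fixes x :: "nat \<Rightarrow> real"
  shows "2 * (\<Sum>i\<le>n. \<Sum>j\<le>n. of_int (d i * C i j) * x i * x j) =
     - (\<Sum>i\<le>n. \<Sum>j\<le>n. of_int (d i * C i j) * real (a i) * real (a j) * (x i / a i - x j / a j)\<^sup>2)"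
proof -
  define y where "y i = x i / a i" for i
  have x: "x i = y i * a i" if "i \<le> n" for i using a_pos[OF that] by (simp add: y_def)
  define M where "M i j = real_of_int (d i * C i j) * real (a i) * real (a j)" for i j
  have row: "(\<Sum>j\<le>n. M i j) = 0" if "i \<le> n" for i
  proof -
    have "(\<Sum>j\<le>n. M i j) = of_int (d i) * real (a i) * of_int (\<Sum>j\<le>n. C i j * int (a j))"
      by (simp add: M_def sum_distrib_left mult_ac)
    then show ?thesis using null[OF that] by simp
  qed
  have Msym: "M i j = M j i" if "i \<le> n" "j \<le> n" for i j
    using symm[OF that] by (simp add: M_def mult_ac)
  have col: "(\<Sum>i\<le>n. M i j) = 0" if "j \<le> n" for j
    using row[OF that] Msym that by (metis (no_types, lifting) atMost_iff sum.cong)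
  have "(\<Sum>i\<le>n. \<Sum>j\<le>n. M i j * (y i - y j)\<^sup>2) =
     (\<Sum>i\<le>n. \<Sum>j\<le>n. M i j * (y i)\<^sup>2) + (\<Sum>i\<le>n. \<Sum>j\<le>n. M i j * (y j)\<^sup>2) - 2 * (\<Sum>i\<le>n. \<Sum>j\<le>n. M i j * y i * y j)"
    by (simp add: power2_diff algebra_simps sum.distrib sum_subtractf sum_distrib_left)
  also have "(\<Sum>i\<le>n. \<Sum>j\<le>n. M i j * (y i)\<^sup>2) = 0"
    using row by (simp flip: sum_distrib_right)
  also have "(\<Sum>i\<le>n. \<Sum>j\<le>n. M i j * (y j)\<^sup>2) = 0"
    using col by (subst sum.swap) (simp flip: sum_distrib_right)
  also have "(\<Sum>i\<le>n. \<Sum>j\<le>n. M i j * y i * y j) = (\<Sum>i\<le>n. \<Sum>j\<le>n. of_int (d i * C i j) * x i * x j)"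
    by (intro sum.cong) (simp_all add: M_def x)
  finally show ?thesis by (simp add: M_def y_def)
qed

text \<open>Off the diagonal the coefficients d_i C_ij a_i a_j are nonpositive, so
  \<open>psd_real\<close> writes the form as a sum of nonnegative terms. If it vanishes, x_i / a_i
  agrees along every edge, and connectedness makes it constant.\<close>

lemma psd_real_nonneg:
  fixes x :: "nat \<Rightarrow> real"
  shows "(\<Sum>i\<le>n. \<Sum>j\<le>n. of_int (d i * C i j) * x i * x j) \<ge> 0" (is "?Q \<ge> 0")
    and "(\<Sum>i\<le>n. \<Sum>j\<le>n. of_int (d i * C i j) * x i * x j) = 0 \<Longrightarrow> i \<le> n \<Longrightarrow> j \<le> n \<Longrightarrow> x i * a j = x j * a i"
proof -
  let ?t = "\<lambda>i j. of_int (d i * C i j) * real (a i) * real (a j) * (x i / a i - x j / a j)\<^sup>2"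
  have t: "?t i j \<le> 0" if "i \<le> n" "j \<le> n" for i j
  proof (cases "i = j")
    case False
    have "d i * C i j \<le> 0" using offdiag[OF that False] d_pos[OF that(1)] by (simp add: mult_nonneg_nonpos)
    then have "real_of_int (d i * C i j) \<le> 0" by linarith
    then show ?thesis by (intro mult_nonpos_nonneg) auto
  qed simp
  have s: "(\<Sum>j\<le>n. ?t i j) \<le> 0" if "i \<le> n" for i by (rule sum_nonpos, rule t[OF that]) simp
  have "(\<Sum>i\<le>n. \<Sum>j\<le>n. ?t i j) \<le> 0" by (rule sum_nonpos, rule s) simp
  then show "?Q \<ge> 0" using psd_real[of x] by linarith
  assume q0: "?Q = 0" and ij: "i \<le> n" "j \<le> n"
  then have "(\<Sum>i\<le>n. \<Sum>j\<le>n. ?t i j) = 0" using psd_real[of x] by linarith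
  then have s0: "(\<Sum>j\<le>n. ?t i j) = 0" if "i \<le> n" for i
    by (rule sum_nonpos_zeroD[OF _ s that])
  have t0: "?t i j = 0" if "i \<le> n" "j \<le> n" for i j
    by (rule sum_nonpos_zeroD[OF s0[OF that(1)] t[OF that(1)] that(2)])
  have "{k. k \<le> n \<and> x k / a k = x i / a i} = {..n}"
  proof (rule conn)
    fix k l assume kl: "k \<in> {k. k \<le> n \<and> x k / a k = x i / a i}" "l \<le> n" "C k l \<noteq> 0"
    then have "x k / a k - x l / a l = 0"
      using t0[of k l] d_pos[of k] a_pos[of k] a_pos[of l] by auto
    with kl show "l \<in> {k. k \<le> n \<and> x k / a k = x i / a i}" by simp
  qed (use ij in auto)
  then have "x j / a j = x i / a i" using ij by auto
  then show "x i * a j = x j * a i" using a_pos ij by (simp add: field_simps)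
qed

text \<open>Pairing the equations with x shows that x is isotropic, hence proportional to the
  labels; the zero at z makes the factor zero. In particular proper subdiagrams have nonsingular
  Cartan matrices.\<close>

lemma real_kernel:
  fixes x :: "nat \<Rightarrow> real"
  assumes "z \<le> n" and "\<And>i. i \<le> n \<Longrightarrow> x i \<noteq> 0 \<Longrightarrow> (\<Sum>j\<le>n. of_int (C i j) * x j) = 0" and "x z = 0" and "i \<le> n"
  shows "x i = 0"
proof -
  have "(\<Sum>i\<le>n. \<Sum>j\<le>n. of_int (d i * C i j) * x i * x j) = (\<Sum>i\<le>n. of_int (d i) * x i * (\<Sum>j\<le>n. of_int (C i j) * x j))"
    by (simp add: sum_distrib_left mult_ac)
  also have "\<dots> = 0" using assms(2) by (intro sum.neutral) auto
  finally show ?thesis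
    using psd_real_nonneg(2)[of x i z] assms a_pos[of z] by auto
qed

lemma int_kernel:
  assumes "z \<le> n" and "\<And>i. i \<le> n \<Longrightarrow> v i \<noteq> 0 \<Longrightarrow> pr i v = 0" and "v z = 0" and "i \<le> n"
  shows "v i = 0"
proof -
  have "(\<Sum>j\<le>n. of_int (C i j) * real_of_int (v j)) = of_int (pr i v)" for i
    by (simp add: pairing_def)
  then show ?thesis using real_kernel[of z "\<lambda>i. of_int (v i)" i] assms by simp
qed

text \<open>The invariant form with (alpha_i, v) = d_i times the value of the i-th coroot on v. The
  squared length of alpha_i is 2 d_i, and delta lies in the radical.\<close>

definition form :: "(nat \<Rightarrow> int) \<Rightarrow> (nat \<Rightarrow> int) \<Rightarrow> int" where
  "form u v = (\<Sum>i\<le>n. u i * d i * pr i v)"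

lemma form_alt: "form u v = (\<Sum>i\<le>n. \<Sum>j\<le>n. d i * C i j * u i * v j)"
  by (simp add: form_def pairing_def sum_distrib_left mult_ac)

lemma form_sym: "form u v = form v u"
  unfolding form_alt by (subst sum.swap, intro sum.cong) (auto simp: symm mult_ac)

lemma flin_form: "flin (form u)" and flin_form2: "flin (\<lambda>v. form v u)"
proof -
  show "flin (form u)" for u
    using flinD[OF flin_pairing] by (auto simp: flin_def form_def algebra_simps sum.distrib sum_distrib_left)
  then show "flin (\<lambda>v. form v u)" using form_sym by (metis (full_types) ext)
qed

lemmas form_simps = flinD[OF flin_form] flinD[OF flin_form2]

lemma form_al: "i \<le> n \<Longrightarrow> form (al i) v = d i * pr i v"
proof -
  assume "i \<le> n"
  have "form (al i) v = (\<Sum>k\<le>n. if k = i then d k * pr k v else 0)"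
    unfolding form_def by (intro sum.cong) (auto simp: simple_root_apply)
  then show ?thesis using \<open>i \<le> n\<close> by simp
qed

lemma form_delta [simp]: "form u delta = 0" "form delta u = 0"
  using form_sym[of delta u] by (simp_all add: form_def pr_delta)

lemma form_nonneg: "form v v \<ge> 0"
  and form_zero: "form v v = 0 \<Longrightarrow> i \<le> n \<Longrightarrow> j \<le> n \<Longrightarrow> v i * a j = v j * a i"
proof -
  have e: "(\<Sum>i\<le>n. \<Sum>j\<le>n. of_int (d i * C i j) * real_of_int (v i) * real_of_int (v j)) = of_int (form v v)"
    by (simp add: form_alt)
  show "form v v \<ge> 0" using psd_real_nonneg(1)[of "\<lambda>i. of_int (v i)"] unfolding e by simp
  assume h: "form v v = 0" "i \<le> n" "j \<le> n"
  have "real_of_int (v i) * a j = real_of_int (v j) * a i"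
    using psd_real_nonneg(2)[of "\<lambda>i. of_int (v i)" i j] h unfolding e by auto
  then have "real_of_int (v i * a j) = real_of_int (v j * a i)" by simp
  then show "v i * a j = v j * a i" by (simp only: of_int_eq_iff)
qed

section \<open>Real roots and their signs\<close>

lemma refl_refl [simp]: "i \<le> n \<Longrightarrow> refl i (refl i v) = v"
  using diag[of i] by (simp add: simple_refl_alt flinD[OF flin_pairing] fun_eq_iff)

lemma form_refl: "i \<le> n \<Longrightarrow> form (refl i u) (refl i v) = form u v"
  using diag[of i] form_al[of i u] form_al[of i v] form_al[of i "al i"] form_sym[of u "al i"]
  by (simp add: simple_refl_alt form_simps algebra_simps)

lemma W_form: "w \<in> W \<Longrightarrow> form (w u) (w v) = form u v"
  by (induct rule: weyl_group.induct) (auto simp: form_refl)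

lemma W_delta: "w \<in> W \<Longrightarrow> w delta = delta"
  by (induct rule: weyl_group.induct) (auto simp: simple_refl_alt pr_delta)

lemma W_inverse: "J \<subseteq> {0..n} \<Longrightarrow> w \<in> weyl_group C n J \<Longrightarrow> \<exists>w'\<in>weyl_group C n J. w \<circ> w' = id \<and> w' \<circ> w = id"
proof -
  assume J: "J \<subseteq> {0..n}" and "w \<in> weyl_group C n J"
  from this(2) show ?thesis
proof induct
  case weyl_id
  then show ?case using weyl_group.weyl_id[of C n J] by (intro bexI[of _ id]) (simp_all only: id_o o_id)
next
  case (weyl_step w i)
  then obtain w' where w': "w' \<in> weyl_group C n J" "w \<circ> w' = id" "w' \<circ> w = id" by blast
  have i: "i \<le> n" using weyl_step(3) J by auto
  have "refl i \<circ> w \<circ> (w' \<circ> refl i) = id" "w' \<circ> refl i \<circ> (refl i \<circ> w) = id"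
    by (rule ext, simp only: o_apply id_apply refl_refl[OF i] pointfree_idE[OF w'(2)] pointfree_idE[OF w'(3)])+
  then show ?case using weyl_group_comp[OF w'(1) weyl_group_refl[of i J]] weyl_step by blast
qed
qed

lemma W_inv:
  assumes "J \<subseteq> {0..n}" "w \<in> weyl_group C n J"
  shows "inv w \<in> weyl_group C n J" "w (inv w v) = v" "inv w (w v) = v" "bij w"
proof -
  obtain w' where w': "w' \<in> weyl_group C n J" "w \<circ> w' = id" "w' \<circ> w = id" using W_inverse[OF assms] by blast
  then have "inv w = w'" by (simp add: inv_unique_comp)
  with w' show "inv w \<in> weyl_group C n J" "w (inv w v) = v" "inv w (w v) = v" "bij w"
    by (auto simp only: pointfree_idE intro: o_bij)
qed

lemma sub_W: "J \<subseteq> {0..n} \<Longrightarrow> w \<in> weyl_group C n J \<Longrightarrow> w \<in> W"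
  by (rule weyl_group_mono)

lemmas W_inv' = W_inv[OF order_refl]

lemma RR_W: "\<beta> \<in> RR \<Longrightarrow> w \<in> W \<Longrightarrow> w \<beta> \<in> RR"
  unfolding real_roots_def by clarify (metis comp_apply weyl_group_comp)

lemma al_RR: "i \<le> n \<Longrightarrow> al i \<in> RR"
  unfolding real_roots_def by (auto intro!: exI[of _ id] weyl_id exI[of _ i])

lemma RR_cases:
  assumes "\<beta> \<in> RR" obtains w i where "w \<in> W" "i \<le> n" "\<beta> = w (al i)"
  using assms by (auto simp: real_roots_def)

lemma refl_al: "i \<le> n \<Longrightarrow> refl i (al i) = - al i"
  using diag[of i] by (simp add: simple_refl_alt fun_eq_iff)

lemma RR_uminus: "\<beta> \<in> RR \<Longrightarrow> - \<beta> \<in> RR"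
proof -
  assume "\<beta> \<in> RR"
  then obtain w i where w: "w \<in> W" "i \<le> n" "\<beta> = w (al i)" by (rule RR_cases)
  have "- \<beta> = (w \<circ> refl i) (al i)" using w linD(4)[OF weyl_group_lin[OF w(1)], of "al i"] by (simp add: refl_al)
  moreover have "w \<circ> refl i \<in> W" using w weyl_group_refl[of i "{0..n}"] by (intro weyl_group_comp) auto
  ultimately show ?thesis using RR_W[OF al_RR[OF w(2)]] by metis
qed

lemma RR_outside: "\<beta> \<in> RR \<Longrightarrow> k > n \<Longrightarrow> \<beta> k = 0"
  by (erule RR_cases) (auto simp: weyl_group_coord simple_root_apply)

lemma form_al_al: "i \<le> n \<Longrightarrow> form (al i) (al i) = 2 * d i"
  by (simp add: form_al diag)

lemma RR_norm: "\<beta> \<in> RR \<Longrightarrow> \<exists>i\<le>n. form \<beta> \<beta> = 2 * d i"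
  by (erule RR_cases) (auto simp: W_form form_al_al)

lemma RR_norm_pos: "\<beta> \<in> RR \<Longrightarrow> form \<beta> \<beta> > 0"
  using RR_norm d_pos by fastforce

text \<open>The reflection replaces v_i by v_i minus the pairing, and by symmetry d_i times this
  pairing is the sum of the C_ji d_j v_j. So divisibility of all d_j v_j is inherited.\<close>

lemma refl_dvd:
  assumes "i \<le> n" "\<And>k. k \<le> n \<Longrightarrow> D dvd d k * v k" "k \<le> n"
  shows "D dvd d k * refl i v k"
proof (cases "k = i")
  case True
  have "d i * pr i v = (\<Sum>j\<le>n. C j i * (d j * v j))"
    unfolding pairing_def sum_distrib_left
    by (intro sum.cong refl) (metis assms(1) atMost_iff mult.assoc mult.commute symm)
  also have "D dvd \<dots>" by (rule dvd_sum, rule dvd_mult, rule assms(2)) simp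
  finally have "D dvd d i * v i - d i * pr i v" using assms(1,2) by (intro dvd_diff) auto
  then show ?thesis using True by (simp add: simple_refl_alt simple_root_apply algebra_simps)
qed (use assms in \<open>simp add: simple_refl_other\<close>)

text \<open>For a root of squared length 2 d_i the quotient d_k beta_k / d_i is the k-th coordinate
  of its coroot; the divisibility expresses that coroots have integral coordinates.\<close>

lemma RR_dvd:
  assumes "\<beta> \<in> RR" "k \<le> n" shows "form \<beta> \<beta> dvd 2 * (d k * \<beta> k)"
proof -
  obtain w i where w: "w \<in> W" "i \<le> n" "\<beta> = w (al i)" using assms by (rule_tac RR_cases)
  have "d i dvd d k * w (al i) k" if "k \<le> n" for k
    using w(1) that
  proof (induct arbitrary: k rule: weyl_group.induct)
    case weyl_id
    then show ?case by (simp add: simple_root_apply)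
  next
    case (weyl_step w j)
    then show ?case unfolding o_apply by (intro refl_dvd) auto
  qed
  then show ?thesis using w assms by (simp add: W_form form_al_al)
qed

text \<open>If \<open>D\<close> divides all \<open>d\<^sub>k v\<^sub>k\<close>, then the norm of \<open>v\<close> is a multiple of \<open>2 D\<close>. Hence both parts of a
  root with coordinates of both signs would already be at least as long as the root.\<close>

lemma form_dvd:
  assumes "\<And>k. k \<le> n \<Longrightarrow> D dvd d k * v k"
  shows "2 * D dvd form v v"
proof -
  define M where "M i j = d i * C i j * v i * v j" for i j
  have sy: "M i j = M j i" if "i \<le> n" "j \<le> n" for i j
    using symm[OF that] by (simp add: M_def mult_ac)
  have dv: "D dvd M i j" if "i \<le> n" for i j
  proof -
    have "M i j = (d i * v i) * (C i j * v j)" by (simp add: M_def mult_ac)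
    then show ?thesis using assms[OF that] by (metis dvd_mult2)
  qed
  have "2 * D dvd (\<Sum>i\<le>m. \<Sum>j\<le>m. M i j)" if "m \<le> n" for m
    using that
  proof (induct m)
    case 0
    have "M 0 0 = 2 * (d 0 * v 0 * v 0)" using diag[of 0] by (simp add: M_def)
    moreover have "D dvd d 0 * v 0 * v 0" using dvd_mult2[OF assms[of 0], of "v 0"] by simp
    ultimately show ?case by simp
  next
    case (Suc m)
    have "(\<Sum>i\<le>Suc m. \<Sum>j\<le>Suc m. M i j) = (\<Sum>i\<le>m. \<Sum>j\<le>m. M i j) + (\<Sum>i\<le>m. M i (Suc m)) + (\<Sum>j\<le>m. M (Suc m) j) + M (Suc m) (Suc m)"
      by (simp add: sum.distrib)
    also have "(\<Sum>j\<le>m. M (Suc m) j) = (\<Sum>i\<le>m. M i (Suc m))"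
      using Suc.prems by (intro sum.cong sy) auto
    also have "M (Suc m) (Suc m) = 2 * (d (Suc m) * v (Suc m) * v (Suc m))"
      using diag[OF Suc.prems] by (simp add: M_def)
    finally have "(\<Sum>i\<le>Suc m. \<Sum>j\<le>Suc m. M i j) = (\<Sum>i\<le>m. \<Sum>j\<le>m. M i j) +
       2 * ((\<Sum>i\<le>m. M i (Suc m)) + d (Suc m) * v (Suc m) * v (Suc m))" by simp
    moreover have "D dvd (\<Sum>i\<le>m. M i (Suc m)) + d (Suc m) * v (Suc m) * v (Suc m)"
      using Suc.prems dvd_mult2[OF assms[OF Suc.prems], of "v (Suc m)"] by (intro dvd_add dvd_sum dv) auto
    ultimately show ?case using Suc by (metis Suc_leD dvd_add dvd_refl mult_dvd_mono)
  qed
  then show ?thesis by (simp add: form_alt M_def)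
qed

lemma form_pos:
  assumes "z \<le> n" "v z = 0" "i \<le> n" "v i \<noteq> 0"
  shows "form v v > 0"
  using form_nonneg[of v] form_zero[of v i z] a_pos[of z] assms by (cases "form v v = 0") auto

lemma RR_coherent:
  assumes "\<beta> \<in> RR" shows "0 \<le> \<beta> \<or> \<beta> \<le> 0"
proof (rule ccontr)
  assume "\<not> ?thesis"
  then obtain i j where ij: "\<beta> i < 0" "\<beta> j > 0" by (auto simp: le_fun_def not_le)
  have n: "i \<le> n" "j \<le> n" using RR_outside[OF assms, of i] RR_outside[OF assms, of j] ij by force+
  define u where "u = (\<lambda>k. max (\<beta> k) 0)"
  define v where "v = (\<lambda>k. max (- \<beta> k) 0)"
  obtain l where l: "l \<le> n" "form \<beta> \<beta> = 2 * d l" using RR_norm[OF assms] by blast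
  have dv: "d l dvd d k * \<beta> k" if "k \<le> n" for k
    using RR_dvd[OF assms that] l by simp
  have "2 * d l dvd form u u" "2 * d l dvd form v v"
    by (rule form_dvd, use dv in \<open>force simp: u_def v_def max_def\<close>)+
  moreover have "form u u > 0" "form v v > 0"
    using form_pos[of i u j] form_pos[of j v i] n ij by (auto simp: u_def v_def)
  ultimately have ge: "form u u \<ge> 2 * d l" "form v v \<ge> 2 * d l" by (auto dest: zdvd_imp_le)
  have "\<beta> = u - v" by (auto simp: fun_eq_iff u_def v_def)
  then have "form \<beta> \<beta> = form u u + form v v - 2 * form u v"
    using form_sym[of u v] by (simp add: form_simps)
  \<comment> \<open>The two parts have disjoint supports and off-diagonal entries are nonpositive,
    so the mixed terms only add length: the squared length of beta would be at least 4 d_l instead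
    of 2 d_l.\<close>
  moreover have "form u v \<le> 0"
    unfolding form_alt
  proof (intro sum_nonpos)
    fix i j assume ij: "i \<in> {..n}" "j \<in> {..n}"
    show "d i * C i j * u i * v j \<le> 0"
    proof (cases "i = j")
      case True
      have "u i * v i = 0" by (auto simp: u_def v_def max_def)
      then show ?thesis using True by (metis mult.assoc mult_zero_right order_refl)
    next
      case False
      have "d i * C i j \<le> 0" using offdiag[of i j] d_pos[of i] ij False by (simp add: mult_nonneg_nonpos)
      moreover have "0 \<le> u i * v j" by (simp add: u_def v_def)
      ultimately show ?thesis by (metis mult.assoc mult_nonpos_nonneg)
    qed
  qed
  ultimately show False using ge l d_pos[of l] by linarith
qed

lemma RR_nonzero: "\<beta> \<in> RR \<Longrightarrow> \<beta> \<noteq> 0"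
  using RR_norm_pos[of \<beta>] by (auto simp: form_simps)

lemma RR_not_both: "\<beta> \<in> RR \<Longrightarrow> 0 \<le> \<beta> \<Longrightarrow> \<beta> \<le> 0 \<Longrightarrow> False"
  using RR_nonzero by (metis order_antisym)

lemma RR_nonneg_iff: "\<beta> \<in> RR \<Longrightarrow> 0 \<le> \<beta> \<longleftrightarrow> \<not> \<beta> \<le> 0"
  using RR_coherent RR_not_both by blast

lemma RR_nonnegI: "\<beta> \<in> RR \<Longrightarrow> \<beta> k > 0 \<Longrightarrow> 0 \<le> \<beta>"
  using RR_coherent[of \<beta>] by (metis le_funD linorder_not_less zero_fun_apply)

text \<open>If beta has a nonzero coordinate besides the one at i, the reflection leaves that
  positive coordinate alone and the sign of the image follows. Otherwise beta = c alpha_i has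
  squared length 2 d_i c^2, which divides 2 d_i c by \<open>RR_dvd\<close>; so c = 1, the excluded
  case.\<close>

lemma refl_pos:
  assumes "\<beta> \<in> RR" "0 \<le> \<beta>" "i \<le> n" "\<beta> \<noteq> al i"
  shows "0 \<le> refl i \<beta>"
proof (cases "\<exists>k. k \<noteq> i \<and> \<beta> k \<noteq> 0")
  case True
  then obtain k where k: "k \<noteq> i" "\<beta> k > 0" using assms(2) by (metis le_funD less_le zero_fun_apply)
  then show ?thesis using RR_W[OF assms(1) weyl_group_refl[of i]] assms(3) by (auto intro!: RR_nonnegI[of _ k] simp: simple_refl_other)
next
  case False
  then have b: "\<beta> = \<beta> i \<cdot> al i" by (auto simp: fun_eq_iff simple_root_apply)
  define c where "c = \<beta> i"
  have c: "c > 0" "\<beta> = c \<cdot> al i" using b RR_nonzero[OF assms(1)] assms(2) unfolding c_def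
    by (metis le_funD less_le smult_0 zero_fun_apply, simp)
  have f: "form \<beta> \<beta> = 2 * d i * c * c" using c assms(3) by (simp add: form_simps form_al_al)
  moreover have "form \<beta> \<beta> dvd 2 * (d i * c)" using RR_dvd[OF assms(1,3)] c by (simp add: simple_root_apply)
  ultimately have "(2 * d i * c) * c dvd (2 * d i * c) * 1" by (simp add: mult_ac)
  then have "c dvd 1" using d_pos[OF assms(3)] c(1) by (subst (asm) dvd_mult_cancel_left) auto
  then have "c = 1" using c(1) by simp
  then show ?thesis using assms c by simp
qed

text \<open>The division is exact if \<open>\<eta>\<close> is a real root.\<close>

definition crt :: "(nat \<Rightarrow> int) \<Rightarrow> (nat \<Rightarrow> int) \<Rightarrow> int" where
  "crt \<eta> v = (2 * form \<eta> v) div form \<eta> \<eta>"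

definition rf :: "(nat \<Rightarrow> int) \<Rightarrow> (nat \<Rightarrow> int) \<Rightarrow> nat \<Rightarrow> int" where
  "rf \<eta> v = v - crt \<eta> v \<cdot> \<eta>"

lemma crt_W: "w \<in> W \<Longrightarrow> i \<le> n \<Longrightarrow> crt (w (al i)) (w v) = pr i v"
  using d_pos[of i] by (simp add: crt_def W_form form_al diag)

lemma rf_W: "w \<in> W \<Longrightarrow> i \<le> n \<Longrightarrow> rf (w (al i)) (w v) = w (refl i v)"
  using linD(2,3)[OF weyl_group_lin[of w C n "{0..n}"]] by (simp add: rf_def crt_W simple_refl_alt)

lemma crt_form: "\<eta> \<in> RR \<Longrightarrow> 2 * form \<eta> v = crt \<eta> v * form \<eta> \<eta>"
proof -
  assume "\<eta> \<in> RR"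
  then obtain w i where w: "w \<in> W" "i \<le> n" "\<eta> = w (al i)" by (rule RR_cases)
  define u where "u = inv w v"
  have v: "v = w u" using W_inv'(2)[OF w(1)] by (simp add: u_def)
  show ?thesis unfolding v w(3) using w by (simp add: crt_W W_form form_al diag)
qed

text \<open>Additivity is not visible through \<open>div\<close>. It is inherited from the form
  because \<open>crt_form\<close> shows that the division is exact.\<close>

lemma flin_crt: "\<eta> \<in> RR \<Longrightarrow> flin (crt \<eta>)"
proof -
  assume e: "\<eta> \<in> RR"
  have nz: "form \<eta> \<eta> \<noteq> 0" using RR_norm_pos[OF e] by simp
  show ?thesis unfolding flin_def
  proof safe
    fix u v c
    have "crt \<eta> (u + v) * form \<eta> \<eta> = (crt \<eta> u + crt \<eta> v) * form \<eta> \<eta>"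
      using crt_form[OF e, of u] crt_form[OF e, of v] crt_form[OF e, of "u + v"] by (simp add: form_simps algebra_simps)
    then show "crt \<eta> (u + v) = crt \<eta> u + crt \<eta> v" using nz by (metis mult_right_cancel)
    have "crt \<eta> (c \<cdot> u) * form \<eta> \<eta> = 2 * (c * form \<eta> u)"
      using crt_form[OF e, of "c \<cdot> u"] by (simp add: form_simps)
    also have "\<dots> = (c * crt \<eta> u) * form \<eta> \<eta>"
      using crt_form[OF e, of u] by (simp add: mult.assoc mult.left_commute)
    finally show "crt \<eta> (c \<cdot> u) = c * crt \<eta> u" using nz by (metis mult_right_cancel)
  qed
qed

lemma crt_self [simp]: "\<eta> \<in> RR \<Longrightarrow> crt \<eta> \<eta> = 2"
  using RR_norm_pos[of \<eta>] by (simp add: crt_def)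

lemma crt_delta [simp]: "crt \<eta> delta = 0"
  by (simp add: crt_def)

lemma crt_shift [simp]: "crt (\<eta> + m \<cdot> delta) = crt \<eta>"
  by (simp add: crt_def form_simps fun_eq_iff)

lemma crt_uminus: "\<eta> \<in> RR \<Longrightarrow> crt (- \<eta>) v = - crt \<eta> v"
proof -
  assume e: "\<eta> \<in> RR"
  have "crt (- \<eta>) v * form \<eta> \<eta> = (- crt \<eta> v) * form \<eta> \<eta>"
    using crt_form[OF e, of v] crt_form[OF RR_uminus[OF e], of v] by (simp add: form_simps)
  then show ?thesis using RR_norm_pos[OF e] by (metis less_irrefl mult_right_cancel)
qed

lemma crt_al: "i \<le> n \<Longrightarrow> crt (al i) v = pr i v"
  using crt_W[OF weyl_id, of i v] by simp

lemma rf_al: "i \<le> n \<Longrightarrow> rf (al i) = refl i"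
  by (simp add: rf_def crt_al simple_refl_alt fun_eq_iff)

lemma rf_uminus: "\<eta> \<in> RR \<Longrightarrow> rf (- \<eta>) = rf \<eta>"
  by (simp add: rf_def crt_uminus fun_eq_iff)

lemma rf_rf: "\<eta> \<in> RR \<Longrightarrow> rf \<eta> (rf \<eta> v) = v"
  using flinD(2,3)[OF flin_crt[of \<eta>]] by (simp add: rf_def fun_eq_iff)

lemma rf_in_weyl:
  assumes "J \<subseteq> {0..n}" "w \<in> weyl_group C n J" "j \<in> J"
  shows "rf (w (al j)) \<in> weyl_group C n J"
proof -
  have "rf (w (al j)) v = (w \<circ> refl j \<circ> inv w) v" for v
    using rf_W[OF sub_W[OF assms(1,2)], of j "inv w v"] W_inv(2)[OF assms(1,2), of v] assms by auto
  then have "rf (w (al j)) = w \<circ> refl j \<circ> inv w" by blast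
  then show ?thesis using weyl_group_comp weyl_group_refl W_inv[OF assms(1,2)] assms by metis
qed

lemma rf_in_W: "\<eta> \<in> RR \<Longrightarrow> rf \<eta> \<in> W"
  by (erule RR_cases) (auto intro: rf_in_weyl)

section \<open>Words, the exchange condition and parabolic subgroups\<close>

definition word :: "nat list \<Rightarrow> (nat \<Rightarrow> int) \<Rightarrow> nat \<Rightarrow> int" where
  "word xs = foldr (\<lambda>i g. refl i \<circ> g) xs id"

lemma word_simps [simp]: "word [] = id" "word (i # xs) = refl i \<circ> word xs"
  by (simp_all add: word_def)

lemma word_append: "word (xs @ ys) = word xs \<circ> word ys"
  by (induct xs) (simp_all add: comp_assoc)

lemma word_W: "set xs \<subseteq> {0..n} \<Longrightarrow> word xs \<in> W"
  by (induct xs) (auto intro: weyl_id weyl_step)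

lemma W_word: "w \<in> W \<Longrightarrow> \<exists>xs. set xs \<subseteq> {0..n} \<and> word xs = w"
proof (induct rule: weyl_group.induct)
  case weyl_id
  show ?case by (rule exI[of _ "[]"]) simp
next
  case (weyl_step w i)
  then obtain xs where "set xs \<subseteq> {0..n}" "word xs = w" by blast
  then show ?case using weyl_step by (intro exI[of _ "i # xs"]) auto
qed

text \<open>Reading the word from its right end, the image of alpha_k is positive at the start and
  negative at the end. At the letter i where the sign changes the image is alpha_i itself by
  \<open>refl_pos\<close>, and dropping this letter gives a word for the product with the reflection
  at k.\<close>

lemma exchange:
  assumes "set xs \<subseteq> {0..n}" "k \<le> n" "word xs (al k) \<le> 0"
  shows "\<exists>ys. set ys \<subseteq> {0..n} \<and> length ys < length xs \<and> word ys = word xs \<circ> refl k"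
  using assms(1,3)
proof (induct xs)
  case Nil
  then have "al k k \<le> 0" by (metis id_apply le_funD word_simps(1) zero_fun_apply)
  then show ?case by (simp add: simple_root_apply)
next
  case (Cons i zs)
  let ?b = "word zs (al k)"
  have i: "i \<le> n" and zs: "set zs \<subseteq> {0..n}" using Cons.prems by auto
  have bR: "?b \<in> RR" using RR_W[OF al_RR[OF assms(2)] word_W[OF zs]] .
  show ?case
  proof (cases "?b \<le> 0")
    case True
    then obtain ys where ys: "set ys \<subseteq> {0..n}" "length ys < length zs" "word ys = word zs \<circ> refl k"
      using Cons.hyps zs by blast
    then show ?thesis using i by (intro exI[of _ "i # ys"]) (auto simp: comp_assoc)
  next
    case False
    then have p: "0 \<le> ?b" using RR_coherent[OF bR] by blast
    have "?b = al i"
    proof (rule ccontr)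
      assume "?b \<noteq> al i"
      then have "0 \<le> refl i ?b" using refl_pos[OF bR p i] by blast
      moreover have "refl i ?b \<le> 0" using Cons.prems(2) by (simp only: word_simps o_apply)
      ultimately show False using RR_not_both[OF RR_W[OF bR weyl_group_refl[of i]]] i by (metis atLeastAtMost_iff le0)
    qed
    then have "refl i (word zs v) = word zs (refl k v)" for v
      using rf_W[OF word_W[OF zs] assms(2), of v] rf_al[OF i] by simp
    then have "word zs = word (i # zs) \<circ> refl k"
      by (intro ext) (metis i o_apply refl_refl word_simps(2))
    moreover have "length zs < length (i # zs)" by simp
    ultimately show ?thesis using zs by blast
  qed
qed

text \<open>In a shortest word with last letter k, positivity of w on alpha_k makes the word without
  k send alpha_k to a negative root. The exchange condition then yields a word for w that is shorter
  still, so the shortest word is empty.\<close>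

lemma W_pos_id:
  assumes "w \<in> W" "\<And>i. i \<le> n \<Longrightarrow> 0 \<le> w (al i)"
  shows "w = id"
proof -
  define P where "P xs \<longleftrightarrow> set xs \<subseteq> {0..n} \<and> word xs = w" for xs
  obtain xs0 where "P xs0" using W_word[OF assms(1)] unfolding P_def by blast
  then obtain xs where xs: "P xs" and min: "\<And>ys. P ys \<Longrightarrow> length xs \<le> length ys"
    using ex_has_least_nat[of P xs0 length] by blast
  show ?thesis
  proof (cases xs rule: rev_cases)
    case Nil
    then show ?thesis using xs unfolding P_def by (metis word_simps(1))
  next
    case (snoc ys k)
    have k: "k \<le> n" and ys: "set ys \<subseteq> {0..n}" using snoc xs unfolding P_def by auto
    have w: "w = word ys \<circ> refl k" using xs unfolding P_def snoc word_append word_simps o_id by blast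
    have "0 \<le> - word ys (al k)"
      using assms(2)[OF k] unfolding w o_apply refl_al[OF k] linD(4)[OF weyl_group_lin[OF word_W[OF ys]]] .
    then have "word ys (al k) \<le> 0" by (simp add: le_fun_def)
    then obtain zs where "set zs \<subseteq> {0..n}" "length zs < length ys" "word zs = w"
      using exchange[OF ys k] w by blast
    then have "length xs \<le> length zs" "length zs < length ys" using min[of zs] unfolding P_def by blast+
    then show ?thesis using snoc by simp
  qed
qed

text \<open>As beta has positive length, some alpha_i in its support pairs positively with it.
  Reflecting there lowers the height and stays positive and supported on J, until a simple root is
  reached. Hence real roots supported on J belong to the subsystem generated by J.\<close>

lemma supp_root:
  assumes "\<beta> \<in> RR" "0 \<le> \<beta>" "J \<subseteq> {0..n}" "\<And>k. k \<notin> J \<Longrightarrow> \<beta> k = 0"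
  shows "\<exists>w\<in>weyl_group C n J. \<exists>j\<in>J. \<beta> = w (al j)"
  using assms
proof (induct "nat (\<Sum>k\<le>n. \<beta> k)" arbitrary: \<beta> rule: less_induct)
  case less
  have "form \<beta> \<beta> > 0" by (rule RR_norm_pos[OF less(2)])
  then have "\<not> (\<forall>i\<in>{..n}. \<beta> i * d i * pr i \<beta> \<le> 0)"
    unfolding form_def using sum_nonpos[of "{..n}" "\<lambda>i. \<beta> i * d i * pr i \<beta>"] by fastforce
  then obtain i where i: "i \<le> n" "\<beta> i * d i * pr i \<beta> > 0" by (auto simp: not_le)
  have b0: "\<beta> i \<ge> 0" using le_funD[OF less(3), of i] by simp
  then have "0 \<le> \<beta> i * d i" using d_pos[OF i(1)] by simp
  with i(2) have bi: "\<beta> i > 0" "pr i \<beta> > 0" using b0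
    by (cases "\<beta> i = 0", simp, simp, simp add: zero_less_mult_iff)
  then have iJ: "i \<in> J" using less(5)[of i] by auto
  show ?case
  proof (cases "\<beta> = al i")
    case True
    then show ?thesis using iJ weyl_id by (intro bexI[of _ id] bexI[of _ i]) auto
  next
    case False
    have r: "refl i \<beta> \<in> RR" "0 \<le> refl i \<beta>"
      using RR_W[OF less(2) weyl_group_refl[of i]] refl_pos[OF less(2,3) i(1) False] i(1) by simp_all
    have "(\<Sum>k\<le>n. refl i \<beta> k) = (\<Sum>k\<le>n. \<beta> k) - (\<Sum>k\<le>n. pr i \<beta> * al i k)"
      by (simp add: simple_refl_alt sum_subtractf)
    also have "(\<Sum>k\<le>n. pr i \<beta> * al i k) = (\<Sum>k\<le>n. if k = i then pr i \<beta> else 0)"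
      by (intro sum.cong) (auto simp: simple_root_apply)
    also have "\<dots> = pr i \<beta>" using i by simp
    finally have "(\<Sum>k\<le>n. refl i \<beta> k) < (\<Sum>k\<le>n. \<beta> k)" using bi by simp
    moreover have "(\<Sum>k\<le>n. refl i \<beta> k) \<ge> 0" using r(2) by (auto intro!: sum_nonneg simp: le_fun_def)
    ultimately have "nat (\<Sum>k\<le>n. refl i \<beta> k) < nat (\<Sum>k\<le>n. \<beta> k)" by linarith
    moreover have "refl i \<beta> k = 0" if "k \<notin> J" for k
      using less(5)[OF that] iJ that by (cases "k = i") (auto simp: simple_refl_other)
    ultimately obtain w j where wj: "w \<in> weyl_group C n J" "j \<in> J" "refl i \<beta> = w (al j)"
      using less(1)[OF _ r less(4)] by blast
    then have "\<beta> = (refl i \<circ> w) (al j)" using refl_refl[OF i(1), of \<beta>] by (simp del: refl_refl)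
    then show ?thesis using wj iJ weyl_step by blast
  qed
qed

lemma rf_in_weyl_supp:
  assumes "\<beta> \<in> RR" "J \<subseteq> {0..n}" "\<And>k. k \<notin> J \<Longrightarrow> \<beta> k = 0"
  shows "rf \<beta> \<in> weyl_group C n J"
proof -
  consider "0 \<le> \<beta>" | "\<beta> \<le> 0" using RR_coherent[OF assms(1)] by blast
  then show ?thesis
  proof cases
    case 1
    then show ?thesis using supp_root[OF assms(1) _ assms(2,3)] rf_in_weyl[OF assms(2)] by auto
  next
    case 2
    then have "0 \<le> - \<beta>" by (auto simp: le_fun_def)
    then show ?thesis using supp_root[OF RR_uminus[OF assms(1)] _ assms(2)] assms(3) rf_in_weyl[OF assms(2)] rf_uminus[OF assms(1)]
      by fastforce
  qed
qed

end

section \<open>Translations and finite parts in the untwisted case\<close>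

lemma smult_minus [simp]: "(- c) \<cdot> u = - (c \<cdot> u)"
  and smult_add: "(b + c) \<cdot> u = b \<cdot> u + c \<cdot> u"
  and smult_diff: "(b - c) \<cdot> u = b \<cdot> u - c \<cdot> u"
  by (simp_all add: fun_eq_iff algebra_simps)

context affine_matrix
begin

text \<open>Translation by the coweight phi in its action on affine roots: only the multiple of
  delta changes. Composition adds the coweights as long as they vanish on delta.\<close>

definition T :: "((nat \<Rightarrow> int) \<Rightarrow> int) \<Rightarrow> (nat \<Rightarrow> int) \<Rightarrow> nat \<Rightarrow> int" where
  "T \<phi> v = v - \<phi> v \<cdot> delta"

lemma T_T: "flin \<phi> \<Longrightarrow> \<phi> delta = 0 \<Longrightarrow> T \<phi> (T \<psi> v) = T (\<lambda>v. \<phi> v + \<psi> v) v"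
  by (simp add: T_def flinD fun_eq_iff algebra_simps)

lemma T_comp: "flin \<phi> \<Longrightarrow> \<phi> delta = 0 \<Longrightarrow> T \<phi> \<circ> T \<psi> = T (\<lambda>v. \<phi> v + \<psi> v)"
  by (rule ext) (simp add: T_T)

lemma T_zero: "T (\<lambda>v. 0) = id"
  by (rule ext) (simp add: T_def)

lemma rf_shift: "rf (\<eta> + m \<cdot> delta) v = rf \<eta> v - (m * crt \<eta> v) \<cdot> delta"
  by (simp add: rf_def fun_eq_iff algebra_simps)

text \<open>The roots eta and eta - delta define parallel hyperplanes, and the product of their
  reflections is the translation by the coroot of eta.\<close>

lemma T_crt:
  assumes "\<eta> \<in> RR" "\<eta> - delta \<in> RR"
  shows "T (crt \<eta>) \<in> W"
proof -
  have e: "\<eta> - delta = \<eta> + (-1) \<cdot> delta" by (simp add: fun_eq_iff)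
  have "rf (\<eta> - delta) (rf \<eta> v) = T (crt \<eta>) v" for v
  proof -
    have "crt \<eta> (rf \<eta> v) = - crt \<eta> v"
      using assms(1) by (simp add: rf_def flinD[OF flin_crt[OF assms(1)]])
    then show ?thesis unfolding e rf_shift rf_rf[OF assms(1)] by (simp add: T_def fun_eq_iff)
  qed
  then have "T (crt \<eta>) = rf (\<eta> - delta) \<circ> rf \<eta>" by (intro ext) simp
  then show ?thesis using weyl_group_comp[OF rf_in_W[OF assms(2)] rf_in_W[OF assms(1)]] by simp
qed

text \<open>The equality case of Cauchy-Schwarz. If beta is not longer than eta, a pairing of
  absolute value at least 2 makes the squared length of their difference or sum nonpositive, hence
  zero by semidefiniteness.\<close>

lemma crt_bound:
  assumes "\<eta> \<in> RR" "form \<beta> \<beta> \<le> form \<eta> \<eta>"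
  shows "crt \<eta> \<beta> \<ge> 2 \<Longrightarrow> form (\<beta> - \<eta>) (\<beta> - \<eta>) = 0" "crt \<eta> \<beta> \<le> -2 \<Longrightarrow> form (\<beta> + \<eta>) (\<beta> + \<eta>) = 0"
proof -
  have p: "form \<eta> \<eta> > 0" by (rule RR_norm_pos[OF assms(1)])
  have 1: "form (\<beta> - \<eta>) (\<beta> - \<eta>) = form \<beta> \<beta> + form \<eta> \<eta> - crt \<eta> \<beta> * form \<eta> \<eta>"
    using crt_form[OF assms(1), of \<beta>] form_sym[of \<beta> \<eta>] by (simp add: form_simps)
  have 2: "form (\<beta> + \<eta>) (\<beta> + \<eta>) = form \<beta> \<beta> + form \<eta> \<eta> + crt \<eta> \<beta> * form \<eta> \<eta>"
    using crt_form[OF assms(1), of \<beta>] form_sym[of \<beta> \<eta>] by (simp add: form_simps)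
  show "form (\<beta> - \<eta>) (\<beta> - \<eta>) = 0" if "crt \<eta> \<beta> \<ge> 2"
  proof -
    have "2 * form \<eta> \<eta> \<le> crt \<eta> \<beta> * form \<eta> \<eta>" using that p by (intro mult_right_mono) auto
    then show ?thesis using form_nonneg[of "\<beta> - \<eta>"] 1 assms(2) by linarith
  qed
  show "form (\<beta> + \<eta>) (\<beta> + \<eta>) = 0" if "crt \<eta> \<beta> \<le> -2"
  proof -
    have "crt \<eta> \<beta> * form \<eta> \<eta> \<le> (-2) * form \<eta> \<eta>" using that p by (intro mult_right_mono) auto
    then show ?thesis using form_nonneg[of "\<beta> + \<eta>"] 2 assms(2) by linarith
  qed
qed

text \<open>Isotropic vectors are proportional to the labels; since p has label 1, the coordinate at
  p is the integral factor.\<close>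

lemma form_zero_delta:
  assumes "p \<le> n" "a p = 1" "\<And>k. k > n \<Longrightarrow> v k = 0" "form v v = 0"
  shows "v = v p \<cdot> delta"
proof
  fix k show "v k = (v p \<cdot> delta) k"
    using form_zero[OF assms(4) _ assms(1), of k] assms by (cases "k \<le> n") (auto simp: delta_def)
qed

section \<open>Coroot lattices as lattices of functionals\<close>

text \<open>The lattice spanned by the simple coroots of J, seen as functionals on the root lattice.
  For the set of all nodes the coefficients are not unique, since the canonical central combination
  of the coroots acts as zero.\<close>

definition rows :: "nat set \<Rightarrow> ((nat \<Rightarrow> int) \<Rightarrow> int) set" where
  "rows J = {(\<lambda>v. \<Sum>i\<in>J. \<gamma> i * pr i v) | \<gamma>. True}"

lemma rowsI: "(\<lambda>v. \<Sum>i\<in>J. \<gamma> i * pr i v) \<in> rows J" by (auto simp: rows_def)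

lemma rows_flin: "\<phi> \<in> rows J \<Longrightarrow> flin \<phi>"
  by (auto simp: rows_def intro!: flin_Sum flin_cmult flin_pairing)

lemma rows_fsupported: "\<phi> \<in> rows J \<Longrightarrow> fsupported n \<phi>"
  using fsupported_pairing by (fastforce simp: rows_def fsupported_def)

lemma rows_delta: "J \<subseteq> {0..n} \<Longrightarrow> \<phi> \<in> rows J \<Longrightarrow> \<phi> delta = 0"
  by (auto simp: rows_def subset_eq pr_delta intro!: sum.neutral)

lemma rows_add: "\<phi> \<in> rows J \<Longrightarrow> \<psi> \<in> rows J \<Longrightarrow> (\<lambda>v. \<phi> v + \<psi> v) \<in> rows J"
proof -
  assume "\<phi> \<in> rows J" "\<psi> \<in> rows J"
  then obtain g h where "\<phi> = (\<lambda>v. \<Sum>i\<in>J. g i * pr i v)" "\<psi> = (\<lambda>v. \<Sum>i\<in>J. h i * pr i v)" unfolding rows_def by auto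
  then show ?thesis using rowsI[of "\<lambda>i. g i + h i" J] by (simp add: algebra_simps sum.distrib)
qed

lemma rows_cmult: "\<phi> \<in> rows J \<Longrightarrow> (\<lambda>v. c * \<phi> v) \<in> rows J"
proof -
  assume "\<phi> \<in> rows J"
  then obtain g where "\<phi> = (\<lambda>v. \<Sum>i\<in>J. g i * pr i v)" unfolding rows_def by auto
  then show ?thesis using rowsI[of "\<lambda>i. c * g i" J] by (simp add: sum_distrib_left mult.assoc)
qed

lemma rows_diff: "\<phi> \<in> rows J \<Longrightarrow> \<psi> \<in> rows J \<Longrightarrow> (\<lambda>v. \<phi> v - \<psi> v) \<in> rows J"
  using rows_add[OF _ rows_cmult[of \<psi> J "-1"]] by simp

lemma rows_zero: "(\<lambda>v. 0) \<in> rows J"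
  using rowsI[of "\<lambda>i. 0" J] by simp

lemma rows_pr: "finite J \<Longrightarrow> i \<in> J \<Longrightarrow> (\<lambda>v. c * pr i v) \<in> rows J"
proof -
  assume J: "finite J" "i \<in> J"
  have "(\<Sum>k\<in>J. (if k = i then c else 0) * pr k v) = c * pr i v" for v
  proof -
    have "(\<Sum>k\<in>J. (if k = i then c else 0) * pr k v) = (\<Sum>k\<in>J. if k = i then c * pr k v else 0)"
      by (intro sum.cong) auto
    then show ?thesis using J by simp
  qed
  then show ?thesis using rowsI[of "\<lambda>k. if k = i then c else 0" J] by simp
qed

lemma rows_sum: "finite A \<Longrightarrow> (\<And>x. x \<in> A \<Longrightarrow> f x \<in> rows J) \<Longrightarrow> (\<lambda>v. \<Sum>x\<in>A. f x v) \<in> rows J"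
  by (induct A rule: finite_induct) (auto intro!: rows_zero rows_add)

lemma comp_refl: "flin \<phi> \<Longrightarrow> \<phi> (refl i v) = \<phi> v - \<phi> (al i) * pr i v"
  by (simp add: simple_refl_alt flinD)

text \<open>Each simple reflection changes a functional by a multiple of the coroot at its node, and
  the group of J maps the coroot lattice of J to itself.\<close>

lemma diff_comp_rows:
  assumes "J \<subseteq> {0..n}" "flin \<phi>" "w \<in> weyl_group C n J"
  shows "(\<lambda>v. \<phi> v - \<phi> (w v)) \<in> rows J"
  using assms(3,2)
proof (induct arbitrary: \<phi> rule: weyl_group.induct)
  case weyl_id
  then show ?case by (simp add: rows_zero)
next
  case (weyl_step w i)
  have fin: "finite J" using assms(1) finite_subset by blast
  have "(\<lambda>v. \<phi> v - \<phi> (w v)) \<in> rows J" using weyl_step by blast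
  moreover have "(\<lambda>v. \<phi> (al i) * pr i (w v)) \<in> rows J"
  proof -
    have "(\<lambda>v. pr i v - pr i (w v)) \<in> rows J" using weyl_step(2)[OF flin_pairing] .
    from rows_cmult[OF rows_diff[OF rows_pr[OF fin weyl_step(3), of 1] this], of "\<phi> (al i)"]
    show ?thesis by simp
  qed
  ultimately have "(\<lambda>v. (\<phi> v - \<phi> (w v)) + \<phi> (al i) * pr i (w v)) \<in> rows J" by (rule rows_add)
  moreover have "(\<phi> v - \<phi> (w v)) + \<phi> (al i) * pr i (w v) = \<phi> v - \<phi> ((refl i \<circ> w) v)" for v
    unfolding o_apply comp_refl[OF weyl_step(4)] by simp
  ultimately show ?case by (simp only:)
qed

lemma comp_rows:
  assumes "J \<subseteq> {0..n}" "\<phi> \<in> rows J" "w \<in> weyl_group C n J"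
  shows "(\<lambda>v. \<phi> (w v)) \<in> rows J"
  using rows_diff[OF assms(2) diff_comp_rows[OF assms(1) rows_flin[OF assms(2)] assms(3)]] by simp

lemma finite_box: "finite {v :: nat \<Rightarrow> int. (\<forall>k\<le>n. \<bar>v k\<bar> \<le> M) \<and> (\<forall>k>n. v k = 0)}"
proof -
  have "{v :: nat \<Rightarrow> int. (\<forall>k\<le>n. \<bar>v k\<bar> \<le> M) \<and> (\<forall>k>n. v k = 0)} \<subseteq>
      {v. \<forall>k. (k \<in> {..n} \<longrightarrow> v k \<in> {-M..M}) \<and> (k \<notin> {..n} \<longrightarrow> v k = 0)}"
    by auto
  then show ?thesis by (rule finite_subset) (intro finite_set_of_finite_funs, auto)
qed

definition ht :: "(nat \<Rightarrow> int) \<Rightarrow> int" where "ht v = (\<Sum>i\<le>n. v i)"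

lemma flin_ht: "flin ht" by (simp add: flin_def ht_def sum.distrib sum_distrib_left)

lemma ht_pos: "\<beta> \<in> RR \<Longrightarrow> 0 \<le> \<beta> \<Longrightarrow> ht \<beta> > 0"
proof -
  assume b: "\<beta> \<in> RR" "0 \<le> \<beta>"
  obtain k where k: "\<beta> k \<noteq> 0" using RR_nonzero[OF b(1)] by (auto simp: fun_eq_iff)
  have nn: "\<beta> i \<ge> 0" for i using le_funD[OF b(2), of i] by simp
  have "k \<le> n" using RR_outside[OF b(1), of k] k by force
  then show ?thesis unfolding ht_def using nn[of k] k nn by (intro sum_pos2[of _ k]) (auto simp: less_le)
qed

lemma ht_nonneg_iff: "\<beta> \<in> RR \<Longrightarrow> ht \<beta> \<ge> 0 \<longleftrightarrow> 0 \<le> \<beta>"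
proof -
  assume b: "\<beta> \<in> RR"
  have "ht \<beta> < 0" if "\<beta> \<le> 0"
  proof -
    have "0 \<le> - \<beta>" using that by (simp add: le_fun_def)
    from ht_pos[OF RR_uminus[OF b] this] show ?thesis using flinD(4)[OF flin_ht, of \<beta>] by simp
  qed
  then show ?thesis using RR_coherent[OF b] ht_pos[OF b] by force
qed

lemma ht_delta: "ht delta > 0"
  unfolding ht_def using a_pos by (intro sum_pos) (auto simp: delta_def)

end

section \<open>Untwisted diagrams: shifts of real roots by delta\<close>

text \<open>Besides the label 1 at the node 0, two facts about the highest root delta - alpha_0 that
  give all shifts by delta: it is a real root, and no simple root is longer. Its length is that of
  alpha_0, as delta is in the radical.\<close>

locale untwisted = affine_matrix +
  assumes a0: "a 0 = 1" and theta: "delta - al 0 \<in> RR" and long0: "i \<le> n \<Longrightarrow> d i \<le> d 0"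
begin

lemma al0_shift1: "al 0 + delta \<in> RR" "al 0 - delta \<in> RR"
proof -
  have 1: "al 0 - delta \<in> RR" using RR_uminus[OF theta] by simp
  then show "al 0 - delta \<in> RR" .
  have "refl 0 (al 0 - delta) = - (al 0 + delta)"
    using linD(3)[OF lin_simple_refl[of C n 0], of "al 0" delta] W_delta[OF weyl_group_refl[of 0]] by (simp add: refl_al)
  moreover have "refl 0 (al 0 - delta) \<in> RR" by (rule RR_W[OF 1 weyl_group_refl]) simp
  ultimately have "- (al 0 + delta) \<in> RR" by metis
  then show "al 0 + delta \<in> RR" using RR_uminus[of "- (al 0 + delta)"] by (simp add: add.commute)
qed

lemma T_al0: "T (crt (al 0)) \<in> W" "T (crt (- al 0)) \<in> W"
proof -
  show "T (crt (al 0)) \<in> W" by (rule T_crt[OF al_RR al0_shift1(2)]) simp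
  have "- al 0 - delta = - (al 0 + delta)" by simp
  then have "- al 0 - delta \<in> RR" using RR_uminus[OF al0_shift1(1)] by metis
  then show "T (crt (- al 0)) \<in> W" using T_crt[OF RR_uminus[OF al_RR]] by simp
qed

lemma al0_shift: "al 0 + m \<cdot> delta \<in> RR"
proof -
  have c: "crt (al 0) (al 0 + k \<cdot> delta) = 2" "crt (- al 0) (al 0 + k \<cdot> delta) = -2" for k
    using flinD[OF flin_crt[OF al_RR[of 0]]] al_RR[of 0] crt_uminus[OF al_RR[of 0]] by simp_all
  have up: "al 0 + (k + 2) \<cdot> delta \<in> RR" and dn: "al 0 + (k - 2) \<cdot> delta \<in> RR" if "al 0 + k \<cdot> delta \<in> RR" for k
  proof -
    have e: "al 0 + (k + 2) \<cdot> delta = al 0 + k \<cdot> delta - (-2) \<cdot> delta" "al 0 + (k - 2) \<cdot> delta = al 0 + k \<cdot> delta - 2 \<cdot> delta"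
      by (auto simp: fun_eq_iff algebra_simps)
    show "al 0 + (k + 2) \<cdot> delta \<in> RR" "al 0 + (k - 2) \<cdot> delta \<in> RR"
      unfolding e using RR_W[OF that T_al0(1)] RR_W[OF that T_al0(2)] unfolding T_def c by blast+
  qed
  \<comment> \<open>The translations by the coroot of alpha_0 move the multiple of delta by two, so
    the induction carries two consecutive values.\<close>
  have "al 0 + m \<cdot> delta \<in> RR \<and> al 0 + (m + 1) \<cdot> delta \<in> RR"
  proof (induct m rule: int_induct[of _ 0])
    case base
    then show ?case unfolding smult_0 add_0_right add_0_left smult_1 using al_RR[of 0] al0_shift1(1) by blast
  next
    case (step1 i)
    moreover have "i + 1 + 1 = i + 2" by simp
    ultimately show ?case using up[of i] by presburger
  next
    case (step2 i)
    moreover have "i - 1 + 1 = i" "i + 1 - 2 = i - 1" by simp_all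
    ultimately show ?case using dn[of "i + 1"] by presburger
  qed
  then show ?thesis by blast
qed

lemma W_al0_shift: "w \<in> W \<Longrightarrow> w (al 0) + m \<cdot> delta \<in> RR"
  using RR_W[OF al0_shift, of w m] linD(1,2)[OF weyl_group_lin, of w C n "{0..n}"] W_delta[of w] by simp

text \<open>If alpha_i is orthogonal to the whole orbit of alpha_0, then so is its image under the
  reflection at j, and for nonzero C_ji this makes alpha_j orthogonal as well. So the non-orthogonal
  nodes are closed under adjacency, and 0 is one of them.\<close>

lemma nonorth: "i \<le> n \<Longrightarrow> \<exists>w\<in>W. form (w (al 0)) (al i) \<noteq> 0"
proof -
  assume i: "i \<le> n"
  have "{i. i \<le> n \<and> (\<exists>w\<in>W. form (w (al 0)) (al i) \<noteq> 0)} = {..n}"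
  proof (rule conn)
    show "{i. i \<le> n \<and> (\<exists>w\<in>W. form (w (al 0)) (al i) \<noteq> 0)} \<noteq> {}"
      using weyl_id[of C n "{0..n}"] form_al_al[of 0] d_pos[of 0] by (auto intro!: exI[of _ 0] bexI[of _ id])
  next
    fix j i assume j: "j \<in> {i. i \<le> n \<and> (\<exists>w\<in>W. form (w (al 0)) (al i) \<noteq> 0)}" and i: "i \<le> n" and c: "C j i \<noteq> 0"
    then obtain w where w: "w \<in> W" "form (w (al 0)) (al j) \<noteq> 0" and jn: "j \<le> n" by auto
    show "i \<in> {i. i \<le> n \<and> (\<exists>w\<in>W. form (w (al 0)) (al i) \<noteq> 0)}"
    proof (rule ccontr)
      assume "\<not> ?thesis"
      then have z: "form (u (al 0)) (al i) = 0" if "u \<in> W" for u using that i by auto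
      have "refl j \<circ> w \<in> W" using w jn by (intro weyl_step) auto
      then have "form (refl j (w (al 0))) (al i) = 0" using z by fastforce
      moreover have "form (refl j (w (al 0))) (al i) = form (w (al 0)) (refl j (al i))"
        using form_refl[OF jn, of "w (al 0)" "refl j (al i)"] jn by simp
      moreover have "refl j (al i) = al i - C j i \<cdot> al j" using i by (simp add: simple_refl_alt)
      ultimately show False using z[OF w(1)] w(2) c by (simp add: form_simps)
    qed
  qed auto
  then show ?thesis using i by auto
qed

text \<open>Take eta in the orbit of alpha_0, not orthogonal to alpha_i and at least as long. If its
  coroot takes the value 1 or -1 on alpha_i, the translations by this coroot and its negative shift
  alpha_i by one delta in either direction. A larger absolute value makes alpha_i equal to eta or
  -eta up to a multiple of delta, and the shifts of eta are known.\<close>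

lemma al_shift: "i \<le> n \<Longrightarrow> al i + delta \<in> RR \<and> al i - delta \<in> RR"
proof -
  assume i: "i \<le> n"
  obtain w where w: "w \<in> W" "form (w (al 0)) (al i) \<noteq> 0" using nonorth[OF i] by blast
  define \<eta> where "\<eta> = w (al 0)"
  have eR: "\<eta> \<in> RR" and sh: "\<eta> + m \<cdot> delta \<in> RR" for m
    using W_al0_shift[OF w(1)] RR_W[OF al_RR w(1)] by (simp_all add: \<eta>_def)
  define c where "c = crt \<eta> (al i)"
  have c0: "c \<noteq> 0" using crt_form[OF eR, of "al i"] w(2) by (auto simp: c_def \<eta>_def)
  have le: "form (al i) (al i) \<le> form \<eta> \<eta>" using long0[OF i] w i by (simp add: \<eta>_def W_form form_al_al)
  have out: "k > n \<Longrightarrow> (al i + e \<cdot> \<eta>) k = 0" for k e using RR_outside[OF eR] i by (simp add: simple_root_apply)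
  consider "c = 1 \<or> c = -1" | "c \<ge> 2" | "c \<le> -2" using c0 by linarith
  then show ?thesis
  proof cases
    case 1
    have "\<eta> - delta \<in> RR" "- \<eta> - delta \<in> RR" using sh[of "-1"] RR_uminus[OF sh[of 1]]
      by (simp_all add: algebra_simps)
    then have "T (crt \<eta>) \<in> W" "T (crt (- \<eta>)) \<in> W" using T_crt eR RR_uminus by blast+
    then have "T (crt \<eta>) (al i) \<in> RR" "T (crt (- \<eta>)) (al i) \<in> RR" using RR_W al_RR[OF i] by blast+
    then have "al i - c \<cdot> delta \<in> RR" "al i - (- c) \<cdot> delta \<in> RR" unfolding T_def c_def crt_uminus[OF eR] by blast+
    then show ?thesis using 1 by (auto simp del: smult_vec_apply)
  next
    case 2
    then have "form (al i - \<eta>) (al i - \<eta>) = 0" using crt_bound(1)[OF eR le] by (simp add: c_def)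
    then have "al i - \<eta> = (al i - \<eta>) 0 \<cdot> delta"
      using out[of _ "-1"] a0 by (intro form_zero_delta) auto
    then obtain m where "al i = \<eta> + m \<cdot> delta" by (metis add.commute diff_add_cancel)
    then have "al i + delta = \<eta> + (m + 1) \<cdot> delta" "al i - delta = \<eta> + (m - 1) \<cdot> delta"
      by (auto simp: fun_eq_iff algebra_simps)
    then show ?thesis using sh by metis
  next
    case 3
    then have "form (al i + \<eta>) (al i + \<eta>) = 0" using crt_bound(2)[OF eR le] by (simp add: c_def)
    then have "al i + \<eta> = (al i + \<eta>) 0 \<cdot> delta"
      using out[of _ "1"] a0 by (intro form_zero_delta) auto
    then obtain m where "al i = m \<cdot> delta - \<eta>" by (metis add_diff_cancel_right')
    then have "al i + delta = - (\<eta> + (- m - 1) \<cdot> delta)" "al i - delta = - (\<eta> + (1 - m) \<cdot> delta)"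
      by (auto simp: fun_eq_iff algebra_simps)
    then show ?thesis using RR_uminus[OF sh] by metis
  qed
qed

lemma RR_shift1: "\<beta> \<in> RR \<Longrightarrow> \<beta> + delta \<in> RR \<and> \<beta> - delta \<in> RR"
proof -
  assume "\<beta> \<in> RR"
  then obtain w i where w: "w \<in> W" "i \<le> n" "\<beta> = w (al i)" by (rule RR_cases)
  have "w (al i + delta) \<in> RR" "w (al i - delta) \<in> RR" using al_shift[OF w(2)] RR_W w(1) by blast+
  then show ?thesis using linD(1,3)[OF weyl_group_lin[OF w(1)]] W_delta[OF w(1)] w(3) by simp
qed

lemma RR_shift: "\<beta> \<in> RR \<Longrightarrow> \<beta> + m \<cdot> delta \<in> RR"
proof (induct m rule: int_induct[of _ 0])
  case base
  then show ?case by simp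
next
  case (step1 i)
  have "\<beta> + (i + 1) \<cdot> delta = \<beta> + i \<cdot> delta + delta" by (simp add: fun_eq_iff algebra_simps)
  then show ?case using RR_shift1 step1 by metis
next
  case (step2 i)
  have "\<beta> + (i - 1) \<cdot> delta = \<beta> + i \<cdot> delta - delta" by (simp add: fun_eq_iff algebra_simps)
  then show ?case using RR_shift1 step2 by metis
qed

lemma T_crt_W: "\<eta> \<in> RR \<Longrightarrow> T (crt \<eta>) \<in> W"
  using T_crt RR_shift1 by blast

lemma T_mult_W: "i \<le> n \<Longrightarrow> T (\<lambda>v. c * pr i v) \<in> W"
proof -
  assume i: "i \<le> n"
  have f: "flin (\<lambda>v. c * pr i v)" "(c * pr i delta) = 0" for c
    using pr_delta[OF i] by (auto intro: flin_cmult flin_pairing)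
  have 1: "T (\<lambda>v. 1 * pr i v) \<in> W" "T (\<lambda>v. (-1) * pr i v) \<in> W"
  proof -
    have "crt (al i) = (\<lambda>v. 1 * pr i v)" "crt (- al i) = (\<lambda>v. (-1) * pr i v)"
      using crt_al[OF i] crt_uminus[OF al_RR[OF i]] by (simp_all add: fun_eq_iff)
    then show "T (\<lambda>v. 1 * pr i v) \<in> W" "T (\<lambda>v. (-1) * pr i v) \<in> W"
      using T_crt_W[OF al_RR[OF i]] T_crt_W[OF RR_uminus[OF al_RR[OF i]]] by metis+
  qed
  show ?thesis
  proof (induct c rule: int_induct[of _ 0])
    case base
    then show ?case using T_zero weyl_id[of C n "{0..n}"] by (simp only: mult_zero_left sum.empty)
  next
    case (step1 c)
    have "T (\<lambda>v. c * pr i v) \<circ> T (\<lambda>v. 1 * pr i v) = T (\<lambda>v. (c + 1) * pr i v)"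
      using T_comp[OF f, of c "\<lambda>v. 1 * pr i v"] by (simp add: algebra_simps)
    then show ?case using weyl_group_comp[OF step1(2) 1(1)] by metis
  next
    case (step2 c)
    have "T (\<lambda>v. c * pr i v) \<circ> T (\<lambda>v. (-1) * pr i v) = T (\<lambda>v. (c - 1) * pr i v)"
      using T_comp[OF f, of c "\<lambda>v. (-1) * pr i v"] by (simp add: algebra_simps)
    then show ?case using weyl_group_comp[OF step2(2) 1(2)] by metis
  qed
qed

lemma T_rows_W:
  assumes "J \<subseteq> {0..n}" "\<phi> \<in> rows J" shows "T \<phi> \<in> W"
proof -
  obtain g where g: "\<phi> = (\<lambda>v. \<Sum>i\<in>J. g i * pr i v)" using assms(2) unfolding rows_def by auto
  have "finite J" using assms(1) finite_subset by blast
  then have "T (\<lambda>v. \<Sum>i\<in>J. g i * pr i v) \<in> W" using assms(1)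
  proof (induct J)
    case empty
    then show ?case using T_zero weyl_id[of C n "{0..n}"] by (simp only: mult_zero_left sum.empty)
  next
    case (insert j J)
    have "T (\<lambda>v. g j * pr j v) \<circ> T (\<lambda>v. \<Sum>i\<in>J. g i * pr i v) = T (\<lambda>v. g j * pr j v + (\<Sum>i\<in>J. g i * pr i v))"
      using insert(4) pr_delta[of j] by (intro T_comp flin_cmult flin_pairing) auto
    moreover have "T (\<lambda>v. g j * pr j v) \<circ> T (\<lambda>v. \<Sum>i\<in>J. g i * pr i v) \<in> W"
      using insert T_mult_W[of j "g j"] by (intro weyl_group_comp) auto
    ultimately show ?case using insert(1,2) by simp
  qed
  then show ?thesis using g by simp
qed

section \<open>Finite root systems and Weyl groups at special nodes\<close>

text \<open>For a special node p, one with label 1, these roots represent the real roots modulo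
  delta; they form the finite system on the remaining nodes.\<close>

definition fin :: "nat \<Rightarrow> (nat \<Rightarrow> int) set" where "fin p = {\<beta> \<in> RR. \<beta> p = 0}"

lemma delta_p: "p \<le> n \<Longrightarrow> a p = 1 \<Longrightarrow> delta p = 1" by (simp add: delta_def)

lemma proj_fin: "p \<le> n \<Longrightarrow> a p = 1 \<Longrightarrow> \<beta> \<in> RR \<Longrightarrow> \<beta> - \<beta> p \<cdot> delta \<in> fin p"
  using RR_shift[of \<beta> "- \<beta> p"] delta_p[of p]
  by (simp add: fin_def)

text \<open>Both delta - beta and delta + beta are real roots with coordinate 1 at p, hence
  positive. This bounds the coordinates of finite roots by the labels.\<close>

lemma fin_bound:
  assumes p: "p \<le> n" "a p = 1" and b: "\<beta> \<in> fin p"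
  shows "0 \<le> delta - \<beta>" "0 \<le> delta + \<beta>"
proof -
  have "\<beta> \<in> RR" "\<beta> p = 0" using b by (auto simp: fin_def)
  then have "delta - \<beta> \<in> RR" "delta + \<beta> \<in> RR" using RR_shift1[of \<beta>] RR_uminus[of "\<beta> - delta"] by (simp_all add: add.commute)
  then show "0 \<le> delta - \<beta>" "0 \<le> delta + \<beta>" using delta_p[OF p] \<open>\<beta> p = 0\<close> RR_nonnegI[of "delta - \<beta>" p] RR_nonnegI[of "delta + \<beta>" p] by simp_all
qed

lemma fin_abs:
  assumes p: "p \<le> n" "a p = 1" and b: "\<beta> \<in> fin p"
  shows "\<bar>\<beta> k\<bar> \<le> delta k"
  using le_funD[OF fin_bound(1)[OF assms], of k] le_funD[OF fin_bound(2)[OF assms], of k] by simp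

lemma delta_le: "delta k \<le> ht delta"
proof (cases "k \<le> n")
  case True
  then show ?thesis unfolding ht_def by (intro member_le_sum) (auto simp: delta_def)
qed (use ht_delta in \<open>simp add: delta_def\<close>)

lemma finite_fin: "p \<le> n \<Longrightarrow> a p = 1 \<Longrightarrow> finite (fin p)"
proof -
  assume p: "p \<le> n" "a p = 1"
  have "fin p \<subseteq> {v. (\<forall>k\<le>n. \<bar>v k\<bar> \<le> ht delta) \<and> (\<forall>k>n. v k = 0)}"
    using fin_abs[OF p] delta_le order_trans RR_outside by (fastforce simp: fin_def)
  then show ?thesis using finite_box finite_subset by blast
qed

text \<open>An element is determined by the images of the simple roots. Their coordinate at p is not
  moved, so each image is a finite root plus 0 or 1 times delta and lies in a bounded box.\<close>

lemma finite_weyl: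
  assumes p: "p \<le> n" "a p = 1" and J: "J \<subseteq> {0..n} - {p}"
  shows "finite (weyl_group C n J)"
proof -
  define B where "B = {v :: nat \<Rightarrow> int. (\<forall>k\<le>n. \<bar>v k\<bar> \<le> 2 * ht delta) \<and> (\<forall>k>n. v k = 0)}"
  define F where "F w = (\<lambda>i. if i \<le> n then w (al i) else 0)" for w :: "(nat \<Rightarrow> int) \<Rightarrow> nat \<Rightarrow> int"
  have J': "J \<subseteq> {0..n}" using J by blast
  have "w (al i) \<in> B" if w: "w \<in> weyl_group C n J" and i: "i \<le> n" for w i
  proof -
    have R: "w (al i) \<in> RR" by (rule RR_W[OF al_RR[OF i] sub_W[OF J' w]])
    have wp: "w (al i) p = al i p" using weyl_group_coord[OF w] J by blast
    have 2: "\<bar>(w (al i) - w (al i) p \<cdot> delta) k\<bar> \<le> delta k" for k by (rule fin_abs[OF p proj_fin[OF p R]])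
    have "\<bar>w (al i) k\<bar> \<le> 2 * ht delta" for k
    proof -
      have "w (al i) p = 0 \<or> w (al i) p = 1" using wp by (simp add: simple_root_apply)
      moreover have "0 \<le> delta k" by (simp add: delta_def)
      ultimately have "\<bar>w (al i) k\<bar> \<le> 2 * delta k" using 2[of k] by auto
      then show ?thesis using delta_le[of k] by linarith
    qed
    then show ?thesis using RR_outside[OF R] by (simp add: B_def)
  qed
  then have "F ` weyl_group C n J \<subseteq> {f. \<forall>i. (i \<in> {..n} \<longrightarrow> f i \<in> B) \<and> (i \<notin> {..n} \<longrightarrow> f i = 0)}"
    by (auto simp: F_def)
  then have "finite (F ` weyl_group C n J)"
    by (rule finite_subset) (intro finite_set_of_finite_funs, auto simp: B_def intro: finite_box)
  moreover have "inj_on F (weyl_group C n J)"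
  proof (rule inj_onI)
    fix u w assume uw: "u \<in> weyl_group C n J" "w \<in> weyl_group C n J" and e: "F u = F w"
    have "u (al i) = w (al i)" if "i \<le> n" for i using fun_cong[OF e, of i] that by (simp add: F_def)
    then show "u = w" using uw by (intro lin_eqI[of u w n]) (auto intro: weyl_group_lin weyl_group_supported[OF _ J'])
  qed
  ultimately show ?thesis by (rule finite_imageD)
qed

text \<open>For p other than 0 the highest root delta - alpha_0 has coordinate 1 at p, and by
  \<open>RR_dvd\<close> its squared length divides 2 d_p.\<close>

lemma long_special: "p \<le> n \<Longrightarrow> a p = 1 \<Longrightarrow> d p = d 0"
proof (cases "p = 0")
  case False
  assume p: "p \<le> n" "a p = 1"
  have "form (delta - al 0) (delta - al 0) = 2 * d 0" by (simp add: form_simps form_al_al)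
  then have "2 * d 0 dvd 2 * d p" using RR_dvd[OF theta p(1)] delta_p[OF p] False by (simp add: simple_root_apply)
  then have "d 0 \<le> d p" using d_pos[OF p(1)] by (intro zdvd_imp_le) auto
  then show ?thesis using long0[OF p(1)] by simp
qed simp

lemma refl_T: "i \<le> n \<Longrightarrow> refl i (T \<phi> v) = T (\<lambda>v. \<phi> (refl i v)) (refl i v)"
  using linD(2,3)[OF lin_simple_refl[of C n i]] W_delta[OF weyl_group_refl[of i]] by (simp add: T_def)

text \<open>Any special node can play the part of the affine node: its reflection is the one in
  delta - alpha_p, a root of the finite system without p, followed by a translation.\<close>

lemma refl_special:
  assumes p: "p \<le> n" "a p = 1"
  shows "refl p v = T (\<lambda>v. - pr p v) (rf (delta - al p) v)" "rf (delta - al p) \<in> weyl_group C n ({0..n} - {p})"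
proof -
  have R: "al p - delta \<in> RR" "delta - al p \<in> RR" using al_shift[OF p(1)] RR_uminus[of "al p - delta"] by auto
  have c: "crt (delta - al p) v = - pr p v" for v
  proof -
    have "crt (al p - delta) = crt (al p)" using crt_shift[of "al p" "-1"] by simp
    moreover have "crt (delta - al p) v = crt (- (al p - delta)) v" by simp
    ultimately show ?thesis using crt_uminus[OF R(1), of v] crt_al[OF p(1), of v] by metis
  qed
  have rv: "rf (delta - al p) v = v + pr p v \<cdot> (delta - al p)"
    by (simp add: rf_def c)
  then have "pr p (rf (delta - al p) v) = - pr p v"
    using flinD(1,2,3)[OF flin_pairing[of C n p]] pr_delta[OF p(1)] diag[OF p(1)] p by simp
  then have "T (\<lambda>v. - pr p v) (rf (delta - al p) v) = v + pr p v \<cdot> (delta - al p) - pr p v \<cdot> delta"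
    unfolding T_def rv by simp
  then show "refl p v = T (\<lambda>v. - pr p v) (rf (delta - al p) v)"
    unfolding simple_refl_alt by (simp add: fun_eq_iff algebra_simps)
  show "rf (delta - al p) \<in> weyl_group C n ({0..n} - {p})"
  proof (rule rf_in_weyl_supp[OF R(2)])
    fix k assume "k \<notin> {0..n} - {p}"
    then have "k = p \<or> k > n" by auto
    then show "(delta - al p) k = 0" using p delta_p[OF p] by (auto simp: delta_def simple_root_apply)
  qed blast
qed

text \<open>The affine Weyl group as translations times the finite group, at an arbitrary special
  node. Reflections carry translations to translations, and a letter p is rewritten by
  \<open>refl_special\<close>.\<close>

lemma W_decomp:
  assumes p: "p \<le> n" "a p = 1" and "w \<in> W"
  shows "\<exists>\<phi>\<in>rows {0..n}. \<exists>u\<in>weyl_group C n ({0..n} - {p}). w = T \<phi> \<circ> u"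
  using assms(3)
proof (induct rule: weyl_group.induct)
  case weyl_id
  have "id = T (\<lambda>v. 0) \<circ> id" by (simp only: T_zero o_id)
  then show ?case using rows_zero weyl_group.weyl_id by blast
next
  case (weyl_step w i)
  then obtain \<phi> u where h: "\<phi> \<in> rows {0..n}" "u \<in> weyl_group C n ({0..n} - {p})" "w = T \<phi> \<circ> u" by blast
  have i: "i \<le> n" using weyl_step(3) by simp
  let ?\<psi> = "\<lambda>v. \<phi> (refl i v)"
  have psi: "?\<psi> \<in> rows {0..n}" using comp_rows[OF order_refl h(1) weyl_group_refl[OF weyl_step(3)]] by simp
  show ?case
  proof (cases "i = p")
    case False
    then have "refl i \<circ> u \<in> weyl_group C n ({0..n} - {p})" using h(2) i by (intro weyl_group.weyl_step) auto
    moreover have "refl i \<circ> w = T ?\<psi> \<circ> (refl i \<circ> u)" unfolding h(3) by (rule ext) (simp add: refl_T[OF i])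
    ultimately show ?thesis using psi by blast
  next
    case True
    have "rf (delta - al p) \<circ> u \<in> weyl_group C n ({0..n} - {p})" using refl_special(2)[OF p] h(2) by (rule weyl_group_comp)
    moreover have "refl i \<circ> w = T (\<lambda>v. ?\<psi> v + - pr p v) \<circ> (rf (delta - al p) \<circ> u)"
    proof
      fix v
      have "refl i (T \<phi> (u v)) = T ?\<psi> (T (\<lambda>v. - pr p v) (rf (delta - al p) (u v)))"
        using refl_T[OF i, of \<phi> "u v"] refl_special(1)[OF p, of "u v"] True by simp
      then show "(refl i \<circ> w) v = (T (\<lambda>v. ?\<psi> v + - pr p v) \<circ> (rf (delta - al p) \<circ> u)) v"
        using T_T[OF rows_flin[OF psi] rows_delta[OF order_refl psi]] h(3) by simp
    qed
    moreover have "(\<lambda>v. ?\<psi> v + - pr p v) \<in> rows {0..n}"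
      using rows_add[OF psi rows_pr[of "{0..n}" p "-1"]] p by simp
    ultimately show ?thesis by blast
  qed
qed

text \<open>Elements of the finite group preserve the coordinate at p, where delta has coordinate 1;
  so this coordinate reads off the translation part.\<close>

lemma T_unique:
  assumes p: "p \<le> n" "a p = 1" and u: "u \<in> weyl_group C n ({0..n} - {p})" "u' \<in> weyl_group C n ({0..n} - {p})"
    and e: "T \<phi> \<circ> u = T \<psi> \<circ> u'"
  shows "u = u'" "\<phi> = \<psi>"
proof -
  have e': "u v - \<phi> (u v) \<cdot> delta = u' v - \<psi> (u' v) \<cdot> delta" for v
    using fun_cong[OF e, of v] by (simp add: T_def)
  have f: "\<phi> (u v) = \<psi> (u' v)" for v
    using fun_cong[OF e'[of v], of p] weyl_group_coord[OF u(1), of p v] weyl_group_coord[OF u(2), of p v] delta_p[OF p] by simp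
  have "u v = u' v" for v using e'[of v] f[of v] by simp
  then show "u = u'" by blast
  then have "\<phi> (u v) = \<psi> (u v)" for v using f by simp
  then show "\<phi> = \<psi>" using W_inv(2)[OF _ u(1)] by (metis Diff_subset ext)
qed

text \<open>Sending an element to its linear part at q is injective: two elements with the same
  image differ by a translation, and then they are equal by \<open>T_unique\<close> at p.\<close>

lemma card_weyl_le:
  assumes p: "p \<le> n" "a p = 1" and q: "q \<le> n" "a q = 1"
  shows "card (weyl_group C n ({0..n} - {p})) \<le> card (weyl_group C n ({0..n} - {q}))"
proof -
  let ?P = "weyl_group C n ({0..n} - {p})" and ?Q = "weyl_group C n ({0..n} - {q})"
  have "\<exists>v. v \<in> ?Q \<and> (\<exists>\<phi>\<in>rows {0..n}. u = T \<phi> \<circ> v)" if "u \<in> ?P" for u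
    using W_decomp[OF q sub_W[OF _ that]] by blast
  then obtain g where g: "g u \<in> ?Q" "\<exists>\<phi>\<in>rows {0..n}. u = T \<phi> \<circ> g u" if "u \<in> ?P" for u by metis
  have "inj_on g ?P"
  proof (rule inj_onI)
    fix u v assume uv: "u \<in> ?P" "v \<in> ?P" and e: "g u = g v"
    obtain \<phi> \<psi> where h: "\<phi> \<in> rows {0..n}" "\<psi> \<in> rows {0..n}" "u = T \<phi> \<circ> g u" "v = T \<psi> \<circ> g u"
      using g[OF uv(1)] g[OF uv(2)] e by metis
    let ?c = "\<lambda>v. \<phi> v + - 1 * \<psi> v" and ?m = "\<lambda>v. - 1 * \<psi> v"
    have m: "?m \<in> rows {0..n}" using rows_cmult[OF h(2)] by blast
    have "T ?m \<circ> T \<psi> = T (\<lambda>v. ?m v + \<psi> v)" by (rule T_comp[OF rows_flin[OF m] rows_delta[OF order_refl m]])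
    then have mi: "T ?m \<circ> T \<psi> = id" using T_zero by simp
    have "T \<phi> \<circ> (T ?m \<circ> T \<psi>) \<circ> g u = u" unfolding mi using h(3) by simp
    then have "T \<phi> \<circ> T ?m \<circ> v = u" using h(4) by (metis comp_assoc)
    moreover have "T \<phi> \<circ> T ?m = T ?c" by (rule T_comp[OF rows_flin[OF h(1)] rows_delta[OF order_refl h(1)]])
    ultimately have "T (\<lambda>v. 0) \<circ> u = T ?c \<circ> v" by (simp only: T_zero id_o)
    then show "u = v" using T_unique(1)[OF p uv] by blast
  qed
  then show ?thesis using g(1) finite_weyl[OF q] by (intro card_inj_on_le) auto
qed

lemma card_weyl_special:
  "p \<le> n \<Longrightarrow> a p = 1 \<Longrightarrow> q \<le> n \<Longrightarrow> a q = 1 \<Longrightarrow> card (weyl_group C n ({0..n} - {p})) = card (weyl_group C n ({0..n} - {q}))"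
  using card_weyl_le[of p q] card_weyl_le[of q p] by simp

lemma rf_lin: "\<eta> \<in> RR \<Longrightarrow> lin (rf \<eta>)"
  using weyl_group_lin[OF rf_in_W] by blast

lemma rf_delta: "rf \<eta> delta = delta" by (simp add: rf_def)

text \<open>A reflection permutes the real roots modulo delta. Projecting back to the
  representatives gives an involution \<open>g\<close> of the finite system that reindexes the
  sum.\<close>

lemma sum_fin_rf:
  assumes eta: "\<eta> \<in> RR" and F: "\<And>v m. F (v + m \<cdot> delta) = (F v :: int)"
  shows "(\<Sum>\<beta>\<in>fin 0. F (rf \<eta> \<beta>)) = (\<Sum>\<beta>\<in>fin 0. F \<beta>)"
proof -
  define g where "g \<beta> = rf \<eta> \<beta> - rf \<eta> \<beta> 0 \<cdot> delta" for \<beta>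
  have z: "(0::nat) \<le> n" by simp
  have g: "g \<beta> \<in> fin 0" if "\<beta> \<in> fin 0" for \<beta>
    using proj_fin[OF z a0 RR_W[OF _ rf_in_W[OF eta]], of \<beta>] that by (simp add: g_def fin_def)
  have gg: "g (g \<beta>) = \<beta>" if "\<beta> \<in> fin 0" for \<beta>
  proof -
    have "rf \<eta> (g \<beta>) = \<beta> - rf \<eta> \<beta> 0 \<cdot> delta"
      using linD(2,3)[OF rf_lin[OF eta]] rf_rf[OF eta] by (simp add: g_def rf_delta)
    moreover have "\<beta> 0 = 0" using that by (simp add: fin_def)
    ultimately show ?thesis using delta_p[OF z a0] by (simp add: g_def[of "g \<beta>"] fun_eq_iff)
  qed
  have "F (rf \<eta> \<beta>) = F (g \<beta>)" for \<beta>
    using F[of "rf \<eta> \<beta>" "- rf \<eta> \<beta> 0"] by (simp add: g_def)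
  then show ?thesis
    by (intro sum.reindex_bij_witness[of _ g g]) (auto simp: g gg)
qed

text \<open>The finite roots define a norm on functionals that vanish on \<open>\<delta>\<close>. Among all \<open>f \<circ> h\<close> take the one
  that is closest to the multiple \<open>M ht\<close> of the height: a reflection in a root on which
  \<open>f \<circ> h\<close> and the height have opposite signs would move it closer.\<close>

lemma exists_positive:
  assumes f: "flin f" "f delta = M * ht delta" "M > 0"
    and H: "h0 \<in> H" "\<And>h. h \<in> H \<Longrightarrow> lin h" "\<And>h. h \<in> H \<Longrightarrow> h delta = delta"
    and Psi: "\<Psi> \<subseteq> RR" "\<And>h \<eta>. h \<in> H \<Longrightarrow> \<eta> \<in> \<Psi> \<Longrightarrow> h \<circ> rf \<eta> \<in> H"
  shows "\<exists>h\<in>H. \<forall>\<eta>\<in>\<Psi>. 0 \<le> \<eta> \<longrightarrow> 0 \<le> f (h \<eta>)"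
proof -
  define E where "E g = (\<Sum>\<beta>\<in>fin 0. (g \<beta> - M * ht \<beta>)\<^sup>2)" for g
  have E0: "E g \<ge> 0" for g by (simp add: E_def sum_nonneg)
  obtain h where h: "h \<in> H" and min: "\<And>h'. h' \<in> H \<Longrightarrow> nat (E (f \<circ> h)) \<le> nat (E (f \<circ> h'))"
    using ex_has_least_nat[of "\<lambda>h. h \<in> H" h0 "\<lambda>h. nat (E (f \<circ> h))"] H(1) by blast
  have "0 \<le> f (h \<eta>)" if eta: "\<eta> \<in> \<Psi>" "0 \<le> \<eta>" for \<eta>
  proof -
    have R: "\<eta> \<in> RR" using eta Psi(1) by blast
    define g where "g v = f (h v)" for v
    define u where "u v = g v - M * ht v" for v
    define \<kappa> where "\<kappa> = crt \<eta>"
    have fg: "flin g" using flin_comp[OF f(1) H(2)[OF h]] by (simp add: g_def[abs_def] comp_def)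
    have fu: "flin u" unfolding u_def[abs_def] by (intro flin_diff fg flin_cmult flin_ht)
    have fk: "flin \<kappa>" unfolding \<kappa>_def by (rule flin_crt[OF R])
    have ud: "u delta = 0" using f(2) H(3)[OF h] by (simp add: u_def g_def)
    have kd: "\<kappa> delta = 0" by (simp add: \<kappa>_def)
    have us: "u (rf \<eta> v) = u v - \<kappa> v * u \<eta>" and gs: "g (rf \<eta> v) = g v - \<kappa> v * g \<eta>"
      and ks: "\<kappa> (rf \<eta> v) = - \<kappa> v" for v
      using flinD[OF fu] flinD[OF fg] flinD[OF fk] crt_self[OF R] by (simp_all add: rf_def \<kappa>_def)
    define K where "K = (\<Sum>\<beta>\<in>fin 0. (\<kappa> \<beta>)\<^sup>2)"
    define L where "L = (\<Sum>\<beta>\<in>fin 0. u \<beta> * \<kappa> \<beta>)"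
    \<comment> \<open>Reindexing by the reflection negates kappa and changes u by a multiple of
      kappa, which evaluates L as half of u(eta) K.\<close>
    have "L = (\<Sum>\<beta>\<in>fin 0. u (rf \<eta> \<beta>) * \<kappa> (rf \<eta> \<beta>))"
      unfolding L_def using flinD[OF fu] flinD[OF fk] ud kd
      by (intro sum_fin_rf[OF R, of "\<lambda>v. u v * \<kappa> v", symmetric]) simp
    also have "\<dots> = - L + u \<eta> * K"
      by (simp add: us ks L_def K_def sum_distrib_left power2_eq_square algebra_simps sum.distrib sum_subtractf sum_negf)
    finally have L: "2 * L = u \<eta> * K" by simp
    have "E (f \<circ> (h \<circ> rf \<eta>)) = (\<Sum>\<beta>\<in>fin 0. (u \<beta> - g \<eta> * \<kappa> \<beta>)\<^sup>2)"
      unfolding E_def by (intro sum.cong refl) (simp add: gs u_def g_def[symmetric] algebra_simps)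
    also have "\<dots> = (\<Sum>\<beta>\<in>fin 0. (u \<beta>)\<^sup>2) - g \<eta> * (2 * L) + (g \<eta>)\<^sup>2 * K"
      by (simp add: power2_diff L_def K_def sum_distrib_left power_mult_distrib algebra_simps sum.distrib sum_subtractf)
    also have "(\<Sum>\<beta>\<in>fin 0. (u \<beta>)\<^sup>2) = E (f \<circ> h)" by (simp add: E_def u_def g_def)
    \<comment> \<open>Since g(eta) - u(eta) = M ht(eta), the squared distance changes by K times
      g(eta) times M ht(eta). Minimality therefore fixes the sign of g(eta).\<close>
    finally have E': "E (f \<circ> (h \<circ> rf \<eta>)) = E (f \<circ> h) + K * (g \<eta> * (M * ht \<eta>))"
      unfolding L by (simp add: u_def power2_eq_square algebra_simps del: o_apply)
    have "E (f \<circ> h) \<le> E (f \<circ> (h \<circ> rf \<eta>))"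
      using min[OF Psi(2)[OF h eta(1)]] E0[of "f \<circ> (h \<circ> rf \<eta>)"] by (simp add: nat_le_eq_zle)
    then have 1: "K * (g \<eta> * (M * ht \<eta>)) \<ge> 0" using E' by simp
    have "K > 0" unfolding K_def
    proof (rule sum_pos2)
      show "\<eta> - \<eta> 0 \<cdot> delta \<in> fin 0" by (rule proj_fin[OF _ a0 R]) simp
      show "0 < (\<kappa> (\<eta> - \<eta> 0 \<cdot> delta))\<^sup>2" using flinD[OF fk] kd crt_self[OF R] by (simp add: \<kappa>_def)
    qed (use finite_fin[of 0] a0 in auto)
    then have "g \<eta> * (M * ht \<eta>) \<ge> 0" using 1 by (simp add: zero_le_mult_iff)
    moreover have "M * ht \<eta> > 0" using ht_pos[OF R eta(2)] f(3) by simp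
    ultimately show ?thesis unfolding g_def by (simp add: zero_le_mult_iff)
  qed
  then show ?thesis using h by blast
qed

end

section \<open>Frames\<close>

context affine_matrix
begin

text \<open>A frame stands for an alcove: \<open>0 \<le> f \<eta>\<close> tells on which side of the
  hyperplane of eta the alcove lies. Weyl group elements are frames and, for untwisted diagrams, so
  are the maps that come from translations by arbitrary coweights.\<close>

definition frame :: "((nat \<Rightarrow> int) \<Rightarrow> nat \<Rightarrow> int) \<Rightarrow> bool" where
  "frame f \<longleftrightarrow> lin f \<and> f delta = delta \<and> (\<forall>\<eta>\<in>RR. f \<eta> \<in> RR)"

lemma frameD:
  assumes "frame f" shows "lin f" "f delta = delta" "\<eta> \<in> RR \<Longrightarrow> f \<eta> \<in> RR"
  using assms by (auto simp: frame_def)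

lemma frame_W: "w \<in> W \<Longrightarrow> frame w"
  unfolding frame_def using weyl_group_lin W_delta RR_W by blast

lemma frame_comp: "frame f \<Longrightarrow> frame g \<Longrightarrow> frame (\<lambda>v. f (g v))"
  unfolding frame_def lin_def by simp

lemma nonneg_comb:
  assumes "lin f" "\<And>k. k > n \<Longrightarrow> v k = 0" "0 \<le> v" "\<And>i. i \<le> n \<Longrightarrow> v i \<noteq> 0 \<Longrightarrow> 0 \<le> f (al i)"
  shows "0 \<le> f v"
proof -
  have r: "(\<lambda>i. if i \<le> n then 0 else v i) = 0" using assms(2) by (auto simp: fun_eq_iff)
  have "v = (\<Sum>i\<le>n. v i \<cdot> al i)" using expand_vec[of v n] unfolding r by simp
  then have e: "f v = (\<Sum>i\<le>n. v i \<cdot> f (al i))" using lin_sum[OF assms(1), of v al "{..n}"] by simp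
  have nn: "0 \<le> v i \<cdot> f (al i)" if "i \<le> n" for i
  proof (cases "v i = 0")
    case False
    show ?thesis unfolding le_fun_def
    proof
      fix k show "(0 :: nat \<Rightarrow> int) k \<le> (v i \<cdot> f (al i)) k"
        using le_funD[OF assms(4)[OF that False], of k] le_funD[OF assms(3), of i] by simp
    qed
  qed simp
  have "0 \<le> (\<Sum>i\<le>n. v i \<cdot> f (al i))" by (rule sum_nonneg, rule nn) simp
  then show ?thesis using e by simp
qed

lemma delta_nonneg: "0 \<le> delta" by (simp add: le_fun_def delta_def)

lemma smult_delta_nonneg: "m \<ge> 0 \<Longrightarrow> 0 \<le> m \<cdot> delta" by (simp add: le_fun_def delta_def)

lemma RR_neg_iff: "\<beta> \<in> RR \<Longrightarrow> 0 \<le> - \<beta> \<longleftrightarrow> \<not> 0 \<le> \<beta>"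
  using RR_nonneg_iff[OF RR_uminus, of \<beta>] RR_nonneg_iff[of \<beta>] by simp

lemma frame_neg: "frame f \<Longrightarrow> f (- v) = - f v"
  using linD(4) frameD(1) by blast

lemma frame_iffI:
  assumes "frame f" "\<eta> \<in> RR" "0 \<le> \<eta> \<Longrightarrow> 0 \<le> f \<eta>" "0 \<le> - \<eta> \<Longrightarrow> 0 \<le> f (- \<eta>)"
  shows "0 \<le> f \<eta> \<longleftrightarrow> 0 \<le> \<eta>"
  using assms RR_neg_iff[OF assms(2)] RR_neg_iff[OF frameD(3)[OF assms(1,2)]] frame_neg[OF assms(1)] by metis

lemma W_id_frame: "w \<in> W \<Longrightarrow> (\<And>\<eta>. \<eta> \<in> RR \<Longrightarrow> 0 \<le> \<eta> \<Longrightarrow> 0 \<le> w \<eta>) \<Longrightarrow> w = id"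
  by (rule W_pos_id) (auto simp: al_RR le_fun_def simple_root_apply)

section \<open>Coweights, their cosets and averages\<close>

text \<open>The coweight lattice of the finite system for untwisted diagrams, realised as integral
  functionals on the affine root lattice that vanish on delta.\<close>

definition P :: "((nat \<Rightarrow> int) \<Rightarrow> int) set" where
  "P = {\<phi>. flin \<phi> \<and> fsupported n \<phi> \<and> \<phi> delta = 0}"

text \<open>The inverse of the element of the extended affine Weyl group with translation part \<open>\<phi>\<close> and
  linear part \<open>u\<close>.\<close>

definition ic :: "((nat \<Rightarrow> int) \<Rightarrow> int) \<Rightarrow> ((nat \<Rightarrow> int) \<Rightarrow> nat \<Rightarrow> int) \<Rightarrow> (nat \<Rightarrow> int) \<Rightarrow> nat \<Rightarrow> int" where
  "ic \<phi> u v = inv u v + \<phi> v \<cdot> delta"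

definition cls :: "((nat \<Rightarrow> int) \<Rightarrow> int) set \<Rightarrow> ((nat \<Rightarrow> int) \<Rightarrow> int) \<Rightarrow> ((nat \<Rightarrow> int) \<Rightarrow> int) set" where
  "cls M \<phi> = {\<psi>. (\<lambda>v. \<psi> v - \<phi> v) \<in> M}"

lemma cls_eq:
  assumes "(\<lambda>v. 0) \<in> M" "\<And>\<phi> \<psi>. \<phi> \<in> M \<Longrightarrow> \<psi> \<in> M \<Longrightarrow> (\<lambda>v. \<phi> v - \<psi> v) \<in> M"
  shows "cls M \<phi> = cls M \<psi> \<longleftrightarrow> (\<lambda>v. \<phi> v - \<psi> v) \<in> M"
proof
  assume "cls M \<phi> = cls M \<psi>"
  moreover have "\<phi> \<in> cls M \<phi>" using assms(1) by (simp add: cls_def)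
  ultimately show "(\<lambda>v. \<phi> v - \<psi> v) \<in> M" by (simp add: cls_def)
next
  assume h: "(\<lambda>v. \<phi> v - \<psi> v) \<in> M"
  have h': "(\<lambda>v. \<psi> v - \<phi> v) \<in> M" using assms(2)[OF assms(1) h] by simp
  have "(\<lambda>v. \<chi> v - \<phi> v) \<in> M \<longleftrightarrow> (\<lambda>v. \<chi> v - \<psi> v) \<in> M" for \<chi>
  proof
    show "(\<lambda>v. \<chi> v - \<psi> v) \<in> M" if "(\<lambda>v. \<chi> v - \<phi> v) \<in> M" using assms(2)[OF that h'] by simp
    show "(\<lambda>v. \<chi> v - \<phi> v) \<in> M" if "(\<lambda>v. \<chi> v - \<psi> v) \<in> M" using assms(2)[OF that h] by simp
  qed
  then show "cls M \<phi> = cls M \<psi>" by (auto simp: cls_def)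
qed

lemma P_D:
  assumes "\<phi> \<in> P" shows "flin \<phi>" "fsupported n \<phi>" "\<phi> delta = 0"
  using assms by (auto simp: P_def)

lemma rows_P: "J \<subseteq> {0..n} \<Longrightarrow> \<phi> \<in> rows J \<Longrightarrow> \<phi> \<in> P"
  unfolding P_def using rows_flin rows_fsupported rows_delta by blast

lemma P_add: "\<phi> \<in> P \<Longrightarrow> \<psi> \<in> P \<Longrightarrow> (\<lambda>v. \<phi> v + \<psi> v) \<in> P"
  by (auto simp: P_def fsupported_def intro: flin_add)

lemma P_W:
  assumes "\<phi> \<in> P" "w \<in> W" shows "(\<lambda>v. \<phi> (w v)) \<in> P"
proof -
  have "flin (\<lambda>v. \<phi> (w v))" using flin_comp[OF P_D(1)[OF assms(1)] weyl_group_lin[OF assms(2)]] by (simp add: comp_def)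
  moreover have "fsupported n (\<lambda>v. \<phi> (w v))"
    using weyl_group_supported[OF assms(2) order_refl] P_D(2)[OF assms(1)] by (simp add: supported_def fsupported_def)
  ultimately show ?thesis using W_delta[OF assms(2)] P_D(3)[OF assms(1)] by (simp add: P_def)
qed

text \<open>The difference of phi and its composite with a group element lies in the coroot lattice
  of K, and so does the sum of these differences. The sum \<open>A\<close> of the composites is
  invariant under the reflections at K, which forces it to vanish on their simple roots.\<close>

lemma averaging:
  assumes K: "K \<subseteq> {0..n}" "finite (weyl_group C n K)" and phi: "\<phi> \<in> P"
  defines "A \<equiv> \<lambda>v. \<Sum>w\<in>weyl_group C n K. \<phi> (w v)"
  shows "(\<lambda>v. int (card (weyl_group C n K)) * \<phi> v - A v) \<in> rows K"
    and "A \<in> P" and "i \<in> K \<Longrightarrow> A (al i) = 0"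
proof -
  have "(\<lambda>v. \<Sum>w\<in>weyl_group C n K. \<phi> v - \<phi> (w v)) \<in> rows K"
    by (rule rows_sum[OF K(2)]) (rule diff_comp_rows[OF K(1) P_D(1)[OF phi]])
  then show "(\<lambda>v. int (card (weyl_group C n K)) * \<phi> v - A v) \<in> rows K"
    by (simp add: A_def sum_subtractf)
  have "(\<lambda>v. \<phi> (w v)) \<in> P" if "w \<in> weyl_group C n K" for w by (rule P_W[OF phi sub_W[OF K(1) that]])
  then show AP: "A \<in> P"
    unfolding A_def P_def by (auto intro!: flin_Sum sum.neutral simp: fsupported_def)
  assume i: "i \<in> K"
  then have in': "i \<le> n" using K by auto
  have m: "w \<circ> refl i \<in> weyl_group C n K" if "w \<in> weyl_group C n K" for w
    by (rule weyl_group_comp[OF that weyl_group_refl[OF i]])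
  have mm: "w \<circ> refl i \<circ> refl i = w" for w :: "(nat \<Rightarrow> int) \<Rightarrow> nat \<Rightarrow> int" by (rule ext) (simp add: in')
  have "(\<Sum>w\<in>weyl_group C n K. \<phi> (w (al i))) = (\<Sum>w\<in>weyl_group C n K. \<phi> ((w \<circ> refl i) (al i)))"
    by (rule sum.reindex_bij_witness[of _ "\<lambda>w. w \<circ> refl i" "\<lambda>w. w \<circ> refl i"]) (simp_all only: m mm)
  also have "\<dots> = (\<Sum>w\<in>weyl_group C n K. - \<phi> (w (al i)))"
  proof (rule sum.cong[OF refl])
    fix w assume w: "w \<in> weyl_group C n K"
    show "\<phi> ((w \<circ> refl i) (al i)) = - \<phi> (w (al i))"
      using linD(4)[OF weyl_group_lin[OF w], of "al i"] flinD(4)[OF P_D(1)[OF phi], of "w (al i)"] refl_al[OF in'] by simp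
  qed
  finally show "A (al i) = 0" by (simp add: A_def sum_negf)
qed

text \<open>A class is determined by the values on the simple roots modulo N: if these agree for two
  coweights, their difference is N times a coweight and lies in M.\<close>

lemma finite_cls:
  assumes M: "(\<lambda>v. 0) \<in> M" "\<And>\<phi> \<psi>. \<phi> \<in> M \<Longrightarrow> \<psi> \<in> M \<Longrightarrow> (\<lambda>v. \<phi> v - \<psi> v) \<in> M"
    and N: "N > 0" "\<And>\<phi>. \<phi> \<in> P \<Longrightarrow> (\<lambda>v. N * \<phi> v) \<in> M"
  shows "finite (cls M ` P)"
proof -
  define r where "r \<phi> = (\<lambda>i. if i \<le> n then \<phi> (al i) mod N else 0)" for \<phi> :: "(nat \<Rightarrow> int) \<Rightarrow> int"
  have key: "cls M \<phi> = cls M \<psi>" if h: "\<phi> \<in> P" "\<psi> \<in> P" "r \<phi> = r \<psi>" for \<phi> \<psi>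
  proof -
    define \<chi> where "\<chi> v = (\<Sum>i\<le>n. v i * ((\<phi> (al i) - \<psi> (al i)) div N))" for v
    have d: "N * ((\<phi> (al i) - \<psi> (al i)) div N) = \<phi> (al i) - \<psi> (al i)" if "i \<le> n" for i
      using fun_cong[OF h(3), of i] that by (simp add: r_def mod_eq_dvd_iff)
    have e: "N * \<chi> v = \<phi> v - \<psi> v" for v
    proof -
      have "N * \<chi> v = (\<Sum>i\<le>n. v i * (\<phi> (al i) - \<psi> (al i)))"
        unfolding \<chi>_def sum_distrib_left by (intro sum.cong refl) (metis atMost_iff d mult.left_commute)
      also have "\<dots> = \<phi> v - \<psi> v"
        by (subst flin_expand[OF P_D(1,2)[OF h(1)], of v], subst flin_expand[OF P_D(1,2)[OF h(2)], of v])
           (simp add: algebra_simps sum_subtractf)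
      finally show ?thesis .
    qed
    have "N * \<chi> delta = 0" using e[of delta] P_D(3)[OF h(1)] P_D(3)[OF h(2)] by simp
    then have "\<chi> delta = 0" using N(1) by simp
    moreover have "flin \<chi>" by (auto simp: flin_def \<chi>_def algebra_simps sum.distrib sum_distrib_left)
    moreover have "fsupported n \<chi>" by (simp add: fsupported_def \<chi>_def)
    ultimately have "\<chi> \<in> P" by (simp add: P_def)
    then have "(\<lambda>v. \<phi> v - \<psi> v) \<in> M" using N(2)[of \<chi>] unfolding e by blast
    then show ?thesis using cls_eq[OF M, of \<phi> \<psi>] by blast
  qed
  have "finite (r ` P)"
  proof (rule finite_subset)
    show "r ` P \<subseteq> {f. \<forall>i. (i \<in> {..n} \<longrightarrow> f i \<in> {0..<N}) \<and> (i \<notin> {..n} \<longrightarrow> f i = 0)}"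
      using N(1) by (auto simp: r_def)
  qed (intro finite_set_of_finite_funs, auto)
  moreover have "cls M ` P \<subseteq> (\<lambda>x. cls M (SOME \<phi>. \<phi> \<in> P \<and> r \<phi> = x)) ` (r ` P)"
  proof
    fix c assume "c \<in> cls M ` P"
    then obtain \<phi> where c: "\<phi> \<in> P" "c = cls M \<phi>" by blast
    have "(SOME \<psi>. \<psi> \<in> P \<and> r \<psi> = r \<phi>) \<in> P \<and> r (SOME \<psi>. \<psi> \<in> P \<and> r \<psi> = r \<phi>) = r \<phi>"
      by (rule someI[of _ \<phi>]) (simp add: c)
    then have "c = cls M (SOME \<psi>. \<psi> \<in> P \<and> r \<psi> = r \<phi>)" using key c by metis
    then show "c \<in> (\<lambda>x. cls M (SOME \<phi>. \<phi> \<in> P \<and> r \<phi> = x)) ` (r ` P)" using c(1) by blast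
  qed
  ultimately show ?thesis using finite_surj by blast
qed

text \<open>Dividing the entries by d_i turns this left kernel into the right kernel of
  \<open>real_kernel\<close>.\<close>

lemma real_rows_kernel:
  fixes t :: "nat \<Rightarrow> real"
  assumes z: "z \<le> n" "t z = 0"
    and t: "\<And>j. j \<le> n \<Longrightarrow> t j \<noteq> 0 \<Longrightarrow> (\<Sum>i\<le>n. t i * of_int (C i j)) = 0"
    and i: "i \<le> n"
  shows "t i = 0"
proof -
  define x where "x i = t i / d i" for i
  have "(\<Sum>j\<le>n. of_int (C k j) * x j) = 0" if "k \<le> n" "x k \<noteq> 0" for k
  proof -
    have "(\<Sum>j\<le>n. of_int (C k j) * x j) = (\<Sum>j\<le>n. t j * of_int (C j k) / d k)"
    proof (rule sum.cong[OF refl])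
      fix j assume "j \<in> {..n}"
      then have jn: "j \<le> n" by simp
      have "real_of_int (d k) * C k j = d j * C j k" using symm[OF that(1) jn] by (metis of_int_mult)
      then show "of_int (C k j) * x j = t j * of_int (C j k) / d k"
        using d_pos[OF jn] d_pos[OF that(1)] by (simp add: x_def field_simps)
    qed
    then show ?thesis using t[OF that(1)] that(2) by (simp add: x_def flip: sum_divide_distrib)
  qed
  then have "x i = 0" using real_kernel[OF z(1), of x i] z(2) i by (simp add: x_def)
  then show ?thesis using d_pos[OF i] by (simp add: x_def)
qed

lemma rows_sum_ext: "J \<subseteq> {0..n} \<Longrightarrow> (\<Sum>i\<in>J. g i * h i) = (\<Sum>i\<le>n. (if i \<in> J then g i else 0) * (h i :: 'b::semiring_0))"
  by (rule sum.mono_neutral_cong_left) auto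

text \<open>On a proper set J of nodes the pairing of coroots and roots is nondegenerate, as the
  Cartan matrix of J is nonsingular.\<close>

lemma rows_kernel:
  assumes J: "J \<subseteq> {0..n}" and z: "z \<le> n" "z \<notin> J" and phi: "\<phi> \<in> rows J" "\<And>j. j \<in> J \<Longrightarrow> \<phi> (al j) = 0"
  shows "\<phi> = (\<lambda>v. 0)"
proof -
  obtain g where g: "\<phi> = (\<lambda>v. \<Sum>i\<in>J. g i * pr i v)" using phi(1) unfolding rows_def by auto
  define t where "t i = real_of_int (if i \<in> J then g i else 0)" for i
  have "(\<Sum>i\<le>n. t i * of_int (C i j)) = of_int (\<phi> (al j))" if "j \<le> n" for j
    unfolding g rows_sum_ext[OF J] t_def using that by simp
  then have "t i = 0" if "i \<le> n" for i
    using real_rows_kernel[OF z(1), of t i] z(2) that phi(2) by (auto simp: t_def split: if_splits)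
  then have "g i = 0" if "i \<in> J" for i using that J by (force simp: t_def)
  then show ?thesis by (simp add: g)
qed

lemma crt_supp:
  assumes b: "\<beta> \<in> RR" and J: "J \<subseteq> {0..n}" "\<And>k. k \<notin> J \<Longrightarrow> \<beta> k = 0"
  shows "crt \<beta> \<in> rows J"
proof -
  have fJ: "finite J" using J(1) finite_subset by blast
  have 1: "crt \<beta> \<in> rows J" if h: "\<beta> \<in> RR" "0 \<le> \<beta>" "\<And>k. k \<notin> J \<Longrightarrow> \<beta> k = 0" for \<beta>
  proof -
    obtain w j where w: "w \<in> weyl_group C n J" "j \<in> J" "\<beta> = w (al j)"
      using supp_root[OF h(1,2) J(1) h(3)] by blast
    have "crt \<beta> v = pr j (inv w v)" for v
      using crt_W[OF sub_W[OF J(1) w(1)], of j "inv w v"] w J(1) W_inv(2)[OF J(1) w(1)] by auto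
    then have "crt \<beta> = (\<lambda>v. pr j (inv w v))" by blast
    moreover have "(\<lambda>v. pr j (inv w v)) \<in> rows J"
      using comp_rows[OF J(1) _ W_inv(1)[OF J(1) w(1)]] rows_pr[OF fJ w(2), of 1] by simp
    ultimately show ?thesis by simp
  qed
  show ?thesis
  proof (cases "0 \<le> \<beta>")
    case False
    then have "0 \<le> - \<beta>" using RR_neg_iff[OF b] by blast
    then have "crt (- \<beta>) \<in> rows J" using 1[OF RR_uminus[OF b]] J(2) by simp
    moreover have "crt \<beta> = (\<lambda>v. (-1) * crt (- \<beta>) v)" using crt_uminus[OF b] by auto
    ultimately show ?thesis using rows_cmult by metis
  qed (use 1[OF b] J(2) in blast)
qed

end

context untwisted
begin

text \<open>Translating by a coweight adds integral multiples of delta to roots, and in the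
  untwisted case the real roots are closed under all of these.\<close>

lemma frame_ic: "\<phi> \<in> P \<Longrightarrow> u \<in> W \<Longrightarrow> frame (ic \<phi> u)"
  unfolding frame_def lin_def ic_def
  using linD(1,2)[OF weyl_group_lin[OF W_inv'(1)[of u]]] flinD(1,2)[OF P_D(1)[of \<phi>]]
    W_delta[OF W_inv'(1)[of u]] P_D(3)[of \<phi>] RR_shift[OF RR_W[OF _ W_inv'(1)[of u]]]
  by (simp add: fun_eq_iff algebra_simps)

text \<open>Positivity of a real root is the sign of its height, so this is
  \<open>exists_positive\<close> for the functional \<open>ht\<close> composed with f.\<close>

lemma frame_exists:
  assumes f: "frame f" and H: "h0 \<in> H" "\<And>h. h \<in> H \<Longrightarrow> frame h"
    and Psi: "\<Psi> \<subseteq> RR" "\<And>h \<eta>. h \<in> H \<Longrightarrow> \<eta> \<in> \<Psi> \<Longrightarrow> h \<circ> rf \<eta> \<in> H"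
  shows "\<exists>h\<in>H. \<forall>\<eta>\<in>\<Psi>. 0 \<le> \<eta> \<longrightarrow> 0 \<le> f (h \<eta>)"
proof -
  have "flin (ht \<circ> f)" by (rule flin_comp[OF flin_ht frameD(1)[OF f]])
  moreover have "(ht \<circ> f) delta = 1 * ht delta" using frameD(2)[OF f] by simp
  ultimately obtain h where h: "h \<in> H" "\<forall>\<eta>\<in>\<Psi>. 0 \<le> \<eta> \<longrightarrow> 0 \<le> (ht \<circ> f) (h \<eta>)"
    using exists_positive[of "ht \<circ> f" 1 h0 H \<Psi>] H(1) frameD(1,2)[OF H(2)] Psi by auto
  then have "0 \<le> f (h \<eta>)" if "\<eta> \<in> \<Psi>" "0 \<le> \<eta>" for \<eta>
    using that ht_nonneg_iff[OF frameD(3)[OF f frameD(3)[OF H(2)[OF h(1)]]], of \<eta>] Psi(1) by auto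
  then show ?thesis using h(1) by blast
qed

text \<open>Every alcove of the extended group is an alcove of the affine Weyl group: reflections in
  all real roots sort f, and the element w that does so has the same sign pattern.\<close>

lemma frame_W_exists:
  assumes "frame f" shows "\<exists>w\<in>W. \<forall>\<eta>\<in>RR. 0 \<le> f \<eta> \<longleftrightarrow> 0 \<le> inv w \<eta>"
proof -
  obtain w where w: "w \<in> W" "\<forall>\<eta>\<in>RR. 0 \<le> \<eta> \<longrightarrow> 0 \<le> f (w \<eta>)"
    using frame_exists[OF assms weyl_id[of C n "{0..n}"], of RR] frame_W weyl_group_comp rf_in_W by blast
  have "0 \<le> f \<eta> \<longleftrightarrow> 0 \<le> inv w \<eta>" if "\<eta> \<in> RR" for \<eta>
  proof -
    have R: "inv w \<eta> \<in> RR" by (rule RR_W[OF that W_inv'(1)[OF w(1)]])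
    have "0 \<le> f (w (inv w \<eta>)) \<longleftrightarrow> 0 \<le> inv w \<eta>"
      by (rule frame_iffI[OF frame_comp[OF assms frame_W[OF w(1)]] R]) (use w(2) R RR_uminus in auto)
    then show ?thesis using W_inv'(2)[OF w(1)] by simp
  qed
  then show ?thesis using w(1) by blast
qed

lemma W_inv_unique:
  assumes "w \<in> W" "w' \<in> W" "\<And>\<eta>. \<eta> \<in> RR \<Longrightarrow> 0 \<le> inv w \<eta> \<longleftrightarrow> 0 \<le> inv w' \<eta>"
  shows "w = w'"
proof -
  have "inv w \<circ> w' = id"
  proof (rule W_id_frame[OF weyl_group_comp[OF W_inv'(1)[OF assms(1)] assms(2)]])
    fix \<eta> assume "\<eta> \<in> RR" "0 \<le> \<eta>"
    then show "0 \<le> (inv w \<circ> w') \<eta>" using assms(3)[OF RR_W[OF _ assms(2)], of \<eta>] W_inv'(3)[OF assms(2)] by simp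
  qed
  then have "inv w (w' v) = v" for v by (simp add: pointfree_idE)
  then show ?thesis using W_inv'(2)[OF assms(1)] by (metis ext)
qed

end

section \<open>Two special nodes: the cylinder of height zero and its period\<close>

text \<open>The nodes p and q are those with s = 1. Then \<open>J\<close> consists of the nodes of
  height zero, \<open>Ws\<close> is the Weyl group of the height zero roots, and \<open>Wp\<close>
  is the finite Weyl group at p, of the same order as the one at 0.\<close>

locale special_pair = untwisted +
  fixes p q :: nat
  assumes p: "p \<le> n" "a p = 1" and q: "q \<le> n" "a q = 1" and pq: "p \<noteq> q"
begin

abbreviation J where "J \<equiv> {0..n} - {p, q}"
abbreviation Ws where "Ws \<equiv> weyl_group C n J"
abbreviation Wp where "Wp \<equiv> weyl_group C n ({0..n} - {p})"

lemma Ws_sub: "w \<in> Ws \<Longrightarrow> w \<in> Wp" "w \<in> Ws \<Longrightarrow> w \<in> W" "w \<in> Wp \<Longrightarrow> w \<in> W"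
  by (erule weyl_group_mono, blast)+

lemma Ws_coord: "x \<in> Ws \<Longrightarrow> x v p = v p" "x \<in> Ws \<Longrightarrow> x v q = v q"
  by (erule weyl_group_coord, blast)+

lemma Wp_coord: "u \<in> Wp \<Longrightarrow> u v p = v p"
  by (erule weyl_group_coord) blast

text \<open>Difference of the fundamental coweights at q and p. Both labels are 1, so it vanishes on
  delta; \<open>P_omega\<close> shows that its multiples are all the coweights that vanish on the
  simple roots in J.\<close>

definition omega :: "(nat \<Rightarrow> int) \<Rightarrow> int" where "omega v = v q - v p"

definition Ds :: "(nat \<Rightarrow> int) set" where "Ds = {\<beta> \<in> RR. \<beta> p = 0 \<and> \<beta> q = 0}"

definition L :: "((nat \<Rightarrow> int) \<Rightarrow> int) set" where
  "L = {(\<lambda>v. \<psi> v + c * omega v) | \<psi> c. \<psi> \<in> rows J}"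

lemma flin_omega: "flin omega" by (auto simp: flin_def omega_def algebra_simps)

lemma delta_pq: "delta p = 1" "delta q = 1" using delta_p p q by auto

lemma omega_delta: "omega delta = 0" by (simp add: omega_def delta_pq)

lemma omega_P: "(\<lambda>v. c * omega v) \<in> P"
  using p q by (auto simp: P_def fsupported_def omega_delta intro: flin_cmult flin_omega) (auto simp: omega_def)

lemma L_I: "\<psi> \<in> rows J \<Longrightarrow> (\<lambda>v. \<psi> v + c * omega v) \<in> L" by (auto simp: L_def)

lemma L_zero: "(\<lambda>v. 0) \<in> L" using L_I[OF rows_zero, of 0] by simp

lemma L_diff: "\<phi> \<in> L \<Longrightarrow> \<psi> \<in> L \<Longrightarrow> (\<lambda>v. \<phi> v - \<psi> v) \<in> L"
proof -
  assume "\<phi> \<in> L" "\<psi> \<in> L"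
  then obtain f b g c where "\<phi> = (\<lambda>v. f v + b * omega v)" "\<psi> = (\<lambda>v. g v + c * omega v)" "f \<in> rows J" "g \<in> rows J"
    unfolding L_def by auto
  then show ?thesis using L_I[OF rows_diff, of f g "b - c"] by (simp add: algebra_simps)
qed

lemma cls_L: "cls L \<phi> = cls L \<psi> \<longleftrightarrow> (\<lambda>v. \<phi> v - \<psi> v) \<in> L"
  by (rule cls_eq) (rule L_zero L_diff; assumption)+

lemma L_P: "\<phi> \<in> L \<Longrightarrow> \<phi> \<in> P"
  unfolding L_def using P_add[OF rows_P omega_P] by blast

lemma L_comp: "\<phi> \<in> L \<Longrightarrow> x \<in> Ws \<Longrightarrow> (\<lambda>v. \<phi> (x v)) \<in> L"
proof -
  assume "\<phi> \<in> L" and x: "x \<in> Ws"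
  then obtain f b where f: "\<phi> = (\<lambda>v. f v + b * omega v)" "f \<in> rows J" unfolding L_def by auto
  have "omega (x v) = omega v" for v using Ws_coord[OF x] by (simp add: omega_def)
  then show ?thesis using L_I[OF comp_rows[OF _ f(2) x], of b] f(1) by auto
qed

lemma fin_q: "\<beta> \<in> fin p \<Longrightarrow> \<beta> q \<in> {-1, 0, 1}"
  using fin_abs[OF p, of \<beta> q] delta_pq by auto

lemma omega_RR: "\<eta> \<in> RR \<Longrightarrow> omega \<eta> \<in> {-1, 0, 1}"
  using fin_q[OF proj_fin[OF p, of \<eta>]] delta_pq by (auto simp: omega_def)

lemma Ds_fin: "\<beta> \<in> Ds \<Longrightarrow> \<beta> \<in> fin p" by (simp add: Ds_def fin_def)

lemma Ds_RR: "\<beta> \<in> Ds \<Longrightarrow> \<beta> \<in> RR" by (simp add: Ds_def)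

lemma Ds_uminus: "\<beta> \<in> Ds \<Longrightarrow> - \<beta> \<in> Ds" using RR_uminus by (simp add: Ds_def)

lemma Ds_Ws: "\<beta> \<in> Ds \<Longrightarrow> x \<in> Ws \<Longrightarrow> x \<beta> \<in> Ds"
  using RR_W[OF _ Ws_sub(2), of \<beta> x] Ws_coord[of x \<beta>] by (simp add: Ds_def)

lemma al_Ds: "i \<in> J \<Longrightarrow> al i \<in> Ds" using al_RR by (auto simp: Ds_def simple_root_apply)

lemma al_nonneg: "0 \<le> al i" by (simp add: le_fun_def simple_root_apply)

lemma rf_Ds: "\<beta> \<in> Ds \<Longrightarrow> rf \<beta> \<in> Ws"
  by (rule rf_in_weyl_supp[OF Ds_RR]) (use RR_outside[of \<beta>] in \<open>force simp: Ds_def\<close>)+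

lemma crt_Ds: "\<beta> \<in> Ds \<Longrightarrow> crt \<beta> \<in> rows J"
  by (rule crt_supp[OF Ds_RR]) (use RR_outside[of \<beta>] in \<open>force simp: Ds_def\<close>)+

text \<open>The alcove of f lies in the fundamental alcove of the affine system over the height zero
  roots. This region is unbounded in the direction of \<open>omega\<close>, hence a
  cylinder.\<close>

definition cyl :: "((nat \<Rightarrow> int) \<Rightarrow> nat \<Rightarrow> int) \<Rightarrow> bool" where
  "cyl f \<longleftrightarrow> (\<forall>\<beta>\<in>Ds. 0 \<le> \<beta> \<longrightarrow> 0 \<le> f \<beta> \<and> 0 \<le> f (delta - \<beta>))"

text \<open>With \<open>cyl\<close>, this cuts a fundamental domain for the translation by \<open>omega\<close> out of the
  cylinder over the alcove of \<open>Ds\<close>.\<close>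

definition period :: "((nat \<Rightarrow> int) \<Rightarrow> nat \<Rightarrow> int) \<Rightarrow> bool" where
  "period f \<longleftrightarrow> cyl f \<and> 0 \<le> f (- al p) \<and> 0 \<le> f (al p + delta)"

lemma cyl_RR: "\<beta> \<in> Ds \<Longrightarrow> delta - \<beta> \<in> RR"
  using RR_shift1[OF RR_uminus[OF Ds_RR]] by (simp add: add.commute)

lemma period_transfer:
  assumes "\<And>\<eta>. \<eta> \<in> RR \<Longrightarrow> 0 \<le> f \<eta> \<longleftrightarrow> 0 \<le> g \<eta>" shows "period f \<longleftrightarrow> period g"
proof -
  have "cyl f \<longleftrightarrow> cyl g" unfolding cyl_def using assms cyl_RR Ds_RR by blast
  moreover have "- al p \<in> RR" "al p + delta \<in> RR" using RR_uminus al_RR[OF p(1)] RR_shift1 by blast+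
  ultimately show ?thesis unfolding period_def using assms by blast
qed

text \<open>With \<open>S2\<close>, the two halves of the set of minuscule elements, separated by
  the sign of the inverse on alpha_p. For \<open>S2\<close> the condition at q is derived in
  \<open>period_q\<close>; \<open>Sh\<close> is the analogue of \<open>S2\<close> in the extended
  group.\<close>

definition S1 where "S1 = {w \<in> W. cyl (inv w) \<and> 0 \<le> inv w (al p) \<and> 0 \<le> inv w (al q + delta)}"
definition S2 where "S2 = {w \<in> W. period (inv w)}"
definition Sh where "Sh = {(\<phi>, u). \<phi> \<in> P \<and> u \<in> Wp \<and> period (ic \<phi> u)}"

text \<open>Real roots with equal coordinates at p and q are beta + m delta with beta in
  \<open>Ds\<close>. If such a root is positive and beta is negative, then m is at least 1, and
  delta + beta is covered by the definition of \<open>cyl\<close> applied to -beta.\<close>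

lemma cyl_iff:
  assumes f: "frame f" "cyl f" and e: "\<eta> \<in> RR" "\<eta> p = \<eta> q"
  shows "0 \<le> f \<eta> \<longleftrightarrow> 0 \<le> \<eta>"
proof -
  have 1: "0 \<le> f \<eta>" if e: "\<eta> \<in> RR" "\<eta> p = \<eta> q" "0 \<le> \<eta>" for \<eta>
  proof -
    define \<beta> m where "\<beta> = \<eta> - \<eta> p \<cdot> delta" and "m = \<eta> p"
    have b: "\<beta> \<in> Ds" using proj_fin[OF p e(1)] e(2) delta_pq by (simp add: \<beta>_def Ds_def fin_def)
    have eq: "\<eta> = \<beta> + m \<cdot> delta" by (simp add: \<beta>_def m_def)
    have fe: "f \<eta> = f \<beta> + m \<cdot> delta" unfolding eq using linD(1,2)[OF frameD(1)[OF f(1)]] frameD(2)[OF f(1)] by simp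
    have m: "m \<ge> 0" using le_funD[OF e(3), of p] by (simp add: m_def)
    show ?thesis
    proof (cases "0 \<le> \<beta>")
      case True
      then have "0 \<le> f \<beta>" using f(2) b by (simp add: cyl_def)
      then show ?thesis unfolding fe using smult_delta_nonneg[OF m] by (rule add_nonneg_nonneg)
    next
      case False
      then have nb: "0 \<le> - \<beta>" using RR_neg_iff Ds_RR b by blast
      have "m \<noteq> 0" using False e(3) eq by auto
      then have "m \<ge> 1" using m by simp
      have "0 \<le> f (delta - (- \<beta>))" using f(2) Ds_uminus[OF b] nb unfolding cyl_def by blast
      also have "f (delta - (- \<beta>)) = delta + f \<beta>"
        using linD(1)[OF frameD(1)[OF f(1)]] frameD(2)[OF f(1)] by simp
      finally have "0 \<le> (delta + f \<beta>) + (m - 1) \<cdot> delta"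
        by (rule add_nonneg_nonneg) (rule smult_delta_nonneg, use \<open>m \<ge> 1\<close> in simp)
      also have "(delta + f \<beta>) + (m - 1) \<cdot> delta = f \<eta>" unfolding fe smult_diff by simp
      finally show ?thesis .
    qed
  qed
  show ?thesis
    by (rule frame_iffI[OF f(1) e(1)]) (use 1 e RR_uminus[OF e(1)] in auto)
qed

lemma Ws_pow: "x \<in> Ws \<Longrightarrow> x ^^ j \<in> Ws"
  by (induct j) (auto intro: weyl_id weyl_group_comp simp del: o_apply simp: funpow_Suc_right)

lemma finite_Ws: "finite Ws" and finite_Wp: "finite Wp"
  by (rule finite_weyl[OF p], blast)+

lemma Ws_finite_order:
  assumes x: "x \<in> Ws" shows "\<exists>m>0. x ^^ m = id"
proof -
  have "\<not> inj (\<lambda>j. x ^^ j)"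
    using finite_imageD[of "\<lambda>j. x ^^ j" UNIV] finite_subset[OF _ finite_Ws, of "range (\<lambda>j. x ^^ j)"] Ws_pow[OF x]
      infinite_UNIV_nat by blast
  then obtain i j where ij: "i < j" "x ^^ i = x ^^ j" unfolding inj_def by (metis linorder_neqE_nat)
  have "x ^^ i = x ^^ i \<circ> x ^^ (j - i)" using ij funpow_add[of i "j - i" x] by simp
  then have "(x ^^ i) v = (x ^^ i) ((x ^^ (j - i)) v)" for v by (metis o_apply)
  moreover have "inj (x ^^ i)" using W_inv(4)[OF _ Ws_pow[OF x]] bij_is_inj by blast
  ultimately have "v = (x ^^ (j - i)) v" for v by (meson injD)
  then have "x ^^ (j - i) = id" by (metis ext id_apply)
  then show ?thesis using ij(1) by (intro exI[of _ "j - i"]) auto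
qed

text \<open>An element of the affine Weyl group of \<open>\<Delta>\<^sub>\<sigma>\<close> that preserves its alcove fixes a functional on
  which no affine root vanishes: average the height over its powers and perturb it by \<open>omega\<close>.
  Hence it is trivial, being an element of the full affine Weyl group as well.\<close>

lemma alcove_stabilizer:
  assumes x: "x \<in> Ws" and psi: "\<psi> \<in> rows J"
    and pos: "\<And>\<eta>. \<eta> \<in> RR \<Longrightarrow> \<eta> p = \<eta> q \<Longrightarrow> 0 \<le> x \<eta> + \<psi> \<eta> \<cdot> delta \<longleftrightarrow> 0 \<le> \<eta>"
  shows "x = id" "\<psi> = (\<lambda>v. 0)"
proof -
  define k where "k v = x v + \<psi> v \<cdot> delta" for v
  have Jn: "J \<subseteq> {0..n}" by blast
  have pf: "flin \<psi>" "\<psi> delta = 0" using rows_flin[OF psi] rows_delta[OF Jn psi] by auto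
  have xd: "x delta = delta" and xl: "lin x" using W_delta[OF Ws_sub(2)[OF x]] weyl_group_lin[OF x] by auto
  have kW: "k \<in> W"
  proof -
    have m: "(\<lambda>v. (-1) * \<psi> v) \<in> rows J" by (rule rows_cmult[OF psi])
    have "k v = (x \<circ> T (\<lambda>v. (-1) * \<psi> v)) v" for v
      using linD(1,2,3,4)[OF xl] xd by (simp add: k_def T_def)
    then have "k = x \<circ> T (\<lambda>v. (-1) * \<psi> v)" by blast
    then show ?thesis using weyl_group_comp[OF Ws_sub(2)[OF x] T_rows_W[OF Jn m]] by simp
  qed
  have kf: "frame k" by (rule frame_W[OF kW])
  have kpq: "k v p = v p + \<psi> v" "k v q = v q + \<psi> v" for v
    using Ws_coord[OF x] delta_pq by (simp_all add: k_def)
  have pw: "frame (k ^^ j)" for j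
  proof (induct j)
    case 0
    then show ?case using frame_W[OF weyl_id] by (simp add: id_def)
  next
    case (Suc j)
    then show ?case using frame_comp[OF kf] by (simp add: comp_def)
  qed
  have pwpos: "(k ^^ j) \<eta> p = (k ^^ j) \<eta> q \<and> (0 \<le> (k ^^ j) \<eta> \<longleftrightarrow> 0 \<le> \<eta>)" if "\<eta> \<in> RR" "\<eta> p = \<eta> q" for j \<eta>
  proof (induct j)
    case (Suc j)
    have "0 \<le> k ((k ^^ j) \<eta>) \<longleftrightarrow> 0 \<le> (k ^^ j) \<eta>"
      using pos[OF frameD(3)[OF pw that(1)], of j] Suc unfolding k_def[symmetric] by blast
    moreover have "k ((k ^^ j) \<eta>) p = k ((k ^^ j) \<eta>) q" using Suc kpq by simp
    ultimately show ?case using Suc unfolding funpow.simps o_apply by blast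
  qed (use that in auto)
  have powx: "\<exists>\<chi>\<in>rows J. \<forall>v. (k ^^ j) v = (x ^^ j) v + \<chi> v \<cdot> delta" for j
  proof (induct j)
    case 0
    then show ?case by (intro bexI[OF _ rows_zero]) auto
  next
    case (Suc j)
    then obtain \<chi> where c: "\<chi> \<in> rows J" "\<And>v. (k ^^ j) v = (x ^^ j) v + \<chi> v \<cdot> delta" by blast
    have "(k ^^ Suc j) v = (x ^^ Suc j) v + (\<psi> ((x ^^ j) v) + \<chi> v) \<cdot> delta" for v
    proof -
      have "(k ^^ Suc j) v = k ((x ^^ j) v + \<chi> v \<cdot> delta)" using c(2) by simp
      also have "\<dots> = x ((x ^^ j) v) + \<chi> v \<cdot> delta + \<psi> ((x ^^ j) v) \<cdot> delta"
        unfolding k_def using linD(1,2)[OF xl] flinD(1,2)[OF pf(1)] xd pf(2) by simp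
      finally show ?thesis by (simp add: smult_add add_ac)
    qed
    moreover have "(\<lambda>v. \<psi> ((x ^^ j) v) + \<chi> v) \<in> rows J"
      by (rule rows_add[OF comp_rows[OF Jn psi Ws_pow[OF x]] c(1)])
    ultimately show ?case by (intro bexI[of _ "\<lambda>v. \<psi> ((x ^^ j) v) + \<chi> v"] allI)
  qed
  \<comment> \<open>The linear part has finite order, so this power of k is a translation by some
    chi in the coroot lattice of J.\<close>
  obtain m where m: "m > 0" "x ^^ m = id" using Ws_finite_order[OF x] by blast
  obtain \<chi> where chi: "\<chi> \<in> rows J" "\<And>v. (k ^^ m) v = v + \<chi> v \<cdot> delta"
    using powx[of m] m(2) by auto
  have "\<chi> (al i) = 0" if i: "i \<in> J" for i
  proof -
    have e: "al i \<in> RR" "delta - al i \<in> RR" using al_Ds[OF i] cyl_RR Ds_RR by blast+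
    have pq0: "al i p = 0" "al i q = 0" using al_Ds[OF i] by (simp_all add: Ds_def)
    have "0 \<le> al i + \<chi> (al i) \<cdot> delta"
      using pwpos[OF e(1), of m] pq0 chi(2)[of "al i"] al_nonneg[of i] by simp
    from le_funD[OF this, of p] have c0: "\<chi> (al i) \<ge> 0" using pq0 delta_pq by simp
    have "0 \<le> delta - al i" by (rule RR_nonnegI[OF e(2), of p]) (use pq0 delta_pq in simp)
    then have "0 \<le> (k ^^ m) (delta - al i)" using pwpos[OF e(2), of m] pq0 delta_pq by simp
    also have "(k ^^ m) (delta - al i) = delta - al i - \<chi> (al i) \<cdot> delta"
      unfolding chi(2) using flinD(3)[OF rows_flin[OF chi(1)], of delta "al i"] rows_delta[OF Jn chi(1)] by simp
    finally have g: "0 \<le> delta - al i - \<chi> (al i) \<cdot> delta" .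
    \<comment> \<open>Positivity of the images of alpha_i and delta - alpha_i confines the value to
      0 and 1; the value 1 would leave the coordinate -1 at i.\<close>
    have "\<chi> (al i) \<noteq> 1" using le_funD[OF g, of i] by (auto simp: simple_root_apply)
    then show ?thesis using le_funD[OF g, of p] c0 pq0 delta_pq by simp
  qed
  then have "\<chi> = (\<lambda>v. 0)" by (intro rows_kernel[OF Jn p(1) _ chi(1)]) auto
  then have km: "(k ^^ m) v = v" for v using chi(2) by simp
  \<comment> \<open>The factor 2 makes the height part even, while \<open>omega\<close> is odd on
    every root where it does not vanish; so F has no zero on those roots. On the others k preserves
    signs, and all summands have the same sign.\<close>
  define F where "F v = 2 * (\<Sum>j<m. ht ((k ^^ j) v)) + omega v" for v
  have Ff: "flin F" unfolding F_def[abs_def]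
  proof (intro flin_add flin_cmult flin_omega flin_Sum)
    show "flin (\<lambda>v. ht ((k ^^ j) v))" for j
      using flin_comp[OF flin_ht frameD(1)[OF pw[of j]]] by (simp add: comp_def)
  qed
  have Fk: "F (k v) = F v" for v
  proof -
    have "(\<Sum>j<m. ht ((k ^^ j) (k v))) + ht v = (\<Sum>j<Suc m. ht ((k ^^ j) v))"
      by (subst sum.lessThan_Suc_shift) (simp add: funpow_swap1)
    also have "\<dots> = (\<Sum>j<m. ht ((k ^^ j) v)) + ht v" using km by simp
    finally show ?thesis using kpq by (simp add: F_def omega_def)
  qed
  have Fd: "F delta = (2 * int m) * ht delta"
    using frameD(2)[OF pw] omega_delta by (simp add: F_def)
  have Fn: "F \<eta> \<noteq> 0" if e: "\<eta> \<in> RR" for \<eta>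
  proof (cases "omega \<eta> = 0")
    case False
    then have "odd (omega \<eta>)" using omega_RR[OF e] by auto
    then have "odd (F \<eta>)" by (simp add: F_def)
    then show ?thesis by auto
  next
    case True
    then have pe: "\<eta> p = \<eta> q" by (simp add: omega_def)
    have R: "(k ^^ j) \<eta> \<in> RR" for j by (rule frameD(3)[OF pw e])
    have iff: "0 \<le> (k ^^ j) \<eta> \<longleftrightarrow> 0 \<le> \<eta>" for j using pwpos[OF e pe] by blast
    have "(\<Sum>j<m. ht ((k ^^ j) \<eta>)) \<noteq> 0"
    proof (cases "0 \<le> \<eta>")
      case True
      have "0 < ht ((k ^^ j) \<eta>)" for j using ht_pos[OF R[of j]] iff[of j] True by blast
      then have "0 < (\<Sum>j<m. ht ((k ^^ j) \<eta>))" using m(1) by (intro sum_pos) auto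
      then show ?thesis by simp
    next
      case False
      have "0 < - ht ((k ^^ j) \<eta>)" for j using ht_nonneg_iff[OF R[of j]] iff[of j] False by linarith
      then have "0 < (\<Sum>j<m. - ht ((k ^^ j) \<eta>))" using m(1) by (intro sum_pos) auto
      then show ?thesis by (simp add: sum_negf)
    qed
    then show ?thesis using True by (simp add: F_def)
  qed
  obtain w where w: "w \<in> W" "\<forall>\<eta>\<in>RR. 0 \<le> \<eta> \<longrightarrow> 0 \<le> F (w \<eta>)"
    using exists_positive[OF Ff Fd _ weyl_id[of C n "{0..n}"], of RR] m(1) weyl_group_lin W_delta weyl_group_comp rf_in_W by auto
  \<comment> \<open>F is invariant under k and, composed with w, strictly positive on positive
    roots. So the conjugate of k by w preserves positivity of roots and is the identity.\<close>
  have "inv w \<circ> (k \<circ> w) = id"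
  proof (rule W_id_frame[OF weyl_group_comp[OF W_inv'(1)[OF w(1)] weyl_group_comp[OF kW w(1)]]])
    fix \<eta> assume e: "\<eta> \<in> RR" "0 \<le> \<eta>"
    let ?z = "inv w (k (w \<eta>))"
    have zR: "?z \<in> RR" using RR_W W_inv'(1)[OF w(1)] kW w(1) e(1) by blast
    have "F (w ?z) = F (w \<eta>)" using W_inv'(2)[OF w(1)] Fk by simp
    moreover have "F (w \<eta>) > 0" using w(2) e Fn[OF RR_W[OF e(1) w(1)]] by force
    moreover have "F (w (- ?z)) = - F (w ?z)"
      using linD(4)[OF weyl_group_lin[OF w(1)]] flinD(4)[OF Ff] by simp
    ultimately have "\<not> 0 \<le> - ?z" using w(2) RR_uminus[OF zR] by force
    then show "0 \<le> (inv w \<circ> (k \<circ> w)) \<eta>" using RR_neg_iff[OF zR] by simp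
  qed
  then have "inv w (k (w v)) = v" for v using pointfree_idE[of "inv w" "k \<circ> w"] by simp
  then have "k (w v) = w v" for v using W_inv'(2)[OF w(1)] by metis
  then have kid: "k v = v" for v using W_inv'(2)[OF w(1)] by metis
  have "\<psi> v = 0" for v using kpq(1)[of v] kid[of v] by simp
  then show "\<psi> = (\<lambda>v. 0)" by blast
  then show "x = id" using kid by (auto simp: k_def)
qed

text \<open>On roots with equal coordinates at p and q the multiple of \<open>omega\<close> is
  invisible, and \<open>alcove_stabilizer\<close> removes x and the coroot part. What remains shifts
  the image of alpha_p by -c delta, while both images lie between -delta and 0; so c = 0.\<close>

lemma period_unique:
  assumes f: "frame f1" "frame f2" "period f1" "period f2"
    and x: "x \<in> Ws" and chi: "\<chi> \<in> L" and e: "\<And>y. f1 y = f2 (x y + \<chi> y \<cdot> delta)"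
  shows "x = id" "\<chi> = (\<lambda>v. 0)"
proof -
  obtain \<psi> c where pc: "\<psi> \<in> rows J" "\<chi> = (\<lambda>v. \<psi> v + c * omega v)" using chi unfolding L_def by auto
  have Jn: "J \<subseteq> {0..n}" by blast
  have cy: "cyl f1" "cyl f2" using f(3,4) by (auto simp: period_def)
  have st: "x = id" "\<psi> = (\<lambda>v. 0)"
  proof -
    have "0 \<le> x \<eta> + \<psi> \<eta> \<cdot> delta \<longleftrightarrow> 0 \<le> \<eta>" if h: "\<eta> \<in> RR" "\<eta> p = \<eta> q" for \<eta>
    proof -
      have "omega \<eta> = 0" using h(2) by (simp add: omega_def)
      then have "f1 \<eta> = f2 (x \<eta> + \<psi> \<eta> \<cdot> delta)" using e[of \<eta>] pc(2) by simp
      moreover have "x \<eta> + \<psi> \<eta> \<cdot> delta \<in> RR" by (rule RR_shift[OF RR_W[OF h(1) Ws_sub(2)[OF x]]])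
      moreover have "(x \<eta> + \<psi> \<eta> \<cdot> delta) p = (x \<eta> + \<psi> \<eta> \<cdot> delta) q" using Ws_coord[OF x] delta_pq h(2) by simp
      ultimately show ?thesis using cyl_iff[OF f(1) cy(1) h] cyl_iff[OF f(2) cy(2), of "x \<eta> + \<psi> \<eta> \<cdot> delta"] by metis
    qed
    then show "x = id" "\<psi> = (\<lambda>v. 0)" using alcove_stabilizer[OF x pc(1)] by blast+
  qed
  show "x = id" by fact
  define \<xi> where "\<xi> = f2 (al p)"
  have xR: "\<xi> \<in> RR" using frameD(3)[OF f(2) al_RR[OF p(1)]] by (simp add: \<xi>_def)
  have om: "omega (al p) = -1" using pq by (simp add: omega_def simple_root_apply)
  have f1p: "f1 (al p) = \<xi> - c \<cdot> delta"
    unfolding e pc(2) st using om linD(1,2,3)[OF frameD(1)[OF f(2)]] frameD(2)[OF f(2)] by (simp add: \<xi>_def)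
  have i1: "0 \<le> - (\<xi> - c \<cdot> delta)" "0 \<le> \<xi> - c \<cdot> delta + delta"
    using f(3) frame_neg[OF f(1)] linD(1)[OF frameD(1)[OF f(1)]] frameD(2)[OF f(1)] f1p by (auto simp: period_def)
  have i2: "0 \<le> - \<xi>" "0 \<le> \<xi> + delta"
    using f(4) frame_neg[OF f(2)] linD(1)[OF frameD(1)[OF f(2)]] frameD(2)[OF f(2)] by (auto simp: period_def \<xi>_def)
  have dn: "delta j \<ge> 0" for j by (simp add: delta_def)
  have c1: "\<not> c \<ge> 1"
  proof
    assume "c \<ge> 1"
    have "0 \<le> \<xi>" unfolding le_fun_def
    proof
      fix j
      have "0 \<le> \<xi> j - c * delta j + delta j" using le_funD[OF i1(2), of j] by simp
      moreover have "delta j \<le> c * delta j" using \<open>c \<ge> 1\<close> dn[of j] by (simp add: mult_le_cancel_right1)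
      ultimately show "(0 :: nat \<Rightarrow> int) j \<le> \<xi> j" by simp
    qed
    then show False using RR_neg_iff[OF xR] i2(1) by blast
  qed
  have c2: "\<not> c \<le> -1"
  proof
    assume "c \<le> -1"
    have "\<xi> + delta \<in> RR" using RR_shift1[OF xR] by blast
    moreover have "0 \<le> - (\<xi> + delta)" unfolding le_fun_def
    proof
      fix j
      have "0 \<le> - (\<xi> j - c * delta j)" using le_funD[OF i1(1), of j] by simp
      moreover have "c * delta j \<le> - 1 * delta j" using \<open>c \<le> -1\<close> dn[of j] by (intro mult_right_mono) auto
      ultimately show "(0 :: nat \<Rightarrow> int) j \<le> (- (\<xi> + delta)) j" by simp
    qed
    ultimately show False using RR_neg_iff i2(2) by blast
  qed
  have "c = 0" using c1 c2 by linarith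
  then show "\<chi> = (\<lambda>v. 0)" using pc(2) st by simp
qed

text \<open>Reflections in the roots with equal coordinates at p and q move the alcove into the
  cylinder. The image of alpha_p is then shifted by a multiple of delta through
  \<open>omega\<close>, which takes the value -1 there and vanishes on all roots that define the
  cylinder.\<close>

lemma period_exists:
  assumes f: "frame f"
  shows "\<exists>x\<in>Ws. \<exists>\<chi>\<in>L. period (\<lambda>y. f (x y + \<chi> y \<cdot> delta))"
proof -
  define H where "H = {(\<lambda>y. x y + \<psi> y \<cdot> delta) | x \<psi>. x \<in> Ws \<and> \<psi> \<in> rows J}"
  define \<Psi> where "\<Psi> = {\<eta> \<in> RR. \<eta> p = \<eta> q}"
  have Jn: "J \<subseteq> {0..n}" by blast
  have HI: "(\<lambda>y. x y + \<psi> y \<cdot> delta) \<in> H" if "x \<in> Ws" "\<psi> \<in> rows J" for x \<psi> using that by (auto simp: H_def)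
  have Hf: "frame h" if hH: "h \<in> H" for h
  proof -
    obtain x \<psi> where h: "x \<in> Ws" "\<psi> \<in> rows J" "h = (\<lambda>y. x y + \<psi> y \<cdot> delta)" using hH unfolding H_def by blast
    have "h = ic \<psi> (inv x)" using W_inv(4)[OF Jn h(1)] by (auto simp: h(3) ic_def inv_inv_eq)
    then show ?thesis using frame_ic[OF rows_P[OF Jn h(2)] Ws_sub(2)[OF W_inv(1)[OF Jn h(1)]]] by simp
  qed
  have "h \<circ> rf \<eta> \<in> H" if hh: "h \<in> H" and e: "\<eta> \<in> \<Psi>" for h \<eta>
  proof -
    obtain x \<psi> where h: "x \<in> Ws" "\<psi> \<in> rows J" "h = (\<lambda>y. x y + \<psi> y \<cdot> delta)" using hh unfolding H_def by blast
    define \<beta> m where "\<beta> = \<eta> - \<eta> p \<cdot> delta" and "m = \<eta> p"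
    have b: "\<beta> \<in> Ds" using proj_fin[OF p, of \<eta>] e delta_pq by (simp add: \<beta>_def Ds_def fin_def \<Psi>_def)
    have eq: "\<eta> = \<beta> + m \<cdot> delta" by (simp add: \<beta>_def m_def)
    have "(h \<circ> rf \<eta>) y = (x \<circ> rf \<beta>) y + (\<psi> (rf \<beta> y) - m * crt \<beta> y) \<cdot> delta" for y
    proof -
      have "h (rf \<eta> y) = h (rf \<beta> y - (m * crt \<beta> y) \<cdot> delta)" unfolding eq rf_shift ..
      also have "\<dots> = x (rf \<beta> y) - (m * crt \<beta> y) \<cdot> delta + \<psi> (rf \<beta> y) \<cdot> delta"
        unfolding h(3) using linD(2,3)[OF weyl_group_lin[OF h(1)]] W_delta[OF Ws_sub(2)[OF h(1)]]
          flinD(2,3)[OF rows_flin[OF h(2)]] rows_delta[OF Jn h(2)] by simp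
      finally show ?thesis by (simp add: smult_diff algebra_simps)
    qed
    then have E: "h \<circ> rf \<eta> = (\<lambda>y. (x \<circ> rf \<beta>) y + (\<psi> (rf \<beta> y) - m * crt \<beta> y) \<cdot> delta)" by blast
    have M: "(\<lambda>y. \<psi> (rf \<beta> y) - m * crt \<beta> y) \<in> rows J"
      by (rule rows_diff[OF comp_rows[OF Jn h(2) rf_Ds[OF b]] rows_cmult[OF crt_Ds[OF b]]])
    show ?thesis unfolding E by (rule HI[OF weyl_group_comp[OF h(1) rf_Ds[OF b]] M])
  qed
  moreover have "\<Psi> \<subseteq> RR" by (auto simp: \<Psi>_def)
  ultimately obtain h where h: "h \<in> H" "\<forall>\<eta>\<in>\<Psi>. 0 \<le> \<eta> \<longrightarrow> 0 \<le> f (h \<eta>)"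
    using frame_exists[OF f HI[OF weyl_id rows_zero], of \<Psi>] Hf by blast
  obtain x \<psi> where x: "x \<in> Ws" "\<psi> \<in> rows J" "h = (\<lambda>y. x y + \<psi> y \<cdot> delta)" using h(1) unfolding H_def by blast
  have fh: "frame (\<lambda>y. f (h y))" by (rule frame_comp[OF f Hf[OF h(1)]])
  define \<xi> where "\<xi> = f (h (al p))"
  have xR: "\<xi> \<in> RR" using frameD(3)[OF fh al_RR[OF p(1)]] by (simp add: \<xi>_def)
  \<comment> \<open>The finite root zeta lies between -delta and delta. So the shift c is the
    coordinate of xi at the node 0, increased by 1 if zeta is positive.\<close>
  define \<zeta> where "\<zeta> = \<xi> - \<xi> 0 \<cdot> delta"
  have z0: "\<zeta> \<in> fin 0" using proj_fin[OF _ a0 xR] by (simp add: \<zeta>_def)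
  have zb: "0 \<le> delta - \<zeta>" "0 \<le> delta + \<zeta>" using fin_bound[OF _ a0 z0] by auto
  obtain c where c: "0 \<le> - (\<xi> - c \<cdot> delta)" "0 \<le> \<xi> - c \<cdot> delta + delta"
  proof (cases "0 \<le> \<zeta>")
    case True
    then have "0 \<le> - (\<xi> - (\<xi> 0 + 1) \<cdot> delta)" "0 \<le> \<xi> - (\<xi> 0 + 1) \<cdot> delta + delta"
      using zb(1) by (simp_all add: \<zeta>_def smult_add algebra_simps)
    then show ?thesis using that by blast
  next
    case False
    then have "0 \<le> - \<zeta>" using RR_neg_iff[of \<zeta>] z0 by (auto simp: fin_def)
    then show ?thesis using that[of "\<xi> 0"] zb(2) by (simp add: \<zeta>_def add.commute)
  qed
  define \<chi> where "\<chi> v = \<psi> v + c * omega v" for v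
  define f' where "f' y = f (x y + \<chi> y \<cdot> delta)" for y
  have f': "f' y = f (h y) + (c * omega y) \<cdot> delta" for y
  proof -
    have "x y + \<chi> y \<cdot> delta = h y + (c * omega y) \<cdot> delta" by (simp add: x(3) \<chi>_def smult_add add_ac)
    then show ?thesis unfolding f'_def using linD(1,2)[OF frameD(1)[OF f]] frameD(2)[OF f] by simp
  qed
  have "cyl f'" unfolding cyl_def
  proof (intro ballI impI)
    fix \<beta> assume b: "\<beta> \<in> Ds" "0 \<le> \<beta>"
    have o: "omega \<beta> = 0" "omega (delta - \<beta>) = 0" using b(1) delta_pq by (simp_all add: Ds_def omega_def)
    have "\<beta> \<in> \<Psi>" "delta - \<beta> \<in> \<Psi>" using b(1) cyl_RR[OF b(1)] delta_pq by (simp_all add: Ds_def \<Psi>_def)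
    moreover have "0 \<le> delta - \<beta>" by (rule RR_nonnegI[OF cyl_RR[OF b(1)], of p]) (use b(1) delta_pq in \<open>simp add: Ds_def\<close>)
    ultimately show "0 \<le> f' \<beta> \<and> 0 \<le> f' (delta - \<beta>)" unfolding f' o using h(2) b(2) by simp
  qed
  moreover have om: "omega (al p) = -1" "omega (- al p) = 1" "omega (al p + delta) = -1"
    using pq delta_pq by (simp_all add: omega_def simple_root_apply)
  have "0 \<le> f' (- al p)" "0 \<le> f' (al p + delta)"
    unfolding f' om using c frame_neg[OF fh] linD(1)[OF frameD(1)[OF fh]] frameD(2)[OF fh]
    by (simp_all add: \<xi>_def algebra_simps)
  ultimately have "period f'" by (simp add: period_def)
  then have "period (\<lambda>y. f (x y + \<chi> y \<cdot> delta))" unfolding f'_def .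
  moreover have "\<chi> \<in> L" using L_I[OF x(2), of c] unfolding \<chi>_def .
  ultimately show ?thesis using x(1) by (intro bexI[of _ x] bexI[of _ \<chi>])
qed

text \<open>The group with translations \<open>L\<close> and linear parts \<open>Ws\<close> acts on
  all pairs from \<open>P\<close> and \<open>Wp\<close>, and \<open>Sh\<close> is a fundamental
  domain: \<open>period_exists\<close> shows that every orbit meets it, \<open>period_unique\<close>
  that it does so once and with trivial stabilizer. Counting the pairs modulo \<open>L\<close> gives
  the product formula.\<close>

lemma card_Sh_L: "card Ws * card Sh = card (cls L ` P) * card Wp" and finite_Sh: "finite (cls L ` P) \<Longrightarrow> finite Sh"
proof -
  define F where "F = (\<lambda>(v :: (nat \<Rightarrow> int) \<Rightarrow> nat \<Rightarrow> int, \<phi>, u :: (nat \<Rightarrow> int) \<Rightarrow> nat \<Rightarrow> int).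
      (cls L (\<lambda>y. \<phi> (inv v y)), v \<circ> u))"
  have Jn: "J \<subseteq> {0..n}" "{0..n} - {p} \<subseteq> {0..n}" by auto
  have inj: "v1 = v2 \<and> \<phi>1 = \<phi>2 \<and> u1 = u2"
    if h: "v1 \<in> Ws" "v2 \<in> Ws" "(\<phi>1, u1) \<in> Sh" "(\<phi>2, u2) \<in> Sh"
      "cls L (\<lambda>y. \<phi>1 (inv v1 y)) = cls L (\<lambda>y. \<phi>2 (inv v2 y))" "v1 \<circ> u1 = v2 \<circ> u2"
    for v1 v2 \<phi>1 \<phi>2 u1 u2
  proof -
    have S: "\<phi>1 \<in> P" "u1 \<in> Wp" "period (ic \<phi>1 u1)" "\<phi>2 \<in> P" "u2 \<in> Wp" "period (ic \<phi>2 u2)"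
      using h(3,4) by (auto simp: Sh_def)
    define \<psi> where "\<psi> y = \<phi>1 (inv v1 y) - \<phi>2 (inv v2 y)" for y
    have psi: "\<psi> \<in> L" using h(5) unfolding cls_L \<psi>_def .
    define x where "x = inv v2 \<circ> v1"
    define \<chi> where "\<chi> y = \<psi> (v1 y)" for y
    have xW: "x \<in> Ws" unfolding x_def by (rule weyl_group_comp[OF W_inv(1)[OF Jn(1) h(2)] h(1)])
    have chi: "\<chi> \<in> L" unfolding \<chi>_def by (rule L_comp[OF psi h(1)])
    have uv: "v1 (u1 z) = v2 (u2 z)" for z using fun_cong[OF h(6), of z] by simp
    have ue: "inv u1 y = inv u2 (x y)" for y
    proof -
      have "v1 y = v2 (u2 (inv u1 y))" using uv[of "inv u1 y"] W_inv(2)[OF Jn(2) S(2)] by simp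
      then have "x y = u2 (inv u1 y)" using W_inv(3)[OF Jn(1) h(2)] by (simp add: x_def)
      then show ?thesis using W_inv(3)[OF Jn(2) S(5)] by simp
    qed
    have e: "ic \<phi>1 u1 y = ic \<phi>2 u2 (x y + \<chi> y \<cdot> delta)" for y
    proof -
      have i2: "inv u2 \<in> W" using W_inv(1)[OF Jn(2) S(5)] Ws_sub(3) by blast
      have "\<phi>1 y = \<chi> y + \<phi>2 (x y)" using W_inv(3)[OF Jn(1) h(1)] by (simp add: \<chi>_def \<psi>_def x_def)
      then show ?thesis unfolding ic_def ue
        using linD(1,2)[OF weyl_group_lin[OF i2]] W_delta[OF i2] flinD(1,2)[OF P_D(1)[OF S(4)]] P_D(3)[OF S(4)]
        by (simp add: smult_add add_ac)
    qed
    have un: "x = id" "\<chi> = (\<lambda>v. 0)"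
      using period_unique[OF frame_ic[OF S(1) Ws_sub(3)[OF S(2)]] frame_ic[OF S(4) Ws_sub(3)[OF S(5)]] S(3,6) xW chi e] by blast+
    have v: "v1 y = v2 y" for y
      using un(1) W_inv(2)[OF Jn(1) h(2), of "v1 y"] pointfree_idE[of "inv v2" v1] unfolding x_def by simp
    then have v12: "v1 = v2" by blast
    have u12: "u1 z = u2 z" for z using uv[of z] W_inv(3)[OF Jn(1) h(2)] v by metis
    have "\<phi>1 y = \<phi>2 y" for y
      using fun_cong[OF un(2), of y] W_inv(3)[OF Jn(1) h(2)] by (simp add: \<chi>_def \<psi>_def v12)
    then show ?thesis using v12 u12 by blast
  qed
  have bij: "bij_betw F (Ws \<times> Sh) (cls L ` P \<times> Wp)"
  proof (rule bij_betw_imageI)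
    show "inj_on F (Ws \<times> Sh)"
    proof (rule inj_onI)
      fix s t assume st: "s \<in> Ws \<times> Sh" "t \<in> Ws \<times> Sh" "F s = F t"
      obtain v1 \<phi>1 u1 v2 \<phi>2 u2 where e: "s = (v1, \<phi>1, u1)" "t = (v2, \<phi>2, u2)" by (metis prod_cases3)
      show "s = t" using st inj[of v1 v2 \<phi>1 u1 \<phi>2 u2] unfolding e F_def by (simp del: o_apply)
    qed
    show "F ` (Ws \<times> Sh) = cls L ` P \<times> Wp"
    proof
      show "F ` (Ws \<times> Sh) \<subseteq> cls L ` P \<times> Wp"
      proof
        fix t assume "t \<in> F ` (Ws \<times> Sh)"
        then obtain v \<phi> u where h: "v \<in> Ws" "(\<phi>, u) \<in> Sh" "t = F (v, \<phi>, u)" by (auto simp del: o_apply)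
        have "(\<lambda>y. \<phi> (inv v y)) \<in> P" using h(2) P_W Ws_sub(2)[OF W_inv(1)[OF Jn(1) h(1)]] by (auto simp: Sh_def)
        moreover have "v \<circ> u \<in> Wp" using weyl_group_comp[OF Ws_sub(1)[OF h(1)]] h(2) by (auto simp: Sh_def simp del: o_apply)
        ultimately show "t \<in> cls L ` P \<times> Wp" unfolding h(3) F_def by (simp del: o_apply)
      qed
      show "cls L ` P \<times> Wp \<subseteq> F ` (Ws \<times> Sh)"
      proof
        fix t assume "t \<in> cls L ` P \<times> Wp"
        then obtain \<phi> u where h: "\<phi> \<in> P" "u \<in> Wp" "t = (cls L \<phi>, u)" by auto
        obtain x \<chi> where x: "x \<in> Ws" "\<chi> \<in> L" "period (\<lambda>y. ic \<phi> u (x y + \<chi> y \<cdot> delta))"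
          using period_exists[OF frame_ic[OF h(1) Ws_sub(3)[OF h(2)]]] by blast
        define u' where "u' = inv x \<circ> u"
        define \<phi>' where "\<phi>' y = \<phi> (x y) + \<chi> y" for y
        have xi: "inv x \<in> Ws" by (rule W_inv(1)[OF Jn(1) x(1)])
        have u': "u' \<in> Wp" unfolding u'_def by (rule weyl_group_comp[OF Ws_sub(1)[OF xi] h(2)])
        have phi': "\<phi>' \<in> P" unfolding \<phi>'_def by (rule P_add[OF P_W[OF h(1) Ws_sub(2)[OF x(1)]] L_P[OF x(2)]])
        have iu: "inv u' y = inv u (x y)" for y
        proof -
          have "u' (inv u (x y)) = y" using W_inv(2)[OF Jn(2) h(2)] W_inv(3)[OF Jn(1) x(1)] by (simp add: u'_def)
          then show ?thesis using W_inv(3)[OF Jn(2) u'] by metis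
        qed
        have ui: "inv u \<in> W" using W_inv(1)[OF Jn(2) h(2)] Ws_sub(3) by blast
        have "ic \<phi>' u' y = ic \<phi> u (x y + \<chi> y \<cdot> delta)" for y
          unfolding ic_def iu \<phi>'_def using linD(1,2)[OF weyl_group_lin[OF ui]] W_delta[OF ui]
            flinD(1,2)[OF P_D(1)[OF h(1)]] P_D(3)[OF h(1)] by (simp add: smult_add add_ac)
        then have "ic \<phi>' u' = (\<lambda>y. ic \<phi> u (x y + \<chi> y \<cdot> delta))" by blast
        then have Sh: "(\<phi>', u') \<in> Sh" using x(3) phi' u' by (simp add: Sh_def)
        have "x \<circ> u' = u" unfolding u'_def using W_inv(2)[OF Jn(1) x(1)] by (intro ext) simp
        moreover have "cls L (\<lambda>y. \<phi>' (inv x y)) = cls L \<phi>"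
          unfolding cls_L \<phi>'_def
          using L_comp[OF x(2) xi] W_inv(2)[OF Jn(1) x(1)] by simp
        ultimately have "F (x, \<phi>', u') = t" unfolding F_def h(3) by (simp del: o_apply)
        then show "t \<in> F ` (Ws \<times> Sh)" using Sh x(1) by (metis SigmaI image_eqI)
      qed
    qed
  qed
  show "card Ws * card Sh = card (cls L ` P) * card Wp"
    using bij_betw_same_card[OF bij] by (simp add: card_cartesian_product)
  assume "finite (cls L ` P)"
  then have "finite (Ws \<times> Sh)" using bij_betw_finite[OF bij] finite_Wp by simp
  moreover have "Ws \<noteq> {}" using weyl_id by blast
  ultimately show "finite Sh" by (auto simp: finite_cartesian_product_iff)
qed

end

section \<open>Counting minuscule elements\<close>

context special_pair
begin

lemma pr_le:
  assumes "0 \<le> \<beta>" "j \<le> n" "\<beta> j = 0" "i \<le> n"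
  shows "pr j \<beta> \<le> C j i * \<beta> i"
proof -
  have "pr j \<beta> = C j i * \<beta> i + (\<Sum>k\<in>{..n} - {i}. C j k * \<beta> k)"
    unfolding pairing_def using assms(4) by (simp add: sum.remove[of "{..n}" i])
  moreover have "(\<Sum>k\<in>{..n} - {i}. C j k * \<beta> k) \<le> 0"
  proof (rule sum_nonpos)
    fix k assume k: "k \<in> {..n} - {i}"
    show "C j k * \<beta> k \<le> 0"
      using offdiag[OF assms(2), of k] k assms(3) le_funD[OF assms(1), of k]
      by (cases "k = j") (auto simp: mult_nonpos_nonneg)
  qed
  ultimately show ?thesis by simp
qed

lemma form_al_le: "\<beta> \<in> RR \<Longrightarrow> form \<beta> \<beta> \<le> form (al p) (al p) \<and> form \<beta> \<beta> \<le> form (al q) (al q)"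
  using RR_norm[of \<beta>] long0 long_special[OF p] long_special[OF q] p q by (auto simp: form_al_al)

lemma zero_delta: "(\<And>k. k > n \<Longrightarrow> v k = 0) \<Longrightarrow> form v v = 0 \<Longrightarrow> v = v p \<cdot> delta"
  by (rule form_zero_delta[OF p])

lemma crt_al_bound:
  assumes "\<beta> \<in> RR" "i \<le> n" "form \<beta> \<beta> \<le> form (al i) (al i)"
  shows "pr i \<beta> \<le> -2 \<Longrightarrow> \<beta> + al i = (\<beta> + al i) p \<cdot> delta" "pr i \<beta> \<ge> 2 \<Longrightarrow> \<beta> - al i = (\<beta> - al i) p \<cdot> delta"
proof -
  have o: "k > n \<Longrightarrow> (\<beta> + al i) k = 0" "k > n \<Longrightarrow> (\<beta> - al i) k = 0" for k
    using RR_outside[OF assms(1)] assms(2) by (simp_all add: simple_root_apply)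
  show "pr i \<beta> \<le> -2 \<Longrightarrow> \<beta> + al i = (\<beta> + al i) p \<cdot> delta"
    using crt_bound(2)[OF al_RR[OF assms(2)] assms(3)] crt_al[OF assms(2)] by (intro zero_delta o) auto
  show "pr i \<beta> \<ge> 2 \<Longrightarrow> \<beta> - al i = (\<beta> - al i) p \<cdot> delta"
    using crt_bound(1)[OF al_RR[OF assms(2)] assms(3)] crt_al[OF assms(2)] by (intro zero_delta o) auto
qed

text \<open>For nonadjacent \<open>p\<close> and \<open>q\<close>, growing roots one node at a time reaches a neighbour of \<open>p\<close>, as the
  diagram is connected; the growth only uses nodes that are not adjacent to \<open>q\<close>.\<close>

lemma bridge_root:
  assumes "C q p = 0"
  shows "\<exists>\<beta>\<in>RR. 0 \<le> \<beta> \<and> \<beta> p = 0 \<and> \<beta> q = 1 \<and> pr q \<beta> = 1 \<and> pr p \<beta> < 0"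
proof (rule ccontr)
  assume no: "\<not> ?thesis"
  define M where "M = {\<beta> \<in> RR. 0 \<le> \<beta> \<and> \<beta> p = 0 \<and> \<beta> q = 1 \<and> pr q \<beta> = 1}"
  have Mp: "pr p \<beta> \<ge> 0" if "\<beta> \<in> M" for \<beta> using no that by (force simp: M_def)
  define U where "U = {i. i \<le> n \<and> (\<exists>\<beta>\<in>M. \<beta> i > 0)}"
  have start: "refl q (al i) \<in> M \<and> refl q (al i) i = 1" if i: "i \<le> n" "i \<noteq> q" "C q i \<noteq> 0" for i
  proof -
    have ip: "i \<noteq> p" using i assms by auto
    have neg: "C q i < 0" using offdiag[OF q(1) i(1)] i by force
    \<comment> \<open>No root is longer than alpha_q, so an entry -2 would make alpha_i + alpha_q a
      multiple of delta; but its coordinates at p and q differ.\<close>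
    have "\<not> C q i \<le> -2"
    proof
      assume "C q i \<le> -2"
      then have "pr q (al i) \<le> -2" using i(1) by simp
      then have e: "al i + al q = (al i + al q) p \<cdot> delta"
        using crt_al_bound(1)[OF al_RR[OF i(1)] q(1)] form_al_le[OF al_RR[OF i(1)]] by blast
      have "(al i + al q) q = 1" "(al i + al q) p = 0" using ip i(2) pq by (auto simp: simple_root_apply)
      then show False using fun_cong[OF e, of q] by simp
    qed
    then have C1: "C q i = -1" using neg by linarith
    have e: "refl q (al i) = al i + al q" using i(1) by (simp add: simple_refl_alt C1)
    have R: "al i + al q \<in> RR" using RR_W[OF al_RR[OF i(1)] weyl_group_refl[of q]] q(1) e by simp
    have "pr q (al i + al q) = 1" using flinD(1)[OF flin_pairing[of C n q]] i(1) q(1) C1 diag by simp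
    then show ?thesis unfolding e M_def
      using R ip i(2) pq al_nonneg by (auto simp: simple_root_apply add_nonneg_nonneg)
  qed
  have "\<exists>i\<le>n. i \<noteq> q \<and> C q i \<noteq> 0"
  proof (rule ccontr)
    assume "\<not> ?thesis"
    then have "{q} = {..n}" using q(1) by (intro conn) auto
    then show False using p(1) pq by (metis atMost_iff singletonD)
  qed
  then obtain i0 where i0: "i0 \<le> n" "i0 \<noteq> q" "C q i0 \<noteq> 0" by blast
  then have qU: "q \<in> U" using start[OF i0] q(1) by (auto simp: U_def M_def intro!: bexI[of _ "refl q (al i0)"])
  have "U = {..n}"
  proof (rule conn)
    fix i j assume iU: "i \<in> U" and j: "j \<le> n" and c: "C i j \<noteq> 0"
    show "j \<in> U"
    proof (rule ccontr)
      assume jU: "j \<notin> U"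
      obtain \<beta> where b: "\<beta> \<in> M" "\<beta> i > 0" and i: "i \<le> n" using iU by (auto simp: U_def)
      have bR: "\<beta> \<in> RR" "0 \<le> \<beta>" "\<beta> p = 0" "\<beta> q = 1" "pr q \<beta> = 1" using b(1) by (auto simp: M_def)
      have jq: "j \<noteq> q" using qU jU by auto
      \<comment> \<open>A neighbour of q was already reached by \<open>start\<close>. So j is not
        adjacent to q, and reflecting at j keeps the pairing with the coroot of q.\<close>
      have Cqj: "C q j = 0" using start[OF j jq] jU j by (force simp: U_def)
      have "\<not> \<beta> j > 0" using jU j b(1) by (auto simp: U_def)
      then have bj: "\<beta> j = 0" using le_funD[OF bR(2), of j] by simp
      have "i \<noteq> j" using bj b(2) by auto
      then have "C j i < 0" using offdiag[OF j i] C_zero_sym[OF i j] c by force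
      then have "C j i * \<beta> i < 0" using b(2) by (simp add: mult_neg_pos)
      then have neg: "pr j \<beta> < 0" using pr_le[OF bR(2) j bj i] by linarith
      have jp: "j \<noteq> p" using Mp[OF b(1)] neg by auto
      have e: "refl j \<beta> = \<beta> + (- pr j \<beta>) \<cdot> al j" by (simp add: simple_refl_alt)
      have "refl j \<beta> \<in> M" unfolding M_def
      proof (intro CollectI conjI)
        show "refl j \<beta> \<in> RR" using RR_W[OF bR(1) weyl_group_refl[of j]] j by simp
        show "0 \<le> refl j \<beta>" unfolding le_fun_def
        proof
          fix k show "(0 :: nat \<Rightarrow> int) k \<le> refl j \<beta> k"
            using le_funD[OF bR(2), of k] bj neg by (cases "k = j") (auto simp: e simple_root_apply)
        qed
        show "refl j \<beta> p = 0" "refl j \<beta> q = 1" using jp jq bR by (simp_all add: simple_refl_other)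
        show "pr q (refl j \<beta>) = 1" using flinD(2,3)[OF flin_pairing[of C n q]] bR(5) Cqj j by (simp add: simple_refl_alt)
      qed
      moreover have "refl j \<beta> j > 0" using bj neg by (simp add: e simple_root_apply)
      ultimately show False using jU j by (auto simp: U_def)
    qed
  qed (use qU in \<open>auto simp: U_def\<close>)
  then have "p \<in> U" using p(1) by auto
  then show False by (auto simp: U_def M_def)
qed

text \<open>For adjacent p and q the root delta - alpha_p is reflected at q. Otherwise
  \<open>bridge_root\<close> provides beta such that beta - alpha_q and beta + alpha_p are roots,
  and the summands are beta - alpha_q and delta - beta - alpha_p. The splitting yields the condition
  at q in \<open>period_q\<close>.\<close>

lemma delta_split:
  "\<exists>g1 g2. delta - al p - al q = g1 + g2 \<and> (g1 = 0 \<or> g1 \<in> Ds) \<and> (g2 = 0 \<or> g2 \<in> Ds) \<and> 0 \<le> g1 \<and> 0 \<le> g2"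
proof (cases "C q p = 0")
  case False
  define \<beta> where "\<beta> = delta - al p"
  have "- (al p - delta) = \<beta>" by (simp add: \<beta>_def)
  then have R: "\<beta> \<in> RR" using RR_uminus[of "al p - delta"] RR_shift1[OF al_RR[OF p(1)]] by metis
  have neg: "C q p < 0" using offdiag[OF q(1) p(1)] pq False by force
  have pb: "pr q \<beta> = - C q p"
    using flinD(3)[OF flin_pairing[of C n q]] pr_delta[OF q(1)] p(1) by (simp add: \<beta>_def)
  show ?thesis
  \<comment> \<open>An entry -2 occurs only for the diagram with two nodes, where delta = alpha_p +
    alpha_q and both summands are zero.\<close>
  proof (cases "C q p \<le> -2")
    case True
    then have "pr q \<beta> \<ge> 2" using pb by simp
    then have "\<beta> - al q = (\<beta> - al q) p \<cdot> delta"
      using crt_al_bound(2)[OF R q(1)] form_al_le[OF R] by blast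
    moreover have "(\<beta> - al q) p = 0" using pq delta_pq by (simp add: \<beta>_def simple_root_apply)
    ultimately have "\<beta> - al q = 0" by (simp only: smult_0)
    then show ?thesis by (intro exI[of _ 0]) (simp add: \<beta>_def)
  next
    case False
    then have "pr q \<beta> = 1" using neg pb by simp
    then have "refl q \<beta> = \<beta> - al q" by (simp add: simple_refl_alt)
    then have "\<beta> - al q \<in> RR" using RR_W[OF R weyl_group_refl[of q]] q(1) by simp
    then have "\<beta> - al q \<in> Ds" using pq delta_pq by (simp add: Ds_def \<beta>_def simple_root_apply)
    moreover have "0 \<le> \<beta> - al q" unfolding le_fun_def
    proof
      fix k show "(0 :: nat \<Rightarrow> int) k \<le> (\<beta> - al q) k"
        using a_pos[of k] pq p q by (auto simp: \<beta>_def simple_root_apply delta_def)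
    qed
    ultimately show ?thesis by (intro exI[of _ "\<beta> - al q"] exI[of _ 0]) (simp add: \<beta>_def)
  qed
next
  case True
  then obtain \<beta> where b: "\<beta> \<in> RR" "0 \<le> \<beta>" "\<beta> p = 0" "\<beta> q = 1" "pr q \<beta> = 1" "pr p \<beta> < 0"
    using bridge_root by blast
  \<comment> \<open>Otherwise beta + alpha_p = delta; but the coroot of q takes the value 1 on the
    left side and 0 on the right.\<close>
  have "\<not> pr p \<beta> \<le> -2"
  proof
    assume "pr p \<beta> \<le> -2"
    then have e: "\<beta> + al p = (\<beta> + al p) p \<cdot> delta"
      using crt_al_bound(1)[OF b(1) p(1)] form_al_le[OF b(1)] by blast
    have "(\<beta> + al p) p = 1" using b by (simp add: simple_root_apply)
    then have "\<beta> + al p = delta" using e by (simp only: smult_1)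
    then have "pr q (\<beta> + al p) = 0" using pr_delta[OF q(1)] by simp
    moreover have "pr q (\<beta> + al p) = 1" using flinD(1)[OF flin_pairing[of C n q]] b(5) True p(1) by simp
    ultimately show False by simp
  qed
  then have "pr p \<beta> = -1" using b(6) by linarith
  then have "refl p \<beta> = \<beta> + al p" by (simp add: simple_refl_alt)
  then have bp: "\<beta> + al p \<in> RR" using RR_W[OF b(1) weyl_group_refl[of p]] p(1) by simp
  have "refl q \<beta> = \<beta> - al q" using b(5) by (simp add: simple_refl_alt)
  then have bq: "\<beta> - al q \<in> RR" using RR_W[OF b(1) weyl_group_refl[of q]] q(1) by simp
  have g1: "\<beta> - al q \<in> Ds" using bq b pq by (simp add: Ds_def simple_root_apply)
  have g1n: "0 \<le> \<beta> - al q" using b(2,4) by (auto simp: le_fun_def simple_root_apply)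
  have "- (\<beta> + al p - delta) = delta - \<beta> - al p" by simp
  then have "delta - \<beta> - al p \<in> RR" using RR_uminus RR_shift1[OF bp] by metis
  then have g2: "delta - \<beta> - al p \<in> Ds" using b pq delta_pq by (simp add: Ds_def simple_root_apply)
  have "0 \<le> delta - \<beta>" using fin_bound(1)[OF p, of \<beta>] b by (simp add: fin_def)
  then have g2n: "0 \<le> delta - \<beta> - al p" using delta_pq b(3) by (auto simp: le_fun_def simple_root_apply)
  show ?thesis
    by (intro exI[of _ "\<beta> - al q"] exI[of _ "delta - \<beta> - al p"]) (use g1 g1n g2 g2n in simp)
qed

lemma cyl_delta_minus: "cyl f \<Longrightarrow> frame f \<Longrightarrow> g = 0 \<or> g \<in> Ds \<Longrightarrow> 0 \<le> g \<Longrightarrow> 0 \<le> f (delta - g)"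
  using frameD(2) delta_nonneg unfolding cyl_def by auto

text \<open>By \<open>delta_split\<close>, alpha_q + delta = -alpha_p + (delta - g1) + (delta - g2),
  and a period is nonnegative on all three summands.\<close>

lemma period_q:
  assumes f: "frame f" "period f" shows "0 \<le> f (al q + delta)"
proof -
  obtain g1 g2 where g: "delta - al p - al q = g1 + g2" "g1 = 0 \<or> g1 \<in> Ds" "g2 = 0 \<or> g2 \<in> Ds" "0 \<le> g1" "0 \<le> g2"
    using delta_split by blast
  have c: "cyl f" using f(2) by (simp add: period_def)
  have "al q + delta = - al p + ((delta - g1) + (delta - g2))"
    using g(1) by (simp add: algebra_simps)
  then have "f (al q + delta) = f (- al p) + (f (delta - g1) + f (delta - g2))"
    using linD(1)[OF frameD(1)[OF f(1)]] by metis
  moreover have "0 \<le> f (- al p)" using f(2) by (simp add: period_def)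
  ultimately show ?thesis
    using cyl_delta_minus[OF c f(1) g(2,4)] cyl_delta_minus[OF c f(1) g(3,5)] by (metis add_nonneg_nonneg)
qed

definition S where
  "S = {w \<in> W. cyl (inv w) \<and> 0 \<le> inv w (al p + delta) \<and> 0 \<le> inv w (al q + delta)}"

lemma frame_inv: "w \<in> W \<Longrightarrow> frame (inv w)"
  using frame_W W_inv'(1) by blast

lemma S_split: "S = S1 \<union> S2" "S1 \<inter> S2 = {}"
proof -
  have "w \<in> S \<longleftrightarrow> w \<in> S1 \<union> S2" if w: "w \<in> W" for w
  proof -
    let ?f = "inv w"
    have f: "frame ?f" by (rule frame_inv[OF w])
    have co: "0 \<le> ?f (- al p) \<longleftrightarrow> \<not> 0 \<le> ?f (al p)"
      using RR_neg_iff[OF frameD(3)[OF f al_RR[OF p(1)]]] frame_neg[OF f] by simp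
    have ad: "0 \<le> ?f (al p + delta)" if "0 \<le> ?f (al p)"
      using add_nonneg_nonneg[OF that delta_nonneg] linD(1)[OF frameD(1)[OF f]] frameD(2)[OF f] by simp
    show ?thesis using w co ad period_q[OF f] unfolding S_def S1_def S2_def period_def by blast
  qed
  then show "S = S1 \<union> S2" by (auto simp: S_def S1_def S2_def)
  show "S1 \<inter> S2 = {}"
  proof (rule equals0I)
    fix w assume "w \<in> S1 \<inter> S2"
    then have w: "w \<in> W" "0 \<le> inv w (al p)" "0 \<le> inv w (- al p)" by (auto simp: S1_def S2_def period_def)
    then show False using RR_neg_iff[OF frameD(3)[OF frame_inv[OF w(1)] al_RR[OF p(1)]]] frame_neg[OF frame_inv[OF w(1)]] by simp
  qed
qed

abbreviation Q where "Q \<equiv> rows {0..n}"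

lemma cls_Q: "cls Q \<phi> = cls Q \<psi> \<longleftrightarrow> (\<lambda>v. \<phi> v - \<psi> v) \<in> Q"
  by (rule cls_eq) (rule rows_zero rows_diff; assumption)+

text \<open>Each pair in \<open>Sh\<close> has the sign pattern of a unique element of W. The pairs
  with a given pattern are a torsor under the stabilizer of the fundamental alcove in the extended
  group, which the translation part identifies with P/Q; so recording the class modulo
  \<open>Q\<close> makes the map bijective.\<close>

lemma card_Sh_Q: "card Sh = card S2 * card (cls Q ` P)" and finite_S2: "finite Sh \<Longrightarrow> finite S2"
proof -
  have pn: "{0..n} - {p} \<subseteq> {0..n}" by blast
  define good where "good \<phi> u w \<longleftrightarrow> w \<in> W \<and> (\<forall>\<eta>\<in>RR. 0 \<le> ic \<phi> u \<eta> \<longleftrightarrow> 0 \<le> inv w \<eta>)" for \<phi> u w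
  define g where "g \<phi> u = (SOME w. good \<phi> u w)" for \<phi> u
  have g: "good \<phi> u (g \<phi> u)" if h: "\<phi> \<in> P" "u \<in> Wp" for \<phi> u
  proof -
    have "\<exists>w. good \<phi> u w" using frame_W_exists[OF frame_ic[OF h(1) Ws_sub(3)[OF h(2)]]] unfolding good_def by blast
    then show ?thesis unfolding g_def by (rule someI_ex)
  qed
  have g_eq: "g \<phi> u = w" if h: "\<phi> \<in> P" "u \<in> Wp" "good \<phi> u w" for \<phi> u w
    using g[OF h(1,2)] h(3) unfolding good_def by (intro W_inv_unique) auto
  define G where "G = (\<lambda>(\<phi>, u). (g \<phi> u, cls Q \<phi>))"
  have inj: "\<phi>1 = \<phi>2 \<and> u1 = u2"
    if h: "\<phi>1 \<in> P" "u1 \<in> Wp" "\<phi>2 \<in> P" "u2 \<in> Wp" "g \<phi>1 u1 = g \<phi>2 u2" "cls Q \<phi>1 = cls Q \<phi>2" for \<phi>1 \<phi>2 u1 u2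
  proof -
    define w where "w = g \<phi>1 u1"
    have gd: "good \<phi>1 u1 w" "good \<phi>2 u2 w" using g[OF h(1,2)] g[OF h(3,4)] h(5) by (auto simp: w_def)
    define \<chi> where "\<chi> y = \<phi>1 (u2 y) - \<phi>2 (u2 y)" for y
    have "(\<lambda>v. \<phi>1 v - \<phi>2 v) \<in> Q" using h(6) unfolding cls_Q .
    then have chi: "\<chi> \<in> Q" unfolding \<chi>_def using comp_rows[OF order_refl _ Ws_sub(3)[OF h(4)]] by blast
    have mchi: "(\<lambda>v. (-1) * \<chi> v) \<in> Q" by (rule rows_cmult[OF chi])
    define z where "z = inv u1 \<circ> u2"
    have zW: "z \<in> Wp" unfolding z_def by (rule weyl_group_comp[OF W_inv(1)[OF pn h(2)] h(4)])
    define k where "k = z \<circ> T (\<lambda>v. (-1) * \<chi> v)"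
    have kW: "k \<in> W" unfolding k_def by (rule weyl_group_comp[OF Ws_sub(3)[OF zW] T_rows_W[OF order_refl mchi]])
    have k: "k y = z y + \<chi> y \<cdot> delta" for y
      using linD(1,2,3,4)[OF weyl_group_lin[OF zW]] W_delta[OF Ws_sub(3)[OF zW]] by (simp add: k_def T_def)
    have i1: "inv u1 \<in> W" using W_inv(1)[OF pn h(2)] Ws_sub(3) by blast
    \<comment> \<open>This map inverts the second frame, so k compares two frames with the same sign
      pattern; it lies in W because the translation parts agree modulo \<open>Q\<close>.\<close>
    define t where "t y = u2 y - \<phi>2 (u2 y) \<cdot> delta" for y
    have t1: "ic \<phi>1 u1 (t y) = k y" for y
      unfolding ic_def t_def k using linD(2,3)[OF weyl_group_lin[OF i1]] W_delta[OF i1]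
        flinD(2,3)[OF P_D(1)[OF h(1)]] P_D(3)[OF h(1)] by (simp add: \<chi>_def z_def smult_diff)
    have i2: "inv u2 \<in> W" using W_inv(1)[OF pn h(4)] Ws_sub(3) by blast
    have t2: "ic \<phi>2 u2 (t y) = y" for y
      unfolding ic_def t_def using linD(2,3)[OF weyl_group_lin[OF i2]] W_delta[OF i2] W_inv(3)[OF pn h(4)]
        flinD(2,3)[OF P_D(1)[OF h(3)]] P_D(3)[OF h(3)] by simp
    have tR: "t \<eta> \<in> RR" if "\<eta> \<in> RR" for \<eta>
      using RR_shift[OF RR_W[OF that Ws_sub(3)[OF h(4)]], of "- \<phi>2 (u2 \<eta>)"] by (simp add: t_def)
    have "k = id"
    proof (rule W_id_frame[OF kW])
      fix \<eta> assume e: "\<eta> \<in> RR" "0 \<le> \<eta>"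
      then have "0 \<le> ic \<phi>2 u2 (t \<eta>)" using t2 by simp
      then have "0 \<le> ic \<phi>1 u1 (t \<eta>)" using gd tR[OF e(1)] unfolding good_def by blast
      then show "0 \<le> k \<eta>" using t1 by simp
    qed
    then have kid: "z y + \<chi> y \<cdot> delta = y" for y using k[of y] by simp
    have c0: "\<chi> y = 0" for y
      using fun_cong[OF kid[of y], of p] Wp_coord[OF zW, of y] delta_pq by simp
    have zid: "z y = y" for y using kid[of y] c0[of y] by simp
    have u: "u1 y = u2 y" for y using W_inv(2)[OF pn h(2), of "u2 y"] zid[of y] by (simp add: z_def)
    have "\<phi>1 y = \<phi>2 y" for y
      using c0[of "inv u2 y"] W_inv(2)[OF pn h(4), of y] by (simp add: \<chi>_def)
    then show ?thesis using u by blast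
  qed
  have per: "period (ic \<phi> u) \<longleftrightarrow> period (inv w)" if "good \<phi> u w" for \<phi> u w
    using that unfolding good_def by (intro period_transfer) auto
  have bij: "bij_betw G Sh (S2 \<times> cls Q ` P)"
  proof (rule bij_betw_imageI)
    show "inj_on G Sh"
    proof (rule inj_onI)
      fix s t assume st: "s \<in> Sh" "t \<in> Sh" "G s = G t"
      obtain \<phi>1 u1 \<phi>2 u2 where e: "s = (\<phi>1, u1)" "t = (\<phi>2, u2)" by fastforce
      show "s = t" using st inj[of \<phi>1 u1 \<phi>2 u2] unfolding e G_def Sh_def by simp
    qed
    show "G ` Sh = S2 \<times> cls Q ` P"
    proof
      show "G ` Sh \<subseteq> S2 \<times> cls Q ` P"
      proof
        fix t assume "t \<in> G ` Sh"
        then obtain \<phi> u where h: "\<phi> \<in> P" "u \<in> Wp" "period (ic \<phi> u)" "t = (g \<phi> u, cls Q \<phi>)" by (auto simp: Sh_def G_def)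
        have "g \<phi> u \<in> S2" using per[OF g[OF h(1,2)]] h(3) g[OF h(1,2)] by (simp add: S2_def good_def)
        then show "t \<in> S2 \<times> cls Q ` P" using h by simp
      qed
      show "S2 \<times> cls Q ` P \<subseteq> G ` Sh"
      proof
        fix t assume "t \<in> S2 \<times> cls Q ` P"
        then obtain w \<phi>0 where h: "w \<in> W" "period (inv w)" "\<phi>0 \<in> P" "t = (w, cls Q \<phi>0)" by (auto simp: S2_def)
        \<comment> \<open>The translation in the given class has the pattern of some w1, and x
          carries this pattern to that of w. Decomposing x changes the translation part only within
          its class modulo \<open>Q\<close>.\<close>
        have f0: "frame (ic \<phi>0 id)" by (rule frame_ic[OF h(3) weyl_id])
        obtain w1 where w1: "w1 \<in> W" "\<forall>\<eta>\<in>RR. 0 \<le> ic \<phi>0 id \<eta> \<longleftrightarrow> 0 \<le> inv w1 \<eta>"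
          using frame_W_exists[OF f0] by blast
        define x where "x = w \<circ> inv w1"
        have xW: "x \<in> W" unfolding x_def by (rule weyl_group_comp[OF h(1) W_inv'(1)[OF w1(1)]])
        obtain \<psi> u where d: "\<psi> \<in> Q" "u \<in> Wp" "x = T \<psi> \<circ> u" using W_decomp[OF p xW] by blast
        have ui: "inv u \<in> W" using W_inv(1)[OF pn d(2)] Ws_sub(3) by blast
        define \<phi> where "\<phi> y = \<psi> y + \<phi>0 (inv u y)" for y
        have phiP: "\<phi> \<in> P" unfolding \<phi>_def by (rule P_add[OF rows_P[OF order_refl d(1)] P_W[OF h(3) ui]])
        have xinv: "inv x y = inv u y + \<psi> y \<cdot> delta" for y
        proof -
          have "x (inv u y + \<psi> y \<cdot> delta) = y"
            using linD(1,2)[OF weyl_group_lin[OF d(2)]] W_delta[OF Ws_sub(3)[OF d(2)]] W_inv(2)[OF pn d(2)]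
              flinD(1,2)[OF rows_flin[OF d(1)]] rows_delta[OF order_refl d(1)] by (simp add: d(3) T_def)
          then show ?thesis using W_inv'(3)[OF xW] by metis
        qed
        have icx: "ic \<phi> u y = ic \<phi>0 id (inv x y)" for y
          using flinD(1,2)[OF P_D(1)[OF h(3)]] P_D(3)[OF h(3)] by (simp add: ic_def xinv \<phi>_def smult_add add_ac)
        have xi: "inv x y = w1 (inv w y)" for y
        proof -
          have "x (w1 (inv w y)) = y" using W_inv'(3)[OF w1(1)] W_inv'(2)[OF h(1)] by (simp add: x_def)
          then show ?thesis using W_inv'(3)[OF xW] by metis
        qed
        have gd: "good \<phi> u w" unfolding good_def
        proof (intro conjI ballI)
          fix \<eta> assume e: "\<eta> \<in> RR"
          have "inv x \<eta> \<in> RR" by (rule RR_W[OF e W_inv'(1)[OF xW]])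
          then have "0 \<le> ic \<phi> u \<eta> \<longleftrightarrow> 0 \<le> inv w1 (inv x \<eta>)" using w1(2) icx by simp
          then show "0 \<le> ic \<phi> u \<eta> \<longleftrightarrow> 0 \<le> inv w \<eta>" unfolding xi using W_inv'(3)[OF w1(1)] by simp
        qed (rule h(1))
        have "(\<phi>, u) \<in> Sh" using phiP d(2) per[OF gd] h(2) by (simp add: Sh_def)
        moreover have "cls Q \<phi> = cls Q \<phi>0"
        proof -
          have "(\<lambda>v. \<phi>0 v - \<phi>0 (inv u v)) \<in> Q" by (rule diff_comp_rows[OF order_refl P_D(1)[OF h(3)] ui])
          from rows_diff[OF d(1) this] show ?thesis unfolding cls_Q \<phi>_def by (simp add: algebra_simps)
        qed
        ultimately show "t \<in> G ` Sh" using g_eq[OF phiP d(2) gd] unfolding h(4) G_def by (intro image_eqI[of _ _ "(\<phi>, u)"]) auto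
      qed
    qed
  qed
  show "card Sh = card S2 * card (cls Q ` P)"
    using bij_betw_same_card[OF bij] by (simp add: card_cartesian_product)
  assume "finite Sh"
  then have "finite (S2 \<times> cls Q ` P)" using bij_betw_finite[OF bij] by simp
  moreover have "cls Q ` P \<noteq> {}" using rows_P[OF order_refl rows_zero] by blast
  ultimately show "finite S2" by (auto simp: finite_cartesian_product_iff)
qed

text \<open>These are the minimal representatives of the cosets of \<open>Ws\<close> in
  \<open>Wp\<close>. The inverse of an element of \<open>Wp\<close> permutes the finite roots at p,
  so the affine conditions hold by themselves. Conversely, the conditions of \<open>S1\<close> make
  the inverse of w nonnegative on delta - beta for all finite beta, and this places w in
  \<open>Wp\<close>.\<close>

lemma S1_eq: "S1 = {w \<in> Wp. \<forall>i\<in>J. 0 \<le> inv w (al i)}"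
proof
  have pn: "{0..n} - {p} \<subseteq> {0..n}" by blast
  show "{w \<in> Wp. \<forall>i\<in>J. 0 \<le> inv w (al i)} \<subseteq> S1"
  proof
    fix w assume "w \<in> {w \<in> Wp. \<forall>i\<in>J. 0 \<le> inv w (al i)}"
    then have w: "w \<in> Wp" "\<And>i. i \<in> J \<Longrightarrow> 0 \<le> inv w (al i)" by auto
    have wi: "inv w \<in> Wp" by (rule W_inv(1)[OF pn w(1)])
    have f: "frame (inv w)" by (rule frame_inv[OF Ws_sub(3)[OF w(1)]])
    have b: "inv w \<beta> \<in> fin p" if "\<beta> \<in> fin p" for \<beta>
      using frameD(3)[OF f] Wp_coord[OF wi] that by (auto simp: fin_def)
    have fl: "inv w (delta - \<beta>) = delta - inv w \<beta>" "inv w (al q + delta) = delta + inv w (al q)" for \<beta>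
      using linD(1,3)[OF frameD(1)[OF f]] frameD(2)[OF f] by (simp_all add: add.commute)
    have "cyl (inv w)" unfolding cyl_def
    proof (intro ballI impI conjI)
      fix \<beta> assume be: "\<beta> \<in> Ds" "0 \<le> \<beta>"
      have nz: "i \<in> J" if "i \<le> n" "\<beta> i \<noteq> 0" for i using be(1) that by (auto simp: Ds_def)
      show "0 \<le> inv w \<beta>"
        by (rule nonneg_comb[OF frameD(1)[OF f]]) (use RR_outside[OF Ds_RR[OF be(1)]] be(2) nz w(2) in auto)
      show "0 \<le> inv w (delta - \<beta>)" unfolding fl by (rule fin_bound(1)[OF p b[OF Ds_fin[OF be(1)]]])
    qed
    moreover have "0 \<le> inv w (al p)"
      by (rule RR_nonnegI[OF frameD(3)[OF f al_RR[OF p(1)]], of p]) (simp add: Wp_coord[OF wi] simple_root_apply)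
    moreover have "al q \<in> fin p" using al_RR[OF q(1)] pq by (simp add: fin_def simple_root_apply)
    then have "0 \<le> inv w (al q + delta)" unfolding fl by (rule fin_bound(2)[OF p b])
    ultimately show "w \<in> S1" using Ws_sub(3)[OF w(1)] by (simp add: S1_def)
  qed
  show "S1 \<subseteq> {w \<in> Wp. \<forall>i\<in>J. 0 \<le> inv w (al i)}"
  proof
    fix w assume "w \<in> S1"
    then have w: "w \<in> W" "cyl (inv w)" "0 \<le> inv w (al p)" "0 \<le> inv w (al q + delta)" by (auto simp: S1_def)
    have f: "frame (inv w)" by (rule frame_inv[OF w(1)])
    have fl: "inv w (u + v) = inv w u + inv w v" "inv w (u - v) = inv w u - inv w v" "inv w delta = delta" "inv w (- v) = - inv w v" for u v
      using linD(1,3,4)[OF frameD(1)[OF f]] frameD(2)[OF f] by simp_all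
    have alJ: "0 \<le> inv w (al i)" if "i \<in> J" for i
      using w(2) al_Ds[OF that] al_nonneg by (auto simp: cyl_def)
    \<comment> \<open>Cases by the coordinate of beta at q: for 1, delta - beta is a nonnegative
      combination of alpha_p and the simple roots in J; for -1, it is alpha_q + delta plus a
      nonnegative combination of the simple roots in J.\<close>
    have D: "0 \<le> inv w (delta - \<beta>)" if be: "\<beta> \<in> fin p" for \<beta>
    proof -
      have R: "\<beta> \<in> RR" "\<beta> p = 0" using be by (auto simp: fin_def)
      consider "\<beta> q = 0" "0 \<le> \<beta>" | "\<beta> q = 0" "0 \<le> - \<beta>" | "\<beta> q = 1" | "\<beta> q = -1"
        using fin_q[OF be] RR_neg_iff[OF R(1)] by auto
      then show ?thesis
      proof cases
        case 1
        then show ?thesis using w(2) R by (auto simp: cyl_def Ds_def)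
      next
        case 2
        then have "0 \<le> inv w (- \<beta>)" using w(2) R RR_uminus[OF R(1)] by (auto simp: cyl_def Ds_def)
        from add_nonneg_nonneg[OF delta_nonneg this] show ?thesis by (simp add: fl)
      next
        case 3
        have dR: "delta - \<beta> \<in> RR" using RR_shift1[OF RR_uminus[OF R(1)]] by (simp add: add.commute)
        have ali: "0 \<le> inv w (al i)" if "i \<le> n" "(delta - \<beta>) i \<noteq> 0" for i
        proof -
          have "i \<noteq> q" using that 3 delta_pq by auto
          then show ?thesis using alJ[of i] w(3) that(1) by (cases "i = p") auto
        qed
        show ?thesis by (rule nonneg_comb[OF frameD(1)[OF f] RR_outside[OF dR] fin_bound(1)[OF p be] ali])
      next
        case 4
        have nb: "0 \<le> - \<beta>" using RR_neg_iff[OF R(1)] le_funD[of 0 \<beta> q] 4 by auto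
        have "0 \<le> inv w (- \<beta> - al q)"
        proof (rule nonneg_comb[OF frameD(1)[OF f]])
          show "(- \<beta> - al q) k = 0" if "k > n" for k using RR_outside[OF R(1) that] that q(1) by (simp add: simple_root_apply)
          show "0 \<le> - \<beta> - al q" unfolding le_fun_def
          proof
            fix k show "(0 :: nat \<Rightarrow> int) k \<le> (- \<beta> - al q) k" using le_funD[OF nb, of k] 4 by (simp add: simple_root_apply)
          qed
          show "0 \<le> inv w (al i)" if "i \<le> n" "(- \<beta> - al q) i \<noteq> 0" for i
          proof -
            have "i \<noteq> q" "i \<noteq> p" using that(2) 4 R(2) pq by (auto simp: simple_root_apply)
            then show ?thesis using alJ[of i] that(1) by simp
          qed
        qed
        from add_nonneg_nonneg[OF w(4) this] show ?thesis by (simp add: fl)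
      qed
    qed
    obtain h where h: "h \<in> Wp" "\<forall>\<eta>\<in>fin p. 0 \<le> \<eta> \<longrightarrow> 0 \<le> inv w (h \<eta>)"
    proof -
      have "rf \<eta> \<in> Wp" if "\<eta> \<in> fin p" for \<eta>
        by (rule rf_in_weyl_supp) (use that RR_outside[of \<eta>] in \<open>force simp: fin_def\<close>)+
      then show ?thesis using that frame_exists[OF f weyl_id[of C n "{0..n} - {p}"], of "fin p"] frame_W Ws_sub(3) weyl_group_comp
        by (auto simp: fin_def simp del: o_apply)
    qed
    have "inv w \<circ> h = id"
    proof (rule W_pos_id[OF weyl_group_comp[OF W_inv'(1)[OF w(1)] Ws_sub(3)[OF h(1)]]])
      fix i assume i: "i \<le> n"
      show "0 \<le> (inv w \<circ> h) (al i)"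
      proof (cases "i = p")
        case False
        then have "al i \<in> fin p" using al_RR[OF i] by (simp add: fin_def simple_root_apply)
        then show ?thesis using h(2) al_nonneg by simp
      next
        case True
        \<comment> \<open>As h maps delta - alpha_p to a finite root, D applied to that root gives
          the sign of the image of alpha_p.\<close>
        have "- (al p - delta) = delta - al p" by simp
        then have "delta - al p \<in> RR" using RR_uminus RR_shift1[OF al_RR[OF p(1)]] by metis
        then have "h (delta - al p) \<in> fin p"
          using RR_W[OF _ Ws_sub(3)[OF h(1)]] Wp_coord[OF h(1)] delta_pq by (simp add: fin_def simple_root_apply)
        from D[OF this] show ?thesis
          using True linD(3)[OF weyl_group_lin[OF h(1)]] W_delta[OF Ws_sub(3)[OF h(1)]] by simp
      qed
    qed
    then have "inv w (h v) = v" for v by (simp add: pointfree_idE)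
    then have "w = h" using W_inv'(2)[OF w(1)] by (metis ext)
    then show "w \<in> {w \<in> Wp. \<forall>i\<in>J. 0 \<le> inv w (al i)}" using h(1) alJ by simp
  qed
qed

text \<open>Every element of \<open>Wp\<close> factors uniquely into an element of \<open>Ws\<close>
  and one of \<open>S1\<close>: \<open>frame_exists\<close> for the height zero roots gives the
  factors, and \<open>W_pos_id\<close> applied to the quotient of two first factors gives
  uniqueness.\<close>

lemma card_S1: "card Ws * card S1 = card Wp" and finite_S1: "finite S1"
proof -
  have pn: "{0..n} - {p} \<subseteq> {0..n}" and Jn: "J \<subseteq> {0..n}" by blast+
  show "finite S1" unfolding S1_eq using finite_Wp by simp
  define F where "F = (\<lambda>(v :: (nat \<Rightarrow> int) \<Rightarrow> nat \<Rightarrow> int, w :: (nat \<Rightarrow> int) \<Rightarrow> nat \<Rightarrow> int). v \<circ> w)"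
  have cyS: "cyl (inv w)" if "w \<in> S1" for w using that by (simp add: S1_def)
  have inj: "v1 = v2 \<and> w1 = w2" if h: "v1 \<in> Ws" "v2 \<in> Ws" "w1 \<in> S1" "w2 \<in> S1" "v1 \<circ> w1 = v2 \<circ> w2" for v1 v2 w1 w2
  proof -
    have wW: "w1 \<in> W" "w2 \<in> W" using h(3,4) by (auto simp: S1_def)
    define x where "x = inv v2 \<circ> v1"
    have xW: "x \<in> Ws" unfolding x_def by (rule weyl_group_comp[OF W_inv(1)[OF Jn h(2)] h(1)])
    have e: "v1 (w1 z) = v2 (w2 z)" for z using fun_cong[OF h(5), of z] by simp
    have ie: "inv w1 y = inv w2 (x y)" for y
    proof -
      have "v1 y = v2 (w2 (inv w1 y))" using e[of "inv w1 y"] W_inv'(2)[OF wW(1)] by simp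
      then have "x y = w2 (inv w1 y)" using W_inv(3)[OF Jn h(2)] by (simp add: x_def)
      then show ?thesis using W_inv'(3)[OF wW(2)] by simp
    qed
    have "x = id"
    proof (rule W_pos_id[OF Ws_sub(2)[OF xW]])
      fix i assume i: "i \<le> n"
      have R: "x (al i) \<in> RR" by (rule RR_W[OF al_RR[OF i] Ws_sub(2)[OF xW]])
      show "0 \<le> x (al i)"
      proof (cases "i \<in> J")
        case True
        have "0 \<le> inv w1 (al i)" using cyS[OF h(3)] al_Ds[OF True] al_nonneg by (auto simp: cyl_def)
        then have 1: "0 \<le> inv w2 (x (al i))" using ie by simp
        have "x (al i) p = x (al i) q" using Ds_Ws[OF al_Ds[OF True] xW] by (simp add: Ds_def)
        then show ?thesis using cyl_iff[OF frame_inv[OF wW(2)] cyS[OF h(4)] R] 1 by blast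
      next
        case False
        then have "i = p \<or> i = q" using i by auto
        then have "x (al i) i > 0" using Ws_coord[OF xW, of "al i"] by (auto simp: simple_root_apply)
        then show ?thesis by (rule RR_nonnegI[OF R])
      qed
    qed
    then have v: "v1 y = v2 y" for y
      using W_inv(2)[OF Jn h(2), of "v1 y"] pointfree_idE[of "inv v2" v1] unfolding x_def by simp
    have "w1 z = w2 z" for z using e[of z] v W_inv(3)[OF Jn h(2)] by metis
    then show ?thesis using v by blast
  qed
  have bij: "bij_betw F (Ws \<times> S1) Wp"
  proof (rule bij_betw_imageI)
    show "inj_on F (Ws \<times> S1)"
    proof (rule inj_onI)
      fix s t assume st: "s \<in> Ws \<times> S1" "t \<in> Ws \<times> S1" "F s = F t"
      obtain v1 w1 v2 w2 where e: "s = (v1, w1)" "t = (v2, w2)" by fastforce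
      show "s = t" using st inj[of v1 v2 w1 w2] unfolding e F_def by (simp del: o_apply)
    qed
    show "F ` (Ws \<times> S1) = Wp"
    proof
      show "F ` (Ws \<times> S1) \<subseteq> Wp"
        using weyl_group_comp[OF Ws_sub(1)] by (auto simp: F_def S1_eq simp del: o_apply)
      show "Wp \<subseteq> F ` (Ws \<times> S1)"
      proof
        fix u assume u: "u \<in> Wp"
        have f: "frame (inv u)" by (rule frame_inv[OF Ws_sub(3)[OF u]])
        have "\<exists>h\<in>Ws. \<forall>\<eta>\<in>Ds. 0 \<le> \<eta> \<longrightarrow> 0 \<le> inv u (h \<eta>)"
        proof (rule frame_exists[OF f weyl_id])
          show "frame h" if "h \<in> Ws" for h by (rule frame_W[OF Ws_sub(2)[OF that]])
          show "Ds \<subseteq> RR" using Ds_RR by blast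
          show "h \<circ> rf \<eta> \<in> Ws" if "h \<in> Ws" "\<eta> \<in> Ds" for h \<eta>
            by (rule weyl_group_comp[OF that(1) rf_Ds[OF that(2)]])
        qed
        then obtain h where h: "h \<in> Ws" "\<forall>\<eta>\<in>Ds. 0 \<le> \<eta> \<longrightarrow> 0 \<le> inv u (h \<eta>)" by blast
        define w where "w = inv h \<circ> u"
        have w: "w \<in> Wp" unfolding w_def by (rule weyl_group_comp[OF Ws_sub(1)[OF W_inv(1)[OF Jn h(1)]] u])
        have iw: "inv w y = inv u (h y)" for y
        proof -
          have "w (inv u (h y)) = y" using W_inv(2)[OF pn u] W_inv(3)[OF Jn h(1)] by (simp add: w_def)
          then show ?thesis using W_inv(3)[OF pn w] by metis
        qed
        have "w \<in> S1" unfolding S1_eq using w h(2) al_Ds al_nonneg iw by auto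
        moreover have "F (h, w) = u" unfolding F_def w_def prod.case
          by (rule ext) (simp add: W_inv(2)[OF Jn h(1)])
        ultimately show "u \<in> F ` (Ws \<times> S1)" using h(1) by (metis SigmaI image_eqI)
      qed
    qed
  qed
  show "card Ws * card S1 = card Wp"
    using bij_betw_same_card[OF bij] by (simp add: card_cartesian_product)
qed

text \<open>Vanishing on delta couples the two remaining values: both labels are 1, so those at
  alpha_p and alpha_q are opposite.\<close>

lemma P_omega:
  assumes A: "A \<in> P" "\<And>i. i \<in> J \<Longrightarrow> A (al i) = 0"
  shows "A = (\<lambda>v. A (al q) * omega v)"
proof -
  have "0 = (\<Sum>i\<le>n. delta i * A (al i))" using flin_expand[OF P_D(1,2)[OF A(1)], of delta] P_D(3)[OF A(1)] by simp
  also have "\<dots> = (\<Sum>i\<in>{p, q}. delta i * A (al i))"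
    using p q A(2) by (intro sum.mono_neutral_right) auto
  also have "\<dots> = A (al p) + A (al q)" using pq delta_pq by simp
  finally have s: "A (al p) = - A (al q)" by simp
  show ?thesis
  proof (rule flin_eqI[OF P_D(1)[OF A(1)] P_D(1)[OF omega_P] P_D(2)[OF A(1)] P_D(2)[OF omega_P]])
    fix i assume "i \<le> n"
    then show "A (al i) = A (al q) * omega (al i)"
      using A(2)[of i] s pq by (cases "i = p"; cases "i = q") (auto simp: omega_def simple_root_apply)
  qed
qed

text \<open>The sum over \<open>Ws\<close> vanishes on the simple roots in J, hence is a multiple of
  \<open>omega\<close>. So |Ws| P lies in \<open>L\<close>, which makes P/L finite.\<close>

lemma averaging_L:
  assumes "\<phi> \<in> P" shows "(\<lambda>v. int (card Ws) * \<phi> v) \<in> L"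
proof -
  define A where "A v = (\<Sum>w\<in>Ws. \<phi> (w v))" for v
  have Jn: "J \<subseteq> {0..n}" by blast
  have av: "(\<lambda>v. int (card Ws) * \<phi> v - A v) \<in> rows J" "A \<in> P" "\<And>i. i \<in> J \<Longrightarrow> A (al i) = 0"
    using averaging[OF Jn finite_Ws assms] unfolding A_def by blast+
  have "(\<lambda>v. (int (card Ws) * \<phi> v - A v) + A (al q) * omega v) = (\<lambda>v. int (card Ws) * \<phi> v)"
    using P_omega[OF av(2,3)] by (metis (no_types, lifting) diff_add_cancel)
  then show ?thesis using L_I[OF av(1), of "A (al q)"] by simp
qed

text \<open>The sum over \<open>Wp\<close> vanishes on all simple roots but alpha_p, and vanishing
  on delta settles that one.\<close>

lemma averaging_Q:
  assumes "\<phi> \<in> P" shows "(\<lambda>v. int (card Wp) * \<phi> v) \<in> rows ({0..n} - {p})"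
proof -
  define A where "A v = (\<Sum>w\<in>Wp. \<phi> (w v))" for v
  have pn: "{0..n} - {p} \<subseteq> {0..n}" by blast
  have av: "(\<lambda>v. int (card Wp) * \<phi> v - A v) \<in> rows ({0..n} - {p})" "A \<in> P" "\<And>i. i \<in> {0..n} - {p} \<Longrightarrow> A (al i) = 0"
    using averaging[OF pn finite_Wp assms] unfolding A_def by blast+
  have "0 = (\<Sum>i\<le>n. delta i * A (al i))" using flin_expand[OF P_D(1,2)[OF av(2)], of delta] P_D(3)[OF av(2)] by simp
  also have "\<dots> = (\<Sum>i\<in>{p}. delta i * A (al i))"
    using p av(3) by (intro sum.mono_neutral_right) auto
  finally have s: "A (al p) = 0" using delta_pq by simp
  have "A (al i) = 0" if "i \<le> n" for i using av(3)[of i] s that by (cases "i = p") auto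
  then have "A v = 0" for v using flin_expand[OF P_D(1,2)[OF av(2)], of v] by simp
  then show ?thesis using av(1) by simp
qed

lemma card_Ws_pos: "card Ws > 0" and card_Wp_pos: "card Wp > 0"
  using finite_Ws finite_Wp weyl_id by (auto simp: card_gt_0_iff)

lemma finite_cls_L: "finite (cls L ` P)"
  by (rule finite_cls[of L "int (card Ws)"]) (use L_zero L_diff card_Ws_pos averaging_L in auto)

lemma rows_mono: "finite K \<Longrightarrow> J' \<subseteq> K \<Longrightarrow> \<phi> \<in> rows J' \<Longrightarrow> \<phi> \<in> rows K"
proof -
  assume K: "finite K" "J' \<subseteq> K" and "\<phi> \<in> rows J'"
  then obtain g where g: "\<phi> = (\<lambda>v. \<Sum>i\<in>J'. g i * pr i v)" unfolding rows_def by auto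
  have "(\<lambda>v. \<Sum>i\<in>J'. g i * pr i v) \<in> rows K"
    by (rule rows_sum) (use K finite_subset rows_pr in auto)
  then show ?thesis using g by simp
qed

lemma finite_cls_Q: "finite (cls Q ` P)"
  by (rule finite_cls[of Q "int (card Wp)"])
    (use rows_zero rows_diff card_Wp_pos averaging_Q rows_mono[of "{0..n}" "{0..n} - {p}"] in auto)

lemma card_cls_Q_pos: "card (cls Q ` P) > 0"
  using finite_cls_Q rows_P[OF order_refl rows_zero] by (auto simp: card_gt_0_iff)

text \<open>The finite Weyl group of the formula omits the node 0 instead of p;
  \<open>card_weyl_special\<close> equates the two orders.\<close>

theorem card_S:
  "real (card S) = real (card (weyl_group C n {1..n})) / real (card Ws) *
     (1 + real (card (cls L ` P)) / real (card (cls Q ` P)))"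
proof -
  have "card (weyl_group C n ({0..n} - {0})) = card Wp" by (rule card_weyl_special) (use p a0 in auto)
  moreover have "{0..n} - {0} = {1..n}" by auto
  ultimately have w: "card (weyl_group C n {1..n}) = card Wp" by simp
  have "card S = card S1 + card S2"
    unfolding S_split(1) using finite_S1 finite_S2[OF finite_Sh[OF finite_cls_L]] S_split(2) by (rule card_Un_disjoint)
  then have cs: "real (card S) = real (card S1) + real (card S2)" by simp
  have 1: "real (card Ws) * real (card S1) = real (card Wp)" using card_S1 by (metis of_nat_mult)
  have 2: "real (card Ws) * (real (card S2) * real (card (cls Q ` P))) = real (card (cls L ` P)) * real (card Wp)"
    using card_Sh_L unfolding card_Sh_Q by (metis of_nat_mult)
  have pos: "real (card Ws) > 0" "real (card (cls Q ` P)) > 0" using card_Ws_pos card_cls_Q_pos by auto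
  have "real (card S1) = real (card Wp) / real (card Ws)" using 1 pos by (simp add: field_simps)
  moreover have "real (card S2) = real (card Wp) / real (card Ws) * (real (card (cls L ` P)) / real (card (cls Q ` P)))"
    using 2 pos by (simp add: field_simps)
  ultimately show ?thesis unfolding cs w by (simp add: algebra_simps)
qed

end

section \<open>Connection indices\<close>

text \<open>Isomorphic quotients, each given as the image of a map whose fibres are the classes; f
  itself need not be injective or onto.\<close>

lemma card_image_kernel:
  assumes AB: "\<And>x. x \<in> A \<Longrightarrow> f x \<in> B"
    and k: "\<And>x y. x \<in> A \<Longrightarrow> y \<in> A \<Longrightarrow> k x = k y \<longleftrightarrow> k' (f x) = k' (f y)"
    and surj: "\<And>b. b \<in> B \<Longrightarrow> \<exists>x\<in>A. k' (f x) = k' b"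
  shows "card (k ` A) = card (k' ` B)"
proof (rule bij_betw_same_card)
  let ?h = "\<lambda>c. k' (f (inv_into A k c))"
  have r: "inv_into A k (k x) \<in> A" "?h (k x) = k' (f x)" if "x \<in> A" for x
    using that k[of "inv_into A k (k x)" x] by (auto simp: inv_into_into f_inv_into_f)
  show "bij_betw ?h (k ` A) (k' ` B)"
    unfolding bij_betw_def
  proof
    show "inj_on ?h (k ` A)" using r k by (auto intro!: inj_onI)
    show "?h ` k ` A = k' ` B"
    proof
      show "?h ` k ` A \<subseteq> k' ` B" using r AB by auto
      show "k' ` B \<subseteq> ?h ` k ` A"
      proof
        fix c assume "c \<in> k' ` B"
        then obtain b where b: "b \<in> B" "c = k' b" by blast
        obtain x where x: "x \<in> A" "k' (f x) = k' b" using surj[OF b(1)] by blast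
        then have "c = ?h (k x)" using r(2) b by simp
        then show "c \<in> ?h ` k ` A" using x(1) by blast
      qed
    qed
  qed
qed

text \<open>A root determines its coroot up to a positive factor, so both have the same support.\<close>

lemma root_coroot_prop:
  assumes rc: "(\<beta>, \<gamma>) \<in> root_coroot C n J" and J: "J \<subseteq> {0..n}"
    and d: "\<And>i. i \<in> J \<Longrightarrow> (d i :: int) > 0" and symm: "\<And>i j. i \<in> J \<Longrightarrow> j \<in> J \<Longrightarrow> d i * C i j = d j * C j i"
  shows "\<exists>D>0. (\<forall>k\<in>J. D * \<gamma> k = d k * \<beta> k) \<and> (\<forall>k. k \<notin> J \<longrightarrow> \<beta> k = 0 \<and> \<gamma> k = 0)"
  using rc
proof (induct rule: root_coroot.induct)
  case (rc_simple i)
  then show ?case using d by (intro exI[of _ "d i"]) (auto simp: simple_root_apply)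
next
  case (rc_refl \<beta> \<gamma> i)
  then obtain D where D: "D > 0" "\<And>k. k \<in> J \<Longrightarrow> D * \<gamma> k = d k * \<beta> k" "\<And>k. k \<notin> J \<Longrightarrow> \<beta> k = 0 \<and> \<gamma> k = 0" by blast
  let ?b = "simple_refl C n i \<beta>" and ?g = "simple_refl (\<lambda>p q. C q p) n i \<gamma>"
  have "D * (\<Sum>j\<le>n. C j i * \<gamma> j) = d i * (\<Sum>j\<le>n. C i j * \<beta> j)"
    unfolding sum_distrib_left
  proof (rule sum.cong[OF refl])
    fix j
    show "D * (C j i * \<gamma> j) = d i * (C i j * \<beta> j)"
    proof (cases "j \<in> J")
      case True
      have "D * (C j i * \<gamma> j) = C j i * (d j * \<beta> j)" using D(2)[OF True] by (simp add: mult.left_commute)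
      also have "\<dots> = d i * (C i j * \<beta> j)" using symm[OF rc_refl(3) True] by (metis mult.assoc mult.commute)
      finally show ?thesis .
    qed (use D(3) in simp)
  qed
  then have "D * ?g i = d i * ?b i" using D(2)[OF rc_refl(3)] by (simp add: simple_refl_def right_diff_distrib)
  moreover have "?g k = \<gamma> k" "?b k = \<beta> k" if "k \<noteq> i" for k using that by (simp_all add: simple_refl_other)
  ultimately show ?case using D rc_refl(3) by (intro exI[of _ D]) metis
qed

context affine_matrix
begin

lemma coroots_supp:
  assumes "\<gamma> \<in> coroots_of C n \<Phi>" and "\<And>\<beta> k. \<beta> \<in> \<Phi> \<Longrightarrow> k \<notin> K \<Longrightarrow> \<beta> k = 0" and k: "k \<notin> K"
  shows "\<gamma> k = 0"
proof -
  obtain \<beta> where b: "\<beta> \<in> \<Phi>" "(\<beta>, \<gamma>) \<in> root_coroot C n {0..n}" using assms(1) by (auto simp: coroots_of_def)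
  obtain D where "D > 0" "\<forall>k\<in>{0..n}. D * \<gamma> k = d k * \<beta> k" "\<forall>k. k \<notin> {0..n} \<longrightarrow> \<beta> k = 0 \<and> \<gamma> k = 0"
    using root_coroot_prop[OF b(2) order_refl, of d] d_pos symm by auto
  moreover have "\<beta> k = 0" by (rule assms(2)[OF b(1) k])
  ultimately show ?thesis by (metis less_irrefl mult_eq_0_iff mult_zero_right)
qed

text \<open>The simple coroots of K already span all vectors supported on K, and nothing in G leaves
  this support. The set U stands for the integers or the reals.\<close>

lemma combinations_eq:
  assumes K: "finite K" and U: "0 \<in> U" "\<And>x y. x \<in> U \<Longrightarrow> y \<in> U \<Longrightarrow> x + y \<in> U" "\<And>x m. x \<in> U \<Longrightarrow> x * real_of_int m \<in> U"
    and G: "simple_root ` K \<subseteq> G" "\<And>\<gamma> k. \<gamma> \<in> G \<Longrightarrow> k \<notin> K \<Longrightarrow> \<gamma> k = 0"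
  shows "combinations U G = {x. (\<forall>k. x k \<in> U) \<and> (\<forall>k. k \<notin> K \<longrightarrow> x k = 0)}"
proof
  show "combinations U G \<subseteq> {x. (\<forall>k. x k \<in> U) \<and> (\<forall>k. k \<notin> K \<longrightarrow> x k = 0)}"
  proof
    fix x assume "x \<in> combinations U G"
    then obtain F c where F: "x = (\<lambda>i. \<Sum>\<gamma>\<in>F. c \<gamma> * real_of_int (\<gamma> i))" "finite F" "F \<subseteq> G" "\<And>\<gamma>. \<gamma> \<in> F \<Longrightarrow> c \<gamma> \<in> U"
      unfolding combinations_def by blast
    have "(\<Sum>\<gamma>\<in>F'. c \<gamma> * real_of_int (\<gamma> k)) \<in> U" if "F' \<subseteq> F" for F' k
      using finite_subset[OF that F(2)] that by (induct F') (auto intro: U F(4))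
    then have "x k \<in> U" for k unfolding F(1) by blast
    moreover have "x k = 0" if "k \<notin> K" for k unfolding F(1) using F(3) G(2)[OF _ that] by (intro sum.neutral) auto
    ultimately show "x \<in> {x. (\<forall>k. x k \<in> U) \<and> (\<forall>k. k \<notin> K \<longrightarrow> x k = 0)}" by blast
  qed
  show "{x. (\<forall>k. x k \<in> U) \<and> (\<forall>k. k \<notin> K \<longrightarrow> x k = 0)} \<subseteq> combinations U G"
  proof
    fix x :: "nat \<Rightarrow> real" assume x: "x \<in> {x. (\<forall>k. x k \<in> U) \<and> (\<forall>k. k \<notin> K \<longrightarrow> x k = 0)}"
    have inj: "inj_on al K"
    proof (rule inj_onI)
      fix i j assume "al i = al j"
      then have "al i i = al j i" by simp
      then show "i = j" by (simp add: simple_root_apply split: if_splits)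
    qed
    define c where "c \<gamma> = x (inv_into K al \<gamma>)" for \<gamma>
    have "x = (\<lambda>i. \<Sum>\<gamma>\<in>al ` K. c \<gamma> * real_of_int (\<gamma> i))"
    proof
      fix i
      have "(\<Sum>\<gamma>\<in>al ` K. c \<gamma> * real_of_int (\<gamma> i)) = (\<Sum>k\<in>K. x k * real_of_int (al k i))"
        using inj by (simp add: sum.reindex c_def)
      also have "\<dots> = (\<Sum>k\<in>K. if k = i then x k else 0)" by (intro sum.cong) (auto simp: simple_root_apply)
      also have "\<dots> = x i" using K x by simp
      finally show "x i = (\<Sum>\<gamma>\<in>al ` K. c \<gamma> * real_of_int (\<gamma> i))" by simp
    qed
    moreover have "c \<gamma> \<in> U" for \<gamma> using x by (simp add: c_def)
    ultimately show "x \<in> combinations U G" unfolding combinations_def using K G(1) by blast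
  qed
qed

text \<open>A vector in coroot coordinates becomes the functional of its pairings with the simple
  roots in K, extended to a coweight through the node z of label 1. By \<open>char\<close>, M is the
  preimage of the coroot lattice of K under restriction to K, so the quotient becomes P/M. The
  multiple N makes every coweight a rational combination of coroots on K, whence
  surjectivity.\<close>

lemma connection_index_eq:
  assumes K: "K \<subseteq> {0..n}" and z: "z \<le> n" "z \<notin> K" "a z = 1"
    and Phi: "\<And>i. i \<in> K \<Longrightarrow> al i \<in> \<Phi>" "\<And>\<beta> k. \<beta> \<in> \<Phi> \<Longrightarrow> k \<notin> K \<Longrightarrow> \<beta> k = 0"
    and M: "(\<lambda>v. 0) \<in> M" "\<And>\<phi> \<psi>. \<phi> \<in> M \<Longrightarrow> \<psi> \<in> M \<Longrightarrow> (\<lambda>v. \<phi> v - \<psi> v) \<in> M"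
    and char: "\<And>\<phi>. \<phi> \<in> P \<Longrightarrow> \<phi> \<in> M \<longleftrightarrow> (\<exists>\<rho>\<in>rows K. \<forall>j\<in>K. \<phi> (al j) = \<rho> (al j))"
    and N: "N > 0" "\<And>\<phi>. \<phi> \<in> P \<Longrightarrow> (\<lambda>v. N * \<phi> v) \<in> M"
  shows "connection_index C n \<Phi> = card (cls M ` P)"
proof -
  have fK: "finite K" using K finite_subset by blast
  have al_co: "simple_root ` K \<subseteq> coroots_of C n \<Phi>"
    using Phi(1) rc_simple[of _ "{0..n}" C n] K by (fastforce simp: coroots_of_def)
  have supp: "\<gamma> k = 0" if "\<gamma> \<in> coroots_of C n \<Phi>" "k \<notin> K" for \<gamma> k
    using coroots_supp[of \<gamma> \<Phi> K k] that Phi(2) by blast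
  have co: "coroot_lattice C n \<Phi> = {x. (\<forall>k. x k \<in> \<int>) \<and> (\<forall>k. k \<notin> K \<longrightarrow> x k = 0)}"
    unfolding coroot_lattice_def by (rule combinations_eq[OF fK _ _ _ al_co]) (auto intro: supp)
  have sp: "combinations UNIV (coroots_of C n \<Phi>) = {x. \<forall>k. k \<notin> K \<longrightarrow> x k = 0}"
    using combinations_eq[OF fK, of UNIV, OF _ _ _ al_co] supp by auto
  define m where "m x j = (\<Sum>i\<le>n. x i * real_of_int (C i j))" for x j
  have cw: "coweight_lattice C n \<Phi> = {x. (\<forall>k. k \<notin> K \<longrightarrow> x k = 0) \<and> (\<forall>j\<in>K. m x j \<in> \<int>)}"
  proof -
    have sw: "(\<Sum>i\<le>n. \<Sum>j\<le>n. x i * real_of_int (C i j) * real_of_int (\<beta> j)) = (\<Sum>j\<le>n. m x j * real_of_int (\<beta> j))" for x \<beta>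
      by (subst sum.swap) (simp add: m_def sum_distrib_right)
    have "(\<forall>\<beta>\<in>\<Phi>. (\<Sum>j\<le>n. m x j * real_of_int (\<beta> j)) \<in> \<int>) \<longleftrightarrow> (\<forall>j\<in>K. m x j \<in> \<int>)" for x
    proof
      assume h: "\<forall>\<beta>\<in>\<Phi>. (\<Sum>j\<le>n. m x j * real_of_int (\<beta> j)) \<in> \<int>"
      show "\<forall>j\<in>K. m x j \<in> \<int>"
      proof
        fix k assume k: "k \<in> K"
        have "(\<Sum>j\<le>n. m x j * real_of_int (al k j)) = (\<Sum>j\<le>n. if j = k then m x j else 0)"
          by (intro sum.cong) (auto simp: simple_root_apply)
        also have "\<dots> = m x k" using k K by auto
        finally show "m x k \<in> \<int>" using h Phi(1)[OF k] by metis
      qed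
    next
      assume h: "\<forall>j\<in>K. m x j \<in> \<int>"
      show "\<forall>\<beta>\<in>\<Phi>. (\<Sum>j\<le>n. m x j * real_of_int (\<beta> j)) \<in> \<int>"
      proof (intro ballI Ints_sum)
        fix \<beta> j assume "\<beta> \<in> \<Phi>"
        then show "m x j * real_of_int (\<beta> j) \<in> \<int>" using h Phi(2)[of \<beta> j] by (cases "j \<in> K") auto
      qed
    qed
    then show ?thesis unfolding coweight_lattice_def sp sw by blast
  qed
  let ?A = "coweight_lattice C n \<Phi>"
  define r where "r = {(x, y). x \<in> ?A \<and> y \<in> ?A \<and> (\<lambda>i. x i - y i) \<in> coroot_lattice C n \<Phi>}"
  have "?A // r = (\<lambda>x. r `` {x}) ` ?A" by (auto simp: quotient_def)
  then have ci: "connection_index C n \<Phi> = card ((\<lambda>x. r `` {x}) ` ?A)"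
    unfolding connection_index_def r_def by simp
  \<comment> \<open>The term with v z fixes the value at alpha_z so that the functional vanishes on
    delta; this stays integral because z has label 1.\<close>
  define f where "f x v = (\<Sum>j\<in>K. (v j - int (a j) * v z) * \<lfloor>m x j\<rfloor>)" for x and v :: "nat \<Rightarrow> int"
  have fP: "f x \<in> P" for x
    unfolding P_def
  proof (intro CollectI conjI)
    show "flin (f x)" by (auto simp: flin_def f_def algebra_simps sum.distrib sum_subtractf sum_distrib_left)
    show "fsupported n (f x)" using K z by (auto simp: fsupported_def f_def subset_eq intro!: sum.neutral)
    show "f x delta = 0" using K z by (auto simp: f_def delta_def subset_eq intro!: sum.neutral)
  qed
  have fal: "f x (al j) = \<lfloor>m x j\<rfloor>" if "j \<in> K" for x j
  proof -
    have "f x (al j) = (\<Sum>k\<in>K. if k = j then \<lfloor>m x j\<rfloor> else 0)"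
      unfolding f_def using that z(2) by (intro sum.cong) (auto simp: simple_root_apply)
    then show ?thesis using that fK by simp
  qed
  have rowsK: "(\<exists>g. \<forall>j\<in>K. \<phi> (al j) = (\<Sum>i\<in>K. g i * C i j)) \<longleftrightarrow> (\<exists>\<rho>\<in>rows K. \<forall>j\<in>K. \<phi> (al j) = \<rho> (al j))" for \<phi> :: "(nat \<Rightarrow> int) \<Rightarrow> int"
  proof -
    have "(\<Sum>i\<in>K. g i * pr i (al j)) = (\<Sum>i\<in>K. g i * C i j)" if "j \<in> K" for g j
      using that K by (intro sum.cong) auto
    then show ?thesis unfolding rows_def by auto
  qed
  have mK: "m x j = (\<Sum>i\<in>K. x i * real_of_int (C i j))" if "\<And>k. k \<notin> K \<Longrightarrow> x k = 0" for x j
    unfolding m_def using K that by (intro sum.mono_neutral_right) auto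
  have ker: "x = y" if h: "\<And>k. k \<notin> K \<Longrightarrow> x k = 0" "\<And>k. k \<notin> K \<Longrightarrow> y k = 0" "\<And>j. j \<in> K \<Longrightarrow> m x j = m y j" for x y
  proof
    fix k
    show "x k = y k"
    proof (cases "k \<in> K")
      case True
      then have kn: "k \<le> n" using K by auto
      have "(\<lambda>i. x i - y i) k = 0"
      proof (rule real_rows_kernel[OF z(1) _ _ kn])
        show "x z - y z = 0" using h(1,2) z(2) by simp
        fix j assume "j \<le> n" "x j - y j \<noteq> 0"
        then have "j \<in> K" using h(1,2)[of j] by (cases "j \<in> K") auto
        then show "(\<Sum>i\<le>n. (x i - y i) * real_of_int (C i j)) = 0"
          using h(3) by (simp add: m_def left_diff_distrib sum_subtractf)
      qed
      then show ?thesis by simp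
    qed (use h in simp)
  qed
  have key: "(\<lambda>i. x i - y i) \<in> coroot_lattice C n \<Phi> \<longleftrightarrow> cls M (f x) = cls M (f y)" if xy: "x \<in> ?A" "y \<in> ?A" for x y
  proof -
    have x: "\<And>k. k \<notin> K \<Longrightarrow> x k = 0" "\<And>j. j \<in> K \<Longrightarrow> m x j = of_int \<lfloor>m x j\<rfloor>"
      and y: "\<And>k. k \<notin> K \<Longrightarrow> y k = 0" "\<And>j. j \<in> K \<Longrightarrow> m y j = of_int \<lfloor>m y j\<rfloor>" using xy by (auto simp: cw)
    have dP: "(\<lambda>v. f x v - f y v) \<in> P"
      using fP[of x] fP[of y] by (auto simp: P_def fsupported_def intro: flin_diff)
    have "cls M (f x) = cls M (f y) \<longleftrightarrow> (\<lambda>v. f x v - f y v) \<in> M" by (rule cls_eq[OF M])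
    also have "\<dots> \<longleftrightarrow> (\<exists>g. \<forall>j\<in>K. f x (al j) - f y (al j) = (\<Sum>i\<in>K. g i * C i j))"
      unfolding char[OF dP] rowsK[of "\<lambda>v. f x v - f y v", symmetric] ..
    also have "\<dots> \<longleftrightarrow> (\<exists>g. \<forall>j\<in>K. m x j - m y j = of_int (\<Sum>i\<in>K. g i * C i j))"
    proof -
      have "f x (al j) - f y (al j) = s \<longleftrightarrow> m x j - m y j = of_int s" if "j \<in> K" for j s
        using fal[OF that] x(2)[OF that] y(2)[OF that] by (metis of_int_diff of_int_eq_iff)
      then show ?thesis by auto
    qed
    also have "\<dots> \<longleftrightarrow> (\<lambda>i. x i - y i) \<in> coroot_lattice C n \<Phi>"
    proof
      assume "\<exists>g. \<forall>j\<in>K. m x j - m y j = of_int (\<Sum>i\<in>K. g i * C i j)"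
      then obtain g where g: "\<And>j. j \<in> K \<Longrightarrow> m x j - m y j = of_int (\<Sum>i\<in>K. g i * C i j)" by blast
      define t where "t i = (if i \<in> K then y i + of_int (g i) else 0)" for i
      have "x = t"
      proof (rule ker)
        fix j assume j: "j \<in> K"
        have "m t j = (\<Sum>i\<in>K. (y i + of_int (g i)) * real_of_int (C i j))"
          by (subst mK) (auto simp: t_def)
        also have "\<dots> = m y j + of_int (\<Sum>i\<in>K. g i * C i j)"
          using mK[of y j] y(1) by (simp add: distrib_right sum.distrib)
        finally show "m x j = m t j" using g[OF j] by simp
      qed (use x t_def in auto)
      then show "(\<lambda>i. x i - y i) \<in> coroot_lattice C n \<Phi>" unfolding co using y(1) by (auto simp: t_def)
    next
      assume "(\<lambda>i. x i - y i) \<in> coroot_lattice C n \<Phi>"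
      then have "x i - y i \<in> \<int>" for i by (simp add: co)
      then have e: "x i - y i = of_int \<lfloor>x i - y i\<rfloor>" for i by (metis Ints_cases floor_of_int)
      have "m x j - m y j = of_int (\<Sum>i\<in>K. \<lfloor>x i - y i\<rfloor> * C i j)" for j
      proof -
        have "m x j - m y j = (\<Sum>i\<in>K. (x i - y i) * real_of_int (C i j))"
          using mK[of x j] mK[of y j] x(1) y(1) by (simp add: left_diff_distrib sum_subtractf)
        also have "\<dots> = (\<Sum>i\<in>K. of_int \<lfloor>x i - y i\<rfloor> * real_of_int (C i j))"
          by (rule sum.cong[OF refl]) (metis e)
        finally show ?thesis by simp
      qed
      then show "\<exists>g. \<forall>j\<in>K. m x j - m y j = of_int (\<Sum>i\<in>K. g i * C i j)"
        by (intro exI[of _ "\<lambda>i. \<lfloor>x i - y i\<rfloor>"] ballI)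
    qed
    finally show ?thesis by simp
  qed
  show ?thesis unfolding ci
  proof (rule card_image_kernel[of ?A f P])
    show "f x \<in> P" for x by (rule fP)
    fix x y assume xy: "x \<in> ?A" "y \<in> ?A"
    show "r `` {x} = r `` {y} \<longleftrightarrow> cls M (f x) = cls M (f y)"
    proof
      assume "r `` {x} = r `` {y}"
      moreover have "y \<in> r `` {y}" using xy(2) by (simp add: r_def co)
      ultimately have "(x, y) \<in> r" by blast
      then show "cls M (f x) = cls M (f y)" using key xy by (simp add: r_def)
    next
      assume h: "cls M (f x) = cls M (f y)"
      have "(x, u) \<in> r \<longleftrightarrow> (y, u) \<in> r" for u
        using xy key[of x u] key[of y u] h by (auto simp: r_def)
      then show "r `` {x} = r `` {y}" by blast
    qed
  next
    fix \<phi> assume phi: "\<phi> \<in> P"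
    have "(\<lambda>v. N * \<phi> v) \<in> P" using phi by (auto simp: P_def fsupported_def intro: flin_cmult)
    then obtain g where g: "\<And>j. j \<in> K \<Longrightarrow> N * \<phi> (al j) = (\<Sum>i\<in>K. g i * C i j)"
      using N(2)[OF phi] char rowsK[of "\<lambda>v. N * \<phi> v"] by auto
    \<comment> \<open>Division by N gives the real coroot coordinates of the restriction of phi to
      K.\<close>
    define x where "x i = (if i \<in> K then real_of_int (g i) / N else 0)" for i
    have mx: "m x j = of_int (\<phi> (al j))" if "j \<in> K" for j
    proof -
      have "m x j = (\<Sum>i\<in>K. real_of_int (g i) / N * real_of_int (C i j))"
        by (subst mK) (auto simp: x_def)
      also have "\<dots> = of_int (\<Sum>i\<in>K. g i * C i j) / N" by (simp add: sum_divide_distrib)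
      also have "\<dots> = of_int (\<phi> (al j))" using g[OF that] N(1) by (simp flip: g[OF that])
      finally show ?thesis .
    qed
    have "x \<in> ?A" unfolding cw using mx by (auto simp: x_def)
    moreover have "cls M (f x) = cls M \<phi>"
    proof -
      have dP: "(\<lambda>v. f x v - \<phi> v) \<in> P" using fP[of x] phi by (auto simp: P_def fsupported_def intro: flin_diff)
      have "f x (al j) - \<phi> (al j) = 0" if "j \<in> K" for j using fal[OF that] mx[OF that] by simp
      then have "(\<lambda>v. f x v - \<phi> v) \<in> M" unfolding char[OF dP] using rows_zero by (intro bexI[of _ "\<lambda>v. 0"]) auto
      then show ?thesis by (simp add: cls_eq[OF M])
    qed
    ultimately show "\<exists>x\<in>?A. cls M (f x) = cls M \<phi>" by blast
  qed
qed

end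

context special_pair
begin

lemma P_diff: "\<phi> \<in> P \<Longrightarrow> \<psi> \<in> P \<Longrightarrow> (\<lambda>v. \<phi> v - \<psi> v) \<in> P"
  by (auto simp: P_def fsupported_def intro: flin_diff)

text \<open>On the root lattice the coroot of alpha_0 is minus that of the highest root, so the node
  0 does not enlarge the coroot lattice. Conversely, a coweight is determined by its values at the
  nodes from 1 on, since it vanishes on delta and 0 has label 1.\<close>

lemma connection_index_finite: "connection_index C n (real_roots C n {1..n}) = card (cls Q ` P)"
proof (rule connection_index_eq[of "{1..n}" 0])
  show "al i \<in> real_roots C n {1..n}" if "i \<in> {1..n}" for i
    unfolding real_roots_def using that weyl_id by (auto intro!: exI[of _ id] exI[of _ i])
  show "\<beta> k = 0" if "\<beta> \<in> real_roots C n {1..n}" "k \<notin> {1..n}" for \<beta> k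
    using that by (auto simp: real_roots_def weyl_group_coord simple_root_apply)
  show "int (card Wp) > 0" using card_Wp_pos by simp
  show "(\<lambda>v. int (card Wp) * \<phi> v) \<in> Q" if "\<phi> \<in> P" for \<phi>
    using rows_mono[OF _ _ averaging_Q[OF that], of "{0..n}"] by auto
  fix \<phi> assume phi: "\<phi> \<in> P"
  show "\<phi> \<in> Q \<longleftrightarrow> (\<exists>\<rho>\<in>rows {1..n}. \<forall>j\<in>{1..n}. \<phi> (al j) = \<rho> (al j))"
  proof
    assume "\<phi> \<in> Q"
    then obtain g where g: "\<phi> = (\<lambda>v. \<Sum>i\<in>{0..n}. g i * pr i v)" unfolding rows_def by auto
    have "crt (delta - al 0) \<in> rows {1..n}"
      by (rule crt_supp[OF theta]) (use delta_p[of 0] a0 in \<open>auto simp: delta_def simple_root_apply Suc_le_eq not_le\<close>)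
    moreover have "crt (delta - al 0) v = - pr 0 v" for v
    proof -
      have "crt (delta - al 0) v = crt (- (al 0 + (-1) \<cdot> delta)) v" by simp
      also have "\<dots> = - crt (al 0 + (-1) \<cdot> delta) v" by (rule crt_uminus[OF RR_shift[OF al_RR]]) simp
      also have "\<dots> = - pr 0 v" unfolding crt_shift by (simp add: crt_al)
      finally show ?thesis .
    qed
    then have "crt (delta - al 0) = (\<lambda>v. - pr 0 v)" by blast
    ultimately have "(\<lambda>v. - pr 0 v) \<in> rows {1..n}" by (simp only:)
    from rows_cmult[OF this, of "- g 0"] have "(\<lambda>v. g 0 * pr 0 v) \<in> rows {1..n}" by simp
    from rows_add[OF this rowsI[of g "{1..n}"]] have "(\<lambda>v. g 0 * pr 0 v + (\<Sum>i\<in>{1..n}. g i * pr i v)) \<in> rows {1..n}" .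
    then have "\<phi> \<in> rows {1..n}" unfolding g by (simp add: sum.atLeast_Suc_atMost)
    then show "\<exists>\<rho>\<in>rows {1..n}. \<forall>j\<in>{1..n}. \<phi> (al j) = \<rho> (al j)" by blast
  next
    assume "\<exists>\<rho>\<in>rows {1..n}. \<forall>j\<in>{1..n}. \<phi> (al j) = \<rho> (al j)"
    then obtain \<rho> where r: "\<rho> \<in> rows {1..n}" "\<And>j. j \<in> {1..n} \<Longrightarrow> \<phi> (al j) = \<rho> (al j)" by blast
    have rP: "\<rho> \<in> P" by (rule rows_P[OF _ r(1)]) auto
    have s: "(\<Sum>i\<le>n. delta i * (\<phi> (al i) - \<rho> (al i))) = 0"
      using flin_expand[OF P_D(1,2)[OF phi], of delta] flin_expand[OF P_D(1,2)[OF rP], of delta] P_D(3)[OF phi] P_D(3)[OF rP]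
      by (simp add: right_diff_distrib sum_subtractf)
    have "(\<Sum>i\<le>n. delta i * (\<phi> (al i) - \<rho> (al i))) = (\<Sum>i\<in>{0}. delta i * (\<phi> (al i) - \<rho> (al i)))"
      using r(2) by (intro sum.mono_neutral_right) auto
    then have "\<phi> (al 0) = \<rho> (al 0)" using s delta_p[of 0] a0 by simp
    then have "\<phi> = \<rho>" using r(2)
      by (intro flin_eqI[OF P_D(1)[OF phi] P_D(1)[OF rP] P_D(2)[OF phi] P_D(2)[OF rP]]) (metis One_nat_def atLeastAtMost_iff le0 not_less_eq_eq le_zero_eq)
    then show "\<phi> \<in> Q" using rows_mono[OF _ _ r(1), of "{0..n}"] by auto
  qed
qed (use a0 rows_zero rows_diff in auto)

text \<open>A coweight that agrees on J with a coroot combination differs from it by a multiple of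
  \<open>omega\<close>, and these multiples belong to \<open>L\<close>.\<close>

lemma connection_index_Ds: "connection_index C n Ds = card (cls L ` P)"
proof (rule connection_index_eq[of J p])
  show "\<beta> k = 0" if "\<beta> \<in> Ds" "k \<notin> J" for \<beta> k
    using that RR_outside[of \<beta> k] by (auto simp: Ds_def)
  show "int (card Ws) > 0" using card_Ws_pos by simp
  fix \<phi> assume phi: "\<phi> \<in> P"
  show "\<phi> \<in> L \<longleftrightarrow> (\<exists>\<rho>\<in>rows J. \<forall>j\<in>J. \<phi> (al j) = \<rho> (al j))"
  proof
    assume "\<phi> \<in> L"
    then obtain \<psi> c where "\<phi> = (\<lambda>v. \<psi> v + c * omega v)" "\<psi> \<in> rows J" unfolding L_def by blast
    then show "\<exists>\<rho>\<in>rows J. \<forall>j\<in>J. \<phi> (al j) = \<rho> (al j)"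
      by (intro bexI[of _ \<psi>]) (auto simp: omega_def simple_root_apply)
  next
    assume "\<exists>\<rho>\<in>rows J. \<forall>j\<in>J. \<phi> (al j) = \<rho> (al j)"
    then obtain \<rho> where r: "\<rho> \<in> rows J" "\<And>j. j \<in> J \<Longrightarrow> \<phi> (al j) = \<rho> (al j)" by blast
    have rP: "\<rho> \<in> P" by (rule rows_P[OF _ r(1)]) auto
    have "(\<lambda>v. \<phi> v - \<rho> v) = (\<lambda>v. (\<phi> (al q) - \<rho> (al q)) * omega v)"
      by (rule P_omega[OF P_diff[OF phi rP]]) (use r(2) in simp)
    then have "\<phi> v = \<rho> v + (\<phi> (al q) - \<rho> (al q)) * omega v" for v by (metis add.commute diff_add_cancel)
    then have "\<phi> = (\<lambda>v. \<rho> v + (\<phi> (al q) - \<rho> (al q)) * omega v)" by blast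
    then show "\<phi> \<in> L" using L_I[OF r(1)] by metis
  qed
qed (use p al_Ds L_zero L_diff averaging_L in auto)

section \<open>Minuscule elements and height zero roots\<close>

lemma cyl_J:
  assumes f: "frame f" "cyl f" and v: "0 \<le> v" "\<And>k. k \<notin> J \<Longrightarrow> v k = 0"
  shows "0 \<le> f v"
  by (rule nonneg_comb[OF frameD(1)[OF f(1)] _ v(1)])
    (use v(2) f(2) al_Ds al_nonneg in \<open>force simp: cyl_def\<close>)+

text \<open>Write a positive root as beta = gamma + m delta with gamma_p = 0, of height 2 m +
  gamma_q. If gamma_q = 1 and the height is not 1, then m is at least 1, and beta is alpha_q + delta
  plus a nonnegative combination of delta and the simple roots in J. If gamma_q = -1, then m is at
  least 2, and alpha_p + delta is split off instead.\<close>

lemma S_iff: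
  assumes w: "w \<in> W"
  shows "w \<in> S \<longleftrightarrow> (\<forall>\<beta>\<in>RR. 0 \<le> \<beta> \<longrightarrow> \<beta> p + \<beta> q \<noteq> 1 \<longrightarrow> 0 \<le> inv w \<beta>)"
proof
  assume h: "\<forall>\<beta>\<in>RR. 0 \<le> \<beta> \<longrightarrow> \<beta> p + \<beta> q \<noteq> 1 \<longrightarrow> 0 \<le> inv w \<beta>"
  have "cyl (inv w)" unfolding cyl_def
  proof (intro ballI impI conjI)
    fix \<beta> assume b: "\<beta> \<in> Ds" "0 \<le> \<beta>"
    then show "0 \<le> inv w \<beta>" using h by (simp add: Ds_def)
    have "0 \<le> delta - \<beta>" by (rule fin_bound(1)[OF p Ds_fin[OF b(1)]])
    then show "0 \<le> inv w (delta - \<beta>)" using h cyl_RR[OF b(1)] b(1) delta_pq by (simp add: Ds_def)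
  qed
  moreover have "0 \<le> inv w (al i + delta)" if "i = p \<or> i = q" for i
  proof -
    have "al i + delta \<in> RR" using RR_shift1[OF al_RR] p q that by blast
    moreover have "0 \<le> al i + delta" by (rule add_nonneg_nonneg[OF al_nonneg delta_nonneg])
    moreover have "(al i + delta) p + (al i + delta) q \<noteq> 1" using that pq delta_pq by (auto simp: simple_root_apply)
    ultimately show ?thesis using h by blast
  qed
  ultimately show "w \<in> S" using w by (simp add: S_def)
next
  assume S: "w \<in> S"
  have f: "frame (inv w)" by (rule frame_inv[OF w])
  have c: "cyl (inv w)" "0 \<le> inv w (al p + delta)" "0 \<le> inv w (al q + delta)" using S by (auto simp: S_def)
  have fl: "inv w (u + v) = inv w u + inv w v" "inv w (m \<cdot> v) = m \<cdot> inv w v" "inv w delta = delta" for u v m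
    using linD(1,2)[OF frameD(1)[OF f]] frameD(2)[OF f] by auto
  show "\<forall>\<beta>\<in>RR. 0 \<le> \<beta> \<longrightarrow> \<beta> p + \<beta> q \<noteq> 1 \<longrightarrow> 0 \<le> inv w \<beta>"
  proof (intro ballI impI)
    fix \<beta> assume b: "\<beta> \<in> RR" "0 \<le> \<beta>" "\<beta> p + \<beta> q \<noteq> 1"
    define m where "m = \<beta> p"
    define \<gamma> where "\<gamma> = \<beta> - m \<cdot> delta"
    have gf: "\<gamma> \<in> fin p" using proj_fin[OF p b(1)] by (simp add: \<gamma>_def m_def)
    then have gR: "\<gamma> \<in> RR" "\<gamma> p = 0" by (auto simp: fin_def)
    have bq: "\<beta> q = m + \<gamma> q" using delta_pq by (simp add: \<gamma>_def)
    have nn: "\<beta> p \<ge> 0" "\<beta> q \<ge> 0" using le_funD[OF b(2), of p] le_funD[OF b(2), of q] by auto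
    consider "\<gamma> q = 0" | "\<gamma> q = 1" | "\<gamma> q = -1" using fin_q[OF gf] by auto
    then show "0 \<le> inv w \<beta>"
    proof cases
      case 1
      then show ?thesis using cyl_iff[OF f c(1) b(1)] b(2) bq by (simp add: m_def)
    next
      case 2
      then have m: "m \<ge> 1" using nn b(3) bq by (simp add: m_def)
      have g0: "0 \<le> \<gamma>" by (rule RR_nonnegI[OF gR(1), of q]) (use 2 in simp)
      have 1: "0 \<le> inv w (\<gamma> - al q)"
      proof (rule cyl_J[OF f c(1)])
        show "0 \<le> \<gamma> - al q" using g0 2 by (auto simp: le_fun_def simple_root_apply)
        show "(\<gamma> - al q) k = 0" if "k \<notin> J" for k
          using that 2 gR RR_outside[OF gR(1), of k] q pq by (auto simp: simple_root_apply)
      qed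
      have "\<beta> = (\<gamma> - al q) + ((al q + delta) + (m - 1) \<cdot> delta)" by (simp add: \<gamma>_def smult_diff)
      then have e: "inv w \<beta> = inv w (\<gamma> - al q) + (inv w (al q + delta) + (m - 1) \<cdot> delta)" using fl by metis
      show ?thesis unfolding e
        by (intro add_nonneg_nonneg 1 c(3)) (rule smult_delta_nonneg, use m in simp)
    next
      case 3
      then have m: "m \<ge> 2" using nn b(3) bq by (simp add: m_def)
      have dR: "\<gamma> + delta \<in> RR" using RR_shift1[OF gR(1)] by blast
      have g0: "0 \<le> \<gamma> + delta" by (rule RR_nonnegI[OF dR, of p]) (use gR delta_pq in simp)
      have 1: "0 \<le> inv w (\<gamma> + delta - al p)"
      proof (rule cyl_J[OF f c(1)])
        show "0 \<le> \<gamma> + delta - al p" unfolding le_fun_def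
        proof
          fix k show "(0 :: nat \<Rightarrow> int) k \<le> (\<gamma> + delta - al p) k"
            using le_funD[OF g0, of k] gR(2) delta_pq by (simp add: simple_root_apply)
        qed
        show "(\<gamma> + delta - al p) k = 0" if "k \<notin> J" for k
          using that 3 gR(2) delta_pq RR_outside[OF dR, of k] p pq by (auto simp: simple_root_apply)
      qed
      have "\<beta> = (\<gamma> + delta - al p) + ((al p + delta) + (m - 2) \<cdot> delta)" by (auto simp: \<gamma>_def fun_eq_iff algebra_simps)
      then have e: "inv w \<beta> = inv w (\<gamma> + delta - al p) + (inv w (al p + delta) + (m - 2) \<cdot> delta)" using fl by metis
      show ?thesis unfolding e
        by (intro add_nonneg_nonneg 1 c(2)) (rule smult_delta_nonneg, use m in simp)
    qed
  qed
qed

context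
  fixes s :: "nat \<Rightarrow> nat"
  assumes s: "s p = 1" "s q = 1" "\<And>i. i \<le> n \<Longrightarrow> i \<noteq> p \<Longrightarrow> i \<noteq> q \<Longrightarrow> s i = 0"
begin

lemma sigma_height_pq: "sigma_height n s \<beta> = \<beta> p + \<beta> q"
proof -
  have "sigma_height n s \<beta> = (\<Sum>i\<in>{p, q}. int (s i) * \<beta> i)"
    unfolding sigma_height_def using p q s(3) by (intro sum.mono_neutral_right) auto
  then show ?thesis using pq s by simp
qed

lemma affine_roots_alt: "affine_roots C n a = RR \<union> {m \<cdot> delta | m. m \<noteq> 0}"
proof -
  have "(\<lambda>i. if i \<le> n then m * int (a i) else 0) = m \<cdot> delta" for m by (auto simp: delta_def fun_eq_iff)
  then show ?thesis by (simp add: affine_roots_def)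
qed

text \<open>The coordinates of a real root have one sign, so those at p and q cancel only if both
  vanish; the imaginary root m delta has height 2 m.\<close>

lemma height_zero_roots_eq: "height_zero_roots C n a s = Ds"
proof -
  have 1: "\<beta> p = 0 \<and> \<beta> q = 0" if "\<beta> \<in> RR" "\<beta> p + \<beta> q = 0" for \<beta>
    using RR_coherent[OF that(1)]
  proof
    assume "0 \<le> \<beta>"
    from le_funD[OF this, of p] le_funD[OF this, of q] show ?thesis using that(2) by simp
  next
    assume "\<beta> \<le> 0"
    from le_funD[OF this, of p] le_funD[OF this, of q] show ?thesis using that(2) by simp
  qed
  have 2: "m = 0" if "(m \<cdot> delta) p + (m \<cdot> delta) q = 0" for m using that delta_pq by simp
  have "\<beta> \<in> height_zero_roots C n a s \<longleftrightarrow> \<beta> \<in> Ds" for \<beta>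
  proof
    assume "\<beta> \<in> height_zero_roots C n a s"
    then have "\<beta> \<in> RR \<or> (\<exists>m. m \<noteq> 0 \<and> \<beta> = m \<cdot> delta)" and z: "\<beta> p + \<beta> q = 0"
      unfolding height_zero_roots_def sigma_height_pq affine_roots_alt by blast+
    then show "\<beta> \<in> Ds"
    proof (elim disjE exE conjE)
      assume "\<beta> \<in> RR"
      then show ?thesis using 1 z by (simp add: Ds_def)
    next
      fix m assume "m \<noteq> 0" "\<beta> = m \<cdot> delta"
      then show ?thesis using 2[of m] z by blast
    qed
  next
    assume "\<beta> \<in> Ds"
    then show "\<beta> \<in> height_zero_roots C n a s"
      unfolding height_zero_roots_def sigma_height_pq affine_roots_alt Ds_def by simp
  qed
  then show ?thesis by blast
qed

text \<open>Weyl group elements fix delta, so imaginary roots are never inverted.\<close>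

lemma inversion_set_eq:
  assumes w: "w \<in> W"
  shows "inversion_set C n a w = {\<beta> \<in> RR. 0 \<le> \<beta> \<and> \<not> 0 \<le> inv w \<beta>}"
proof -
  have f: "frame (inv w)" by (rule frame_inv[OF w])
  have pos: "positive_roots C n a = {\<beta> \<in> RR \<union> {m \<cdot> delta | m. m \<noteq> 0}. 0 \<le> \<beta>}"
    by (simp add: positive_roots_def affine_roots_alt le_fun_def)
  have im: "\<not> (0 \<le> m \<cdot> delta \<and> 0 \<le> - inv w (m \<cdot> delta))" if "m \<noteq> 0" for m
  proof
    assume h: "0 \<le> m \<cdot> delta \<and> 0 \<le> - inv w (m \<cdot> delta)"
    have "inv w (m \<cdot> delta) = m \<cdot> delta" using linD(2)[OF frameD(1)[OF f]] frameD(2)[OF f] by simp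
    then have g: "0 \<le> m \<cdot> delta" "0 \<le> - (m \<cdot> delta)" using h by simp_all
    have "0 \<le> m" "0 \<le> - m" using le_funD[OF g(1), of p] le_funD[OF g(2), of p] delta_pq by simp_all
    then show False using that by simp
  qed
  have re: "\<beta> \<in> RR \<and> 0 \<le> \<beta> \<and> - inv w \<beta> \<in> positive_roots C n a \<longleftrightarrow> \<beta> \<in> RR \<and> 0 \<le> \<beta> \<and> \<not> 0 \<le> inv w \<beta>" for \<beta>
    using RR_neg_iff[OF frameD(3)[OF f]] RR_uminus[OF frameD(3)[OF f]] unfolding pos by blast
  have "(\<lambda>i. - inv w \<beta> i) = - inv w \<beta>" for \<beta> by (simp add: fun_eq_iff)
  then have "inversion_set C n a w = {\<beta> \<in> positive_roots C n a. - inv w \<beta> \<in> positive_roots C n a}"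
    by (simp add: inversion_set_def)
  also have "\<dots> = {\<beta> \<in> RR. 0 \<le> \<beta> \<and> \<not> 0 \<le> inv w \<beta>}"
  proof (intro set_eqI iffI)
    fix \<beta> assume "\<beta> \<in> {\<beta> \<in> positive_roots C n a. - inv w \<beta> \<in> positive_roots C n a}"
    then have h: "\<beta> \<in> positive_roots C n a" "- inv w \<beta> \<in> positive_roots C n a" by auto
    have "0 \<le> \<beta>" "0 \<le> - inv w \<beta>" "\<beta> \<in> RR \<or> (\<exists>m. m \<noteq> 0 \<and> \<beta> = m \<cdot> delta)" using h unfolding pos by blast+
    moreover have "\<beta> \<in> RR" using im calculation by blast
    ultimately show "\<beta> \<in> {\<beta> \<in> RR. 0 \<le> \<beta> \<and> \<not> 0 \<le> inv w \<beta>}" using re h(2) by blast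
  next
    fix \<beta> assume "\<beta> \<in> {\<beta> \<in> RR. 0 \<le> \<beta> \<and> \<not> 0 \<le> inv w \<beta>}"
    then show "\<beta> \<in> {\<beta> \<in> positive_roots C n a. - inv w \<beta> \<in> positive_roots C n a}" using re[of \<beta>] unfolding pos by blast
  qed
  finally show ?thesis .
qed

lemma sigma_minuscule_eq: "sigma_minuscule C n a s = S"
proof -
  have "w \<in> sigma_minuscule C n a s \<longleftrightarrow> w \<in> S" if w: "w \<in> W" for w
    unfolding S_iff[OF w] sigma_minuscule_def mem_Collect_eq inversion_set_eq[OF w] sigma_height_pq
    using w by (auto simp: affine_roots_alt)
  then show ?thesis by (auto simp: sigma_minuscule_def S_def)
qed

lemma minuscule_count:
  "real (card (sigma_minuscule C n a s)) =
      real (card (weyl_group C n {1..n})) / real (card (weyl_group C n {i. i \<le> n \<and> s i = 0})) *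
      (1 + real (connection_index C n (height_zero_roots C n a s)) /
           real (connection_index C n (real_roots C n {1..n})))"
proof -
  have "{i. i \<le> n \<and> s i = 0} = J" using s by force
  then show ?thesis
    unfolding sigma_minuscule_eq height_zero_roots_eq connection_index_finite connection_index_Ds card_S by simp
qed

end

end

section \<open>The affine diagrams\<close>

text \<open>If one length divides the other, the length of i times
  \<open>max 1 (len j div len i)\<close> is the larger of the two lengths, which is symmetric in i
  and j.\<close>

lemma diagram_cartan_props:
  assumes "\<And>i. len i > 0" "\<And>i j. len i dvd len j \<or> len j dvd (len i :: nat)"
  shows "diagram_cartan E len i i = 2" "i \<noteq> j \<Longrightarrow> diagram_cartan E len i j \<le> 0"
    and "int (len i) * diagram_cartan E len i j = int (len j) * diagram_cartan E len j i"
    and "(i, j) \<in> E \<or> (j, i) \<in> E \<Longrightarrow> diagram_cartan E len i j \<noteq> 0"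
proof -
  have m: "x * max 1 (y div x) = max x y" if "x > 0" "y > 0" "x dvd y \<or> y dvd x" for x y :: nat
  proof (cases "x dvd y")
    case True
    then show ?thesis using that by (auto simp: max_def dvd_div_mult_self div_le_dividend dest: dvd_imp_le)
  next
    case False
    then have "y dvd x" "y < x" using that by (auto dest: dvd_imp_le simp: le_less)
    then show ?thesis by simp
  qed
  have "len i * max 1 (len j div len i) = len j * max 1 (len i div len j)"
    using m[of "len i" "len j"] m[of "len j" "len i"] assms(1)[of i] assms(1)[of j] assms(2)[of i j] by (metis max.commute)
  then have "int (len i) * int (max 1 (len j div len i)) = int (len j) * int (max 1 (len i div len j))"
    by (metis of_nat_mult)
  then show "int (len i) * diagram_cartan E len i j = int (len j) * diagram_cartan E len j i"
    by (auto simp: diagram_cartan_def)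
qed (auto simp: diagram_cartan_def)

text \<open>A spanning tree given by parents of smaller rank: a nonempty closed set contains the
  root r by descending, and then every node by ascending.\<close>

lemma closed_eq:
  fixes rk :: "'a \<Rightarrow> nat"
  assumes r: "r \<in> A"
    and par: "\<And>i. i \<in> A \<Longrightarrow> i \<noteq> r \<Longrightarrow> par i \<in> A \<and> rk (par i) < rk i \<and> c i (par i) \<and> c (par i) i"
    and S: "S \<subseteq> A" "S \<noteq> {}" "\<And>i j. i \<in> S \<Longrightarrow> j \<in> A \<Longrightarrow> c i j \<Longrightarrow> j \<in> S"
  shows "S = A"
proof -
  have down: "x \<in> S \<Longrightarrow> r \<in> S" for x
  proof (induct "rk x" arbitrary: x rule: less_induct)
    case less
    show ?case
    proof (cases "x = r")
      case False
      then show ?thesis using less(1)[of "par x"] par[of x] less(2) S by blast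
    qed (use less in simp)
  qed
  have "x \<in> A \<Longrightarrow> x \<in> S" for x
  proof (induct "rk x" arbitrary: x rule: less_induct)
    case less
    show ?case
    proof (cases "x = r")
      case False
      then show ?thesis using less(1)[of "par x"] par[of x] less(2) S by blast
    qed (use S(2) down in blast)
  qed
  then show ?thesis using S(1) by blast
qed

definition tree_on :: "nat set \<Rightarrow> (nat \<times> nat) set \<Rightarrow> nat \<Rightarrow> (nat \<Rightarrow> nat) \<Rightarrow> (nat \<Rightarrow> nat) \<Rightarrow> bool" where
  "tree_on A E r par rk \<longleftrightarrow> r \<in> A \<and>
     (\<forall>i\<in>A. i \<noteq> r \<longrightarrow> par i \<in> A \<and> rk (par i) < rk i \<and> ((i, par i) \<in> E \<or> (par i, i) \<in> E))"

lemma tree_chain: "b \<le> c \<Longrightarrow> tree_on {b..c} (chain b c) b (\<lambda>i. i - 1) id"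
  by (force simp: tree_on_def chain_def)

definition good_lengths :: "(nat \<Rightarrow> nat) \<Rightarrow> bool" where
  "good_lengths len \<longleftrightarrow> (\<forall>i. len i > 0) \<and> (\<forall>i j. len i dvd len j \<or> len j dvd len i)"

lemma finite_cartan_data:
  assumes "finite_type X n"
  shows "\<exists>E len r par rk. finite_cartan X n = diagram_cartan E len \<and> good_lengths len \<and> tree_on {1..n} E r par rk"
proof -
  have chain: ?thesis
    if "finite_cartan X n = diagram_cartan (chain 1 n) len" "good_lengths len" "n \<ge> 1" for len
    using that tree_chain[of 1 n] by blast
  show ?thesis
  proof (cases X)
    case D_fam
    then have "n \<ge> 4" using assms by simp
    then have "tree_on {1..n} (insert (n - 2, n) (chain 1 (n - 1))) 1 (\<lambda>i. if i = n then n - 2 else i - 1) id"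
      by (force simp: tree_on_def chain_def)
    moreover have "good_lengths (\<lambda>i. 1)" by (simp add: good_lengths_def)
    ultimately show ?thesis unfolding D_fam finite_cartan.simps by blast
  next
    case E_fam
    then have n: "6 \<le> n" using assms by auto
    \<comment> \<open>The tree is rooted at the branch node 4. On the arms 2 and 3, 1 the numbering
      does not grow with the distance from it, so the rank is set by hand.\<close>
    have "tree_on {1..n} ({(1, 3), (3, 4), (2, 4)} \<union> chain 4 n) 4
       (\<lambda>i. if i = 1 then 3 else if i = 2 then 4 else if i = 3 then 4 else i - 1)
       (\<lambda>i. if i = 4 then 0 else if i = 1 then 2 else if i \<le> 3 then 1 else i)"
      unfolding tree_on_def
    proof (intro conjI ballI impI)
      show "4 \<in> {1..n}" using n by simp
      fix i assume i: "i \<in> {1..n}" "i \<noteq> 4"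
      let ?p = "if i = 1 then 3 else if i = 2 then 4 else if i = 3 then 4 else i - 1"
      have c: "i = 1 \<or> i = 2 \<or> i = 3 \<or> i > 4" using i by auto
      show "?p \<in> {1..n}" using c n i by auto
      show "(if ?p = 4 then 0 else if ?p = 1 then 2 else if ?p \<le> 3 then 1 else ?p)
          < (if i = 4 then 0 else if i = 1 then 2 else if i \<le> 3 then 1 else i)" using c by auto
      show "(i, ?p) \<in> {(1, 3), (3, 4), (2, 4)} \<union> chain 4 n \<or> (?p, i) \<in> {(1, 3), (3, 4), (2, 4)} \<union> chain 4 n"
        using c i by (auto simp: chain_def)
    qed
    moreover have "good_lengths (\<lambda>i. 1)" by (simp add: good_lengths_def)
    ultimately show ?thesis unfolding E_fam finite_cartan.simps by blast
  next
    case A_fam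
    show ?thesis by (rule chain[of "\<lambda>i. 1"]) (use A_fam assms in \<open>simp_all add: good_lengths_def\<close>)
  next
    case B_fam
    show ?thesis by (rule chain[of "\<lambda>i. if i = n then 1 else 2"]) (use B_fam assms in \<open>simp_all add: good_lengths_def\<close>)
  next
    case C_fam
    show ?thesis by (rule chain[of "\<lambda>i. if i = n then 2 else 1"]) (use C_fam assms in \<open>simp_all add: good_lengths_def\<close>)
  next
    case F_fam
    show ?thesis by (rule chain[of "\<lambda>i. if i \<le> 2 then 2 else 1"]) (use F_fam assms in \<open>simp_all add: good_lengths_def\<close>)
  next
    case G_fam
    show ?thesis by (rule chain[of "\<lambda>i. if i = 1 then 1 else 3"]) (use G_fam assms in \<open>simp_all add: good_lengths_def\<close>)
  qed
qed

context affine_matrix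
begin

text \<open>The difference of the labels and a_z b vanishes at z and satisfies the null equations on
  its support, so \<open>int_kernel\<close> kills it. Then a_z divides all labels, which are
  coprime.\<close>

lemma label_one:
  assumes z: "z \<le> n" "b z = 1" and b: "\<And>i. i \<le> n \<Longrightarrow> i \<noteq> z \<Longrightarrow> (\<Sum>j\<le>n. C i j * b j) = 0"
    and gcd: "Gcd (a ` {0..n}) = 1"
  shows "a z = 1" "i \<le> n \<Longrightarrow> int (a i) = b i"
proof -
  define v where "v i = int (a i) - int (a z) * b i" for i
  have v0: "v i = 0" if "i \<le> n" for i
  proof (rule int_kernel[OF z(1) _ _ that])
    show "v z = 0" by (simp add: v_def z)
    fix i assume i: "i \<le> n" "v i \<noteq> 0"
    then have "i \<noteq> z" using \<open>v z = 0\<close> by auto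
    have "pr i v = (\<Sum>j\<le>n. C i j * int (a j)) - int (a z) * (\<Sum>j\<le>n. C i j * b j)"
      by (simp add: pairing_def v_def algebra_simps sum_subtractf sum_distrib_left)
    then show "pr i v = 0" using null[OF i(1)] b[OF i(1) \<open>i \<noteq> z\<close>] by simp
  qed
  have e: "int (a i) = int (a z) * b i" if "i \<le> n" for i using v0[OF that] by (simp add: v_def)
  have "a z dvd a i" if "i \<le> n" for i
    using e[OF that] by (metis dvd_triv_left int_dvd_int_iff)
  then have "a z dvd Gcd (a ` {0..n})" by (intro Gcd_greatest) auto
  then show one: "a z = 1" using gcd by simp
  show "i \<le> n \<Longrightarrow> int (a i) = b i" using e one by simp
qed

end

section \<open>The untwisted diagrams\<close>

text \<open>The symmetrizer extends to the node 0 by the factor between the highest root and its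
  coroot. The inequalities at the node 0 and the maximal length of alpha_0 both come from dominance
  of the highest root.\<close>

lemma untwisted_affine_locale:
  assumes U: "untwisted_affine X n C" and lab: "affine_labels C n a"
  shows "\<exists>d. untwisted C n a d"
proof -
  obtain \<theta> \<theta>' where C: "finite_type X n" "\<And>i j. i \<in> {1..n} \<Longrightarrow> j \<in> {1..n} \<Longrightarrow> C i j = finite_cartan X n i j"
    and hr: "highest_root C n {1..n} \<theta>" and rc: "(\<theta>, \<theta>') \<in> root_coroot C n {1..n}" and C00: "C 0 0 = 2"
    and C0j: "\<And>j. j \<in> {1..n} \<Longrightarrow> C 0 j = - (\<Sum>i=1..n. \<theta>' i * C i j)"
    and Ci0: "\<And>i. i \<in> {1..n} \<Longrightarrow> C i 0 = - (\<Sum>j=1..n. C i j * \<theta> j)"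
    using U unfolding untwisted_affine_def by blast
  obtain E len r par rk where fc: "finite_cartan X n = diagram_cartan E len" and gl: "good_lengths len"
    and tr: "tree_on {1..n} E r par rk" using finite_cartan_data[OF C(1)] by blast
  have lp: "0 < len i" "len i dvd len j \<or> len j dvd len i" for i j using gl by (auto simp: good_lengths_def)
  note dp = diagram_cartan_props[of len, OF lp, where E = E, folded fc]
  define d0 where "d0 i = int (len i)" for i
  have d0: "d0 i > 0" for i using gl by (simp add: d0_def good_lengths_def)
  have sym0: "d0 i * C i j = d0 j * C j i" if "i \<in> {1..n}" "j \<in> {1..n}" for i j
    using dp(3)[of i j] C(2) that by (simp add: d0_def)
  obtain D where D: "D > 0" "\<And>k. k \<in> {1..n} \<Longrightarrow> D * \<theta>' k = d0 k * \<theta> k" "\<And>k. k \<notin> {1..n} \<Longrightarrow> \<theta> k = 0 \<and> \<theta>' k = 0"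
    using root_coroot_prop[OF rc, of d0] d0 sym0 by auto
  define d where "d i = (if i = 0 then D else d0 i)" for i
  have sum1: "(\<Sum>j\<le>n. C i j * \<theta> j) = (\<Sum>j=1..n. C i j * \<theta> j)" for i
    using D(3) by (intro sum.mono_neutral_right) auto
  have rr: "\<theta> \<in> real_roots C n {1..n}" and top: "\<And>\<beta> i. \<beta> \<in> real_roots C n {1..n} \<Longrightarrow> \<beta> i \<le> \<theta> i"
    using hr by (auto simp: highest_root_def)
  have wr: "simple_refl C n i \<beta> \<in> real_roots C n {1..n}" if h: "\<beta> \<in> real_roots C n {1..n}" "i \<in> {1..n}" for \<beta> i
  proof -
    obtain w j where w: "\<beta> = w (simple_root j)" "w \<in> weyl_group C n {1..n}" "j \<in> {1..n}" using h(1) unfolding real_roots_def by blast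
    then have "simple_refl C n i \<beta> = (simple_refl C n i \<circ> w) (simple_root j)" by simp
    then show ?thesis using weyl_step[OF w(2) h(2)] w(3) unfolding real_roots_def by blast
  qed
  \<comment> \<open>Reflecting the highest root cannot increase its coordinate at i, so its pairing
    with the i-th coroot is nonnegative.\<close>
  have Ci0le: "C i 0 \<le> 0" if "i \<in> {1..n}" for i
    using top[OF wr[OF rr that], of i] Ci0[OF that] sum1[of i] by (simp add: simple_refl_def)
  have symm0: "D * C 0 j = d0 j * C j 0" if j: "j \<in> {1..n}" for j
  proof -
    have "D * C 0 j = - (\<Sum>i=1..n. D * \<theta>' i * C i j)" by (simp add: C0j[OF j] sum_distrib_left mult.assoc)
    also have "(\<Sum>i=1..n. D * \<theta>' i * C i j) = (\<Sum>i=1..n. d0 j * (C j i * \<theta> i))"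
      by (rule sum.cong[OF refl]) (use D(2) sym0[OF _ j] in \<open>simp add: mult.assoc mult.left_commute mult.commute\<close>)
    finally show ?thesis by (simp add: Ci0[OF j] sum_distrib_left)
  qed
  have C0jle: "C 0 j \<le> 0" if "j \<in> {1..n}" for j
  proof -
    have "D * C 0 j \<le> 0" unfolding symm0[OF that] using Ci0le[OF that] d0[of j] by (simp add: mult_nonneg_nonpos)
    then show ?thesis using D(1) by (simp add: mult_le_0_iff)
  qed
  have zero_iff: "C 0 j = 0 \<longleftrightarrow> C j 0 = 0" if "j \<in> {1..n}" for j
    using symm0[OF that] D(1) d0[of j] by auto
  have in1: "i \<in> {1..n} \<or> i = 0" if "i \<le> n" for i using that by auto
  have lab': "\<And>i. i \<le> n \<Longrightarrow> a i > 0" "Gcd (a ` {0..n}) = 1" "\<And>i. i \<le> n \<Longrightarrow> (\<Sum>j\<le>n. C i j * int (a j)) = 0"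
    using lab by (auto simp: affine_labels_def)
  \<comment> \<open>If 0 had no neighbour, the label equation in row 0 would read 2 a_0 = 0.\<close>
  obtain j0 where j0: "j0 \<in> {1..n}" "C 0 j0 \<noteq> 0"
  proof (rule ccontr)
    assume "\<not> thesis"
    then have z: "C 0 j = 0" if "j \<in> {1..n}" for j using that \<open>\<And>j0. j0 \<in> {1..n} \<Longrightarrow> C 0 j0 \<noteq> 0 \<Longrightarrow> thesis\<close> by blast
    have "(\<Sum>j\<le>n. C 0 j * int (a j)) = (\<Sum>j\<in>{0}. C 0 j * int (a j))"
      by (rule sum.mono_neutral_right) (auto simp: z)
    then show False using lab'(3)[of 0] lab'(1)[of 0] C00 by simp
  qed
  interpret A: affine_matrix C n a d
  proof
    show "C i i = 2" if "i \<le> n" for i using in1[OF that] C(2)[of i i] dp(1) C00 by auto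
    show "C i j \<le> 0" if "i \<le> n" "j \<le> n" "i \<noteq> j" for i j
      using in1[OF that(1)] in1[OF that(2)] that(3) C(2)[of i j] dp(2)[of i j] Ci0le[of i] C0jle[of j] by auto
    show "d i > 0" if "i \<le> n" for i using D(1) d0 by (simp add: d_def)
    show "d i * C i j = d j * C j i" if "i \<le> n" "j \<le> n" for i j
      using in1[OF that(1)] in1[OF that(2)] sym0[of i j] symm0[of j] symm0[of i] by (auto simp: d_def)
    show "a i > 0" if "i \<le> n" for i by (rule lab'(1)[OF that])
    show "(\<Sum>j\<le>n. C i j * int (a j)) = 0" if "i \<le> n" for i by (rule lab'(3)[OF that])
    fix S :: "nat set" assume S: "S \<subseteq> {..n}" "S \<noteq> {}" "\<And>i j. i \<in> S \<Longrightarrow> j \<le> n \<Longrightarrow> C i j \<noteq> 0 \<Longrightarrow> j \<in> S"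
    show "S = {..n}"
    proof (rule closed_eq[where r = r and par = "\<lambda>i. if i = 0 then j0 else par i" and c = "\<lambda>i j. C i j \<noteq> 0"
          and rk = "\<lambda>i. if i = 0 then Suc (rk j0) else rk i"])
      show "r \<in> {..n}" using tr by (simp add: tree_on_def)
      fix i assume i: "i \<in> {..n}" "i \<noteq> r"
      show "(if i = 0 then j0 else par i) \<in> {..n} \<and>
        (if (if i = 0 then j0 else par i) = 0 then Suc (rk j0) else rk (if i = 0 then j0 else par i)) <
        (if i = 0 then Suc (rk j0) else rk i) \<and>
        C i (if i = 0 then j0 else par i) \<noteq> 0 \<and> C (if i = 0 then j0 else par i) i \<noteq> 0"
      proof (cases "i = 0")
        case True
        then show ?thesis using j0 zero_iff[OF j0(1)] by auto
      next
        case False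
        then have i1: "i \<in> {1..n}" using i by auto
        then have p: "par i \<in> {1..n}" "rk (par i) < rk i" "(i, par i) \<in> E \<or> (par i, i) \<in> E"
          using tr i(2) by (auto simp: tree_on_def)
        have "C i (par i) \<noteq> 0" "C (par i) i \<noteq> 0"
          unfolding C(2)[OF i1 p(1)] C(2)[OF p(1) i1] by (rule dp(4), use p(3) in blast)+
        then show ?thesis using False p by auto
      qed
    qed (use S in auto)
  qed
  \<comment> \<open>The vector theta + alpha_0 has coordinate 1 at the node 0 and satisfies the
    label equations in all other rows; so it consists of the labels.\<close>
  have lo: "a 0 = 1" "i \<le> n \<Longrightarrow> int (a i) = \<theta> i + A.al 0 i" for i
  proof -
    have b: "\<theta> 0 + A.al 0 0 = 1" using D(3)[of 0] by (simp add: simple_root_apply)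
    have row: "(\<Sum>j\<le>n. C i j * (\<theta> j + A.al 0 j)) = 0" if "i \<le> n" "i \<noteq> 0" for i
    proof -
      have "(\<Sum>j\<le>n. C i j * (\<theta> j + A.al 0 j)) = (\<Sum>j\<le>n. C i j * \<theta> j) + A.pr i (A.al 0)"
        by (simp add: distrib_left sum.distrib pairing_def)
      also have "\<dots> = 0" using Ci0[of i] that sum1[of i] by simp
      finally show ?thesis .
    qed
    show "a 0 = 1" by (rule A.label_one(1)[OF _ b row lab'(2)]) auto
    show "i \<le> n \<Longrightarrow> int (a i) = \<theta> i + A.al 0 i" by (rule A.label_one(2)[OF _ b row lab'(2)]) auto
  qed
  have th: "A.delta - A.al 0 = \<theta>"
  proof
    fix k show "(A.delta - A.al 0) k = \<theta> k"
      using lo(2)[of k] D(3)[of k] by (cases "k \<le> n") (auto simp: A.delta_def simple_root_apply)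
  qed
  have sub: "real_roots C n {1..n} \<subseteq> A.RR"
    unfolding real_roots_def using A.sub_W[of "{1..n}"] by fastforce
  have thR: "\<theta> \<in> A.RR" using rr sub by blast
  have fth: "A.form \<theta> \<theta> = 2 * d 0"
    using A.form_al_al[of 0] by (simp flip: th add: A.form_simps)
  \<comment> \<open>A vector that is dominant on the nodes 1 to n pairs nonnegatively with theta
    minus any finite root, as this difference has nonnegative coordinates.\<close>
  have dom: "A.form \<eta> (\<theta> - \<eta>') \<ge> 0"
    if h: "\<And>j. j \<in> {1..n} \<Longrightarrow> A.pr j \<eta> \<ge> 0" "\<eta>' \<in> real_roots C n {1..n}" for \<eta> \<eta>'
  proof -
    have "A.form (\<theta> - \<eta>') \<eta> \<ge> 0" unfolding A.form_def
    proof (rule sum_nonneg)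
      fix k assume "k \<in> {..n}"
      show "0 \<le> (\<theta> - \<eta>') k * d k * A.pr k \<eta>"
      proof (cases "k = 0")
        case True
        have "\<eta>' 0 = 0" using h(2) by (auto simp: real_roots_def weyl_group_coord simple_root_apply)
        then show ?thesis using True D(3)[of 0] by simp
      next
        case False
        then have k: "k \<in> {1..n}" using \<open>k \<in> {..n}\<close> by auto
        have "0 \<le> (\<theta> - \<eta>') k" using top[OF h(2), of k] by simp
        moreover have "0 < d k" using k by (intro A.d_pos) auto
        ultimately show ?thesis using h(1)[OF k] by (intro mult_nonneg_nonneg) auto
      qed
    qed
    then show ?thesis by (simp add: A.form_sym)
  qed
  have "d i \<le> d 0" if i: "i \<le> n" for i
  proof (cases "i = 0")
    case False
    then have i1: "i \<in> {1..n}" using i by auto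
    \<comment> \<open>In the orbit under the finite Weyl group heights are bounded by that of theta,
      and an element eta of greatest height is dominant. Dominance of eta and of theta gives (eta,
      eta) \<le> (eta, theta) \<le> (theta, theta), so alpha_i is not longer than theta.\<close>
    define orb where "orb = {w (A.al i) | w. w \<in> weyl_group C n {1..n}}"
    have OR: "\<eta> \<in> real_roots C n {1..n}" if "\<eta> \<in> orb" for \<eta> using that i1 by (auto simp: orb_def real_roots_def)
    have Oi: "A.al i \<in> orb" unfolding orb_def using weyl_id by (metis (mono_tags, lifting) id_apply mem_Collect_eq)
    have bd: "nat (A.ht \<eta>) < Suc (nat (A.ht \<theta>))" if "\<eta> \<in> orb" for \<eta>
    proof -
      have "A.ht \<eta> \<le> A.ht \<theta>" unfolding A.ht_def using top[OF OR[OF that]] by (intro sum_mono) auto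
      then show ?thesis by simp
    qed
    obtain \<eta> where e: "\<eta> \<in> orb" "\<And>\<zeta>. \<zeta> \<in> orb \<Longrightarrow> nat (A.ht \<zeta>) \<le> nat (A.ht \<eta>)"
      using ex_has_greatest_nat[of "\<lambda>x. x \<in> orb" "A.al i" "\<lambda>x. nat (A.ht x)" "Suc (nat (A.ht \<theta>))"] Oi bd by (auto simp: less_imp_le)
    have ale: "A.ht (A.al i) = 1"
    proof -
      have "A.ht (A.al i) = (\<Sum>k\<le>n. if k = i then 1 else 0)" by (simp add: A.ht_def simple_root_apply)
      then show ?thesis using i by simp
    qed
    have hpos: "A.ht \<eta> \<ge> 1" using e(2)[OF Oi] ale by simp
    have de: "A.pr j \<eta> \<ge> 0" if j: "j \<in> {1..n}" for j
    proof (rule ccontr)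
      assume neg: "\<not> ?thesis"
      obtain w where w: "w \<in> weyl_group C n {1..n}" "\<eta> = w (A.al i)" using e(1) orb_def by auto
      have "simple_refl C n j \<eta> = (simple_refl C n j \<circ> w) (A.al i)" using w(2) by simp
      then have "simple_refl C n j \<eta> \<in> orb" unfolding orb_def using weyl_step[OF w(1) j] by blast
      then have le: "nat (A.ht (simple_refl C n j \<eta>)) \<le> nat (A.ht \<eta>)" by (rule e(2))
      have "A.ht (simple_refl C n j \<eta>) = A.ht \<eta> - A.pr j \<eta> * A.ht (A.al j)"
        using flinD(2,3)[OF A.flin_ht] by (simp add: simple_refl_alt)
      moreover have "A.ht (A.al j) > 0" using A.ht_pos[OF A.al_RR] j by (simp add: le_fun_def simple_root_apply)
      ultimately have "A.ht (simple_refl C n j \<eta>) > A.ht \<eta>" using neg by (simp add: mult_neg_pos)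
      then show False using le hpos by linarith
    qed
    have dt: "A.pr j \<theta> \<ge> 0" if "j \<in> {1..n}" for j
      using top[OF wr[OF rr that], of j] by (simp add: simple_refl_alt simple_root_apply)
    have eR: "\<eta> \<in> real_roots C n {1..n}" by (rule OR[OF e(1)])
    have "A.form \<theta> (\<theta> - \<eta>) \<ge> 0" "A.form \<eta> (\<theta> - \<eta>) \<ge> 0" using dom[OF dt eR] dom[OF de eR] by auto
    then have "A.form \<eta> \<eta> \<le> A.form \<theta> \<theta>" using A.form_sym[of \<theta> \<eta>] by (simp add: A.form_simps)
    moreover have "A.form \<eta> \<eta> = 2 * d i"
    proof -
      obtain w where w: "w \<in> weyl_group C n {1..n}" "\<eta> = w (A.al i)" using e(1) orb_def by auto
      show ?thesis unfolding w(2) using A.W_form[OF A.sub_W[OF _ w(1)]] A.form_al_al[OF i] by simp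
    qed
    ultimately show ?thesis using fth by simp
  qed simp
  then have "untwisted C n a d"
    by unfold_locales (use lo(1) thR th in auto)
  then show ?thesis by blast
qed

section \<open>The twisted diagrams and the label of the loop node\<close>

lemma sum_triple:
  fixes i n :: nat
  assumes "0 < i" "i < n" "\<And>j. j \<le> n \<Longrightarrow> j \<noteq> i - 1 \<Longrightarrow> j \<noteq> i \<Longrightarrow> j \<noteq> i + 1 \<Longrightarrow> f j = (0::int)"
  shows "(\<Sum>j\<le>n. f j) = f (i - 1) + f i + f (i + 1)"
proof -
  have "(\<Sum>j\<le>n. f j) = (\<Sum>j\<in>{i - 1, i, i + 1}. f j)"
    using assms by (intro sum.mono_neutral_right) auto
  moreover have "i - 1 \<noteq> i" "i - 1 \<noteq> i + 1" using assms(1) by auto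
  ultimately show ?thesis by simp
qed

lemma sum_pair:
  fixes i k n :: nat
  assumes "i \<noteq> k" "i \<le> n" "k \<le> n" "\<And>j. j \<le> n \<Longrightarrow> j \<noteq> i \<Longrightarrow> j \<noteq> k \<Longrightarrow> f j = (0::int)"
  shows "(\<Sum>j\<le>n. f j) = f i + f k"
proof -
  have "(\<Sum>j\<le>n. f j) = (\<Sum>j\<in>{i, k}. f j)"
    using assms by (intro sum.mono_neutral_right) auto
  then show ?thesis using assms(1) by simp
qed

lemma diagram_affine_matrix:
  assumes C: "\<And>i j. i \<le> n \<Longrightarrow> j \<le> n \<Longrightarrow> C i j = diagram_cartan E len i j"
    and gl: "good_lengths len" and tr: "tree_on {0..n} E r par rk" and lab: "affine_labels C n a"
  shows "affine_matrix C n a (\<lambda>i. int (len i))"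
proof
  have lp: "0 < len i" "len i dvd len j \<or> len j dvd len i" for i j using gl by (auto simp: good_lengths_def)
  note dp = diagram_cartan_props[of len, OF lp, where E = E]
  show "C i i = 2" if "i \<le> n" for i using C dp(1) that by simp
  show "C i j \<le> 0" if "i \<le> n" "j \<le> n" "i \<noteq> j" for i j using C dp(2) that by simp
  show "int (len i) > 0" for i using gl by (simp add: good_lengths_def)
  show "int (len i) * C i j = int (len j) * C j i" if "i \<le> n" "j \<le> n" for i j using C that dp(3) by simp
  show "a i > 0" if "i \<le> n" for i using lab that by (simp add: affine_labels_def)
  show "(\<Sum>j\<le>n. C i j * int (a j)) = 0" if "i \<le> n" for i using lab that by (simp add: affine_labels_def)
  fix S :: "nat set" assume S: "S \<subseteq> {..n}" "S \<noteq> {}" "\<And>i j. i \<in> S \<Longrightarrow> j \<le> n \<Longrightarrow> C i j \<noteq> 0 \<Longrightarrow> j \<in> S"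
  show "S = {..n}"
  proof (rule closed_eq[where c = "\<lambda>i j. C i j \<noteq> 0"])
    show "r \<in> {..n}" using tr by (simp add: tree_on_def)
    fix i assume i: "i \<in> {..n}" "i \<noteq> r"
    then have p: "par i \<le> n" "rk (par i) < rk i" "(i, par i) \<in> E \<or> (par i, i) \<in> E"
      using tr by (auto simp: tree_on_def)
    moreover have "C i (par i) \<noteq> 0" "C (par i) i \<noteq> 0" using C p i dp(4) by auto
    ultimately show "par i \<in> {..n} \<and> rk (par i) < rk i \<and> C i (par i) \<noteq> 0 \<and> C (par i) i \<noteq> 0" by simp
  qed (use S in auto)
qed

text \<open>In each case the vector b lists the expected labels. It is checked in the rows other
  than that of the loop node, and \<open>label_one\<close> returns the label 1 there.\<close>

lemma twisted_affine_matrix: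
  assumes T: "twisted_affine X N n C" and lab: "affine_labels C n a"
  shows "\<exists>d. affine_matrix C n a d" "loop_node X N 2 n \<le> n" "a (loop_node X N 2 n) = 1"
proof -
  let ?e = "loop_node X N 2 n"
  have gcd: "Gcd (a ` {0..n}) = 1" using lab by (simp add: affine_labels_def)
  have tc: "tree_on {0..n} (chain 0 n) 0 (\<lambda>i. i - 1) id" by (rule tree_chain) simp
  have "(\<exists>d. affine_matrix C n a d) \<and> ?e \<le> n \<and> a ?e = 1"
    using T unfolding twisted_affine_def
  proof (elim disjE conjE)
    assume h: "X = A_fam" "1 \<le> n" "N = 2 * n"
      and C: "\<forall>i\<le>n. \<forall>j\<le>n. C i j = diagram_cartan (chain 0 n) (\<lambda>i. if i = 0 then 1 else if i = n then 4 else 2) i j"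
    interpret affine_matrix C n a "\<lambda>i. int (if i = 0 then 1 else if i = n then 4 else 2)"
      by (rule diagram_affine_matrix[OF _ _ tc lab]) (use C in \<open>auto simp: good_lengths_def\<close>)
    have "a n = 1"
    proof (rule label_one(1)[where b = "\<lambda>i. if i = n then 1 else 2"])
      fix i assume i: "i \<le> n" "i \<noteq> n"
      show "(\<Sum>j\<le>n. C i j * (if j = n then 1 else 2)) = 0"
      proof (cases "i = 0")
        case True
        then show ?thesis using C h(2)
          by (subst sum_pair[of 0 1]) (auto simp: diagram_cartan_def chain_def)
      next
        case False
        then show ?thesis using C i
          by (subst sum_triple[of i]) (auto simp: diagram_cartan_def chain_def)
      qed
    qed (use gcd in auto)
    moreover have "?e = n" using h by (simp add: loop_node_def)
    ultimately show ?thesis using affine_matrix_axioms by auto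
  next
    assume h: "X = A_fam" "3 \<le> n" "N = 2 * n - 1"
      and C: "\<forall>i\<le>n. \<forall>j\<le>n. C i j = diagram_cartan (insert (0, 2) (chain 1 n)) (\<lambda>i. if i = n then 2 else 1) i j"
    have tr: "tree_on {0..n} (insert (0, 2) (chain 1 n)) 1 (\<lambda>i. if i = 0 then 2 else i - 1) (\<lambda>i. if i = 0 then 3 else i)"
      using h(2) by (force simp: tree_on_def chain_def)
    interpret affine_matrix C n a "\<lambda>i. int (if i = n then 2 else 1)"
      by (rule diagram_affine_matrix[OF _ _ tr lab]) (use C in \<open>auto simp: good_lengths_def\<close>)
    have "a 0 = 1"
    proof (rule label_one(1)[where b = "\<lambda>i. if i = 0 \<or> i = 1 \<or> i = n then 1 else 2"])
      fix i assume i: "i \<le> n" "i \<noteq> 0"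
      let ?b = "\<lambda>i. if i = 0 \<or> i = 1 \<or> i = n then 1 else 2 :: int"
      consider "i = 1" | "i = 2" | "i = n" | "2 < i" "i < n" using i by linarith
      then show "(\<Sum>j\<le>n. C i j * ?b j) = 0"
      proof cases
        case 1
        then show ?thesis using C h(2)
          by (subst sum_pair[of 1 2]) (auto simp: diagram_cartan_def chain_def)
      next
        case 2
        have "(\<Sum>j\<le>n. C i j * ?b j) = (\<Sum>j\<in>{0, 1, 2, 3}. C i j * ?b j)"
          using C 2 h(2) by (intro sum.mono_neutral_right) (auto simp: diagram_cartan_def chain_def)
        then show ?thesis using C 2 h(2) by (auto simp: diagram_cartan_def chain_def)
      next
        case 3
        then show ?thesis using C h(2)
          by (subst sum_pair[of "n - 1" n]) (auto simp: diagram_cartan_def chain_def)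
      next
        case 4
        then show ?thesis using C
          by (subst sum_triple[of i]) (auto simp: diagram_cartan_def chain_def)
      qed
    qed (use gcd in auto)
    moreover have "?e = 0" using h by (simp add: loop_node_def)
    ultimately show ?thesis using affine_matrix_axioms by auto
  next
    assume h: "X = D_fam" "2 \<le> n" "N = n + 1"
      and C: "\<forall>i\<le>n. \<forall>j\<le>n. C i j = diagram_cartan (chain 0 n) (\<lambda>i. if i = 0 \<or> i = n then 1 else 2) i j"
    interpret affine_matrix C n a "\<lambda>i. int (if i = 0 \<or> i = n then 1 else 2)"
      by (rule diagram_affine_matrix[OF _ _ tc lab]) (use C in \<open>auto simp: good_lengths_def\<close>)
    have "a 0 = 1"
    proof (rule label_one(1)[where b = "\<lambda>i. 1"])
      fix i assume i: "i \<le> n" "i \<noteq> 0"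
      show "(\<Sum>j\<le>n. C i j * 1) = 0"
      proof (cases "i = n")
        case True
        then show ?thesis using C h(2)
          by (subst sum_pair[of "n - 1" n]) (auto simp: diagram_cartan_def chain_def)
      next
        case False
        then show ?thesis using C i
          by (subst sum_triple[of i]) (auto simp: diagram_cartan_def chain_def)
      qed
    qed (use gcd in auto)
    moreover have "?e = 0" using h by (simp add: loop_node_def)
    ultimately show ?thesis using affine_matrix_axioms by auto
  next
    assume h: "X = E_fam" "n = 4" "N = 6"
      and C: "\<forall>i\<le>n. \<forall>j\<le>n. C i j = diagram_cartan (chain 0 4) (\<lambda>i. if i \<le> 2 then 1 else 2) i j"
    have tr: "tree_on {0..n} (chain 0 4) 0 (\<lambda>i. i - 1) id" using tc h(2) by simp
    interpret affine_matrix C n a "\<lambda>i. int (if i \<le> 2 then 1 else 2)"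
      by (rule diagram_affine_matrix[OF _ _ tr lab]) (use C in \<open>auto simp: good_lengths_def\<close>)
    have "a 0 = 1"
    proof (rule label_one(1)[where b = "\<lambda>i. if i = 0 \<or> i = 4 then 1 else if i = 2 then 3 else 2"])
      fix i assume i: "i \<le> n" "i \<noteq> 0"
      show "(\<Sum>j\<le>n. C i j * (if j = 0 \<or> j = 4 then 1 else if j = 2 then 3 else 2)) = 0"
      proof (cases "i = 4")
        case True
        then show ?thesis using C h(2)
          by (subst sum_pair[of 3 4]) (auto simp: diagram_cartan_def chain_def)
      next
        case False
        then have "i = 1 \<or> i = 2 \<or> i = 3" using i h(2) by auto
        then show ?thesis using C h(2)
          by (subst sum_triple[of i]) (auto simp: diagram_cartan_def chain_def)
      qed
    qed (use gcd in auto)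
    moreover have "?e = 0" using h by (simp add: loop_node_def)
    ultimately show ?thesis using affine_matrix_axioms by auto
  qed
  then show "\<exists>d. affine_matrix C n a d" "?e \<le> n" "a ?e = 1" by auto
qed

section \<open>Semisimplicity of the fixed point algebra\<close>

lemma lie_generated_subset: "lie_subalgebra scale br L \<Longrightarrow> S \<subseteq> L \<Longrightarrow> lie_generated scale br S \<subseteq> L"
  by (auto simp: lie_generated_def)

lemma lie_generated_base: "S \<subseteq> lie_generated scale br S"
  by (auto simp: lie_generated_def)

context complex_lie_algebra
begin

lemma br_zero [simp]: "br 0 x = 0" "br x 0 = 0"
  using br_add_left[of 0 0 x] br_add_right[of x 0 0] by simp_all

lemma br_minus: "br (- x) y = - br x y" "br x (- y) = - br x y"
  using br_add_left[of x "- x" y] br_add_right[of x y "- y"] by (simp_all add: eq_neg_iff_add_eq_0 add.commute)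

lemma br_anti: "br y x = - br x y"
proof -
  have "br x (x + y) + br y (x + y) = 0" using br_self[of "x + y"] unfolding br_add_left .
  then have "br y x + br x y = 0" by (simp add: br_add_right br_self add.commute)
  then show ?thesis by (simp add: eq_neg_iff_add_eq_0)
qed

lemma br_br: "br x (br y z) = br (br x y) z + br y (br x z)"
proof -
  have "br x (br y z) + br y (br z x) + br z (br x y) = 0" by (rule jacobi)
  moreover have "br y (br z x) = - br y (br x z)" "br z (br x y) = - br (br x y) z"
    using br_anti[of z x] br_anti[of z "br x y"] by (simp_all add: br_minus)
  ultimately show ?thesis by (simp add: algebra_simps)
qed

lemma br_span:
  assumes "x \<in> span A" "y \<in> span B" "\<And>a b. a \<in> A \<Longrightarrow> b \<in> B \<Longrightarrow> br a b \<in> span D"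
  shows "br x y \<in> span D"
proof -
  have 1: "br a y \<in> span D" if "a \<in> A" for a
    using assms(2)
  proof (induct rule: span_induct_alt)
    case base
    then show ?case by (simp add: span_zero)
  next
    case (step c b z)
    then show ?case using assms(3)[OF that] by (simp add: br_add_right br_scale_right span_add span_scale)
  qed
  show ?thesis using assms(1)
  proof (induct rule: span_induct_alt)
    case base
    then show ?case by (simp add: span_zero)
  next
    case (step c b z)
    then show ?case using 1 by (simp add: br_add_left br_scale_left span_add span_scale)
  qed
qed

definition lop :: "('g \<Rightarrow> 'g) \<Rightarrow> bool" where
  "lop f \<longleftrightarrow> (\<forall>x y. f (x + y) = f x + f y) \<and> (\<forall>c x. f (scale c x) = scale c (f x))"

lemma lop_br: "lop (br x)" by (simp add: lop_def br_add_right br_scale_right)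

lemma lop_comp: "lop f \<Longrightarrow> lop g \<Longrightarrow> lop (\<lambda>v. f (g v))" by (simp add: lop_def)

lemma lop_zero: "lop f \<Longrightarrow> f 0 = 0"
  unfolding lop_def by (metis scale_zero_left)

lemma lop_sum: "lop f \<Longrightarrow> f (\<Sum>b\<in>A. scale (u b) (g b)) = (\<Sum>b\<in>A. scale (u b) (f (g b)))"
  by (induct A rule: infinite_finite_induct) (auto simp: lop_def lop_zero[unfolded lop_def])

text \<open>Choose a basis among the joint eigenvectors and compare coordinates: a basis vector that
  occurs in x must have the eigenvalues of x.\<close>

lemma eigen_span:
  assumes T: "\<And>i. i \<in> N \<Longrightarrow> lop (T i)" and S: "\<And>v i. v \<in> S \<Longrightarrow> i \<in> N \<Longrightarrow> \<exists>c. T i v = scale c v"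
    and x: "x \<in> span S" "\<And>i. i \<in> N \<Longrightarrow> T i x = scale (c i) x"
  shows "x \<in> span {v \<in> S. \<forall>i\<in>N. T i v = scale (c i) v}"
proof -
  obtain B where B: "B \<subseteq> S" "independent B" "S \<subseteq> span B" by (rule maximal_independent_subset)
  have xB: "x \<in> span B" using x(1) B(3) by (meson in_mono span_minimal subspace_span)
  let ?r = "representation B x"
  define F where "F = {b. ?r b \<noteq> 0}"
  have F: "finite F" "F \<subseteq> B" unfolding F_def using finite_representation representation_ne_zero by blast+
  have xe: "x = (\<Sum>b\<in>F. scale (?r b) b)" unfolding F_def by (rule sum_nonzero_representation_eq[OF B(2) xB, symmetric])
  have "T i b = scale (c i) b" if i: "i \<in> N" and b: "b \<in> F" for i b
  proof -
    have "\<exists>c. T i b = scale c b" if "b \<in> F" for b using S i that F B(1) by blast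
    then obtain e where e: "\<And>b. b \<in> F \<Longrightarrow> T i b = scale (e b) b" by metis
    have "T i x = (\<Sum>b\<in>F. scale (?r b) (T i b))" by (subst xe) (rule lop_sum[OF T[OF i]])
    also have "\<dots> = (\<Sum>b\<in>F. scale (?r b * e b) b)" by (rule sum.cong) (simp_all add: e)
    finally have "(\<Sum>b\<in>F. scale (?r b * e b) b) = scale (c i) x" using x(2)[OF i] by simp
    also have "\<dots> = (\<Sum>b\<in>F. scale (c i * ?r b) b)" by (subst xe) (simp add: scale_sum_right)
    finally have "(\<Sum>b\<in>F. scale (?r b * e b - c i * ?r b) b) = 0"
      by (simp add: scale_left_diff_distrib sum_subtractf)
    then have "?r b * e b - c i * ?r b = 0"
      using independentD[OF B(2) F(1,2) _ b, of "\<lambda>b. ?r b * e b - c i * ?r b"] by simp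
    then have "?r b * (e b - c i) = 0" by (simp add: algebra_simps)
    then have "e b = c i" using b by (simp add: F_def)
    then show ?thesis using e[OF b] by simp
  qed
  then have "F \<subseteq> {v \<in> S. \<forall>i\<in>N. T i v = scale (c i) v}" using F B(1) by blast
  then show ?thesis by (subst xe) (intro span_sum span_scale span_base, blast)
qed

section \<open>Triangular decomposition of generated subalgebras\<close>

text \<open>Nested brackets together with their degree in the root lattice. The degree is recorded
  because a vector, for instance 0, does not determine it.\<close>

inductive_set npos :: "(nat \<Rightarrow> 'g) \<Rightarrow> nat set \<Rightarrow> ((nat \<Rightarrow> int) \<times> 'g) set" for e N where
  npos_gen: "i \<in> N \<Longrightarrow> (simple_root i, e i) \<in> npos e N"
| npos_br: "(m, y) \<in> npos e N \<Longrightarrow> i \<in> N \<Longrightarrow> (simple_root i + m, br (e i) y) \<in> npos e N"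

end

locale chevalley_algebra = complex_lie_algebra scale br + affine_matrix C n a d
  for scale :: "complex \<Rightarrow> 'g::ab_group_add \<Rightarrow> 'g" and br C n a d +
  fixes E F :: "nat \<Rightarrow> 'g"
  assumes rel: "chevalley_relations scale br C n E F"
begin

definition H where "H i = br (E i) (F i)"

lemma rel_simps:
  assumes "i \<le> n" "j \<le> n"
  shows "i \<noteq> j \<Longrightarrow> br (E i) (F j) = 0" "br (H i) (H j) = 0" "br (H i) (E j) = scale (of_int (C i j)) (E j)"
    "br (H i) (F j) = scale (of_int (- C i j)) (F j)"
  using rel assms by (auto simp: chevalley_relations_def H_def)

text \<open>The relations are symmetric under exchange of E and F, with H_i replaced by -H_i.
  Statements on the positive part thus apply to the negative part through the sublocale
  \<open>sw\<close>.\<close>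

lemma swap_EF: "chevalley_relations scale br C n F E"
  using rel unfolding chevalley_relations_def
  by (auto simp: br_anti[of "F _" "E _"] br_minus)

lemma npos_weight:
  assumes "(m, y) \<in> npos E N" "N \<subseteq> {0..n}" "i \<le> n"
  shows "br (H i) y = scale (of_int (pr i m)) y"
  using assms(1)
proof induct
  case (npos_gen j)
  then show ?case using rel_simps(3)[of i j] assms by auto
next
  case (npos_br m y j)
  then have j: "j \<le> n" using assms(2) by auto
  have "br (H i) (br (E j) y) = br (scale (of_int (C i j)) (E j)) y + br (E j) (scale (of_int (pr i m)) y)"
    using br_br[of "H i" "E j" y] rel_simps(3)[OF assms(3) j] npos_br by simp
  moreover have "pr i (simple_root j + m) = C i j + pr i m"
    using flinD(1)[OF flin_pairing[of C n i], of "simple_root j" m] j by simp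
  ultimately show ?case by (simp only: br_scale_left br_scale_right scale_left_distrib of_int_add)
qed

lemma npos_deg:
  assumes "(m, y) \<in> npos E N"
  shows "0 \<le> m" "m \<noteq> 0" "k \<notin> N \<Longrightarrow> m k = 0"
proof -
  have "0 \<le> m \<and> (\<exists>k. m k > 0) \<and> (\<forall>k. k \<notin> N \<longrightarrow> m k = 0)"
    using assms
  proof induct
    case (npos_gen i)
    then show ?case by (auto simp: le_fun_def simple_root_apply)
  next
    case (npos_br m y i)
    then have m: "\<And>k. 0 \<le> m k" by (auto dest: le_funD)
    show ?case
    proof (intro conjI)
      show "0 \<le> simple_root i + m" using m by (auto simp: le_fun_def simple_root_apply)
      have "(simple_root i + m) i > 0" using m[of i] by (simp add: simple_root_apply)
      then show "\<exists>k. (simple_root i + m) k > 0" by blast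
      show "\<forall>k. k \<notin> N \<longrightarrow> (simple_root i + m) k = 0" using npos_br by (auto simp: simple_root_apply)
    qed
  qed
  then show "0 \<le> m" "m \<noteq> 0" "k \<notin> N \<Longrightarrow> m k = 0" by auto
qed

text \<open>F_j moves through the nested bracket as a derivation; the only contributions come from
  [F_j, E_j] = -H_j, which acts on the inner bracket by a scalar.\<close>

lemma npos_lower:
  assumes y: "(m, y) \<in> npos E N" and N: "N \<subseteq> {0..n}" "j \<in> N"
  shows "br (F j) y \<in> span (snd ` npos E N \<union> H ` N)"
  using y
proof induct
  case (npos_gen i)
  show ?case
  proof (cases "i = j")
    case True
    then have "br (F j) (E i) = - H j" using br_anti[of "F j" "E i"] by (simp add: H_def)
    then show ?thesis using N by (simp add: span_neg span_base)
  next
    case False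
    moreover have "i \<le> n" "j \<le> n" using npos_gen N by auto
    ultimately have "br (F j) (E i) = 0" using br_anti[of "F j" "E i"] rel_simps(1)[of i j] by simp
    then show ?thesis by (simp add: span_zero)
  qed
next
  case (npos_br m y i)
  have ij: "i \<le> n" "j \<le> n" using N npos_br(3) by auto
  let ?U = "span (snd ` npos E N \<union> H ` N)"
  have yU: "y \<in> ?U" using npos_br(1) by (intro span_base) force
  have "br (br (F j) (E i)) y \<in> ?U"
  proof (cases "i = j")
    case True
    then have "br (F j) (E i) = - H j" using br_anti[of "F j" "E i"] by (simp add: H_def)
    then have "br (br (F j) (E i)) y = - scale (of_int (pr j m)) y"
      using npos_weight[OF npos_br(1) N(1) ij(2)] by (simp add: br_minus)
    then show ?thesis using yU by (simp add: span_neg span_scale)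
  next
    case False
    then have "br (F j) (E i) = 0" using br_anti[of "F j" "E i"] rel_simps(1)[of i j] ij by auto
    then show ?thesis by (simp add: span_zero)
  qed
  moreover have "br (E i) (br (F j) y) \<in> ?U"
  proof (rule br_span[OF span_base[of "E i" "{E i}"] npos_br(2)])
    fix u b assume u: "u \<in> {E i}" and b: "b \<in> snd ` npos E N \<union> H ` N"
    show "br u b \<in> ?U"
    proof (cases "b \<in> snd ` npos E N")
      case True
      then obtain m' where "(m', b) \<in> npos E N" by auto
      then have "(simple_root i + m', br (E i) b) \<in> npos E N" using npos_br(3) by (rule npos.npos_br)
      then show ?thesis using u by (intro span_base) force
    next
      case False
      then obtain k where k: "k \<in> N" "b = H k" using b by auto
      then have "br (E i) b = - scale (of_int (C k i)) (E i)" using br_anti[of "E i" "H k"] rel_simps(3)[of k i] ij N by auto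
      moreover have "E i \<in> ?U" using npos_gen[OF npos_br(3), of E] by (intro span_base) force
      ultimately show ?thesis using u by (simp add: span_neg span_scale)
    qed
  qed simp
  ultimately show ?case using br_br[of "F j" "E i" y] by (simp add: span_add)
qed

end

context chevalley_algebra
begin

sublocale sw: chevalley_algebra scale br C n a d F E
  by unfold_locales (rule swap_EF)

lemma sw_H: "sw.H i = - H i"
  by (simp add: sw.H_def H_def br_anti[of "F i" "E i"])

definition triang :: "nat set \<Rightarrow> 'g set" where
  "triang N = snd ` npos E N \<union> H ` N \<union> snd ` npos F N"

text \<open>The span is stable under all E_i and F_i with i in N. Its elements whose bracket with
  the span stays inside form a subalgebra that contains these generators.\<close>

lemma generated_triang:
  assumes N: "N \<subseteq> {0..n}"
  shows "lie_generated scale br (E ` N \<union> F ` N) \<subseteq> span (triang N)"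
proof -
  let ?U = "span (triang N)"
  have U1: "span (snd ` npos E N \<union> H ` N) \<subseteq> ?U" by (rule span_mono) (auto simp: triang_def)
  have U2: "span (snd ` npos F N \<union> sw.H ` N) \<subseteq> ?U"
  proof (rule span_minimal[OF _ subspace_span])
    have "sw.H k \<in> ?U" if "k \<in> N" for k unfolding sw_H
      by (rule span_neg, rule span_base) (use that in \<open>simp add: triang_def\<close>)
    moreover have "snd ` npos F N \<subseteq> ?U" using span_superset[of "triang N"] unfolding triang_def by blast
    ultimately show "snd ` npos F N \<union> sw.H ` N \<subseteq> ?U" by blast
  qed
  have EU: "E i \<in> ?U" "F i \<in> ?U" if "i \<in> N" for i
    using npos_gen[OF that, of E] npos_gen[OF that, of F] by (auto simp: triang_def intro!: span_base) force+
  have stab: "br (E i) u \<in> ?U" "br (F i) u \<in> ?U" if i: "i \<in> N" and u: "u \<in> ?U" for i u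
  proof -
    have il: "i \<le> n" using i N by auto
    have "br (E i) b \<in> ?U \<and> br (F i) b \<in> ?U" if b: "b \<in> triang N" for b
    proof -
      consider m where "(m, b) \<in> npos E N" | k where "k \<in> N" "b = H k" | m where "(m, b) \<in> npos F N"
        using b by (auto simp: triang_def)
      then show ?thesis
      proof cases
        case 1
        have "br (E i) b \<in> snd ` npos E N" using npos_br[OF 1 i] by force
        then show ?thesis using npos_lower[OF 1 N i] U1 by (auto simp: triang_def intro: span_base)
      next
        case 2
        then have k: "k \<le> n" using N by auto
        have "br (E i) b = - scale (of_int (C k i)) (E i)" "br (F i) b = - scale (of_int (- C k i)) (F i)"
          using br_anti[of "E i" "H k"] br_anti[of "F i" "H k"] rel_simps(3,4)[OF k il] 2 by auto
        then show ?thesis using EU[OF i] by (simp add: span_neg span_scale)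
      next
        case 3
        have "br (F i) b \<in> snd ` npos F N" using npos_br[OF 3 i] by force
        then show ?thesis using sw.npos_lower[OF 3 N i] U2 by (auto simp: triang_def intro: span_base)
      qed
    qed
    then show "br (E i) u \<in> ?U" "br (F i) u \<in> ?U"
      using br_span[OF span_base[of "E i" "{E i}"] u] br_span[OF span_base[of "F i" "{F i}"] u] by auto
  qed
  define G where "G = {x \<in> ?U. \<forall>u\<in>?U. br x u \<in> ?U}"
  have "lie_subalgebra scale br G" unfolding lie_subalgebra_def
  proof (intro conjI ballI)
    show "subspace G"
      by (rule subspaceI) (auto simp: G_def span_zero span_add span_scale br_add_left br_scale_left)
    fix x y assume xy: "x \<in> G" "y \<in> G"
    have "br (br x y) u \<in> ?U" if "u \<in> ?U" for u
    proof -
      have "br (br x y) u = br x (br y u) - br y (br x u)" using br_br[of x y u] by simp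
      then show ?thesis using xy that by (simp add: G_def span_diff)
    qed
    then show "br x y \<in> G" using xy by (simp add: G_def)
  qed
  moreover have "E ` N \<union> F ` N \<subseteq> G" using stab EU by (auto simp: G_def)
  ultimately have "lie_generated scale br (E ` N \<union> F ` N) \<subseteq> G" by (rule lie_generated_subset)
  then show ?thesis unfolding G_def by blast
qed

text \<open>By \<open>int_kernel\<close>, a nonzero degree that vanishes at z is not annihilated by
  all coroots. So nonzero nested brackets have nonzero weight, and only the H_i contribute.\<close>

lemma triang_zero_weight:
  assumes N: "N = {0..n} - {z}" "z \<le> n" and x: "x \<in> span (triang N)" "\<And>i. i \<le> n \<Longrightarrow> br (H i) x = 0"
  shows "x \<in> span (H ` {0..n})"
proof -
  have Nn: "N \<subseteq> {0..n}" using N by auto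
  have ev: "\<exists>c. br (H i) v = scale c v" if v: "v \<in> triang N" and i: "i \<in> {0..n}" for v i
  proof -
    have il: "i \<le> n" using i by simp
    consider m where "(m, v) \<in> npos E N" | k where "k \<in> N" "v = H k" | m where "(m, v) \<in> npos F N"
      using v by (auto simp: triang_def)
    then show ?thesis
    proof cases
      case 1
      then show ?thesis using npos_weight[OF 1 Nn il] by blast
    next
      case 2
      then have "br (H i) v = scale 0 v" using rel_simps(2)[OF il, of k] Nn by auto
      then show ?thesis by blast
    next
      case 3
      have "br (H i) v = - br (sw.H i) v" by (simp add: sw_H br_minus)
      also have "\<dots> = scale (- of_int (pr i m)) v" using sw.npos_weight[OF 3 Nn il] by (simp add: scale_minus_left)
      finally show ?thesis by blast
    qed
  qed
  have "x \<in> span {v \<in> triang N. \<forall>i\<in>{0..n}. br (H i) v = scale 0 v}"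
    by (rule eigen_span[of "{0..n}" "\<lambda>i. br (H i)" "triang N" x "\<lambda>_. 0"]) (use lop_br ev x in auto)
  moreover have "{v \<in> triang N. \<forall>i\<in>{0..n}. br (H i) v = scale 0 v} \<subseteq> span (H ` {0..n})"
  proof
    fix v assume "v \<in> {v \<in> triang N. \<forall>i\<in>{0..n}. br (H i) v = scale 0 v}"
    then have v: "v \<in> triang N" "\<And>i. i \<le> n \<Longrightarrow> br (H i) v = 0" by auto
    have z: "v = 0" if w: "\<And>i. i \<le> n \<Longrightarrow> scale (of_int (pr i m)) v = 0" and m: "m \<noteq> 0" "\<And>k. k \<notin> N \<Longrightarrow> m k = 0" for m
    proof (rule ccontr)
      assume "v \<noteq> 0"
      then have "pr i m = 0" if "i \<le> n" for i using w[OF that] by simp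
      then have "m i = 0" if "i \<le> n" for i using int_kernel[OF N(2), of m i] m(2)[of z] N that by auto
      moreover have "m i = 0" if "i > n" for i using m(2)[of i] that N by auto
      ultimately have "m = 0" by (metis ext linorder_not_less zero_fun_apply)
      then show False using m(1) by simp
    qed
    consider m where "(m, v) \<in> npos E N" | k where "k \<in> N" "v = H k" | m where "(m, v) \<in> npos F N"
      using v(1) by (auto simp: triang_def)
    then show "v \<in> span (H ` {0..n})"
    proof cases
      case 1
      have "v = 0" by (rule z[of m]) (use npos_weight[OF 1 Nn] v(2) npos_deg[OF 1] in auto)
      then show ?thesis by (simp add: span_zero)
    next
      case 2
      then show ?thesis using Nn by (intro span_base) auto
    next
      case 3
      have "scale (of_int (pr i m)) v = 0" if "i \<le> n" for i
        using sw.npos_weight[OF 3 Nn that] v(2)[OF that] by (simp add: sw_H br_minus)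
      then have "v = 0" by (rule z[of m]) (use sw.npos_deg[OF 3] in auto)
      then show ?thesis by (simp add: span_zero)
    qed
  qed
  ultimately show ?thesis by (meson in_mono span_minimal subspace_span)
qed

text \<open>One choice of coefficients of z serves all weight vectors. The H_i need not be linearly
  independent, so the coefficients are only asserted to exist.\<close>

lemma cartan_acts:
  assumes "z \<in> span (H ` {0..n})"
  shows "\<exists>t. \<forall>x l. (\<forall>i\<le>n. br (H i) x = scale (l i) x) \<longrightarrow> br z x = scale (\<Sum>i\<le>n. t i * l i) x"
  using assms
proof (induct rule: span_induct_alt)
  case base
  show ?case by (rule exI[of _ "\<lambda>_. 0"]) simp
next
  case (step c b z)
  then obtain t where t: "\<And>x l. (\<forall>i\<le>n. br (H i) x = scale (l i) x) \<Longrightarrow> br z x = scale (\<Sum>i\<le>n. t i * l i) x" by blast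
  obtain k where k: "k \<le> n" "b = H k" using step(1) by auto
  show ?case
  proof (intro exI[of _ "\<lambda>i. (if i = k then c else 0) + t i"] allI impI)
    fix x l assume h: "\<forall>i\<le>n. br (H i) x = scale (l i) x"
    have "(\<Sum>i\<le>n. ((if i = k then c else 0) + t i) * l i) = (\<Sum>i\<le>n. (if i = k then c * l i else 0)) + (\<Sum>i\<le>n. t i * l i)"
      unfolding sum.distrib[symmetric] by (intro sum.cong) (auto simp: algebra_simps)
    also have "(\<Sum>i\<le>n. (if i = k then c * l i else 0)) = c * l k" using k by simp
    finally show "br (scale c b + z) x = scale (\<Sum>i\<le>n. ((if i = k then c else 0) + t i) * l i) x"
      using t[OF h] h k by (simp add: br_add_left br_scale_left scale_left_distrib)
  qed
qed

end

section \<open>The fixed point algebra of an involution supported on one node\<close>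

text \<open>The situation of one node p with s_p = 1, where k a_p = 2. For k = 2 this gives a_p = 1,
  and the loop node z has label 1 as well; the last assumption records this.\<close>

locale involution_algebra = chevalley_algebra scale br C n a d E F
  for scale :: "complex \<Rightarrow> 'g::ab_group_add \<Rightarrow> 'g" and br C n a d E F +
  fixes \<sigma> \<mu> :: "'g \<Rightarrow> 'g" and p z k :: nat
  assumes fd: "\<exists>B. finite B \<and> span B = UNIV"
    and simple: "lie_simple scale br"
    and gen: "lie_generated scale br (E ` {0..n} \<union> F ` {0..n}) = UNIV"
    and p: "p \<le> n" and z: "z \<le> n"
    and sig: "lie_automorphism scale br \<sigma>" "\<sigma> (E p) = - E p" "\<sigma> (F p) = - F p"
      "\<And>i. i \<le> n \<Longrightarrow> i \<noteq> p \<Longrightarrow> \<sigma> (E i) = E i \<and> \<sigma> (F i) = F i"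
      "\<And>x. \<sigma> (\<sigma> x) = x"
    and mu: "lie_automorphism scale br \<mu>"
      "{x. \<mu> x = x} = lie_generated scale br (E ` ({0..n} - {z}) \<union> F ` ({0..n} - {z}))"
      "\<mu> (E z) = scale ((-1) ^ (k - 1)) (E z)" "\<mu> (F z) = scale ((-1) ^ (k - 1)) (F z)"
    and k: "k = 1 \<or> k = 2 \<and> a z = 1 \<and> a p = 1"
begin

lemma lop_aut: "lie_automorphism scale br f \<Longrightarrow> lop f"
  unfolding lie_automorphism_def lop_def linear_iff_module_hom[symmetric]
  by (auto simp: Vector_Spaces.linear_def module_hom_def module_hom_axioms_def)

lemma sig_simps:
  shows "\<sigma> (x + y) = \<sigma> x + \<sigma> y" "\<sigma> (scale c x) = scale c (\<sigma> x)" "\<sigma> (br x y) = br (\<sigma> x) (\<sigma> y)" "\<sigma> 0 = 0" "\<sigma> (- x) = - \<sigma> x"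
proof -
  have l: "lop \<sigma>" by (rule lop_aut[OF sig(1)])
  show a: "\<sigma> (x + y) = \<sigma> x + \<sigma> y" "\<sigma> (scale c x) = scale c (\<sigma> x)" for x y c using l by (auto simp: lop_def)
  show "\<sigma> (br x y) = br (\<sigma> x) (\<sigma> y)" using sig(1) by (simp add: lie_automorphism_def)
  show "\<sigma> 0 = 0" by (rule lop_zero[OF l])
  show "\<sigma> (- x) = - \<sigma> x" using a(2)[of "-1" x] by simp
qed

text \<open>Arbitrary bracket monomials with their degrees. They span the algebra and are joint
  eigenvectors of the H_i, of sigma and of mu; the signs for sigma and, if k = 2, for mu are the
  parities of the degree at p and at z.\<close>

inductive_set mon :: "((nat \<Rightarrow> int) \<times> 'g) set" where
  mon_E: "i \<le> n \<Longrightarrow> (simple_root i, E i) \<in> mon"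
| mon_F: "i \<le> n \<Longrightarrow> (- simple_root i, F i) \<in> mon"
| mon_br: "(m, x) \<in> mon \<Longrightarrow> (m', y) \<in> mon \<Longrightarrow> (m + m', br x y) \<in> mon"

lemma mon_span: "span (snd ` mon) = UNIV"
proof -
  have "lie_subalgebra scale br (span (snd ` mon))" unfolding lie_subalgebra_def
  proof (intro conjI ballI)
    show "subspace (span (snd ` mon))" by (rule subspace_span)
    show "br x y \<in> span (snd ` mon)" if "x \<in> span (snd ` mon)" "y \<in> span (snd ` mon)" for x y
    proof (rule br_span[OF that])
      fix u v assume "u \<in> snd ` mon" "v \<in> snd ` mon"
      then obtain m m' where "(m, u) \<in> mon" "(m', v) \<in> mon" by auto
      then have "(m + m', br u v) \<in> mon" by (rule mon_br)
      then show "br u v \<in> span (snd ` mon)" by (intro span_base) force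
    qed
  qed
  moreover have "E ` {0..n} \<union> F ` {0..n} \<subseteq> span (snd ` mon)"
    using mon_E mon_F by (auto intro!: span_base) force+
  ultimately show ?thesis using lie_generated_subset[of scale br] gen by blast
qed

lemma mon_H: "(m, x) \<in> mon \<Longrightarrow> i \<le> n \<Longrightarrow> br (H i) x = scale (of_int (pr i m)) x"
proof (induct rule: mon.induct)
  case (mon_E j)
  then show ?case using rel_simps(3) by simp
next
  case (mon_F j)
  moreover have "pr i (- simple_root j) = - C i j"
    using mon_F flinD(4)[OF flin_pairing[of C n i], of "simple_root j"] by simp
  ultimately show ?case using rel_simps(4)[of i j] by (simp only:)
next
  case (mon_br m x m' y)
  have "br (H i) (br x y) = br (scale (of_int (pr i m)) x) y + br x (scale (of_int (pr i m')) y)"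
    using br_br[of "H i" x y] mon_br by simp
  moreover have "pr i (m + m') = pr i m + pr i m'" by (rule flinD(1)[OF flin_pairing])
  ultimately show ?case by (simp only: br_scale_left br_scale_right scale_left_distrib of_int_add)
qed

lemma mon_sigma: "(m, x) \<in> mon \<Longrightarrow> \<sigma> x = (if even (m p) then x else - x)"
proof (induct rule: mon.induct)
  case (mon_br m x m' y)
  then show ?case by (auto simp: sig_simps br_minus)
qed (use sig in \<open>auto simp: simple_root_apply\<close>)

lemma mu_gen: "i \<le> n \<Longrightarrow> i \<noteq> z \<Longrightarrow> \<mu> (E i) = E i \<and> \<mu> (F i) = F i"
proof -
  assume i: "i \<le> n" "i \<noteq> z"
  have "E i \<in> {x. \<mu> x = x}" "F i \<in> {x. \<mu> x = x}"
    unfolding mu(2) using i lie_generated_base[of "E ` ({0..n} - {z}) \<union> F ` ({0..n} - {z})" scale br] by auto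
  then show ?thesis by simp
qed

lemma mon_mu: "(m, x) \<in> mon \<Longrightarrow> \<mu> x = (if k = 1 \<or> even (m z) then x else - x)"
proof (induct rule: mon.induct)
  case (mon_br m x m' y)
  have "\<mu> (br x y) = br (\<mu> x) (\<mu> y)" using mu(1) by (simp add: lie_automorphism_def)
  then show ?case using mon_br by (auto simp: br_minus)
qed (use mu(3,4) mu_gen k in \<open>fastforce simp: simple_root_apply\<close>)+

text \<open>A nonzero monomial of weight zero has a degree proportional to the labels. For k = 2 its
  coordinates at p and z agree, so if sigma fixes it, it is fixed by mu; for k = 1 every monomial
  is. Hence x lies in the fixed algebra of mu, generated by the nodes other than z, where
  \<open>triang_zero_weight\<close> applies.\<close>

lemma zero_weight_cartan:
  assumes "\<sigma> x = x" "\<And>i. i \<le> n \<Longrightarrow> br (H i) x = 0"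
  shows "x \<in> span (H ` {0..n})"
proof -
  \<comment> \<open>The index n + 1 stands for sigma, so that \<open>eigen_span\<close> treats it
    together with the H_i.\<close>
  define T where "T i = (if i \<le> n then br (H i) else \<sigma>)" for i
  define c where "c i = (if i \<le> n then 0 else 1 :: complex)" for i
  have "x \<in> span {v \<in> snd ` mon. \<forall>i\<in>{0..Suc n}. T i v = scale (c i) v}"
  proof (rule eigen_span)
    show "lop (T i)" for i using lop_br lop_aut[OF sig(1)] by (simp add: T_def)
    show "x \<in> span (snd ` mon)" by (simp add: mon_span)
    show "T i x = scale (c i) x" for i using assms by (simp add: T_def c_def)
    fix v i assume "v \<in> snd ` mon"
    then obtain m where m: "(m, v) \<in> mon" by auto
    show "\<exists>c. T i v = scale c v"
    proof (cases "i \<le> n")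
      case True
      then show ?thesis using mon_H[OF m] by (auto simp: T_def)
    next
      case False
      then have "T i v = scale (if even (m p) then 1 else -1) v" using mon_sigma[OF m] by (simp add: T_def)
      then show ?thesis by blast
    qed
  qed
  moreover have "{v \<in> snd ` mon. \<forall>i\<in>{0..Suc n}. T i v = scale (c i) v} \<subseteq> {x. \<mu> x = x}"
  proof
    fix v assume "v \<in> {v \<in> snd ` mon. \<forall>i\<in>{0..Suc n}. T i v = scale (c i) v}"
    then obtain m where m: "(m, v) \<in> mon" and h: "\<And>i. i \<le> Suc n \<Longrightarrow> T i v = scale (c i) v" by auto
    have s: "\<sigma> v = v" using h[of "Suc n"] by (simp add: T_def c_def)
    show "v \<in> {x. \<mu> x = x}"
    proof (cases "v = 0")
      case True
      then show ?thesis using lop_zero[OF lop_aut[OF mu(1)]] by simp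
    next
      case False
      have "even (m p)"
      proof (rule ccontr)
        assume "odd (m p)"
        then have "- v = v" using mon_sigma[OF m] s by simp
        then have "scale 2 v = 0" by (metis ab_left_minus one_add_one scale_left_distrib scale_one)
        then show False using False by simp
      qed
      moreover have "m p = m z * int (a p)" if "a z = 1"
      proof -
        define v' where "v' = m - m z \<cdot> delta"
        have "v' z = 0" using that z by (simp add: v'_def delta_def)
        moreover have "pr i v' = 0" if "i \<le> n" for i
        proof -
          have "scale (of_int (pr i m)) v = 0" using mon_H[OF m that] h[of i] that by (simp add: T_def c_def)
          then have "pr i m = 0" using False by simp
          then show ?thesis using flinD(2,3)[OF flin_pairing[of C n i]] pr_delta[OF that] by (simp add: v'_def)
        qed
        ultimately have "v' p = 0" using int_kernel[OF z, of v' p] p by blast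
        then show ?thesis using p by (simp add: v'_def delta_def)
      qed
      ultimately have "k = 1 \<or> even (m z)" using k by auto
      then show ?thesis using mon_mu[OF m] by simp
    qed
  qed
  moreover have "subspace {x. \<mu> x = x}"
    using lop_aut[OF mu(1)] lop_zero[OF lop_aut[OF mu(1)]] by (intro subspaceI) (auto simp: lop_def)
  ultimately have "x \<in> {x. \<mu> x = x}" using span_minimal by blast
  then have "x \<in> span (triang ({0..n} - {z}))"
    unfolding mu(2) using generated_triang[of "{0..n} - {z}"] by blast
  then show ?thesis by (rule triang_zero_weight[OF refl z]) (rule assms(2))
qed

text \<open>A basis of monomials, so that all H_i are diagonal with integral eigenvalues.\<close>

definition BB :: "'g set" where "BB = (SOME B. B \<subseteq> snd ` mon \<and> independent B \<and> snd ` mon \<subseteq> span B)"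

lemma BB: "BB \<subseteq> snd ` mon" "independent BB" "span BB = UNIV" "finite BB"
proof -
  obtain B where "B \<subseteq> snd ` mon" "independent B" "snd ` mon \<subseteq> span B" by (rule maximal_independent_subset)
  then have s: "BB \<subseteq> snd ` mon \<and> independent BB \<and> snd ` mon \<subseteq> span BB"
    unfolding BB_def using someI[of "\<lambda>B. B \<subseteq> snd ` mon \<and> independent B \<and> snd ` mon \<subseteq> span B"] by blast
  then show "BB \<subseteq> snd ` mon" "independent BB" by auto
  have "span (snd ` mon) \<subseteq> span BB" using s by (meson span_minimal subspace_span)
  then show "span BB = UNIV" using mon_span by auto
  obtain B' where "finite B'" "span B' = UNIV" using fd by blast
  then show "finite BB" using independent_span_bound[of B' BB] s by auto
qed

abbreviation R where "R \<equiv> representation BB"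

lemma R_add: "R (x + y) b = R x b + R y b" and R_scale: "R (scale c x) b = c * R x b"
  and R_sum: "(\<Sum>b\<in>BB. scale (R x b) b) = x"
  using BB representation_add[OF BB(2), of y x] representation_scale[OF BB(2), of x c]
    sum_representation_eq[OF BB(2), of x BB] by auto

lemma R_linsum: "R (\<Sum>i\<in>A. scale (c i) (f i)) b = (\<Sum>i\<in>A. c i * R (f i) b)"
proof -
  have "R 0 b = 0" using R_scale[of 0 0 b] by simp
  then show ?thesis by (induct A rule: infinite_finite_induct) (auto simp: R_add R_scale)
qed

section \<open>The Killing form\<close>

definition tr :: "('g \<Rightarrow> 'g) \<Rightarrow> complex" where "tr f = (\<Sum>b\<in>BB. R (f b) b)"

lemma tr_comm:
  assumes "lop f" "lop g" shows "tr (\<lambda>v. f (g v)) = tr (\<lambda>v. g (f v))"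
proof -
  have e: "R (f (g b)) b = (\<Sum>c\<in>BB. R (g b) c * R (f c) b)" if "lop f" for f g b
  proof -
    have "f (g b) = (\<Sum>c\<in>BB. scale (R (g b) c) (f c))"
      using lop_sum[OF that, of "R (g b)" "\<lambda>c. c" BB] R_sum[of "g b"] by simp
    then show ?thesis by (simp add: R_linsum)
  qed
  have "tr (\<lambda>v. f (g v)) = (\<Sum>b\<in>BB. \<Sum>c\<in>BB. R (g b) c * R (f c) b)" by (simp add: tr_def e[OF assms(1)])
  also have "\<dots> = (\<Sum>c\<in>BB. \<Sum>b\<in>BB. R (f c) b * R (g b) c)" by (subst sum.swap) (simp add: mult.commute)
  also have "\<dots> = tr (\<lambda>v. g (f v))" by (simp add: tr_def e[OF assms(2)])
  finally show ?thesis .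
qed

text \<open>The Killing form, with the trace taken in the basis \<open>BB\<close>.\<close>

definition K :: "'g \<Rightarrow> 'g \<Rightarrow> complex" where "K x y = tr (\<lambda>v. br x (br y v))"

lemma K_lin: "K (x + x') y = K x y + K x' y" "K (scale c x) y = c * K x y"
  "K x (y + y') = K x y + K x y'" "K x (scale c y) = c * K x y"
  by (simp_all add: K_def tr_def br_add_left br_add_right br_scale_left br_scale_right R_add R_scale sum.distrib sum_distrib_left)

lemma K_zero [simp]: "K 0 y = 0" "K x 0 = 0"
  using K_lin(2)[of 0 0 y] K_lin(4)[of x 0 0] by simp_all

lemma K_minus: "K (- x) y = - K x y" "K x (- y) = - K x y"
  using K_lin(2)[of "-1" x y] K_lin(4)[of x "-1" y] by simp_all

lemma K_inv: "K (br x y) w = K x (br y w)"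
proof -
  have m: "R (u - v) b = R u b - R v b" for u v b
    using R_add[of u "scale (-1) v" b] R_scale[of "-1" v b] by simp
  have "br (br x y) (br w v) = br x (br y (br w v)) - br y (br x (br w v))" for v
    using br_br[of x y "br w v"] by simp
  then have 1: "K (br x y) w = tr (\<lambda>v. br x (br y (br w v))) - tr (\<lambda>v. br y (br x (br w v)))"
    by (simp add: K_def tr_def m sum_subtractf)
  have "br x (br (br y w) v) = br x (br y (br w v)) - br x (br w (br y v))" for v
  proof -
    have "br (br y w) v = br y (br w v) + - br w (br y v)" using br_br[of y w v] by simp
    then show ?thesis by (simp only: br_add_right br_minus) simp
  qed
  then have 2: "K x (br y w) = tr (\<lambda>v. br x (br y (br w v))) - tr (\<lambda>v. br x (br w (br y v)))"
    by (simp add: K_def tr_def m sum_subtractf)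
  have "tr (\<lambda>v. br y (br x (br w v))) = tr (\<lambda>v. br x (br w (br y v)))"
    by (rule tr_comm[OF lop_br lop_comp[OF lop_br lop_br]])
  then show ?thesis using 1 2 by simp
qed

text \<open>An automorphism preserves the Killing form, because the trace is invariant under
  conjugation; so the two eigenspaces of sigma are orthogonal.\<close>

lemma K_sigma: "\<sigma> x = x \<Longrightarrow> \<sigma> y = - y \<Longrightarrow> K x y = 0"
proof -
  assume xy: "\<sigma> x = x" "\<sigma> y = - y"
  have l: "lop \<sigma>" by (rule lop_aut[OF sig(1)])
  have "br (\<sigma> x) (br (\<sigma> y) v) = \<sigma> (br x (br y (\<sigma> v)))" for v by (simp add: sig_simps sig(5))
  then have "K (\<sigma> x) (\<sigma> y) = tr (\<lambda>v. \<sigma> (br x (br y (\<sigma> v))))" by (simp add: K_def)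
  also have "\<dots> = tr (\<lambda>v. br x (br y (\<sigma> (\<sigma> v))))"
    by (rule tr_comm[OF l lop_comp[OF lop_br lop_comp[OF lop_br l]]])
  also have "\<dots> = K x y" by (simp add: sig(5) K_def)
  finally show ?thesis using xy by (simp add: K_minus)
qed

lemma K_weight:
  assumes "br h x = scale l x" "br h y = scale l' y" "l + l' \<noteq> 0" shows "K x y = 0"
proof -
  have "l * K x y = K (br h x) y" by (simp add: assms K_lin)
  also have "\<dots> = - K (br x h) y" using br_anti[of h x] by (simp add: K_minus)
  also have "\<dots> = - l' * K x y" by (simp add: K_inv assms K_lin)
  finally have "(l + l') * K x y = 0" by (simp add: algebra_simps)
  then show ?thesis using assms(3) by simp
qed

lemma not_all_zero: "\<exists>i\<le>n. E i \<noteq> 0 \<or> F i \<noteq> 0"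
proof (rule ccontr)
  assume "\<not> ?thesis"
  then have z0: "E i = 0" "F i = 0" if "i \<le> n" for i using that by auto
  have "x = 0" if "(m, x) \<in> mon" for m x using that by induct (auto simp: z0)
  then have "snd ` mon \<subseteq> {0}" by auto
  then have "span (snd ` mon) \<subseteq> span {0}" by (rule span_mono)
  then have "x \<in> {0}" for x :: 'g unfolding mon_span span_insert_0 span_empty by blast
  moreover obtain u v where "br u v \<noteq> 0" using simple unfolding lie_simple_def by blast
  ultimately show False by blast
qed

lemma EF_zeroD: "i \<le> n \<Longrightarrow> H i = 0 \<Longrightarrow> E i = 0 \<and> F i = 0"
  using rel_simps(3,4)[of i i] diag[of i] by simp

text \<open>If E_i or F_i vanishes, so does H_i, and then E_l for every neighbour l because
  [H_i, E_l] is a nonzero multiple of it. Along the connected diagram all generators would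
  vanish.\<close>

lemma E_nonzero: "i \<le> n \<Longrightarrow> E i \<noteq> 0 \<and> F i \<noteq> 0"
proof (rule ccontr)
  assume i: "i \<le> n" "\<not> (E i \<noteq> 0 \<and> F i \<noteq> 0)"
  then have "H i = 0" by (auto simp: H_def)
  then have "{j. j \<le> n \<and> H j = 0} = {..n}"
  proof (intro conn)
    fix j l assume "j \<in> {j. j \<le> n \<and> H j = 0}" "l \<le> n" "C j l \<noteq> 0"
    then have "E l = 0" using rel_simps(3)[of j l] by simp
    then show "l \<in> {j. j \<le> n \<and> H j = 0}" using \<open>l \<le> n\<close> by (simp add: H_def)
  qed (use i in auto)
  then show False using not_all_zero EF_zeroD by blast
qed

lemma center_trivial: "(\<And>y. br x y = 0) \<Longrightarrow> x = 0"
proof -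
  define Z where "Z = {x. \<forall>y. br x y = 0}"
  have "lie_ideal scale br UNIV Z" unfolding lie_ideal_def
  proof (intro conjI ballI)
    show "subspace Z" by (rule subspaceI) (auto simp: Z_def br_add_left br_scale_left)
    fix u x assume "x \<in> Z"
    then have "br u x = 0" using br_anti[of u x] by (simp add: Z_def)
    then show "br u x \<in> Z" by (simp add: Z_def)
  qed simp
  then have "Z = {0} \<or> Z = UNIV" using simple by (simp add: lie_simple_def)
  moreover have "Z \<noteq> UNIV" using simple by (auto simp: lie_simple_def Z_def)
  ultimately show "(\<And>y. br x y = 0) \<Longrightarrow> x = 0" by (auto simp: Z_def)
qed

definition deg :: "'g \<Rightarrow> nat \<Rightarrow> int" where "deg b = (SOME m. (m, b) \<in> mon)"

lemma deg: "b \<in> BB \<Longrightarrow> (deg b, b) \<in> mon"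
proof -
  assume "b \<in> BB"
  then obtain m where "(m, b) \<in> mon" using BB(1) by auto
  then show ?thesis unfolding deg_def by (rule someI[of "\<lambda>m. (m, b) \<in> mon"])
qed

lemma R_basis: "b \<in> BB \<Longrightarrow> R b b = 1"
  using representation_basis[OF BB(2)] by simp

text \<open>The radical is an ideal, hence zero or everything. In the latter case K(H_i, H_i), a sum
  of squares of integers, is zero; then H_i acts as zero, is central and hence zero, and all
  generators vanish. This replaces Cartan's criterion.\<close>

lemma K_nondegenerate:
  assumes "\<And>y. K x y = 0" shows "x = 0"
proof -
  define Z where "Z = {x. \<forall>y. K x y = 0}"
  have "lie_ideal scale br UNIV Z" unfolding lie_ideal_def
  proof (intro conjI ballI)
    show "subspace Z" by (rule subspaceI) (auto simp: Z_def K_lin)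
    fix u x assume "x \<in> Z"
    then have "K (br u x) y = 0" for y using br_anti[of u x] K_inv[of x u y] by (simp add: Z_def K_minus)
    then show "br u x \<in> Z" by (simp add: Z_def)
  qed simp
  then have "Z = {0} \<or> Z = UNIV" using simple by (simp add: lie_simple_def)
  moreover have "Z \<noteq> UNIV"
  proof
    assume "Z = UNIV"
    then have K0: "K x y = 0" for x y by (auto simp: Z_def)
    have "H i = 0" if i: "i \<le> n" for i
    proof -
      have hb: "br (H i) b = scale (of_int (pr i (deg b))) b" if "b \<in> BB" for b using mon_H[OF deg[OF that] i] .
      have "K (H i) (H i) = (\<Sum>b\<in>BB. of_int ((pr i (deg b))\<^sup>2))"
        unfolding K_def tr_def
        by (rule sum.cong) (simp_all add: hb br_scale_right R_scale R_basis power2_eq_square)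
      also have "\<dots> = of_int (\<Sum>b\<in>BB. (pr i (deg b))\<^sup>2)" by simp
      finally have "(\<Sum>b\<in>BB. (pr i (deg b))\<^sup>2) = 0" using K0[of "H i" "H i"] by (metis of_int_eq_0_iff)
      then have "pr i (deg b) = 0" if "b \<in> BB" for b
        using that BB(4) by (simp add: sum_nonneg_eq_0_iff)
      then have b0: "br (H i) b = 0" if "b \<in> BB" for b using hb[OF that] that by simp
      have "br (H i) y = 0" for y
        using lop_sum[OF lop_br[of "H i"], of "R y" "\<lambda>b. b" BB] R_sum[of y] b0 by simp
      then show ?thesis by (rule center_trivial)
    qed
    then show False using EF_zeroD not_all_zero by blast
  qed
  ultimately show ?thesis using assms by (auto simp: Z_def)
qed

text \<open>Eigenvectors shifted by a nonzero weight eventually vanish, since \<open>H i\<close> has finitely many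
  eigenvalues.\<close>

lemma ad_nilpotent:
  assumes i: "i \<le> n" and x: "br (H i) x = scale l x" "l \<noteq> 0" and v: "br (H i) v = scale c v"
  shows "\<exists>j. (br x ^^ j) v = 0"
proof (rule ccontr)
  assume no: "\<not> ?thesis"
  have w: "br (H i) ((br x ^^ j) v) = scale (c + of_nat j * l) ((br x ^^ j) v)" for j
  proof (induct j)
    case 0
    then show ?case using v by simp
  next
    case (Suc j)
    let ?y = "(br x ^^ j) v"
    have "br (H i) (br x ?y) = br (br (H i) x) ?y + br x (br (H i) ?y)" by (rule br_br)
    also have "\<dots> = scale (l + (c + of_nat j * l)) (br x ?y)"
      unfolding x(1) Suc br_scale_left br_scale_right scale_left_distrib br_add_right ..
    also have "l + (c + of_nat j * l) = c + of_nat (Suc j) * l" by (simp add: algebra_simps)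
    finally show ?case by simp
  qed
  have ev: "e \<in> (\<lambda>b. of_int (pr i (deg b))) ` BB" if e: "br (H i) y = scale e y" "y \<noteq> 0" for e y
  proof -
    have "y \<in> span {b \<in> BB. \<forall>j\<in>{i}. br (H j) b = scale e b}"
    proof (rule eigen_span)
      show "lop (br (H j))" for j by (rule lop_br)
      show "\<exists>c. br (H j) b = scale c b" if "b \<in> BB" "j \<in> {i}" for b j
        using mon_H[OF deg[OF that(1)] i] that(2) by blast
      show "y \<in> span BB" by (simp add: BB(3))
      show "br (H j) y = scale e y" if "j \<in> {i}" for j using that e(1) by simp
    qed
    moreover have "\<not> y \<in> span {}" using e(2) by simp
    ultimately have "{b \<in> BB. \<forall>j\<in>{i}. br (H j) b = scale e b} \<noteq> {}" by metis
    then obtain b where b: "b \<in> BB" "br (H i) b = scale e b" by blast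
    have "b \<noteq> 0" using R_basis[OF b(1)] R_scale[of 0 0 b] by auto
    then have "e = of_int (pr i (deg b))" using mon_H[OF deg[OF b(1)] i] b(2) by simp
    then show ?thesis using b(1) by blast
  qed
  have "range (\<lambda>j. c + of_nat j * l) \<subseteq> (\<lambda>b. of_int (pr i (deg b))) ` BB"
    using ev[OF w] no by blast
  then have "finite (range (\<lambda>j :: nat. c + of_nat j * l))" using BB(4) finite_subset by blast
  moreover have "inj (\<lambda>j :: nat. c + of_nat j * l)" using x(2) by (auto intro: injI)
  ultimately show False using finite_imageD infinite_UNIV_nat by blast
qed

lemma last_nonzero:
  assumes "(f ^^ j) v = 0" "v \<noteq> (0::'g)" obtains i where "(f ^^ i) v \<noteq> 0" "f ((f ^^ i) v) = 0"
proof -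
  define j0 where "j0 = (LEAST j. (f ^^ j) v = 0)"
  have j0: "(f ^^ j0) v = 0" unfolding j0_def by (rule LeastI[of _ j]) (rule assms(1))
  then have "j0 \<noteq> 0" using assms(2) by (metis funpow_0)
  then obtain i where i: "j0 = Suc i" by (cases j0) auto
  have "(f ^^ i) v \<noteq> 0" using not_less_Least[of i "\<lambda>j. (f ^^ j) v = 0"] i unfolding j0_def by auto
  then show ?thesis using that[of i] j0 i by simp
qed

abbreviation G0 where "G0 \<equiv> {x. \<sigma> x = x}"

lemma H_G0: "i \<le> n \<Longrightarrow> \<sigma> (H i) = H i"
  unfolding H_def using sig by (cases "i = p") (auto simp: sig_simps br_minus)

text \<open>With \<open>z = [x, y]\<close> in the Cartan subalgebra and \<open>z\<close> commuting with \<open>x\<close> and \<open>y\<close>, both nilpotent on weight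
  vectors, the Heisenberg relation forces all eigenvalues of \<open>z\<close> to vanish.\<close>

lemma heisenberg:
  assumes i: "i \<le> n" "l i \<noteq> 0" and x: "\<And>i. i \<le> n \<Longrightarrow> br (H i) x = scale (l i) x"
    and y: "\<And>i. i \<le> n \<Longrightarrow> br (H i) y = scale (- l i) y"
    and c: "br x y \<in> span (H ` {0..n})" "br (br x y) x = 0" and x0: "x \<noteq> 0"
  shows "br x y = 0"
proof (rule ccontr)
  define h where "h = br x y"
  assume "br x y \<noteq> 0"
  then have "h \<noteq> 0" by (simp add: h_def)
  obtain t where t: "\<And>x l. (\<And>i. i \<le> n \<Longrightarrow> br (H i) x = scale (l i) x) \<Longrightarrow> br h x = scale (\<Sum>i\<le>n. t i * l i) x"
    using cartan_acts[OF c(1)] unfolding h_def by blast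
  have "scale (\<Sum>i\<le>n. t i * l i) x = 0" using t[OF x] c(2) by (simp add: h_def)
  then have tl: "(\<Sum>i\<le>n. t i * l i) = 0" using x0 by simp
  have hy: "br h y = 0" using t[OF y] tl by (simp add: sum_negf)
  have hx: "br h x = 0" using c(2) by (simp add: h_def)
  obtain u where "br h u \<noteq> 0" using center_trivial[of h] \<open>h \<noteq> 0\<close> by blast
  then obtain b where b: "b \<in> BB" "br h b \<noteq> 0"
    using lop_sum[OF lop_br[of h], of "R u" "\<lambda>b. b" BB] R_sum[of u] by (metis (no_types, lifting) scale_zero_right sum.neutral)
  define \<nu> where "\<nu> = (\<Sum>i\<le>n. t i * of_int (pr i (deg b)))"
  have hb: "br h b = scale \<nu> b" unfolding \<nu>_def by (rule t) (rule mon_H[OF deg[OF b(1)]])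
  then have nu: "\<nu> \<noteq> 0" "b \<noteq> 0" using b(2) by auto
  obtain j where "(br x ^^ j) b = 0" using ad_nilpotent[OF i(1) x[OF i(1)] i(2) mon_H[OF deg[OF b(1)] i(1)]] by blast
  \<comment> \<open>The last nonzero power of ad x on b gives a vector annihilated by x, still with
    the eigenvalue nu under h.\<close>
  then obtain j where w0: "(br x ^^ j) b \<noteq> 0" "br x ((br x ^^ j) b) = 0" using nu(2) by (rule last_nonzero)
  define w where "w = (br x ^^ j) b"
  have hw: "br h ((br x ^^ j) b) = scale \<nu> ((br x ^^ j) b)" for j
  proof (induct j)
    case (Suc j)
    then show ?case using br_br[of h x "(br x ^^ j) b"] hx by (simp add: br_scale_right)
  qed (simp add: hb)
  have wH: "\<exists>c. br (H i) ((br x ^^ j) b) = scale c ((br x ^^ j) b)" for j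
  proof (induct j)
    case 0
    then show ?case using mon_H[OF deg[OF b(1)] i(1)] by auto
  next
    case (Suc j)
    then obtain c where "br (H i) ((br x ^^ j) b) = scale c ((br x ^^ j) b)" by blast
    then have "br (H i) ((br x ^^ Suc j) b) = scale (l i + c) ((br x ^^ Suc j) b)"
      using br_br[of "H i" x "(br x ^^ j) b"] x[OF i(1)]
      by (simp add: br_scale_left br_scale_right scale_left_distrib)
    then show ?case by blast
  qed
  obtain c where wc: "br (H i) w = scale c w" using wH unfolding w_def by blast
  have "- l i \<noteq> 0" using i(2) by simp
  then obtain m where "(br y ^^ m) w = 0" using ad_nilpotent[OF i(1) y[OF i(1)] _ wc] by blast
  then obtain m where m: "(br y ^^ m) w \<noteq> 0" "br y ((br y ^^ m) w) = 0" using w0(1) unfolding w_def by (rule last_nonzero)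
  have hyw: "br h ((br y ^^ m) w) = scale \<nu> ((br y ^^ m) w)" for m
  proof (induct m)
    case 0
    then show ?case using hw by (simp add: w_def)
  next
    case (Suc m)
    then show ?case using br_br[of h y "(br y ^^ m) w"] hy by (simp add: br_scale_right)
  qed
  \<comment> \<open>As h commutes with y, [x, y^(m+1) w] = (m+1) nu y^m w. For the last nonzero y^m
    w the left side vanishes while (m+1) nu is not zero.\<close>
  have "br x ((br y ^^ Suc m) w) = scale (of_nat (Suc m) * \<nu>) ((br y ^^ m) w)" for m
  proof (induct m)
    case 0
    then show ?case using br_br[of x y w] w0(2) hyw[of 0] by (simp add: h_def w_def)
  next
    case (Suc m)
    have "br x (br y ((br y ^^ Suc m) w)) = br h ((br y ^^ Suc m) w) + br y (br x ((br y ^^ Suc m) w))"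
      unfolding h_def by (rule br_br)
    also have "\<dots> = scale (\<nu> + of_nat (Suc m) * \<nu>) (br y ((br y ^^ m) w))"
      unfolding Suc hyw br_scale_right scale_left_distrib by simp
    also have "\<nu> + of_nat (Suc m) * \<nu> = of_nat (Suc (Suc m)) * \<nu>" by (simp add: algebra_simps)
    finally show ?case by simp
  qed
  then have "scale (of_nat (Suc m) * \<nu>) ((br y ^^ m) w) = 0" using m(2) by (metis br_zero(2) comp_apply funpow.simps(2))
  moreover have "(of_nat (Suc m) :: complex) \<noteq> 0" by (rule of_nat_neq_0)
  ultimately show False using m(1) nu(1) by (simp del: of_nat_Suc)
qed

section \<open>Abelian ideals of the fixed point algebra\<close>

text \<open>For a monomial b that is odd under sigma or not of opposite weight, K(x, b) = 0 by
  orthogonality. Otherwise [x, b] lies in the Cartan subalgebra and in A, so it commutes with x and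
  vanishes by \<open>heisenberg\<close>; invariance gives l_i K(x, b) = K(H_i, [x, b]) = 0.\<close>

lemma abelian_ideal_weight:
  assumes A: "lie_ideal scale br G0 A" "\<And>x y. x \<in> A \<Longrightarrow> y \<in> A \<Longrightarrow> br x y = 0"
    and x: "x \<in> A" "\<And>i. i \<le> n \<Longrightarrow> br (H i) x = scale (l i) x" and i: "i \<le> n" "l i \<noteq> 0"
  shows "x = 0"
proof (rule ccontr)
  assume x0: "x \<noteq> 0"
  have xs: "\<sigma> x = x" using A(1) x(1) by (auto simp: lie_ideal_def)
  have Ksub: "K x b = 0" if b: "b \<in> snd ` mon" for b
  proof -
    obtain m where m: "(m, b) \<in> mon" using b by auto
    show ?thesis
    proof (cases "even (m p)")
      case False
      then show ?thesis using mon_sigma[OF m] xs by (intro K_sigma) auto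
    next
      case True
      then have bs: "\<sigma> b = b" using mon_sigma[OF m] by simp
      show ?thesis
      proof (cases "\<exists>j\<le>n. l j + of_int (pr j m) \<noteq> 0")
        case True
        then show ?thesis using K_weight[OF x(2) mon_H[OF m]] by blast
      next
        case False
        have bm: "br (H j) b = scale (- l j) b" if "j \<le> n" for j
        proof -
          have "of_int (pr j m) = - l j" using False that by (auto simp: add_eq_0_iff)
          then show ?thesis using mon_H[OF m that] by simp
        qed
        have "- br b x \<in> A" using A(1) x(1) bs by (auto simp: lie_ideal_def subspace_neg)
        then have zA: "br x b \<in> A" using br_anti[of x b] by simp
        have z0: "br (H j) (br x b) = 0" if "j \<le> n" for j
          using br_br[of "H j" x b] x(2)[OF that] bm[OF that] by (simp add: br_scale_left br_scale_right br_minus)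
        have "\<sigma> (br x b) = br x b" by (simp add: sig_simps xs bs)
        then have "br x b \<in> span (H ` {0..n})" using z0 by (rule zero_weight_cartan)
        then have "br x b = 0"
          using heisenberg[OF i x(2) bm] A(2)[OF zA x(1)] x0 by blast
        then have "K (br (H i) x) b = 0" by (simp add: K_inv)
        then show ?thesis using x(2)[OF i(1)] i(2) by (simp add: K_lin)
      qed
    qed
  qed
  have "K x y = 0" for y
  proof -
    have "y \<in> span (snd ` mon)" by (simp add: mon_span)
    then show ?thesis
      by (induct rule: span_induct_alt) (auto simp: K_lin Ksub)
  qed
  then show False using K_nondegenerate x0 by blast
qed

lemma no_abelian_ideal:
  assumes A: "lie_ideal scale br G0 A" "\<And>x y. x \<in> A \<Longrightarrow> y \<in> A \<Longrightarrow> br x y = 0"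
  shows "A = {0}"
proof (rule ccontr)
  assume ne: "A \<noteq> {0}"
  have sub: "subspace A" and stab: "\<And>x y. \<sigma> x = x \<Longrightarrow> y \<in> A \<Longrightarrow> br x y \<in> A" and AG: "\<And>x. x \<in> A \<Longrightarrow> \<sigma> x = x"
    using A(1) by (auto simp: lie_ideal_def)
  have "0 \<in> A" using sub by (rule subspace_0)
  then obtain x1 where x1: "x1 \<in> A" "x1 \<noteq> 0" using ne by blast
  define sp where "sp x = {b \<in> BB. R x b \<noteq> 0}" for x
  \<comment> \<open>An element with the fewest coordinates in \<open>BB\<close> is a joint
    eigenvector: applying H_i minus its eigenvalue at b0 stays in A and removes the coordinate at
    b0.\<close>
  obtain x where x: "x \<in> A" "x \<noteq> 0" and min: "\<And>y. y \<in> A \<Longrightarrow> y \<noteq> 0 \<Longrightarrow> card (sp x) \<le> card (sp y)"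
    using ex_has_least_nat[of "\<lambda>x. x \<in> A \<and> x \<noteq> 0" x1 "\<lambda>x. card (sp x)"] x1 by blast
  have spf: "finite (sp x)" for x using BB(4) by (simp add: sp_def)
  have R0: "R 0 b = 0" for b using R_scale[of 0 0 b] by simp
  have spn: "sp y = {} \<Longrightarrow> y = 0" for y using R_sum[of y] by (auto simp: sp_def)
  obtain b0 where b0: "b0 \<in> sp x" using spn x(2) by blast
  define l where "l i = (of_int (pr i (deg b0)) :: complex)" for i
  have RH: "R (br (H i) y) b = of_int (pr i (deg b)) * R y b" if i: "i \<le> n" and b: "b \<in> BB" for i y b
  proof -
    have "br (H i) y = (\<Sum>c\<in>BB. scale (R y c) (br (H i) c))"
      using lop_sum[OF lop_br[of "H i"], of "R y" "\<lambda>b. b" BB] R_sum[of y] by simp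
    also have "\<dots> = (\<Sum>c\<in>BB. scale (R y c * of_int (pr i (deg c))) c)"
      by (rule sum.cong) (simp_all add: mon_H[OF deg i])
    finally have "R (br (H i) y) b = (\<Sum>c\<in>BB. (R y c * of_int (pr i (deg c))) * R c b)" by (simp add: R_linsum)
    also have "\<dots> = (\<Sum>c\<in>BB. if c = b then R y c * of_int (pr i (deg c)) else 0)"
      using representation_basis[OF BB(2)] by (intro sum.cong) auto
    finally show ?thesis using b BB(4) by (simp add: mult.commute)
  qed
  have xl: "br (H i) x = scale (l i) x" if i: "i \<le> n" for i
  proof -
    define y where "y = br (H i) x - scale (l i) x"
    have yA: "y \<in> A" unfolding y_def
      using stab[OF H_G0[OF i] x(1)] sub x(1) by (intro subspace_diff subspace_scale)
    have "R y b = (of_int (pr i (deg b)) - l i) * R x b" if "b \<in> BB" for b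
    proof -
      have "y = br (H i) x + scale (- l i) x" by (simp add: y_def scale_minus_left)
      then have "R y b = R (br (H i) x) b + - l i * R x b" by (simp only: R_add R_scale)
      then show ?thesis by (simp add: RH[OF i that] left_diff_distrib)
    qed
    then have "sp y \<subseteq> sp x - {b0}" by (auto simp: sp_def l_def)
    then have "card (sp y) < card (sp x)"
      using b0 spf by (metis card_Diff1_less card_mono finite_Diff order_le_less_trans)
    then have "y = 0" using min[OF yA] by force
    then show ?thesis by (simp add: y_def)
  qed
  have l0: "l i = 0" if "i \<le> n" for i
    using abelian_ideal_weight[OF A x(1) xl that] x(2) by blast
  then have x0: "br (H i) x = 0" if "i \<le> n" for i using xl[OF that] that by simp
  have xH: "x \<in> span (H ` {0..n})" by (rule zero_weight_cartan[OF AG[OF x(1)] x0])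
  obtain t where t: "\<And>v l. (\<And>i. i \<le> n \<Longrightarrow> br (H i) v = scale (l i) v) \<Longrightarrow> br x v = scale (\<Sum>i\<le>n. t i * l i) v"
    using cartan_acts[OF xH] by blast
  define \<tau> where "\<tau> i = (\<Sum>j\<le>n. t j * of_int (C j i))" for i
  have xE: "br x (E i) = scale (\<tau> i) (E i)" and xF: "br x (F i) = scale (- \<tau> i) (F i)" if i: "i \<le> n" for i
  proof -
    show "br x (E i) = scale (\<tau> i) (E i)" unfolding \<tau>_def by (rule t) (rule rel_simps(3)[OF _ i])
    have "br x (F i) = scale (\<Sum>j\<le>n. t j * of_int (- C j i)) (F i)" by (rule t) (rule rel_simps(4)[OF _ i])
    then show "br x (F i) = scale (- \<tau> i) (F i)" by (simp add: \<tau>_def sum_negf)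
  qed
  have tau0: "\<tau> i = 0" if i: "i \<le> n" "i \<noteq> p" for i
  proof (rule ccontr)
    \<comment> \<open>Otherwise E_i lies in A with eigenvalue C_ii = 2 under H_i and must
      vanish.\<close>
    assume nz: "\<tau> i \<noteq> 0"
    have "\<sigma> (E i) = E i" using sig(4) i by blast
    then have "- br (E i) x \<in> A" using stab x(1) sub by (intro subspace_neg) auto
    then have "scale (\<tau> i) (E i) \<in> A" using xE[OF i(1)] br_anti[of x "E i"] by simp
    then have "scale (inverse (\<tau> i)) (scale (\<tau> i) (E i)) \<in> A" by (rule subspace_scale[OF sub])
    then have EA: "E i \<in> A" using nz by simp
    have "E i = 0"
      using abelian_ideal_weight[OF A EA, of "\<lambda>j. of_int (C j i)" i] rel_simps(3)[OF _ i(1)] i(1) diag[OF i(1)] by simp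
    then show False using E_nonzero[OF i(1)] by simp
  qed
  \<comment> \<open>The labels are a null vector, so the eigenvalues tau_i satisfy a linear relation
    in which tau_p has a positive coefficient.\<close>
  have "(\<Sum>i\<le>n. of_nat (a i) * \<tau> i) = (\<Sum>i\<le>n. \<Sum>j\<le>n. t j * of_int (C j i * int (a i)))"
    by (simp add: \<tau>_def sum_distrib_left mult_ac)
  also have "\<dots> = (\<Sum>j\<le>n. \<Sum>i\<le>n. t j * of_int (C j i * int (a i)))" by (rule sum.swap)
  also have "\<dots> = (\<Sum>j\<le>n. t j * of_int (\<Sum>i\<le>n. C j i * int (a i)))"
    unfolding of_int_sum sum_distrib_left ..
  also have "\<dots> = 0" using null by simp
  finally have "(\<Sum>i\<le>n. of_nat (a i) * \<tau> i) = 0" .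
  moreover have "(\<Sum>i\<le>n. of_nat (a i) * \<tau> i) = (\<Sum>i\<in>{p}. of_nat (a i) * \<tau> i)"
    using p tau0 by (intro sum.mono_neutral_right) auto
  ultimately have "\<tau> p = 0" using a_pos[OF p] by simp
  then have tau: "\<tau> i = 0" if "i \<le> n" for i using tau0 that by blast
  define Z where "Z = {y. br x y = 0}"
  have "lie_subalgebra scale br Z" unfolding lie_subalgebra_def
  proof (intro conjI ballI)
    show "subspace Z" by (rule subspaceI) (auto simp: Z_def br_add_right br_scale_right)
    show "br u v \<in> Z" if "u \<in> Z" "v \<in> Z" for u v using that br_br[of x u v] by (simp add: Z_def)
  qed
  moreover have "E ` {0..n} \<union> F ` {0..n} \<subseteq> Z" using xE xF tau by (auto simp: Z_def)
  ultimately have "UNIV \<subseteq> Z" using lie_generated_subset[of scale br Z] gen by blast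
  then have "br x y = 0" for y by (auto simp: Z_def)
  then show False using center_trivial x(2) by blast
qed

lemma derived_ideal:
  assumes I: "lie_ideal scale br G0 I" shows "lie_ideal scale br G0 (lie_derived scale br I)"
proof -
  let ?D = "{br x y | x y. x \<in> I \<and> y \<in> I}"
  have sub: "subspace G0" by (rule subspaceI) (auto simp: sig_simps)
  have I': "I \<subseteq> G0" "\<And>x y. \<sigma> x = x \<Longrightarrow> y \<in> I \<Longrightarrow> br x y \<in> I" using I by (auto simp: lie_ideal_def)
  show ?thesis unfolding lie_ideal_def lie_derived_def
  proof (intro conjI ballI)
    show "subspace (span ?D)" by (rule subspace_span)
    have "\<sigma> (br x y) = br x y" if "x \<in> I" "y \<in> I" for x y
      unfolding sig_simps(3) using subsetD[OF I'(1) that(1)] subsetD[OF I'(1) that(2)] by simp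
    then show "span ?D \<subseteq> G0" by (intro span_minimal[OF _ sub]) blast
    fix g u assume g: "g \<in> G0" and u: "u \<in> span ?D"
    show "br g u \<in> span ?D"
    proof (rule br_span[OF span_base[of g "{g}"] u])
      fix g' b assume "g' \<in> {g}" "b \<in> ?D"
      then obtain x y where xy: "b = br x y" "x \<in> I" "y \<in> I" "g' = g" by auto
      have "br g b = br (br g x) y + br x (br g y)" using br_br[of g x y] xy(1) by simp
      moreover have "br (br g x) y \<in> ?D" "br x (br g y) \<in> ?D" using I'(2) g xy(2,3) by auto
      ultimately show "br g' b \<in> span ?D" using xy(4) by (simp add: span_add span_base)
    qed simp
  qed
qed

text \<open>The last nonzero term of the derived series of a nonzero solvable ideal is an abelian
  ideal.\<close>

theorem fixed_semisimple: "lie_semisimple scale br G0"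
  unfolding lie_semisimple_def
proof (intro allI impI)
  fix I assume h: "lie_ideal scale br G0 I \<and> lie_solvable scale br I"
  let ?D = "lie_derived scale br"
  have ideal: "lie_ideal scale br G0 ((?D ^^ m) I)" for m
    by (induct m) (use h derived_ideal in auto)
  define m where "m = (LEAST m. (?D ^^ m) I = {0})"
  have m: "(?D ^^ m) I = {0}" using h unfolding m_def lie_solvable_def by (metis (mono_tags, lifting) LeastI_ex)
  show "I = {0}"
  proof (cases m)
    case 0
    then show ?thesis using m by simp
  next
    case (Suc j)
    let ?A = "(?D ^^ j) I"
    have "?A \<noteq> {0}" using not_less_Least[of j "\<lambda>m. (?D ^^ m) I = {0}"] Suc unfolding m_def by simp
    moreover have "br x y = 0" if "x \<in> ?A" "y \<in> ?A" for x y
    proof -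
      have "br x y \<in> ?D ?A" unfolding lie_derived_def[of scale br ?A] using that by (intro span_base) blast
      then show ?thesis using m Suc by simp
    qed
    ultimately show ?thesis using no_abelian_ideal[OF ideal] by blast
  qed
qed

end

section \<open>The shape of s and the conclusion\<close>

text \<open>Coprimality gives a node p with odd s_p. The bound 2 leaves either no further node, and
  then s_p = 1, or exactly one, and then both products a_i s_i are 1.\<close>

lemma support_cases:
  fixes a s :: "nat \<Rightarrow> nat"
  assumes a: "\<And>i. i \<le> n \<Longrightarrow> a i > 0" and gcd: "Gcd (s ` {0..n}) = 1" and sum: "(\<Sum>i\<le>n. a i * s i) \<le> 2"
  obtains (one) p where "p \<le> n" "s p = 1" "\<And>i. i \<le> n \<Longrightarrow> i \<noteq> p \<Longrightarrow> s i = 0"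
    | (two) p q where "p \<le> n" "q \<le> n" "p \<noteq> q" "a p = 1" "a q = 1" "s p = 1" "s q = 1"
      "\<And>i. i \<le> n \<Longrightarrow> i \<noteq> p \<Longrightarrow> i \<noteq> q \<Longrightarrow> s i = 0"
proof -
  have "\<exists>p\<le>n. odd (s p)"
  proof (rule ccontr)
    assume "\<not> ?thesis"
    then have "2 dvd Gcd (s ` {0..n})" by (intro Gcd_greatest) auto
    then show False using gcd by simp
  qed
  then obtain p where p: "p \<le> n" "odd (s p)" by blast
  then have p1: "a p * s p \<ge> 1" using a[OF p(1)] by (cases "s p") auto
  have sp: "(\<Sum>i\<le>n. a i * s i) = a p * s p + (\<Sum>i\<in>{..n} - {p}. a i * s i)"
    using p(1) by (intro sum.remove) auto
  show thesis
  proof (cases "\<exists>q\<le>n. q \<noteq> p \<and> s q \<noteq> 0")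
    case False
    have "s p \<le> a p * s p" using a[OF p(1)] by simp
    then have "s p \<le> 2" using sp sum by linarith
    then have "s p = 1" using p(2) by (cases "s p = 2") (auto simp: le_Suc_eq numeral_2_eq_2)
    then show thesis using one[OF p(1)] False by blast
  next
    case True
    then obtain q where q: "q \<le> n" "q \<noteq> p" "s q \<noteq> 0" by blast
    have sq: "(\<Sum>i\<in>{..n} - {p}. a i * s i) = a q * s q + (\<Sum>i\<in>{..n} - {p} - {q}. a i * s i)"
      using q by (intro sum.remove) auto
    have "a q * s q \<ge> 1" using a[OF q(1)] q(3) by (cases "s q") auto
    then have eq: "a p * s p = 1" "a q * s q = 1" "(\<Sum>i\<in>{..n} - {p} - {q}. a i * s i) = 0"
      using sp sq p1 sum by linarith+
    have "s i = 0" if "i \<le> n" "i \<noteq> p" "i \<noteq> q" for i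
    proof -
      have "a i * s i = 0" using eq(3) that by (simp add: sum_eq_0_iff del: mult_eq_0_iff)
      then show ?thesis using a[OF that(1)] by simp
    qed
    then show thesis using two[OF p(1) q(1) q(2)[symmetric]] eq by simp
  qed
qed

theorem theorem6p3:
  fixes scale :: "complex \<Rightarrow> 'g::ab_group_add \<Rightarrow> 'g"
    and br :: "'g \<Rightarrow> 'g \<Rightarrow> 'g"
    and X :: family and N k n :: nat
    and C :: "nat \<Rightarrow> nat \<Rightarrow> int"
    and a s :: "nat \<Rightarrow> nat"
    and E F :: "nat \<Rightarrow> 'g"
    and \<sigma> :: "'g \<Rightarrow> 'g"
  assumes "complex_lie_algebra scale br"
    and "lie_finite_dim scale"
    and "lie_simple scale br"
    and "affine_cartan X N k n C"
    and "affine_labels C n a"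
    and "loop_generators scale br X N k n C E F"
    and "Gcd (s ` {0..n}) = 1"
    and "k * (\<Sum>i\<le>n. a i * s i) = 2"
    and "involution_of_type scale br n E F s \<sigma>"
    and "\<not> lie_semisimple scale br {x. \<sigma> x = x}"
  shows "real (card (sigma_minuscule C n a s)) =
      real (card (weyl_group C n {1..n})) / real (card (weyl_group C n {i. i \<le> n \<and> s i = 0})) *
      (1 + real (connection_index C n (height_zero_roots C n a s)) /
           real (connection_index C n (real_roots C n {1..n})))"
proof -
  have apos: "a i > 0" if "i \<le> n" for i using assms(5) that by (simp add: affine_labels_def)
  have k12: "k = 1 \<or> k = 2" using assms(4) by (auto simp: affine_cartan_def)
  \<comment> \<open>This excludes k = 2 as well as k = 1 with a_p = 2.\<close>
  have not_single: False if p: "p \<le> n" "s p = 1" "\<And>i. i \<le> n \<Longrightarrow> i \<noteq> p \<Longrightarrow> s i = 0" for p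
  proof -
    let ?z = "loop_node X N k n"
    have "\<exists>d. affine_matrix C n a d \<and> ?z \<le> n \<and> (k = 1 \<or> k = 2 \<and> a ?z = 1)"
    proof (cases "k = 1")
      case True
      then obtain d where "untwisted C n a d"
        using untwisted_affine_locale[OF _ assms(5)] assms(4) by (auto simp: affine_cartan_def)
      then show ?thesis using True by (auto simp: untwisted_def loop_node_def)
    next
      case False
      then have "k = 2" "twisted_affine X N n C" using assms(4) by (auto simp: affine_cartan_def)
      then show ?thesis using twisted_affine_matrix[OF _ assms(5), of X N] by blast
    qed
    then obtain d where d: "affine_matrix C n a d" and z: "?z \<le> n" "k = 1 \<or> k = 2 \<and> a ?z = 1" by blast
    have "(\<Sum>i\<le>n. a i * s i) = (\<Sum>i\<in>{p}. a i * s i)"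
      using p by (intro sum.mono_neutral_right) auto
    then have "k * a p = 2" using assms(8) p(2) by simp
    then have k: "k = 1 \<or> k = 2 \<and> a ?z = 1 \<and> a p = 1" using z(2) by auto
    interpret complex_lie_algebra scale br by (rule assms(1))
    obtain \<mu> where \<mu>: "lie_automorphism scale br \<mu>"
      "{x. \<mu> x = x} = lie_generated scale br (E ` ({0..n} - {?z}) \<union> F ` ({0..n} - {?z}))"
      "\<mu> (E ?z) = scale ((-1) ^ (k - 1)) (E ?z)" "\<mu> (F ?z) = scale ((-1) ^ (k - 1)) (F ?z)"
      using assms(6) unfolding loop_generators_def by blast
    interpret am: affine_matrix C n a d by (rule d)
    have \<sigma>: "\<sigma> (E i) = scale ((-1) ^ s i) (E i)" "\<sigma> (F i) = scale ((-1) ^ s i) (F i)" if "i \<le> n" for i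
      using assms(9) that by (auto simp: involution_of_type_def)
    have "involution_algebra scale br C n a d E F \<sigma> \<mu> p ?z k"
    proof unfold_locales
      show "chevalley_relations scale br C n E F" "lie_generated scale br (E ` {0..n} \<union> F ` {0..n}) = UNIV"
        using assms(6) by (auto simp: loop_generators_def)
      show "lie_automorphism scale br \<sigma>" "\<sigma> (\<sigma> x) = x" for x
        using assms(9) by (auto simp: involution_of_type_def fun_eq_iff)
      show "\<exists>B. finite B \<and> span B = UNIV" using assms(2) by (simp add: lie_finite_dim_def)
      show "\<sigma> (E p) = - E p" "\<sigma> (F p) = - F p" using \<sigma>[OF p(1)] p(2) by simp_all
      show "\<sigma> (E i) = E i \<and> \<sigma> (F i) = F i" if "i \<le> n" "i \<noteq> p" for i using \<sigma>[OF that(1)] p(3)[OF that] by simp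
    qed (use assms(3) \<mu> p(1) z(1) k in auto)
    then show False using involution_algebra.fixed_semisimple assms(10) by blast
  qed
  have le2: "(\<Sum>i\<le>n. a i * s i) \<le> 2" using assms(8) k12 by auto
  consider (one) p where "p \<le> n" "s p = 1" "\<And>i. i \<le> n \<Longrightarrow> i \<noteq> p \<Longrightarrow> s i = 0"
    | (two) p q where "p \<le> n" "q \<le> n" "p \<noteq> q" "a p = 1" "a q = 1" "s p = 1" "s q = 1"
      "\<And>i. i \<le> n \<Longrightarrow> i \<noteq> p \<Longrightarrow> i \<noteq> q \<Longrightarrow> s i = 0"
    using support_cases[of n a s, OF apos assms(7) le2] by auto
  then show ?thesis
  proof cases
    case (one p)
    show ?thesis using not_single[OF one] by (rule FalseE)
  next
    case (two p q)
    \<comment> \<open>Two nodes of label 1 already contribute 2 to the weighted sum, so k = 1 and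
      the diagram is untwisted.\<close>
    have "(\<Sum>i\<in>{p, q}. a i * s i) \<le> (\<Sum>i\<le>n. a i * s i)" using two by (intro sum_mono2) auto
    then have "2 \<le> (\<Sum>i\<le>n. a i * s i)" using two by simp
    then have "k = 1" using assms(8) k12 by auto
    then obtain d where d: "untwisted C n a d"
      using untwisted_affine_locale[OF _ assms(5)] assms(4) by (auto simp: affine_cartan_def)
    then have "special_pair C n a d p q" using two by (auto simp: special_pair_def special_pair_axioms_def)
    then show ?thesis by (rule special_pair.minuscule_count) (use two in auto)
  qed
qed

end
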